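(* Let $k$ be a field of characteristic $p$ ($p$ a prime). Let $H$ be a finite group, or a linear algebraic group over $k$. Suppose that one of the following holds. (i) $H$ has non-isomorphic simple modules $S\not\cong T$ over $k$ such that $\mathrm{End}_H(S)\cong \mathrm{End}_H(T)\cong k$ and $\dim_k \mathrm{Ext}^1_H(S,T)\ge 3$. (ii) $H$ has pairwise non-isomorphic simple modules $R$, $S$ and $T$ over $k$ with $\mathrm{End}_H(R)\cong\mathrm{End}_H(S)\cong\mathrm{End}_H(T)\cong k$, $\dim_k\mathrm{Ext}^1_H(R,T)\ge 1$ and $\dim_k\mathrm{Ext}^1_H(S,T)\ge 2$. (iii) For some integer $r\ge 2$, $H$ has pairwise non-isomorphic simple modules $R$, $S_1,\dots,S_r$, and $T_1,\dots,T_r$ over $k$ with endomorphism rings isomorphic to $k$, such that the groups $\mathrm{Ext}^1_H(R,T_1)$, $\mathrm{Ext}^1_H(S_i,T_i)$ for $1\le i\le r$, $\mathrm{Ext}^1_H(S_{i+1},T_i)$ for $1\le i\le r-1$, and $\mathrm{Ext}^1_H(S_1,T_r)$ are all non-trivial. Then there exist a sequence of indecomposable $H$-modules $M_m$ over $k$ ($m\ge 1$) and embeddings $M_m\to M_{m+1}$ such that: (1) (in cases (i) and (ii), where $T$ is defined) the radical $\mathrm{Rad}(M_m)$ is isomorphic to a direct sum of $m$ copies of $T$; (2) $M_m/\mathrm{Rad}(M_m)$ is isomorphic to a direct sum of $m$ copies of $S$ in case (i), and to a direct sum of one copy of $R$ and $m-1$ copies of $S$ in case (ii); (3) (in all three cases)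 the endomorphism ring $\mathrm{End}_H(M_m)$ consists just of scalar multiples of the identity map.
   Context: $H$-modules over $k$ are representations of $H$ over $k$ (that is, $kH$-modules if $H$ is finite, and rational modules if $H$ is a linear algebraic group), and $\mathrm{End}_H$ and $\mathrm{Ext}^1_H$ are taken in the category of such modules. The radical $\mathrm{Rad}(M)$ of a module $M$ is the intersection of its maximal submodules. *)

theory Defs
  imports "HOL-Algebra.Algebra"
begin

section \<open>Vector spaces and tensor products over a field\<close>

text \<open>
  A vector space over the field \<open>K\<close> is a record \<open>V\<close> with \<^term>\<open>module K V\<close>. Such a record also has
  fields \<open>mult\<close> and \<open>one\<close> (inherited from rings), which play no role for plain vector spaces; they
  are left \<^term>\<open>undefined\<close> below whenever the object is not an algebra.
\<close>

definition ring_char :: "'k ring \<Rightarrow> nat \<Rightarrow> bool" where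
  "ring_char K p \<longleftrightarrow> (\<forall>n::nat. [n] \<cdot>\<^bsub>K\<^esub> \<one>\<^bsub>K\<^esub> = \<zero>\<^bsub>K\<^esub> \<longleftrightarrow> p dvd n)"

definition scalars :: "'k ring \<Rightarrow> ('k, 'k) module" where
  "scalars K = \<lparr>carrier = carrier K, monoid.mult = monoid.mult K, one = \<one>\<^bsub>K\<^esub>,
                ring.zero = \<zero>\<^bsub>K\<^esub>, ring.add = ring.add K, smult = monoid.mult K\<rparr>"

definition lin ::
  "'k ring \<Rightarrow> ('k, 'v, 'm) module_scheme \<Rightarrow> ('k, 'w, 'n) module_scheme \<Rightarrow> ('v \<Rightarrow> 'w) set" where
  "lin K V W = {f \<in> hom (add_monoid V) (add_monoid W).
     \<forall>c\<in>carrier K. \<forall>v\<in>carrier V. f (c \<odot>\<^bsub>V\<^esub> v) = c \<odot>\<^bsub>W\<^esub> f v}"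

definition bilin ::
  "'k ring \<Rightarrow> ('k, 'v, 'm) module_scheme \<Rightarrow> ('k, 'w, 'n) module_scheme
    \<Rightarrow> ('k, 'u, 'o) module_scheme \<Rightarrow> ('v \<Rightarrow> 'w \<Rightarrow> 'u) set" where
  "bilin K V W U = {f. (\<forall>v\<in>carrier V. f v \<in> lin K W U) \<and>
                       (\<forall>w\<in>carrier W. (\<lambda>v. f v w) \<in> lin K V U)}"

text \<open>
  The tensor product \<open>V \<otimes> W\<close> is modelled inside the dual of the space of bilinear forms on
  \<open>V \<times> W\<close>: \<open>v \<otimes> w\<close> is evaluation at \<open>(v, w)\<close>, and \<open>V \<otimes> W\<close> consists of the finite sums of such
  elements. As \<open>K\<close> is a field, bilinear forms separate the elements of the usual tensor product,
  so this has the universal property of the tensor product. Everything defined on top of it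
  uses that property only, through \<open>tensor_lift\<close>.
\<close>

type_synonym ('k, 'v, 'w) tensor = "('v \<Rightarrow> 'w \<Rightarrow> 'k) \<Rightarrow> 'k"

definition pure_tensor ::
  "'k ring \<Rightarrow> ('k, 'v, 'm) module_scheme \<Rightarrow> ('k, 'w, 'n) module_scheme
    \<Rightarrow> 'v \<Rightarrow> 'w \<Rightarrow> ('k, 'v, 'w) tensor" where
  "pure_tensor K V W v w = (\<lambda>b\<in>bilin K V W (scalars K). b v w)"

definition tensor ::
  "'k ring \<Rightarrow> ('k, 'v, 'm) module_scheme \<Rightarrow> ('k, 'w, 'n) module_scheme
    \<Rightarrow> ('k, ('k, 'v, 'w) tensor) module" where
  "tensor K V W =
    \<lparr>carrier = {(\<lambda>b\<in>bilin K V W (scalars K). \<Oplus>\<^bsub>K\<^esub>i\<in>{..<n}. b (x i) (y i)) | (n::nat) x y.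
                  x \<in> {..<n} \<rightarrow> carrier V \<and> y \<in> {..<n} \<rightarrow> carrier W},
     monoid.mult = undefined, one = undefined,
     ring.zero = (\<lambda>b\<in>bilin K V W (scalars K). \<zero>\<^bsub>K\<^esub>),
     ring.add = (\<lambda>s t. \<lambda>b\<in>bilin K V W (scalars K). s b \<oplus>\<^bsub>K\<^esub> t b),
     smult = (\<lambda>c t. \<lambda>b\<in>bilin K V W (scalars K). c \<otimes>\<^bsub>K\<^esub> t b)\<rparr>"

text \<open>The linear map \<open>V \<otimes> W \<rightarrow> U\<close> induced by a bilinear map \<open>f : V \<times> W \<rightarrow> U\<close>.\<close>

definition tensor_lift ::
  "'k ring \<Rightarrow> ('k, 'v, 'm) module_scheme \<Rightarrow> ('k, 'w, 'n) module_scheme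
    \<Rightarrow> ('k, 'u, 'o) module_scheme \<Rightarrow> ('v \<Rightarrow> 'w \<Rightarrow> 'u) \<Rightarrow> ('k, 'v, 'w) tensor \<Rightarrow> 'u" where
  "tensor_lift K V W U f =
    (THE L. L \<in> lin K (tensor K V W) U \<and> L \<in> extensional (carrier (tensor K V W)) \<and>
       (\<forall>v\<in>carrier V. \<forall>w\<in>carrier W. L (pure_tensor K V W v w) = f v w))"

text \<open>\<open>f \<otimes> g : V \<otimes> W \<rightarrow> V' \<otimes> W'\<close> for linear \<open>f : V \<rightarrow> V'\<close> and \<open>g : W \<rightarrow> W'\<close>.\<close>

definition tensor_map ::
  "'k ring \<Rightarrow> ('k, 'v, 'm) module_scheme \<Rightarrow> ('k, 'w, 'n) module_scheme
    \<Rightarrow> ('k, 'v2, 'm2) module_scheme \<Rightarrow> ('k, 'w2, 'n2) module_scheme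
    \<Rightarrow> ('v \<Rightarrow> 'v2) \<Rightarrow> ('w \<Rightarrow> 'w2) \<Rightarrow> ('k, 'v, 'w) tensor \<Rightarrow> ('k, 'v2, 'w2) tensor" where
  "tensor_map K V W V' W' f g =
    tensor_lift K V W (tensor K V' W') (\<lambda>v w. pure_tensor K V' W' (f v) (g w))"

text \<open>The associativity isomorphism \<open>(V \<otimes> W) \<otimes> U \<rightarrow> V \<otimes> (W \<otimes> U)\<close>.\<close>

definition tensor_assoc ::
  "'k ring \<Rightarrow> ('k, 'v, 'm) module_scheme \<Rightarrow> ('k, 'w, 'n) module_scheme
    \<Rightarrow> ('k, 'u, 'o) module_scheme
    \<Rightarrow> ('k, ('k, 'v, 'w) tensor, 'u) tensor \<Rightarrow> ('k, 'v, ('k, 'w, 'u) tensor) tensor" where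
  "tensor_assoc K V W U =
    tensor_lift K (tensor K V W) U (tensor K V (tensor K W U))
      (\<lambda>t u. tensor_lift K V W (tensor K V (tensor K W U))
         (\<lambda>v w. pure_tensor K V (tensor K W U) v (pure_tensor K W U w u)) t)"

text \<open>\<open>A \<otimes> B\<close> as an algebra, for algebras \<open>A\<close> and \<open>B\<close>: \<open>(a \<otimes> b) (c \<otimes> d) = ac \<otimes> bd\<close>.\<close>

definition tensor_alg ::
  "'k ring \<Rightarrow> ('k, 'v, 'm) module_scheme \<Rightarrow> ('k, 'w, 'n) module_scheme
    \<Rightarrow> ('k, ('k, 'v, 'w) tensor) module" where
  "tensor_alg K A B = (tensor K A B)
    \<lparr>monoid.mult := (\<lambda>s t. tensor_lift K A B (tensor K A B)
        (\<lambda>a b. tensor_lift K A B (tensor K A B)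
           (\<lambda>c d. pure_tensor K A B (a \<otimes>\<^bsub>A\<^esub> c) (b \<otimes>\<^bsub>B\<^esub> d)) t) s),
     one := pure_tensor K A B \<one>\<^bsub>A\<^esub> \<one>\<^bsub>B\<^esub>\<rparr>"


section \<open>The groups\<close>

text \<open>
  A linear algebraic group over \<open>K\<close> (an affine group scheme of finite type) is given by its
  coordinate algebra: a finitely generated commutative Hopf algebra over \<open>K\<close>. No reducedness is
  required, so smooth groups are included, as is \<open>K\<close> that is not algebraically closed.
\<close>

record ('k, 'a) hopf = "('k, 'a) module" +
  comult :: "'a \<Rightarrow> ('k, 'a, 'a) tensor"
  counit :: "'a \<Rightarrow> 'k"
  antipode :: "'a \<Rightarrow> 'a"

locale linear_algebraic_group = algebra K A
  for K :: "'k ring" and A :: "('k, 'a) hopf" +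
  assumes finitely_generated:
      "\<exists>F. finite F \<and> F \<subseteq> carrier A \<and>
           carrier A = generate_ring A (F \<union> {c \<odot>\<^bsub>A\<^esub> \<one>\<^bsub>A\<^esub> | c. c \<in> carrier K})"
    and comult_lin: "comult A \<in> lin K A (tensor K A A)"
    and comult_hom: "comult A \<in> ring_hom A (tensor_alg K A A)"
    and counit_lin: "counit A \<in> lin K A (scalars K)"
    and counit_hom: "counit A \<in> ring_hom A K"
    and antipode_lin: "antipode A \<in> lin K A A"
    and coassoc: "a \<in> carrier A \<Longrightarrow>
      tensor_assoc K A A A (tensor_map K A A (tensor K A A) A (comult A) id (comult A a)) =
      tensor_map K A A A (tensor K A A) id (comult A) (comult A a)"
    and counit_left: "a \<in> carrier A \<Longrightarrow>
      tensor_lift K A A A (\<lambda>x y. counit A x \<odot>\<^bsub>A\<^esub> y) (comult A a) = a"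
    and counit_right: "a \<in> carrier A \<Longrightarrow>
      tensor_lift K A A A (\<lambda>x y. counit A y \<odot>\<^bsub>A\<^esub> x) (comult A a) = a"
    and antipode_left: "a \<in> carrier A \<Longrightarrow>
      tensor_lift K A A A (\<lambda>x y. antipode A x \<otimes>\<^bsub>A\<^esub> y) (comult A a) = counit A a \<odot>\<^bsub>A\<^esub> \<one>\<^bsub>A\<^esub>"
    and antipode_right: "a \<in> carrier A \<Longrightarrow>
      tensor_lift K A A A (\<lambda>x y. x \<otimes>\<^bsub>A\<^esub> antipode A y) (comult A a) = counit A a \<odot>\<^bsub>A\<^esub> \<one>\<^bsub>A\<^esub>"

datatype ('k, 'g, 'a) hgroup =
    Finite_Group "'g monoid"
  | Algebraic_Group "('k, 'a) hopf"

definition is_hgroup :: "'k ring \<Rightarrow> ('k, 'g, 'a) hgroup \<Rightarrow> bool" where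
  "is_hgroup K H \<longleftrightarrow> (case H of
      Finite_Group G \<Rightarrow> group G \<and> finite (carrier G)
    | Algebraic_Group A \<Rightarrow> linear_algebraic_group K A)"


section \<open>Modules\<close>

text \<open>
  An \<open>H\<close>-module is a vector space with a linear action of \<open>H\<close> if \<open>H\<close> is a finite group, and a
  rational module, i.e. a right comodule over the coordinate algebra, if \<open>H\<close> is a linear algebraic
  group. Only the field \<open>action\<close> is relevant in the first case and only \<open>coaction\<close> in the second.
\<close>

record ('k, 'v, 'g, 'a) hmod = "('k, 'v) module" +
  action :: "'g \<Rightarrow> 'v \<Rightarrow> 'v"
  coaction :: "'v \<Rightarrow> ('k, 'v, 'a) tensor"

definition hmodule :: "'k ring \<Rightarrow> ('k, 'g, 'a) hgroup \<Rightarrow> ('k, 'v, 'g, 'a) hmod \<Rightarrow> bool" where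
  "hmodule K H M \<longleftrightarrow> module K M \<and> (case H of
      Finite_Group G \<Rightarrow>
        (\<forall>g\<in>carrier G. action M g \<in> lin K M M) \<and>
        (\<forall>v\<in>carrier M. action M \<one>\<^bsub>G\<^esub> v = v) \<and>
        (\<forall>g\<in>carrier G. \<forall>h\<in>carrier G. \<forall>v\<in>carrier M.
           action M (g \<otimes>\<^bsub>G\<^esub> h) v = action M g (action M h v))
    | Algebraic_Group A \<Rightarrow>
        coaction M \<in> lin K M (tensor K M A) \<and>
        (\<forall>v\<in>carrier M.
           tensor_assoc K M A A (tensor_map K M A (tensor K M A) A (coaction M) id (coaction M v)) =
           tensor_map K M A M (tensor K A A) id (comult A) (coaction M v)) \<and>
        (\<forall>v\<in>carrier M. tensor_lift K M A M (\<lambda>w a. counit A a \<odot>\<^bsub>M\<^esub> w) (coaction M v) = v))"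

definition hmod_hom ::
  "'k ring \<Rightarrow> ('k, 'g, 'a) hgroup \<Rightarrow> ('k, 'v, 'g, 'a) hmod \<Rightarrow> ('k, 'w, 'g, 'a) hmod
    \<Rightarrow> ('v \<Rightarrow> 'w) set" where
  "hmod_hom K H M N = {f \<in> lin K M N. (case H of
      Finite_Group G \<Rightarrow>
        (\<forall>g\<in>carrier G. \<forall>v\<in>carrier M. f (action M g v) = action N g (f v))
    | Algebraic_Group A \<Rightarrow>
        (\<forall>v\<in>carrier M. coaction N (f v) = tensor_map K M A N A f id (coaction M v)))}"

definition hmod_iso ::
  "'k ring \<Rightarrow> ('k, 'g, 'a) hgroup \<Rightarrow> ('k, 'v, 'g, 'a) hmod \<Rightarrow> ('k, 'w, 'g, 'a) hmod \<Rightarrow> bool" where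
  "hmod_iso K H M N \<longleftrightarrow> (\<exists>f\<in>hmod_hom K H M N. bij_betw f (carrier M) (carrier N))"

text \<open>
  For comodules, a subspace \<open>N\<close> of \<open>M\<close> is a submodule if the coaction maps \<open>N\<close> into the image of
  \<open>N \<otimes> A\<close> in \<open>M \<otimes> A\<close>.
\<close>

definition hsubmodule ::
  "'k ring \<Rightarrow> ('k, 'g, 'a) hgroup \<Rightarrow> 'v set \<Rightarrow> ('k, 'v, 'g, 'a) hmod \<Rightarrow> bool" where
  "hsubmodule K H N M \<longleftrightarrow> submodule N K M \<and> (case H of
      Finite_Group G \<Rightarrow> (\<forall>g\<in>carrier G. \<forall>v\<in>N. action M g v \<in> N)
    | Algebraic_Group A \<Rightarrow>
        (\<forall>v\<in>N. coaction M v \<in>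
           tensor_map K (M\<lparr>carrier := N\<rparr>) A M A id id ` carrier (tensor K (M\<lparr>carrier := N\<rparr>) A)))"

text \<open>
  A submodule as a module in its own right; \<open>N \<otimes> A \<rightarrow> M \<otimes> A\<close> is injective over a field, which
  determines the coaction of \<open>N\<close>.
\<close>

definition sub_hmod ::
  "'k ring \<Rightarrow> ('k, 'g, 'a) hgroup \<Rightarrow> ('k, 'v, 'g, 'a) hmod \<Rightarrow> 'v set \<Rightarrow> ('k, 'v, 'g, 'a) hmod" where
  "sub_hmod K H M N = (let N' = M\<lparr>carrier := N\<rparr> in
     N'\<lparr>coaction := (case H of
        Finite_Group G \<Rightarrow> undefined
      | Algebraic_Group A \<Rightarrow>
          (\<lambda>v. THE t. t \<in> carrier (tensor K N' A) \<and>
                      tensor_map K N' A M A id id t = coaction M v))\<rparr>)"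

definition quot_hmod ::
  "'k ring \<Rightarrow> ('k, 'g, 'a) hgroup \<Rightarrow> ('k, 'v, 'g, 'a) hmod \<Rightarrow> 'v set
    \<Rightarrow> ('k, 'v set, 'g, 'a) hmod" where
  "quot_hmod K H M N = (let Q =
      \<lparr>carrier = a_rcosets\<^bsub>M\<^esub> N, monoid.mult = undefined, one = undefined,
       ring.zero = N, ring.add = set_add M,
       smult = (\<lambda>c C. \<Union>x\<in>C. N +>\<^bsub>M\<^esub> (c \<odot>\<^bsub>M\<^esub> x)),
       action = (\<lambda>g C. \<Union>x\<in>C. N +>\<^bsub>M\<^esub> (action M g x)),
       coaction = undefined\<rparr>
    in Q\<lparr>coaction := (case H of
        Finite_Group G \<Rightarrow> undefined
      | Algebraic_Group A \<Rightarrow>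
          (\<lambda>C. tensor_map K M A Q A (\<lambda>x. N +>\<^bsub>M\<^esub> x) id (coaction M (SOME x. x \<in> C))))\<rparr>)"

definition sum_hmod ::
  "'k ring \<Rightarrow> ('k, 'g, 'a) hgroup \<Rightarrow> ('k, 'v, 'g, 'a) hmod \<Rightarrow> ('k, 'w, 'g, 'a) hmod
    \<Rightarrow> ('k, 'v \<times> 'w, 'g, 'a) hmod" where
  "sum_hmod K H M N = (let P =
      \<lparr>carrier = carrier M \<times> carrier N, monoid.mult = undefined, one = undefined,
       ring.zero = (\<zero>\<^bsub>M\<^esub>, \<zero>\<^bsub>N\<^esub>),
       ring.add = (\<lambda>(x, y) (x', y'). (x \<oplus>\<^bsub>M\<^esub> x', y \<oplus>\<^bsub>N\<^esub> y')),
       smult = (\<lambda>c (x, y). (c \<odot>\<^bsub>M\<^esub> x, c \<odot>\<^bsub>N\<^esub> y)),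
       action = (\<lambda>g (x, y). (action M g x, action N g y)),
       coaction = undefined\<rparr>
    in P\<lparr>coaction := (case H of
        Finite_Group G \<Rightarrow> undefined
      | Algebraic_Group A \<Rightarrow>
          (\<lambda>(x, y). tensor_map K M A P A (\<lambda>u. (u, \<zero>\<^bsub>N\<^esub>)) id (coaction M x)
             \<oplus>\<^bsub>tensor K P A\<^esub> tensor_map K N A P A (\<lambda>w. (\<zero>\<^bsub>M\<^esub>, w)) id (coaction N y)))\<rparr>)"

definition power_hmod ::
  "'k ring \<Rightarrow> ('k, 'g, 'a) hgroup \<Rightarrow> nat \<Rightarrow> ('k, 'v, 'g, 'a) hmod
    \<Rightarrow> ('k, nat \<Rightarrow> 'v, 'g, 'a) hmod" where
  "power_hmod K H n M = (let P =
      \<lparr>carrier = {..<n} \<rightarrow>\<^sub>E carrier M, monoid.mult = undefined, one = undefined,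
       ring.zero = (\<lambda>i\<in>{..<n}. \<zero>\<^bsub>M\<^esub>),
       ring.add = (\<lambda>x y. \<lambda>i\<in>{..<n}. x i \<oplus>\<^bsub>M\<^esub> y i),
       smult = (\<lambda>c x. \<lambda>i\<in>{..<n}. c \<odot>\<^bsub>M\<^esub> x i),
       action = (\<lambda>g x. \<lambda>i\<in>{..<n}. action M g (x i)),
       coaction = undefined\<rparr>
    in P\<lparr>coaction := (case H of
        Finite_Group G \<Rightarrow> undefined
      | Algebraic_Group A \<Rightarrow>
          (\<lambda>x. \<Oplus>\<^bsub>tensor K P A\<^esub>i\<in>{..<n}.
             tensor_map K M A P A (\<lambda>u. \<lambda>j\<in>{..<n}. if j = i then u else \<zero>\<^bsub>M\<^esub>) id
               (coaction M (x i))))\<rparr>)"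

definition simple :: "'k ring \<Rightarrow> ('k, 'g, 'a) hgroup \<Rightarrow> ('k, 'v, 'g, 'a) hmod \<Rightarrow> bool" where
  "simple K H M \<longleftrightarrow> hmodule K H M \<and> carrier M \<noteq> {\<zero>\<^bsub>M\<^esub>} \<and>
     (\<forall>N. hsubmodule K H N M \<longrightarrow> N = {\<zero>\<^bsub>M\<^esub>} \<or> N = carrier M)"

definition indecomposable ::
  "'k ring \<Rightarrow> ('k, 'g, 'a) hgroup \<Rightarrow> ('k, 'v, 'g, 'a) hmod \<Rightarrow> bool" where
  "indecomposable K H M \<longleftrightarrow> hmodule K H M \<and> carrier M \<noteq> {\<zero>\<^bsub>M\<^esub>} \<and>
     (\<forall>N L. hsubmodule K H N M \<and> hsubmodule K H L M \<and>
            N <+>\<^bsub>M\<^esub> L = carrier M \<and> N \<inter> L = {\<zero>\<^bsub>M\<^esub>} \<longrightarrow> N = {\<zero>\<^bsub>M\<^esub>} \<or> L = {\<zero>\<^bsub>M\<^esub>})"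

definition maximal_hsubmodule ::
  "'k ring \<Rightarrow> ('k, 'g, 'a) hgroup \<Rightarrow> 'v set \<Rightarrow> ('k, 'v, 'g, 'a) hmod \<Rightarrow> bool" where
  "maximal_hsubmodule K H N M \<longleftrightarrow> hsubmodule K H N M \<and> N \<noteq> carrier M \<and>
     (\<forall>L. hsubmodule K H L M \<and> N \<subseteq> L \<longrightarrow> L = N \<or> L = carrier M)"

definition Rad :: "'k ring \<Rightarrow> ('k, 'g, 'a) hgroup \<Rightarrow> ('k, 'v, 'g, 'a) hmod \<Rightarrow> 'v set" where
  "Rad K H M = carrier M \<inter> \<Inter>{N. maximal_hsubmodule K H N M}"

text \<open>
  Homomorphisms are only determined on the carrier, so the elements of the endomorphism algebra
  are normalised to be \<^const>\<open>undefined\<close> outside it.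
\<close>

definition End_alg ::
  "'k ring \<Rightarrow> ('k, 'g, 'a) hgroup \<Rightarrow> ('k, 'v, 'g, 'a) hmod \<Rightarrow> ('k, 'v \<Rightarrow> 'v) module" where
  "End_alg K H M =
    \<lparr>carrier = hmod_hom K H M M \<inter> extensional (carrier M),
     monoid.mult = (\<lambda>f g. compose (carrier M) f g),
     one = (\<lambda>v\<in>carrier M. v),
     ring.zero = (\<lambda>v\<in>carrier M. \<zero>\<^bsub>M\<^esub>),
     ring.add = (\<lambda>f g. \<lambda>v\<in>carrier M. f v \<oplus>\<^bsub>M\<^esub> g v),
     smult = (\<lambda>c f. \<lambda>v\<in>carrier M. c \<odot>\<^bsub>M\<^esub> f v)\<rparr>"

text \<open>\<open>End(M) \<cong> K\<close> is an isomorphism of \<open>K\<close>-algebras, not merely of abstract rings.\<close>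

definition End_iso_field ::
  "'k ring \<Rightarrow> ('k, 'g, 'a) hgroup \<Rightarrow> ('k, 'v, 'g, 'a) hmod \<Rightarrow> bool" where
  "End_iso_field K H M \<longleftrightarrow>
     (\<exists>h\<in>ring_iso (End_alg K H M) K.
        \<forall>c\<in>carrier K. \<forall>f\<in>carrier (End_alg K H M). h (c \<odot>\<^bsub>End_alg K H M\<^esub> f) = c \<otimes>\<^bsub>K\<^esub> h f)"

definition End_scalar ::
  "'k ring \<Rightarrow> ('k, 'g, 'a) hgroup \<Rightarrow> ('k, 'v, 'g, 'a) hmod \<Rightarrow> bool" where
  "End_scalar K H M \<longleftrightarrow>
     carrier (End_alg K H M) =
       {c \<odot>\<^bsub>End_alg K H M\<^esub> \<one>\<^bsub>End_alg K H M\<^esub> | c. c \<in> carrier K}"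


section \<open>Extensions\<close>

text \<open>
  \<open>Ext\<^sup>1(S, T)\<close> is Yoneda's group of equivalence classes of short exact sequences
  \<open>0 \<rightarrow> T \<rightarrow> E \<rightarrow> S \<rightarrow> 0\<close>, given by triples \<open>(E, i, q)\<close>. The underlying set of \<open>E\<close> is in bijection
  with \<open>T \<times> S\<close>, so up to equivalence it suffices to consider \<open>E\<close> whose elements are of the type
  \<open>'t \<times> 's\<close>.
\<close>

type_synonym ('k, 'g, 'a, 't, 's) ext =
  "('k, 't \<times> 's, 'g, 'a) hmod \<times> ('t \<Rightarrow> 't \<times> 's) \<times> ('t \<times> 's \<Rightarrow> 's)"

definition extensions ::
  "'k ring \<Rightarrow> ('k, 'g, 'a) hgroup \<Rightarrow> ('k, 's, 'g, 'a) hmod \<Rightarrow> ('k, 't, 'g, 'a) hmod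
    \<Rightarrow> ('k, 'g, 'a, 't, 's) ext set" where
  "extensions K H S T = {(E, i, q). hmodule K H E \<and>
     i \<in> hmod_hom K H T E \<and> inj_on i (carrier T) \<and>
     q \<in> hmod_hom K H E S \<and> q ` carrier E = carrier S \<and>
     i ` carrier T = a_kernel E S q}"

definition ext_equiv ::
  "'k ring \<Rightarrow> ('k, 'g, 'a) hgroup \<Rightarrow> ('k, 's, 'g, 'a) hmod \<Rightarrow> ('k, 't, 'g, 'a) hmod
    \<Rightarrow> (('k, 'g, 'a, 't, 's) ext \<times> ('k, 'g, 'a, 't, 's) ext) set" where
  "ext_equiv K H S T = {((E, i, q), (E', i', q')).
     (E, i, q) \<in> extensions K H S T \<and> (E', i', q') \<in> extensions K H S T \<and>
     (\<exists>f\<in>hmod_hom K H E E'. (\<forall>t\<in>carrier T. f (i t) = i' t) \<and> (\<forall>e\<in>carrier E. q' (f e) = q e))}"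

definition split_ext ::
  "'k ring \<Rightarrow> ('k, 'g, 'a) hgroup \<Rightarrow> ('k, 's, 'g, 'a) hmod \<Rightarrow> ('k, 'g, 'a, 't, 's) ext \<Rightarrow> bool" where
  "split_ext K H S Y \<longleftrightarrow>
     (case Y of (E, i, q) \<Rightarrow> \<exists>s\<in>hmod_hom K H S E. \<forall>x\<in>carrier S. q (s x) = x)"

text \<open>
  \<open>Y''\<close> is (equivalent to) the Baer sum of \<open>Y\<close> and \<open>Y'\<close>, i.e. to the pushout along the addition
  \<open>T \<oplus> T \<rightarrow> T\<close> of the pullback along the diagonal \<open>S \<rightarrow> S \<oplus> S\<close> of \<open>Y \<oplus> Y'\<close>, iff there is a morphism
  \<open>(+, f, id)\<close> to \<open>Y''\<close> from the extension \<open>0 \<rightarrow> T \<oplus> T \<rightarrow> E \<times>\<^sub>S E' \<rightarrow> S \<rightarrow> 0\<close>.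
  Likewise, the scalar multiple of \<open>Y\<close> by \<open>c\<close> is the pushout of \<open>Y\<close> along \<open>c : T \<rightarrow> T\<close>.
\<close>

definition baer_sum ::
  "'k ring \<Rightarrow> ('k, 'g, 'a) hgroup \<Rightarrow> ('k, 't, 'g, 'a) hmod \<Rightarrow> ('k, 'g, 'a, 't, 's) ext
    \<Rightarrow> ('k, 'g, 'a, 't, 's) ext \<Rightarrow> ('k, 'g, 'a, 't, 's) ext \<Rightarrow> bool" where
  "baer_sum K H T Y Y' Y'' \<longleftrightarrow> (case (Y, Y', Y'') of ((E, i, q), (E', i', q'), (E'', i'', q'')) \<Rightarrow>
     (let P = {(e, e') \<in> carrier E \<times> carrier E'. q e = q' e'} in
       \<exists>f\<in>hmod_hom K H (sub_hmod K H (sum_hmod K H E E') P) E''.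
         (\<forall>t\<in>carrier T. \<forall>t'\<in>carrier T. f (i t, i' t') = i'' (t \<oplus>\<^bsub>T\<^esub> t')) \<and>
         (\<forall>(e, e')\<in>P. q'' (f (e, e')) = q e)))"

definition ext_scale ::
  "'k ring \<Rightarrow> ('k, 'g, 'a) hgroup \<Rightarrow> ('k, 't, 'g, 'a) hmod \<Rightarrow> 'k \<Rightarrow> ('k, 'g, 'a, 't, 's) ext
    \<Rightarrow> ('k, 'g, 'a, 't, 's) ext \<Rightarrow> bool" where
  "ext_scale K H T c Y Y' \<longleftrightarrow> (case (Y, Y') of ((E, i, q), (E', i', q')) \<Rightarrow>
     \<exists>f\<in>hmod_hom K H E E'.
       (\<forall>t\<in>carrier T. f (i t) = i' (c \<odot>\<^bsub>T\<^esub> t)) \<and> (\<forall>e\<in>carrier E. q' (f e) = q e))"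

definition Ext1 ::
  "'k ring \<Rightarrow> ('k, 'g, 'a) hgroup \<Rightarrow> ('k, 's, 'g, 'a) hmod \<Rightarrow> ('k, 't, 'g, 'a) hmod
    \<Rightarrow> ('k, ('k, 'g, 'a, 't, 's) ext set) module" where
  "Ext1 K H S T =
    \<lparr>carrier = extensions K H S T // ext_equiv K H S T,
     monoid.mult = undefined, one = undefined,
     ring.zero = {Y \<in> extensions K H S T. split_ext K H S Y},
     ring.add = (\<lambda>C C'. {Z \<in> extensions K H S T. \<exists>Y\<in>C. \<exists>Y'\<in>C'. baer_sum K H T Y Y' Z}),
     smult = (\<lambda>c C. {Z \<in> extensions K H S T. \<exists>Y\<in>C. ext_scale K H T c Y Z})\<rparr>"

text \<open>\<open>dim V \<ge> n\<close>, where \<open>V\<close> may be infinite-dimensional.\<close>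

definition dim_ge :: "'k ring \<Rightarrow> ('k, 'v, 'm) module_scheme \<Rightarrow> nat \<Rightarrow> bool" where
  "dim_ge K V n \<longleftrightarrow> (\<exists>B\<subseteq>carrier V. finite B \<and> card B = n \<and>
     (\<forall>c\<in>B \<rightarrow> carrier K. (\<Oplus>\<^bsub>V\<^esub>b\<in>B. c b \<odot>\<^bsub>V\<^esub> b) = \<zero>\<^bsub>V\<^esub> \<longrightarrow> (\<forall>b\<in>B. c b = \<zero>\<^bsub>K\<^esub>)))"

definition Ext1_nontrivial ::
  "'k ring \<Rightarrow> ('k, 'g, 'a) hgroup \<Rightarrow> ('k, 's, 'g, 'a) hmod \<Rightarrow> ('k, 't, 'g, 'a) hmod \<Rightarrow> bool" where
  "Ext1_nontrivial K H S T \<longleftrightarrow> carrier (Ext1 K H S T) \<noteq> {\<zero>\<^bsub>Ext1 K H S T\<^esub>}"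


section \<open>The hypotheses and the sequence of modules\<close>

definition case_i ::
  "'k ring \<Rightarrow> ('k, 'g, 'a) hgroup \<Rightarrow> ('k, 's, 'g, 'a) hmod \<Rightarrow> ('k, 't, 'g, 'a) hmod \<Rightarrow> bool" where
  "case_i K H S T \<longleftrightarrow> simple K H S \<and> simple K H T \<and> \<not> hmod_iso K H S T \<and>
     End_iso_field K H S \<and> End_iso_field K H T \<and> dim_ge K (Ext1 K H S T) 3"

definition case_ii ::
  "'k ring \<Rightarrow> ('k, 'g, 'a) hgroup \<Rightarrow> ('k, 'r, 'g, 'a) hmod \<Rightarrow> ('k, 's, 'g, 'a) hmod
    \<Rightarrow> ('k, 't, 'g, 'a) hmod \<Rightarrow> bool" where
  "case_ii K H R S T \<longleftrightarrow> simple K H R \<and> simple K H S \<and> simple K H T \<and>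
     \<not> hmod_iso K H R S \<and> \<not> hmod_iso K H R T \<and> \<not> hmod_iso K H S T \<and>
     End_iso_field K H R \<and> End_iso_field K H S \<and> End_iso_field K H T \<and>
     dim_ge K (Ext1 K H R T) 1 \<and> dim_ge K (Ext1 K H S T) 2"

definition case_iii ::
  "'k ring \<Rightarrow> ('k, 'g, 'a) hgroup \<Rightarrow> nat \<Rightarrow> ('k, 'r, 'g, 'a) hmod
    \<Rightarrow> (nat \<Rightarrow> ('k, 's, 'g, 'a) hmod) \<Rightarrow> (nat \<Rightarrow> ('k, 't, 'g, 'a) hmod) \<Rightarrow> bool" where
  "case_iii K H r R S T \<longleftrightarrow> 2 \<le> r \<and>
     simple K H R \<and> (\<forall>i\<in>{1..r}. simple K H (S i) \<and> simple K H (T i)) \<and>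
     (\<forall>i\<in>{1..r}. \<not> hmod_iso K H R (S i) \<and> \<not> hmod_iso K H R (T i)) \<and>
     (\<forall>i\<in>{1..r}. \<forall>j\<in>{1..r}. \<not> hmod_iso K H (S i) (T j)) \<and>
     (\<forall>i\<in>{1..r}. \<forall>j\<in>{1..r}. i \<noteq> j \<longrightarrow>
        \<not> hmod_iso K H (S i) (S j) \<and> \<not> hmod_iso K H (T i) (T j)) \<and>
     End_iso_field K H R \<and> (\<forall>i\<in>{1..r}. End_iso_field K H (S i) \<and> End_iso_field K H (T i)) \<and>
     Ext1_nontrivial K H R (T 1) \<and>
     (\<forall>i\<in>{1..r}. Ext1_nontrivial K H (S i) (T i)) \<and>
     (\<forall>i\<in>{1..r - 1}. Ext1_nontrivial K H (S (i + 1)) (T i)) \<and>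
     Ext1_nontrivial K H (S 1) (T r)"

definition embedded_sequence ::
  "'k ring \<Rightarrow> ('k, 'g, 'a) hgroup \<Rightarrow> (nat \<Rightarrow> ('k, 'v, 'g, 'a) hmod) \<Rightarrow> (nat \<Rightarrow> 'v \<Rightarrow> 'v) \<Rightarrow> bool"
  where
  "embedded_sequence K H M e \<longleftrightarrow>
     (\<forall>m\<ge>1. indecomposable K H (M m) \<and>
            e m \<in> hmod_hom K H (M m) (M (m + 1)) \<and> inj_on (e m) (carrier (M m)))"

end

theory Submission imports Defs "HOL-Library.Nat_Bijection" begin

text \<open>
  The module \<open>M\<^sub>m\<close> is a string. Its top consists of simple modules \<open>P\<^sub>0, \<dots>, P\<^sub>m\<^sub>-\<^sub>1\<close>, its bottom of simple modules
  \<open>Q\<^sub>0, \<dots>, Q\<^sub>m\<^sub>-\<^sub>1\<close>; each \<open>P\<^sub>i\<close> is glued to \<open>Q\<^sub>i\<close> by a non-split extension \<open>b\<^sub>i\<close>, and each \<open>P\<^sub>i\<^sub>+\<^sub>1\<close> to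
  \<open>Q\<^sub>i\<close> by an extension \<open>a\<^sub>i\<close>:

    \<open>P\<^sub>0 \<midarrow>b\<^sub>0\<rightarrow> Q\<^sub>0 \<leftarrow>a\<^sub>0\<midarrow> P\<^sub>1 \<midarrow>b\<^sub>1\<rightarrow> Q\<^sub>1 \<leftarrow>a\<^sub>1\<midarrow> P\<^sub>2 \<midarrow>b\<^sub>2\<rightarrow> \<dots>\<close>

  Cutting the string after \<open>Q\<^sub>m\<^sub>-\<^sub>1\<close> gives \<open>M\<^sub>m\<close>, so \<open>M\<^sub>m\<close> is literally a submodule of \<open>M\<^sub>m\<^sub>+\<^sub>1\<close>. If
  \<open>dim Ext\<^sup>1(S, T) \<ge> 3\<close>, take all \<open>P\<^sub>i = S\<close>, all \<open>Q\<^sub>i = T\<close>, three independent classes \<open>\<gamma>, \<beta>, \<alpha>\<close>, and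
  \<open>b\<^sub>0 = \<gamma>\<close>, \<open>b\<^sub>i = \<beta>\<close> for \<open>i \<ge> 1\<close>, \<open>a\<^sub>i = \<alpha>\<close>. If only \<open>dim Ext\<^sup>1(S, T) \<ge> 2\<close>, a further simple module
  \<open>P\<^sub>0 = R\<close> with \<open>Ext\<^sup>1(R, T) \<noteq> 0\<close> takes over the part of the third class. In the cyclic case
  \<open>P\<^sub>0 = R\<close>, and the string winds around the cycle \<open>T\<^sub>1, S\<^sub>2, T\<^sub>2, S\<^sub>3, \<dots>, T\<^sub>r, S\<^sub>1, T\<^sub>1, \<dots>\<close> for ever.

  An endomorphism \<open>\<phi>\<close> of \<open>M\<^sub>m\<close> maps the bottom to itself, as no top module occurs in the bottom. By
  Schur's lemma, with endomorphism rings equal to the field, its components \<open>P\<^sub>j \<rightarrow> P\<^sub>i\<close> and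
  \<open>Q\<^sub>j \<rightarrow> Q\<^sub>i\<close> are scalars \<open>A\<^sub>i\<^sub>j\<close> and \<open>B\<^sub>i\<^sub>j\<close>. That \<open>\<phi>\<close> respects the extensions amounts to

    \<open>B\<^sub>i\<^sub>j b\<^sub>j + B\<^sub>i\<^sub>,\<^sub>j\<^sub>-\<^sub>1 a\<^sub>j\<^sub>-\<^sub>1 = A\<^sub>i\<^sub>j b\<^sub>i + A\<^sub>i\<^sub>+\<^sub>1\<^sub>,\<^sub>j a\<^sub>i\<close>  in  \<open>Ext\<^sup>1(P\<^sub>j, Q\<^sub>i)\<close>.

  Linear independence of the classes yields \<open>A\<^sub>i\<^sub>j = B\<^sub>i\<^sub>j\<close> and \<open>A\<^sub>i\<^sub>+\<^sub>1\<^sub>,\<^sub>j = B\<^sub>i\<^sub>,\<^sub>j\<^sub>-\<^sub>1\<close>, so that both matrices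
  are constant along diagonals, and the exceptional module or class at the beginning of the string makes the
  entries of row and column \<open>0\<close> vanish off the diagonal. Hence both matrices are the same scalar \<open>c\<close>,
  and \<open>\<phi> - c\<close> is induced by a homomorphism from top to bottom, which is zero
  (\<open>scalar_end_M\<close>). A module with scalar endomorphisms only is indecomposable. The radical is the
  bottom (\<open>Rad_M\<close>): the quotient by the bottom is semisimple, and a maximal submodule that misses some
  \<open>Q\<^sub>j\<close> would have \<open>Q\<^sub>j\<close> as a complement, whereas every homomorphism \<open>M\<^sub>m \<rightarrow> Q\<^sub>j\<close> vanishes on
  the bottom, because no \<open>b\<^sub>j\<close> splits (\<open>hom_M_Q\<close>).

  Finite groups and algebraic groups are treated together. The role of the group elements is played by
  operators: the elements of a finite group \<open>G\<close>, or the linear functionals \<open>f\<close> on the coordinate algebra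
  \<open>A\<close>, acting on a comodule by \<open>(id \<otimes> f) \<circ> coaction\<close> and multiplied by convolution. Functionals separate
  the elements of \<open>V \<otimes> A\<close> (\<open>slices_separate\<close>), so homomorphisms, submodules, quotients and sums of
  comodules can be described by these operators, and a representation by operators comes from a comodule if
  and only if every orbit map has the form \<open>f \<mapsto> \<Sum>f(a\<^sub>i) u\<^sub>i\<close>. In this language the Yoneda group
  \<open>Ext\<^sup>1(S, T)\<close> is the space of cocycles modulo coboundaries, with the Baer sum becoming the sum of cocycles
  (\<open>Ext1_carrier\<close>, \<open>Ext1_add\<close>, \<open>Ext1_smult\<close>), and the strings can be written down directly.

  Finally, simple modules are finite-dimensional, so that they have copies whose elements are functions
  \<open>nat \<Rightarrow> 'k\<close>; a string over such copies again fits into this type.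
\<close>

section \<open>Vector spaces as records\<close>

locale ground = field K for K :: "'k ring" (structure)
begin

text \<open>
  The rules below carry the premise \<open>module K V\<close> instead of living in the locale \<open>module\<close>, since most proofs
  compute in several spaces at once, some of them built by operations such as \<open>tensor\<close> or \<open>power_hmod\<close>.
\<close>
lemma v_grp: "module K V \<Longrightarrow> abelian_group V"
  by (simp add: module_def)
lemma v_mon: "module K V \<Longrightarrow> abelian_monoid V"
  by (simp add: module_def abelian_group_def)

lemma vadd_closed [simp]: "module K V \<Longrightarrow> x \<in> carrier V \<Longrightarrow> y \<in> carrier V \<Longrightarrow> x \<oplus>\<^bsub>V\<^esub> y \<in> carrier V"
  by (simp add: abelian_monoid.a_closed v_mon)
lemma vzero_closed [simp]: "module K V \<Longrightarrow> \<zero>\<^bsub>V\<^esub> \<in> carrier V"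
  by (simp add: abelian_monoid.zero_closed v_mon)
lemma vneg_closed [simp]: "module K V \<Longrightarrow> x \<in> carrier V \<Longrightarrow> \<ominus>\<^bsub>V\<^esub> x \<in> carrier V"
  by (simp add: abelian_group.a_inv_closed v_grp)
lemma vminus_closed [simp]: "module K V \<Longrightarrow> x \<in> carrier V \<Longrightarrow> y \<in> carrier V \<Longrightarrow> x \<ominus>\<^bsub>V\<^esub> y \<in> carrier V"
  by (simp add: a_minus_def)
lemma vsmult_closed [simp]: "module K V \<Longrightarrow> c \<in> carrier K \<Longrightarrow> x \<in> carrier V \<Longrightarrow> c \<odot>\<^bsub>V\<^esub> x \<in> carrier V"
  by (simp add: module.smult_closed)

lemma vassoc: "module K V \<Longrightarrow> x \<in> carrier V \<Longrightarrow> y \<in> carrier V \<Longrightarrow> z \<in> carrier V \<Longrightarrow>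
    (x \<oplus>\<^bsub>V\<^esub> y) \<oplus>\<^bsub>V\<^esub> z = x \<oplus>\<^bsub>V\<^esub> (y \<oplus>\<^bsub>V\<^esub> z)"
  by (simp add: abelian_monoid.a_assoc v_mon)
lemma vcomm: "module K V \<Longrightarrow> x \<in> carrier V \<Longrightarrow> y \<in> carrier V \<Longrightarrow> x \<oplus>\<^bsub>V\<^esub> y = y \<oplus>\<^bsub>V\<^esub> x"
  by (simp add: abelian_monoid.a_comm v_mon)
lemma vlcomm: "module K V \<Longrightarrow> x \<in> carrier V \<Longrightarrow> y \<in> carrier V \<Longrightarrow> z \<in> carrier V \<Longrightarrow>
    x \<oplus>\<^bsub>V\<^esub> (y \<oplus>\<^bsub>V\<^esub> z) = y \<oplus>\<^bsub>V\<^esub> (x \<oplus>\<^bsub>V\<^esub> z)"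
  by (simp add: abelian_monoid.a_lcomm v_mon)
lemmas vac = vassoc vcomm vlcomm

lemma vlzero [simp]: "module K V \<Longrightarrow> x \<in> carrier V \<Longrightarrow> \<zero>\<^bsub>V\<^esub> \<oplus>\<^bsub>V\<^esub> x = x"
  by (simp add: abelian_monoid.l_zero v_mon)
lemma vrzero [simp]: "module K V \<Longrightarrow> x \<in> carrier V \<Longrightarrow> x \<oplus>\<^bsub>V\<^esub> \<zero>\<^bsub>V\<^esub> = x"
  by (simp add: abelian_monoid.r_zero v_mon)
lemma vlneg [simp]: "module K V \<Longrightarrow> x \<in> carrier V \<Longrightarrow> \<ominus>\<^bsub>V\<^esub> x \<oplus>\<^bsub>V\<^esub> x = \<zero>\<^bsub>V\<^esub>"
  by (simp add: abelian_group.l_neg v_grp)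
lemma vrneg [simp]: "module K V \<Longrightarrow> x \<in> carrier V \<Longrightarrow> x \<oplus>\<^bsub>V\<^esub> \<ominus>\<^bsub>V\<^esub> x = \<zero>\<^bsub>V\<^esub>"
  by (simp add: abelian_group.r_neg v_grp)
lemma vlneg1 [simp]: "module K V \<Longrightarrow> x \<in> carrier V \<Longrightarrow> y \<in> carrier V \<Longrightarrow> \<ominus>\<^bsub>V\<^esub> x \<oplus>\<^bsub>V\<^esub> (x \<oplus>\<^bsub>V\<^esub> y) = y"
  by (simp add: abelian_group.r_neg1 v_grp)
lemma vlneg2 [simp]: "module K V \<Longrightarrow> x \<in> carrier V \<Longrightarrow> y \<in> carrier V \<Longrightarrow> x \<oplus>\<^bsub>V\<^esub> (\<ominus>\<^bsub>V\<^esub> x \<oplus>\<^bsub>V\<^esub> y) = y"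
  by (simp add: abelian_group.r_neg2 v_grp)
lemma vnegneg [simp]: "module K V \<Longrightarrow> x \<in> carrier V \<Longrightarrow> \<ominus>\<^bsub>V\<^esub> (\<ominus>\<^bsub>V\<^esub> x) = x"
  by (simp add: abelian_group.minus_minus v_grp)
lemma vneg_add: "module K V \<Longrightarrow> x \<in> carrier V \<Longrightarrow> y \<in> carrier V \<Longrightarrow> \<ominus>\<^bsub>V\<^esub> (x \<oplus>\<^bsub>V\<^esub> y) = \<ominus>\<^bsub>V\<^esub> x \<oplus>\<^bsub>V\<^esub> \<ominus>\<^bsub>V\<^esub> y"
  by (simp add: abelian_group.minus_add v_grp)
lemma vneg_zero [simp]: "module K V \<Longrightarrow> \<ominus>\<^bsub>V\<^esub> \<zero>\<^bsub>V\<^esub> = \<zero>\<^bsub>V\<^esub>"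
  by (metis vrneg vlzero vzero_closed vneg_closed)
lemma vadd_cancel [simp]: "module K V \<Longrightarrow> x \<in> carrier V \<Longrightarrow> y \<in> carrier V \<Longrightarrow> z \<in> carrier V \<Longrightarrow>
    (x \<oplus>\<^bsub>V\<^esub> y = x \<oplus>\<^bsub>V\<^esub> z) \<longleftrightarrow> y = z"
  by (metis vlneg1)
lemma vminus_eq_zero [simp]: "module K V \<Longrightarrow> x \<in> carrier V \<Longrightarrow> y \<in> carrier V \<Longrightarrow>
    (x \<ominus>\<^bsub>V\<^esub> y = \<zero>\<^bsub>V\<^esub>) \<longleftrightarrow> x = y"
  by (metis a_minus_def vlneg2 vneg_closed vrneg vrzero vcomm)
lemma vminus_add_cancel [simp]: "module K V \<Longrightarrow> x \<in> carrier V \<Longrightarrow> y \<in> carrier V \<Longrightarrow>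
    y \<oplus>\<^bsub>V\<^esub> (x \<ominus>\<^bsub>V\<^esub> y) = x"
  by (simp add: a_minus_def vac)
lemma vcancels [simp]:
  assumes "module K V" "x \<in> carrier V" "y \<in> carrier V"
  shows "x \<oplus>\<^bsub>V\<^esub> (y \<oplus>\<^bsub>V\<^esub> \<ominus>\<^bsub>V\<^esub> x) = y" "\<ominus>\<^bsub>V\<^esub> x \<oplus>\<^bsub>V\<^esub> (y \<oplus>\<^bsub>V\<^esub> x) = y"
    "z \<in> carrier V \<Longrightarrow> x \<oplus>\<^bsub>V\<^esub> (y \<oplus>\<^bsub>V\<^esub> (\<ominus>\<^bsub>V\<^esub> x \<oplus>\<^bsub>V\<^esub> z)) = y \<oplus>\<^bsub>V\<^esub> z"
    "z \<in> carrier V \<Longrightarrow> \<ominus>\<^bsub>V\<^esub> x \<oplus>\<^bsub>V\<^esub> (y \<oplus>\<^bsub>V\<^esub> (x \<oplus>\<^bsub>V\<^esub> z)) = y \<oplus>\<^bsub>V\<^esub> z"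
proof -
  note assms [simp]
  show "x \<oplus>\<^bsub>V\<^esub> (y \<oplus>\<^bsub>V\<^esub> \<ominus>\<^bsub>V\<^esub> x) = y" by (subst vcomm[of V y]) simp_all
  show "\<ominus>\<^bsub>V\<^esub> x \<oplus>\<^bsub>V\<^esub> (y \<oplus>\<^bsub>V\<^esub> x) = y" by (subst vcomm[of V y]) simp_all
  assume [simp]: "z \<in> carrier V"
  show "x \<oplus>\<^bsub>V\<^esub> (y \<oplus>\<^bsub>V\<^esub> (\<ominus>\<^bsub>V\<^esub> x \<oplus>\<^bsub>V\<^esub> z)) = y \<oplus>\<^bsub>V\<^esub> z" by (subst vlcomm[of V y]) simp_all
  show "\<ominus>\<^bsub>V\<^esub> x \<oplus>\<^bsub>V\<^esub> (y \<oplus>\<^bsub>V\<^esub> (x \<oplus>\<^bsub>V\<^esub> z)) = y \<oplus>\<^bsub>V\<^esub> z" by (subst vlcomm[of V y]) simp_all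
qed
lemma vminus_self [simp]: "module K V \<Longrightarrow> x \<in> carrier V \<Longrightarrow> x \<ominus>\<^bsub>V\<^esub> x = \<zero>\<^bsub>V\<^esub>"
  by simp
lemma vminus_zero [simp]: "module K V \<Longrightarrow> x \<in> carrier V \<Longrightarrow> x \<ominus>\<^bsub>V\<^esub> \<zero>\<^bsub>V\<^esub> = x"
  by (simp add: a_minus_def)

lemma smult_l_null [simp]: "module K V \<Longrightarrow> x \<in> carrier V \<Longrightarrow> \<zero> \<odot>\<^bsub>V\<^esub> x = \<zero>\<^bsub>V\<^esub>"
  by (simp add: module.smult_l_null)
lemma smult_r_null [simp]: "module K V \<Longrightarrow> c \<in> carrier K \<Longrightarrow> c \<odot>\<^bsub>V\<^esub> \<zero>\<^bsub>V\<^esub> = \<zero>\<^bsub>V\<^esub>"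
  by (simp add: module.smult_r_null)
lemma smult_one [simp]: "module K V \<Longrightarrow> x \<in> carrier V \<Longrightarrow> \<one> \<odot>\<^bsub>V\<^esub> x = x"
  by (simp add: module.smult_one)
lemma smult_smult: "module K V \<Longrightarrow> c \<in> carrier K \<Longrightarrow> d \<in> carrier K \<Longrightarrow> x \<in> carrier V \<Longrightarrow>
    c \<odot>\<^bsub>V\<^esub> (d \<odot>\<^bsub>V\<^esub> x) = (c \<otimes> d) \<odot>\<^bsub>V\<^esub> x"
  by (simp add: module.smult_assoc1)
lemma smult_add: "module K V \<Longrightarrow> c \<in> carrier K \<Longrightarrow> x \<in> carrier V \<Longrightarrow> y \<in> carrier V \<Longrightarrow>
    c \<odot>\<^bsub>V\<^esub> (x \<oplus>\<^bsub>V\<^esub> y) = c \<odot>\<^bsub>V\<^esub> x \<oplus>\<^bsub>V\<^esub> c \<odot>\<^bsub>V\<^esub> y"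
  by (simp add: module.smult_r_distr)
lemma add_smult: "module K V \<Longrightarrow> c \<in> carrier K \<Longrightarrow> d \<in> carrier K \<Longrightarrow> x \<in> carrier V \<Longrightarrow>
    (c \<oplus> d) \<odot>\<^bsub>V\<^esub> x = c \<odot>\<^bsub>V\<^esub> x \<oplus>\<^bsub>V\<^esub> d \<odot>\<^bsub>V\<^esub> x"
  by (simp add: module.smult_l_distr)
lemma smult_neg: "module K V \<Longrightarrow> c \<in> carrier K \<Longrightarrow> x \<in> carrier V \<Longrightarrow>
    c \<odot>\<^bsub>V\<^esub> (\<ominus>\<^bsub>V\<^esub> x) = \<ominus>\<^bsub>V\<^esub> (c \<odot>\<^bsub>V\<^esub> x)"
  by (simp add: module.smult_r_minus)
lemma neg_smult: "module K V \<Longrightarrow> c \<in> carrier K \<Longrightarrow> x \<in> carrier V \<Longrightarrow>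
    (\<ominus> c) \<odot>\<^bsub>V\<^esub> x = \<ominus>\<^bsub>V\<^esub> (c \<odot>\<^bsub>V\<^esub> x)"
  by (simp add: module.smult_l_minus)
lemma smult_minus: "module K V \<Longrightarrow> c \<in> carrier K \<Longrightarrow> x \<in> carrier V \<Longrightarrow> y \<in> carrier V \<Longrightarrow>
    c \<odot>\<^bsub>V\<^esub> (x \<ominus>\<^bsub>V\<^esub> y) = c \<odot>\<^bsub>V\<^esub> x \<ominus>\<^bsub>V\<^esub> c \<odot>\<^bsub>V\<^esub> y"
  by (simp add: a_minus_def smult_add smult_neg)
lemma minus_smult: "module K V \<Longrightarrow> c \<in> carrier K \<Longrightarrow> d \<in> carrier K \<Longrightarrow> x \<in> carrier V \<Longrightarrow>
    (c \<ominus> d) \<odot>\<^bsub>V\<^esub> x = c \<odot>\<^bsub>V\<^esub> x \<ominus>\<^bsub>V\<^esub> d \<odot>\<^bsub>V\<^esub> x"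
  by (simp add: a_minus_def add_smult neg_smult)

lemma inv_smult [simp]:
  assumes "module K V" "c \<in> carrier K" "c \<noteq> \<zero>" "x \<in> carrier V"
  shows "inv c \<odot>\<^bsub>V\<^esub> (c \<odot>\<^bsub>V\<^esub> x) = x" "inv c \<in> carrier K"
proof -
  have "c \<in> Units K" using assms field_Units by auto
  then show "inv c \<in> carrier K" "inv c \<odot>\<^bsub>V\<^esub> (c \<odot>\<^bsub>V\<^esub> x) = x"
    using assms by (simp_all add: smult_smult)
qed

lemma smult_eq_zero [simp]:
  assumes "module K V" "c \<in> carrier K" "x \<in> carrier V"
  shows "c \<odot>\<^bsub>V\<^esub> x = \<zero>\<^bsub>V\<^esub> \<longleftrightarrow> c = \<zero> \<or> x = \<zero>\<^bsub>V\<^esub>"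
  using assms inv_smult by (metis smult_l_null smult_r_null)

text \<open>
  Over a field, \<open>(-1) v\<close> supplies the additive inverse, so no inverse has to be exhibited.
\<close>
lemma moduleI':
  assumes "\<And>x y. x \<in> carrier V \<Longrightarrow> y \<in> carrier V \<Longrightarrow> x \<oplus>\<^bsub>V\<^esub> y \<in> carrier V"
    and "\<zero>\<^bsub>V\<^esub> \<in> carrier V"
    and "\<And>c x. c \<in> carrier K \<Longrightarrow> x \<in> carrier V \<Longrightarrow> c \<odot>\<^bsub>V\<^esub> x \<in> carrier V"
    and "\<And>x y z. x \<in> carrier V \<Longrightarrow> y \<in> carrier V \<Longrightarrow> z \<in> carrier V \<Longrightarrow>
            (x \<oplus>\<^bsub>V\<^esub> y) \<oplus>\<^bsub>V\<^esub> z = x \<oplus>\<^bsub>V\<^esub> (y \<oplus>\<^bsub>V\<^esub> z)"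
    and "\<And>x y. x \<in> carrier V \<Longrightarrow> y \<in> carrier V \<Longrightarrow> x \<oplus>\<^bsub>V\<^esub> y = y \<oplus>\<^bsub>V\<^esub> x"
    and "\<And>x. x \<in> carrier V \<Longrightarrow> \<zero>\<^bsub>V\<^esub> \<oplus>\<^bsub>V\<^esub> x = x"
    and neg: "\<And>x. x \<in> carrier V \<Longrightarrow> x \<oplus>\<^bsub>V\<^esub> (\<ominus> \<one>) \<odot>\<^bsub>V\<^esub> x = \<zero>\<^bsub>V\<^esub>"
    and "\<And>c d x. c \<in> carrier K \<Longrightarrow> d \<in> carrier K \<Longrightarrow> x \<in> carrier V \<Longrightarrow>
            (c \<oplus> d) \<odot>\<^bsub>V\<^esub> x = c \<odot>\<^bsub>V\<^esub> x \<oplus>\<^bsub>V\<^esub> d \<odot>\<^bsub>V\<^esub> x"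
    and "\<And>c x y. c \<in> carrier K \<Longrightarrow> x \<in> carrier V \<Longrightarrow> y \<in> carrier V \<Longrightarrow>
            c \<odot>\<^bsub>V\<^esub> (x \<oplus>\<^bsub>V\<^esub> y) = c \<odot>\<^bsub>V\<^esub> x \<oplus>\<^bsub>V\<^esub> c \<odot>\<^bsub>V\<^esub> y"
    and "\<And>c d x. c \<in> carrier K \<Longrightarrow> d \<in> carrier K \<Longrightarrow> x \<in> carrier V \<Longrightarrow>
            (c \<otimes> d) \<odot>\<^bsub>V\<^esub> x = c \<odot>\<^bsub>V\<^esub> (d \<odot>\<^bsub>V\<^esub> x)"
    and "\<And>x. x \<in> carrier V \<Longrightarrow> \<one> \<odot>\<^bsub>V\<^esub> x = x"
  shows "module K V"
proof (rule moduleI)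
  show "cring K" by (rule is_cring)
  show "abelian_group V"
  proof (rule abelian_groupI)
    fix x assume "x \<in> carrier V"
    then show "\<exists>y\<in>carrier V. y \<oplus>\<^bsub>V\<^esub> x = \<zero>\<^bsub>V\<^esub>"
      using assms(3)[of "\<ominus> \<one>" x] assms(5)[of "(\<ominus> \<one>) \<odot>\<^bsub>V\<^esub> x" x] neg[of x] by auto
  qed (rule assms; assumption)+
qed (rule assms; assumption)+

lemma linI:
  assumes "\<And>v. v \<in> carrier V \<Longrightarrow> f v \<in> carrier W"
    and "\<And>u v. u \<in> carrier V \<Longrightarrow> v \<in> carrier V \<Longrightarrow> f (u \<oplus>\<^bsub>V\<^esub> v) = f u \<oplus>\<^bsub>W\<^esub> f v"
    and "\<And>c v. c \<in> carrier K \<Longrightarrow> v \<in> carrier V \<Longrightarrow> f (c \<odot>\<^bsub>V\<^esub> v) = c \<odot>\<^bsub>W\<^esub> f v"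
  shows "f \<in> lin K V W"
  using assms by (auto simp: lin_def hom_def)

lemma lin_closed: "f \<in> lin K V W \<Longrightarrow> v \<in> carrier V \<Longrightarrow> f v \<in> carrier W"
  by (auto simp: lin_def hom_def)
lemma lin_add: "f \<in> lin K V W \<Longrightarrow> u \<in> carrier V \<Longrightarrow> v \<in> carrier V \<Longrightarrow> f (u \<oplus>\<^bsub>V\<^esub> v) = f u \<oplus>\<^bsub>W\<^esub> f v"
  by (auto simp: lin_def hom_def)
lemma lin_smult: "f \<in> lin K V W \<Longrightarrow> c \<in> carrier K \<Longrightarrow> v \<in> carrier V \<Longrightarrow> f (c \<odot>\<^bsub>V\<^esub> v) = c \<odot>\<^bsub>W\<^esub> f v"
  by (auto simp: lin_def hom_def)
lemma lin_zero [simp]: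
  assumes "f \<in> lin K V W" "module K V" "module K W" shows "f \<zero>\<^bsub>V\<^esub> = \<zero>\<^bsub>W\<^esub>"
  using lin_smult[OF assms(1), of \<zero> "\<zero>\<^bsub>V\<^esub>"] assms by (simp add: lin_closed)
lemma lin_neg:
  assumes "f \<in> lin K V W" "module K V" "module K W" "v \<in> carrier V" shows "f (\<ominus>\<^bsub>V\<^esub> v) = \<ominus>\<^bsub>W\<^esub> f v"
  using lin_smult[OF assms(1), of "\<ominus> \<one>" v] assms by (simp add: neg_smult lin_closed)
lemma lin_minus:
  assumes "f \<in> lin K V W" "module K V" "module K W" "u \<in> carrier V" "v \<in> carrier V"
  shows "f (u \<ominus>\<^bsub>V\<^esub> v) = f u \<ominus>\<^bsub>W\<^esub> f v"
  using assms by (simp add: a_minus_def lin_add lin_neg)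
declare lin_closed [simp]
lemmas lin_simps = lin_add lin_smult lin_neg lin_minus

lemma lin_id [simp]: "id \<in> lin K V V" "(\<lambda>x. x) \<in> lin K V V"
  by (auto intro: linI)
lemma lin_comp: "f \<in> lin K V W \<Longrightarrow> g \<in> lin K W U \<Longrightarrow> (\<lambda>v. g (f v)) \<in> lin K V U"
  by (rule linI) (auto simp: lin_simps)
lemma lin_cong: "f \<in> lin K V W \<Longrightarrow> module K V \<Longrightarrow> (\<And>v. v \<in> carrier V \<Longrightarrow> f v = g v) \<Longrightarrow> g \<in> lin K V W"
proof (rule linI)
  assume a: "f \<in> lin K V W" "module K V" and e: "\<And>v. v \<in> carrier V \<Longrightarrow> f v = g v"
  show "g v \<in> carrier W" if "v \<in> carrier V" for v using lin_closed[OF a(1) that] e[OF that] by simp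
  show "g (u \<oplus>\<^bsub>V\<^esub> v) = g u \<oplus>\<^bsub>W\<^esub> g v" if "u \<in> carrier V" "v \<in> carrier V" for u v
    using lin_add[OF a(1) that] a(2) that by (simp add: e[symmetric])
  show "g (c \<odot>\<^bsub>V\<^esub> v) = c \<odot>\<^bsub>W\<^esub> g v" if "c \<in> carrier K" "v \<in> carrier V" for c v
    using lin_smult[OF a(1) that] a(2) that by (simp add: e[symmetric])
qed

lemma lin_plus: "module K W \<Longrightarrow> f \<in> lin K V W \<Longrightarrow> g \<in> lin K V W \<Longrightarrow> (\<lambda>v. f v \<oplus>\<^bsub>W\<^esub> g v) \<in> lin K V W"
  by (rule linI) (auto simp: lin_add lin_smult vac smult_add)
lemma lin_diff: "module K W \<Longrightarrow> f \<in> lin K V W \<Longrightarrow> g \<in> lin K V W \<Longrightarrow> (\<lambda>v. f v \<ominus>\<^bsub>W\<^esub> g v) \<in> lin K V W"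
  by (rule linI) (auto simp: a_minus_def lin_add lin_smult vac vneg_add smult_add smult_neg)
lemma lin_scale: "module K W \<Longrightarrow> f \<in> lin K V W \<Longrightarrow> c \<in> carrier K \<Longrightarrow> (\<lambda>v. c \<odot>\<^bsub>W\<^esub> f v) \<in> lin K V W"
  by (rule linI) (auto simp: lin_add lin_smult smult_add smult_smult m_comm)
lemma lin_const_zero [simp]: "module K W \<Longrightarrow> (\<lambda>v. \<zero>\<^bsub>W\<^esub>) \<in> lin K V W"
  by (rule linI) auto

lemma vsum_empty [simp]: "module K V \<Longrightarrow> finsum V f {} = \<zero>\<^bsub>V\<^esub>"
  by (simp add: abelian_monoid.finsum_empty v_mon)
lemma vsum_Suc: "module K V \<Longrightarrow> (\<And>i. i < Suc n \<Longrightarrow> f i \<in> carrier V) \<Longrightarrow>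
   (\<Oplus>\<^bsub>V\<^esub>i\<in>{..<Suc n}. f i) = (\<Oplus>\<^bsub>V\<^esub>i\<in>{..<n}. f i) \<oplus>\<^bsub>V\<^esub> f n"
  unfolding lessThan_Suc
  by (subst abelian_monoid.finsum_insert) (auto simp: v_mon vcomm abelian_monoid.finsum_closed Pi_def)
lemma vsum_closed: "module K V \<Longrightarrow> (\<And>i. i < n \<Longrightarrow> f i \<in> carrier V) \<Longrightarrow>
   (\<Oplus>\<^bsub>V\<^esub>i\<in>{..<n::nat}. f i) \<in> carrier V"
  by (auto simp: v_mon abelian_monoid.finsum_closed Pi_def)
lemma vsum_cong: "module K V \<Longrightarrow> (\<And>i. i < n \<Longrightarrow> f i \<in> carrier V) \<Longrightarrow> (\<And>i. i < n \<Longrightarrow> f i = g i) \<Longrightarrow>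
   (\<Oplus>\<^bsub>V\<^esub>i\<in>{..<n::nat}. f i) = (\<Oplus>\<^bsub>V\<^esub>i\<in>{..<n}. g i)"
  by (rule abelian_monoid.finsum_cong') (auto simp: v_mon)
lemma vsum_add: "module K V \<Longrightarrow> (\<And>i. i < n \<Longrightarrow> f i \<in> carrier V) \<Longrightarrow> (\<And>i. i < n \<Longrightarrow> g i \<in> carrier V) \<Longrightarrow>
   (\<Oplus>\<^bsub>V\<^esub>i\<in>{..<n::nat}. f i \<oplus>\<^bsub>V\<^esub> g i) = (\<Oplus>\<^bsub>V\<^esub>i\<in>{..<n}. f i) \<oplus>\<^bsub>V\<^esub> (\<Oplus>\<^bsub>V\<^esub>i\<in>{..<n}. g i)"
  by (rule abelian_monoid.finsum_addf) (auto simp: v_mon)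
lemma lin_vsum:
  assumes "f \<in> lin K V W" "module K V" "module K W" "\<And>i. i < n \<Longrightarrow> x i \<in> carrier V"
  shows "f (\<Oplus>\<^bsub>V\<^esub>i\<in>{..<n::nat}. x i) = (\<Oplus>\<^bsub>W\<^esub>i\<in>{..<n}. f (x i))"
  using assms(4)
proof (induction n)
  case (Suc n) then show ?case using assms(1-3)
    by (simp add: vsum_Suc lin_add vsum_closed)
qed (use assms in \<open>simp\<close>)
lemma vsum_zero: "module K V \<Longrightarrow> (\<And>i. i < n \<Longrightarrow> f i = \<zero>\<^bsub>V\<^esub>) \<Longrightarrow>
   (\<Oplus>\<^bsub>V\<^esub>i\<in>{..<n::nat}. f i) = \<zero>\<^bsub>V\<^esub>"
  by (induction n) (auto simp: vsum_Suc)
lemma smult_vsum: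
  assumes "module K V" "c \<in> carrier K" "\<And>i. i < n \<Longrightarrow> f i \<in> carrier V"
  shows "c \<odot>\<^bsub>V\<^esub> (\<Oplus>\<^bsub>V\<^esub>i\<in>{..<n::nat}. f i) = (\<Oplus>\<^bsub>V\<^esub>i\<in>{..<n}. c \<odot>\<^bsub>V\<^esub> f i)"
  using assms by (intro lin_vsum[of "\<lambda>v. c \<odot>\<^bsub>V\<^esub> v"] lin_scale) auto

lemma submodule_iff:
  assumes "module K V"
  shows "submodule N K V \<longleftrightarrow> N \<subseteq> carrier V \<and> \<zero>\<^bsub>V\<^esub> \<in> N \<and> (\<forall>x\<in>N. \<forall>y\<in>N. x \<oplus>\<^bsub>V\<^esub> y \<in> N) \<and>
    (\<forall>c\<in>carrier K. \<forall>x\<in>N. c \<odot>\<^bsub>V\<^esub> x \<in> N)"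
proof
  assume s: "submodule N K V"
  have "subgroup N (add_monoid V)" using s by (simp add: submodule_def)
  then have "\<zero>\<^bsub>V\<^esub> \<in> N" using subgroup.one_closed by fastforce
  then show "N \<subseteq> carrier V \<and> \<zero>\<^bsub>V\<^esub> \<in> N \<and> (\<forall>x\<in>N. \<forall>y\<in>N. x \<oplus>\<^bsub>V\<^esub> y \<in> N) \<and>
    (\<forall>c\<in>carrier K. \<forall>x\<in>N. c \<odot>\<^bsub>V\<^esub> x \<in> N)"
    using module.submoduleE[OF assms s] by blast
next
  assume r: "N \<subseteq> carrier V \<and> \<zero>\<^bsub>V\<^esub> \<in> N \<and> (\<forall>x\<in>N. \<forall>y\<in>N. x \<oplus>\<^bsub>V\<^esub> y \<in> N) \<and>
    (\<forall>c\<in>carrier K. \<forall>x\<in>N. c \<odot>\<^bsub>V\<^esub> x \<in> N)"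
  have "\<ominus>\<^bsub>V\<^esub> a \<in> N" if "a \<in> N" for a
  proof -
    have "\<ominus>\<^bsub>V\<^esub> a = (\<ominus> \<one>) \<odot>\<^bsub>V\<^esub> a" using r that assms neg_smult[of V \<one> a] by auto
    then show ?thesis using r that by auto
  qed
  then show "submodule N K V" using r by (intro module.submoduleI[OF assms]) auto
qed

lemma submodule_minus: "module K V \<Longrightarrow> submodule N K V \<Longrightarrow> x \<in> N \<Longrightarrow> y \<in> N \<Longrightarrow> x \<ominus>\<^bsub>V\<^esub> y \<in> N"
  by (simp add: a_minus_def module.submoduleE)

lemma submodule_module: "module K V \<Longrightarrow> submodule N K V \<Longrightarrow> module K (V\<lparr>carrier := N\<rparr>)"
  by (rule submodule.submodule_is_module)

text \<open>
  Zorn's lemma gives a largest subspace \<open>L\<close> that meets \<open>N\<close> trivially. If \<open>v\<close> were outside \<open>N + L\<close>, then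
  \<open>L + K v\<close> would meet \<open>N\<close> in some \<open>n = l + c v\<close> with \<open>c \<noteq> 0\<close>, which can be solved for \<open>v\<close>.
\<close>
lemma complement_exists:
  assumes V: "module K V" and N: "submodule N K V"
  shows "\<exists>L. submodule L K V \<and> N \<inter> L = {\<zero>\<^bsub>V\<^esub>} \<and> (\<forall>v\<in>carrier V. \<exists>n\<in>N. \<exists>l\<in>L. v = n \<oplus>\<^bsub>V\<^esub> l)"
proof -
  note V [simp]
  have Ns: "N \<subseteq> carrier V" "\<zero>\<^bsub>V\<^esub> \<in> N" "\<And>x y. x \<in> N \<Longrightarrow> y \<in> N \<Longrightarrow> x \<oplus>\<^bsub>V\<^esub> y \<in> N"
    "\<And>c x. c \<in> carrier K \<Longrightarrow> x \<in> N \<Longrightarrow> c \<odot>\<^bsub>V\<^esub> x \<in> N"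
    using N by (auto simp: submodule_iff)
  define A where "A = {L. submodule L K V \<and> N \<inter> L = {\<zero>\<^bsub>V\<^esub>}}"
  have "\<exists>M\<in>A. \<forall>Z\<in>A. M \<subseteq> Z \<longrightarrow> Z = M"
  proof (rule subset_Zorn_nonempty)
    have "{\<zero>\<^bsub>V\<^esub>} \<in> A" using Ns by (auto simp: A_def submodule_iff)
    then show "A \<noteq> {}" by blast
    fix C assume C: "C \<noteq> {}" "subset.chain A C"
    then have CA: "L \<subseteq> carrier V \<and> \<zero>\<^bsub>V\<^esub> \<in> L \<and> (\<forall>x\<in>L. \<forall>y\<in>L. x \<oplus>\<^bsub>V\<^esub> y \<in> L) \<and>
      (\<forall>c\<in>carrier K. \<forall>x\<in>L. c \<odot>\<^bsub>V\<^esub> x \<in> L) \<and> N \<inter> L = {\<zero>\<^bsub>V\<^esub>}" if "L \<in> C" for L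
      using that by (auto simp: subset.chain_def A_def submodule_iff)
    have ch: "L \<subseteq> L' \<or> L' \<subseteq> L" if "L \<in> C" "L' \<in> C" for L L'
      using C that by (auto simp: subset.chain_def)
    have "submodule (\<Union>C) K V"
      unfolding submodule_iff[OF V]
    proof (intro conjI ballI)
      show "\<Union>C \<subseteq> carrier V" using CA by blast
      show "\<zero>\<^bsub>V\<^esub> \<in> \<Union>C" using CA C by blast
      fix x y assume "x \<in> \<Union>C" "y \<in> \<Union>C"
      then obtain L L' where "L \<in> C" "L' \<in> C" "x \<in> L" "y \<in> L'" by blast
      then show "x \<oplus>\<^bsub>V\<^esub> y \<in> \<Union>C" using ch[of L L'] CA by blast
    next
      fix c x assume "x \<in> \<Union>C" "c \<in> carrier K"
      then show "c \<odot>\<^bsub>V\<^esub> x \<in> \<Union>C" using CA by blast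
    qed
    moreover have "N \<inter> \<Union>C = {\<zero>\<^bsub>V\<^esub>}" using CA C by blast
    ultimately show "\<Union>C \<in> A" by (simp add: A_def)
  qed
  then obtain L where L: "L \<in> A" and max: "\<And>Z. Z \<in> A \<Longrightarrow> L \<subseteq> Z \<Longrightarrow> Z = L" by blast
  have Ls: "L \<subseteq> carrier V" "\<zero>\<^bsub>V\<^esub> \<in> L" "\<And>x y. x \<in> L \<Longrightarrow> y \<in> L \<Longrightarrow> x \<oplus>\<^bsub>V\<^esub> y \<in> L"
    "\<And>c x. c \<in> carrier K \<Longrightarrow> x \<in> L \<Longrightarrow> c \<odot>\<^bsub>V\<^esub> x \<in> L" "N \<inter> L = {\<zero>\<^bsub>V\<^esub>}"
    using L by (auto simp: A_def submodule_iff)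
  have "\<exists>n\<in>N. \<exists>l\<in>L. v = n \<oplus>\<^bsub>V\<^esub> l" if v: "v \<in> carrier V" for v
  proof (rule ccontr)
    assume no: "\<not> ?thesis"
    define L' where "L' = {l \<oplus>\<^bsub>V\<^esub> c \<odot>\<^bsub>V\<^esub> v | l c. l \<in> L \<and> c \<in> carrier K}"
    have LL: "l \<oplus>\<^bsub>V\<^esub> c \<odot>\<^bsub>V\<^esub> v \<in> L'" if "l \<in> L" "c \<in> carrier K" for l c
      using that by (auto simp: L'_def)
    have cl: "x \<in> carrier V" if "x \<in> L" for x using that Ls by blast
    have "submodule L' K V"
      unfolding submodule_iff[OF V]
    proof (intro conjI ballI)
      show "L' \<subseteq> carrier V" using v cl by (auto simp: L'_def)
      show "\<zero>\<^bsub>V\<^esub> \<in> L'" using LL[of "\<zero>\<^bsub>V\<^esub>" \<zero>] v Ls by simp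
    next
      fix x y assume "x \<in> L'" "y \<in> L'"
      then obtain l c l' c' where *: "x = l \<oplus>\<^bsub>V\<^esub> c \<odot>\<^bsub>V\<^esub> v" "y = l' \<oplus>\<^bsub>V\<^esub> c' \<odot>\<^bsub>V\<^esub> v"
        "l \<in> L" "l' \<in> L" "c \<in> carrier K" "c' \<in> carrier K" by (auto simp: L'_def)
      then have "x \<oplus>\<^bsub>V\<^esub> y = (l \<oplus>\<^bsub>V\<^esub> l') \<oplus>\<^bsub>V\<^esub> (c \<oplus> c') \<odot>\<^bsub>V\<^esub> v"
        using v cl by (simp add: add_smult vac)
      then show "x \<oplus>\<^bsub>V\<^esub> y \<in> L'" using * LL Ls by simp
    next
      fix d x assume d: "d \<in> carrier K" and "x \<in> L'"
      then obtain l c where *: "x = l \<oplus>\<^bsub>V\<^esub> c \<odot>\<^bsub>V\<^esub> v" "l \<in> L" "c \<in> carrier K"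
        by (auto simp: L'_def)
      then have "d \<odot>\<^bsub>V\<^esub> x = (d \<odot>\<^bsub>V\<^esub> l) \<oplus>\<^bsub>V\<^esub> (d \<otimes> c) \<odot>\<^bsub>V\<^esub> v"
        using v cl d by (simp add: smult_add smult_smult)
      then show "d \<odot>\<^bsub>V\<^esub> x \<in> L'" using * LL Ls d by simp
    qed
    moreover have "L \<subseteq> L'"
    proof
      fix l assume "l \<in> L" then show "l \<in> L'" using LL[of l \<zero>] v cl by simp
    qed
    moreover have "v \<in> L'" using LL[of "\<zero>\<^bsub>V\<^esub>" \<one>] v Ls by simp
    moreover have "v \<notin> L"
    proof
      assume "v \<in> L"
      then have "v = \<zero>\<^bsub>V\<^esub> \<oplus>\<^bsub>V\<^esub> v" using v by simp
      then show False using no \<open>v \<in> L\<close> Ns by blast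
    qed
    ultimately have "L' \<notin> A" using max by blast
    with \<open>submodule L' K V\<close> have "N \<inter> L' \<noteq> {\<zero>\<^bsub>V\<^esub>}" by (simp add: A_def)
    moreover have "\<zero>\<^bsub>V\<^esub> \<in> N \<inter> L'" using Ns(2) Ls(2) \<open>L \<subseteq> L'\<close> by auto
    ultimately obtain n where n: "n \<in> N" "n \<in> L'" "n \<noteq> \<zero>\<^bsub>V\<^esub>" by blast
    then obtain l c where lc: "n = l \<oplus>\<^bsub>V\<^esub> c \<odot>\<^bsub>V\<^esub> v" "l \<in> L" "c \<in> carrier K" by (auto simp: L'_def)
    have "c \<noteq> \<zero>"
    proof
      assume "c = \<zero>"
      then have "n = l" using lc v cl by simp
      then show False using n lc Ls by blast
    qed
    have "inv c \<in> carrier K" using inv_smult(2)[OF V lc(3) \<open>c \<noteq> \<zero>\<close> v] .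
    have nV: "n \<in> carrier V" "l \<in> carrier V" using n Ns lc cl by auto
    have "c \<odot>\<^bsub>V\<^esub> v = n \<oplus>\<^bsub>V\<^esub> (\<ominus> \<one>) \<odot>\<^bsub>V\<^esub> l"
      using lc v nV by (simp add: neg_smult vac)
    then have "v = inv c \<odot>\<^bsub>V\<^esub> (n \<oplus>\<^bsub>V\<^esub> (\<ominus> \<one>) \<odot>\<^bsub>V\<^esub> l)"
      using inv_smult(1)[OF V lc(3) \<open>c \<noteq> \<zero>\<close> v] by simp
    also have "\<dots> = inv c \<odot>\<^bsub>V\<^esub> n \<oplus>\<^bsub>V\<^esub> inv c \<odot>\<^bsub>V\<^esub> ((\<ominus> \<one>) \<odot>\<^bsub>V\<^esub> l)"
      using nV \<open>inv c \<in> carrier K\<close> by (simp add: smult_add)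
    finally have e: "v = inv c \<odot>\<^bsub>V\<^esub> n \<oplus>\<^bsub>V\<^esub> inv c \<odot>\<^bsub>V\<^esub> ((\<ominus> \<one>) \<odot>\<^bsub>V\<^esub> l)" .
    have "inv c \<odot>\<^bsub>V\<^esub> n \<in> N" "inv c \<odot>\<^bsub>V\<^esub> ((\<ominus> \<one>) \<odot>\<^bsub>V\<^esub> l) \<in> L"
      using n lc Ns(4) Ls(4) \<open>inv c \<in> carrier K\<close> by auto
    then show False using no e by blast
  qed
  then show ?thesis using L by (auto simp: A_def)
qed

lemma direct_sum_projection:
  assumes V: "module K V" and N: "submodule N K V" and L: "submodule L K V" and int: "N \<inter> L = {\<zero>\<^bsub>V\<^esub>}"
    and dec: "\<And>v. v \<in> carrier V \<Longrightarrow> \<exists>n\<in>N. \<exists>l\<in>L. v = n \<oplus>\<^bsub>V\<^esub> l"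
  shows "\<exists>\<pi>\<in>lin K V V. \<forall>n\<in>N. \<forall>l\<in>L. \<pi> (n \<oplus>\<^bsub>V\<^esub> l) = n"
proof -
  note V [simp]
  have Ns: "N \<subseteq> carrier V" "\<zero>\<^bsub>V\<^esub> \<in> N" "\<And>x y. x \<in> N \<Longrightarrow> y \<in> N \<Longrightarrow> x \<oplus>\<^bsub>V\<^esub> y \<in> N"
    "\<And>c x. c \<in> carrier K \<Longrightarrow> x \<in> N \<Longrightarrow> c \<odot>\<^bsub>V\<^esub> x \<in> N"
    using N by (auto simp: submodule_iff)
  have Ls: "L \<subseteq> carrier V" "\<zero>\<^bsub>V\<^esub> \<in> L" "\<And>x y. x \<in> L \<Longrightarrow> y \<in> L \<Longrightarrow> x \<oplus>\<^bsub>V\<^esub> y \<in> L"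
    "\<And>c x. c \<in> carrier K \<Longrightarrow> x \<in> L \<Longrightarrow> c \<odot>\<^bsub>V\<^esub> x \<in> L"
    using L by (auto simp: submodule_iff)
  have uniq: "n = n'" if h: "n \<in> N" "n' \<in> N" "l \<in> L" "l' \<in> L" "n \<oplus>\<^bsub>V\<^esub> l = n' \<oplus>\<^bsub>V\<^esub> l'" for n n' l l'
  proof -
    have c: "n \<in> carrier V" "n' \<in> carrier V" "l \<in> carrier V" "l' \<in> carrier V" using h Ns Ls by auto
    have "n \<ominus>\<^bsub>V\<^esub> n' = (n \<oplus>\<^bsub>V\<^esub> l) \<oplus>\<^bsub>V\<^esub> (\<ominus>\<^bsub>V\<^esub> l \<oplus>\<^bsub>V\<^esub> \<ominus>\<^bsub>V\<^esub> n')" using c by (simp add: a_minus_def vassoc)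
    also have "\<dots> = ((l' \<oplus>\<^bsub>V\<^esub> \<ominus>\<^bsub>V\<^esub> l) \<oplus>\<^bsub>V\<^esub> n') \<oplus>\<^bsub>V\<^esub> \<ominus>\<^bsub>V\<^esub> n'" unfolding h(5) using c by (simp add: vac)
    also have "\<dots> = l' \<ominus>\<^bsub>V\<^esub> l" using c by (simp add: a_minus_def vassoc)
    finally have "n \<ominus>\<^bsub>V\<^esub> n' \<in> N \<inter> L"
      using submodule_minus[OF V N h(1,2)] submodule_minus[OF V L h(4,3)] by simp
    then show ?thesis using int c by auto
  qed
  define \<pi> where "\<pi> v = (THE n. n \<in> N \<and> (\<exists>l\<in>L. v = n \<oplus>\<^bsub>V\<^esub> l))" for v
  have \<pi>: "\<pi> (n \<oplus>\<^bsub>V\<^esub> l) = n" if "n \<in> N" "l \<in> L" for n l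
    unfolding \<pi>_def by (rule the_equality) (use that uniq in blast)+
  have "\<pi> \<in> lin K V V"
  proof (rule linI)
    fix v assume "v \<in> carrier V" then show "\<pi> v \<in> carrier V" using dec[of v] \<pi> Ns(1) by auto
  next
    fix u v assume "u \<in> carrier V" "v \<in> carrier V"
    then obtain n l n' l' where *: "u = n \<oplus>\<^bsub>V\<^esub> l" "v = n' \<oplus>\<^bsub>V\<^esub> l'" "n \<in> N" "n' \<in> N" "l \<in> L" "l' \<in> L"
      using dec by blast
    have c: "n \<in> carrier V" "n' \<in> carrier V" "l \<in> carrier V" "l' \<in> carrier V" using * Ns Ls by auto
    have "u \<oplus>\<^bsub>V\<^esub> v = (n \<oplus>\<^bsub>V\<^esub> n') \<oplus>\<^bsub>V\<^esub> (l \<oplus>\<^bsub>V\<^esub> l')" using c * by (simp add: vac)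
    then show "\<pi> (u \<oplus>\<^bsub>V\<^esub> v) = \<pi> u \<oplus>\<^bsub>V\<^esub> \<pi> v" using * \<pi> Ns Ls by simp
  next
    fix a v assume a: "a \<in> carrier K" "v \<in> carrier V"
    then obtain n l where *: "v = n \<oplus>\<^bsub>V\<^esub> l" "n \<in> N" "l \<in> L" using dec by blast
    have c: "n \<in> carrier V" "l \<in> carrier V" using * Ns Ls by auto
    show "\<pi> (a \<odot>\<^bsub>V\<^esub> v) = a \<odot>\<^bsub>V\<^esub> \<pi> v" using * \<pi> Ns Ls a c by (simp add: smult_add)
  qed
  then show ?thesis using \<pi> by blast
qed

lemma projection_exists:
  assumes V: "module K V" and N: "submodule N K V"
  shows "\<exists>\<pi>\<in>lin K V V. (\<forall>v\<in>carrier V. \<pi> v \<in> N) \<and> (\<forall>n\<in>N. \<pi> n = n)"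
proof -
  obtain L where L: "submodule L K V" "N \<inter> L = {\<zero>\<^bsub>V\<^esub>}"
    and dec: "\<And>v. v \<in> carrier V \<Longrightarrow> \<exists>n\<in>N. \<exists>l\<in>L. v = n \<oplus>\<^bsub>V\<^esub> l"
    using complement_exists[OF V N] by auto
  obtain \<pi> where \<pi>: "\<pi> \<in> lin K V V" "\<And>n l. n \<in> N \<Longrightarrow> l \<in> L \<Longrightarrow> \<pi> (n \<oplus>\<^bsub>V\<^esub> l) = n"
    using direct_sum_projection[OF V N L dec] by blast
  have "\<pi> n = n" if "n \<in> N" for n
    using \<pi>(2)[OF that, of "\<zero>\<^bsub>V\<^esub>"] that N L(1) V by (auto simp: submodule_iff)
  moreover have "\<pi> v \<in> N" if "v \<in> carrier V" for v using dec[OF that] \<pi>(2) by auto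
  ultimately show ?thesis using \<pi>(1) by blast
qed

lemma scalars_simps [simp]: "carrier (scalars K) = carrier K" "\<zero>\<^bsub>scalars K\<^esub> = \<zero>"
  "x \<oplus>\<^bsub>scalars K\<^esub> y = x \<oplus> y" "c \<odot>\<^bsub>scalars K\<^esub> x = c \<otimes> x"
  by (auto simp: scalars_def)
lemma finsum_scalars [simp]: "finsum (scalars K) = finsum K"
  by (rule ext)+ (simp add: finsum_def finprod_def scalars_def)
lemma scalars_module [simp]: "module K (scalars K)"
  by (rule moduleI') (auto simp: a_ac m_ac l_distr r_distr r_minus r_neg)

text \<open>
  Project along \<open>N\<close>, then onto the line through the image \<open>u'\<close> of \<open>u\<close>, and read off the coefficient.
\<close>
lemma functional_exists:
  assumes V: "module K V" and N: "submodule N K V" and u: "u \<in> carrier V" "u \<notin> N"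
  shows "\<exists>\<phi>\<in>lin K V (scalars K). (\<forall>n\<in>N. \<phi> n = \<zero>) \<and> \<phi> u = \<one>"
proof -
  note V [simp]
  obtain \<pi> where \<pi>: "\<pi> \<in> lin K V V" "\<And>v. v \<in> carrier V \<Longrightarrow> \<pi> v \<in> N" "\<And>n. n \<in> N \<Longrightarrow> \<pi> n = n"
    using projection_exists[OF V N] by blast
  define u' where "u' = u \<ominus>\<^bsub>V\<^esub> \<pi> u"
  have u': "u' \<in> carrier V" using u \<pi> by (simp add: u'_def)
  have "u' \<noteq> \<zero>\<^bsub>V\<^esub>"
  proof
    assume "u' = \<zero>\<^bsub>V\<^esub>"
    then have "u = \<pi> u" using u \<pi>(1) by (simp add: u'_def)
    then show False using \<pi>(2)[OF u(1)] u(2) by metis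
  qed
  define D where "D = {c \<odot>\<^bsub>V\<^esub> u' | c. c \<in> carrier K}"
  have D: "submodule D K V"
    unfolding submodule_iff[OF V]
  proof (intro conjI ballI)
    show "D \<subseteq> carrier V" using u' by (auto simp: D_def)
    show "\<zero>\<^bsub>V\<^esub> \<in> D" unfolding D_def using u' smult_l_null[OF V u'] by (metis (mono_tags, lifting) mem_Collect_eq zero_closed)
  next
    fix x y assume "x \<in> D" "y \<in> D"
    then show "x \<oplus>\<^bsub>V\<^esub> y \<in> D" using u' unfolding D_def by (auto simp: add_smult[symmetric])
  next
    fix c x assume "x \<in> D" "c \<in> carrier K"
    then show "c \<odot>\<^bsub>V\<^esub> x \<in> D" using u' unfolding D_def by (auto simp: smult_smult)
  qed
  obtain \<rho> where \<rho>: "\<rho> \<in> lin K V V" "\<And>v. v \<in> carrier V \<Longrightarrow> \<rho> v \<in> D" "\<And>n. n \<in> D \<Longrightarrow> \<rho> n = n"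
    using projection_exists[OF V D] by blast
  have inj: "c = d" if "c \<in> carrier K" "d \<in> carrier K" "c \<odot>\<^bsub>V\<^esub> u' = d \<odot>\<^bsub>V\<^esub> u'" for c d
  proof -
    have "(c \<ominus> d) \<odot>\<^bsub>V\<^esub> u' = \<zero>\<^bsub>V\<^esub>" using that u' by (simp add: minus_smult)
    then have "c \<ominus> d = \<zero>" using \<open>u' \<noteq> \<zero>\<^bsub>V\<^esub>\<close> u' that by simp
    then show ?thesis using that by simp
  qed
  define \<phi> where "\<phi> v = (THE c. c \<in> carrier K \<and> \<rho> (v \<ominus>\<^bsub>V\<^esub> \<pi> v) = c \<odot>\<^bsub>V\<^esub> u')" for v
  have \<phi>I: "\<phi> v = c" if "c \<in> carrier K" "\<rho> (v \<ominus>\<^bsub>V\<^esub> \<pi> v) = c \<odot>\<^bsub>V\<^esub> u'" for v c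
    unfolding \<phi>_def by (rule the_equality) (use that inj in auto)
  have \<phi>E: "\<phi> v \<in> carrier K \<and> \<rho> (v \<ominus>\<^bsub>V\<^esub> \<pi> v) = \<phi> v \<odot>\<^bsub>V\<^esub> u'" if "v \<in> carrier V" for v
  proof -
    have "\<rho> (v \<ominus>\<^bsub>V\<^esub> \<pi> v) \<in> D" using \<rho> \<pi> that by simp
    then obtain c where "c \<in> carrier K" "\<rho> (v \<ominus>\<^bsub>V\<^esub> \<pi> v) = c \<odot>\<^bsub>V\<^esub> u'" by (auto simp: D_def)
    then show ?thesis using \<phi>I by simp
  qed
  have l: "(\<lambda>v. \<rho> (v \<ominus>\<^bsub>V\<^esub> \<pi> v)) \<in> lin K V V"
    by (rule lin_comp[OF lin_diff \<rho>(1)]) (use \<pi> in auto)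
  have "\<phi> \<in> lin K V (scalars K)"
  proof (rule linI)
    fix v assume "v \<in> carrier V" then show "\<phi> v \<in> carrier (scalars K)" using \<phi>E by simp
  next
    fix x v assume xv: "x \<in> carrier V" "v \<in> carrier V"
    then show "\<phi> (x \<oplus>\<^bsub>V\<^esub> v) = \<phi> x \<oplus>\<^bsub>scalars K\<^esub> \<phi> v"
      using \<phi>E[OF xv(1)] \<phi>E[OF xv(2)] u' lin_add[OF l xv] by (intro \<phi>I) (simp_all add: add_smult)
  next
    fix c v assume cv: "c \<in> carrier K" "v \<in> carrier V"
    then show "\<phi> (c \<odot>\<^bsub>V\<^esub> v) = c \<odot>\<^bsub>scalars K\<^esub> \<phi> v"
      using \<phi>E[OF cv(2)] u' lin_smult[OF l cv] by (intro \<phi>I) (simp_all add: smult_smult)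
  qed
  moreover have "\<phi> n = \<zero>" if "n \<in> N" for n
  proof -
    have "n \<in> carrier V" using that N by (auto simp: submodule_iff)
    then show ?thesis using that \<pi> \<rho> u' by (intro \<phi>I) auto
  qed
  moreover have "\<phi> u = \<one>"
  proof (rule \<phi>I)
    have "u' \<in> D" unfolding D_def using u' smult_one[OF V u'] by (metis (mono_tags, lifting) mem_Collect_eq one_closed)
    then show "\<rho> (u \<ominus>\<^bsub>V\<^esub> \<pi> u) = \<one> \<odot>\<^bsub>V\<^esub> u'" using \<rho> u' by (simp add: u'_def)
  qed simp
  ultimately show ?thesis by blast
qed

lemma functional_separates:
  assumes "module K V" "u \<in> carrier V" "\<And>\<phi>. \<phi> \<in> lin K V (scalars K) \<Longrightarrow> \<phi> u = \<zero>"
  shows "u = \<zero>\<^bsub>V\<^esub>"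
proof (rule ccontr)
  assume "u \<noteq> \<zero>\<^bsub>V\<^esub>"
  then obtain \<phi> where "\<phi>\<in>lin K V (scalars K)" "\<phi> u = \<one>"
    using functional_exists[of V "{\<zero>\<^bsub>V\<^esub>}" u] assms by (auto simp: submodule_iff)
  then show False using assms(3) by fastforce
qed

text \<open>
  Choose preimages arbitrarily and subtract their components in the kernel: \<open>e - \<pi> e\<close> depends only on \<open>q e\<close>,
  and is therefore linear in \<open>q e\<close>.
\<close>
lemma section_exists:
  assumes V: "module K E" "module K S" and q: "q \<in> lin K E S" "q ` carrier E = carrier S"
  shows "\<exists>\<sigma>\<in>lin K S E. \<forall>s\<in>carrier S. q (\<sigma> s) = s"
proof -
  note V [simp]
  have sub: "submodule {e \<in> carrier E. q e = \<zero>\<^bsub>S\<^esub>} K E"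
    unfolding submodule_iff[OF V(1)] using q by (auto simp: lin_simps)
  then obtain \<pi> where \<pi>: "\<pi> \<in> lin K E E" "\<And>v. v \<in> carrier E \<Longrightarrow> q (\<pi> v) = \<zero>\<^bsub>S\<^esub>"
      "\<And>n. n \<in> carrier E \<Longrightarrow> q n = \<zero>\<^bsub>S\<^esub> \<Longrightarrow> \<pi> n = n"
    using projection_exists[OF V(1) sub] by blast
  define \<tau> where "\<tau> s = (SOME e. e \<in> carrier E \<and> q e = s)" for s
  have \<tau>: "\<tau> s \<in> carrier E \<and> q (\<tau> s) = s" if "s \<in> carrier S" for s
    unfolding \<tau>_def
  proof (rule someI_ex)
    have "s \<in> q ` carrier E" using q that by simp
    then show "\<exists>e. e \<in> carrier E \<and> q e = s" by auto
  qed
  define \<sigma> where "\<sigma> s = \<tau> s \<ominus>\<^bsub>E\<^esub> \<pi> (\<tau> s)" for s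
  have \<sigma>: "\<sigma> s = e \<ominus>\<^bsub>E\<^esub> \<pi> e" if "e \<in> carrier E" "q e = s" for s e
  proof -
    have sc: "s \<in> carrier S" using that q by auto
    define d where "d = \<tau> s \<ominus>\<^bsub>E\<^esub> e"
    have d: "d \<in> carrier E" "q d = \<zero>\<^bsub>S\<^esub>" using \<tau>[OF sc] that q sc by (auto simp: d_def lin_simps)
    have t: "\<tau> s = e \<oplus>\<^bsub>E\<^esub> d" using \<tau>[OF sc] that by (simp add: d_def)
    show ?thesis unfolding \<sigma>_def t using that d \<pi>(1) \<pi>(3)[OF d]
      by (simp add: lin_simps a_minus_def vneg_add vac)
  qed
  have "\<sigma> \<in> lin K S E"
  proof (rule linI)
    fix s assume "s \<in> carrier S" then show "\<sigma> s \<in> carrier E" using \<tau> \<pi> by (simp add: \<sigma>_def)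
  next
    fix s s' assume s: "s \<in> carrier S" "s' \<in> carrier S"
    have "\<sigma> (s \<oplus>\<^bsub>S\<^esub> s') = (\<tau> s \<oplus>\<^bsub>E\<^esub> \<tau> s') \<ominus>\<^bsub>E\<^esub> \<pi> (\<tau> s \<oplus>\<^bsub>E\<^esub> \<tau> s')"
      by (rule \<sigma>) (use \<tau> s q in \<open>auto simp: lin_simps\<close>)
    then show "\<sigma> (s \<oplus>\<^bsub>S\<^esub> s') = \<sigma> s \<oplus>\<^bsub>E\<^esub> \<sigma> s'"
      using s \<tau> \<pi> by (simp add: \<sigma>_def lin_simps a_minus_def vneg_add vac)
  next
    fix c s assume s: "c \<in> carrier K" "s \<in> carrier S"
    have "\<sigma> (c \<odot>\<^bsub>S\<^esub> s) = (c \<odot>\<^bsub>E\<^esub> \<tau> s) \<ominus>\<^bsub>E\<^esub> \<pi> (c \<odot>\<^bsub>E\<^esub> \<tau> s)"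
      by (rule \<sigma>) (use \<tau> s q in \<open>auto simp: lin_simps\<close>)
    then show "\<sigma> (c \<odot>\<^bsub>S\<^esub> s) = c \<odot>\<^bsub>E\<^esub> \<sigma> s"
      using s \<tau> \<pi> by (simp add: \<sigma>_def lin_simps smult_minus)
  qed
  moreover have "q (\<sigma> s) = s" if "s \<in> carrier S" for s
    using \<tau>[OF that] \<pi> q that by (simp add: \<sigma>_def lin_simps)
  ultimately show ?thesis by blast
qed

section \<open>Tensor products and their slices\<close>
lemma vsum_split:
  assumes "module K V" "\<And>i. i < n \<Longrightarrow> h i = f i" "\<And>i. i < m \<Longrightarrow> h (n + i) = g i"
    "\<And>i. i < n \<Longrightarrow> f i \<in> carrier V" "\<And>i. i < m \<Longrightarrow> g i \<in> carrier V"
  shows "(\<Oplus>\<^bsub>V\<^esub>i\<in>{..<n + m::nat}. h i) = (\<Oplus>\<^bsub>V\<^esub>i\<in>{..<n}. f i) \<oplus>\<^bsub>V\<^esub> (\<Oplus>\<^bsub>V\<^esub>i\<in>{..<m}. g i)"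
  using assms(3,5)
proof (induction m)
  case 0
  have "(\<Oplus>\<^bsub>V\<^esub>i\<in>{..<n}. h i) = (\<Oplus>\<^bsub>V\<^esub>i\<in>{..<n}. f i)"
    by (rule vsum_cong) (use assms in auto)
  then show ?case using assms by (simp add: vsum_closed)
next
  case (Suc m)
  have h: "h i \<in> carrier V" if "i < n + Suc m" for i
  proof (cases "i < n")
    case False
    then have "h (n + (i - n)) = g (i - n)" using that by (intro Suc.prems) auto
    then show ?thesis using False that Suc.prems(2)[of "i - n"] by simp
  qed (use assms in auto)
  have "(\<Oplus>\<^bsub>V\<^esub>i\<in>{..<n + Suc m}. h i) = (\<Oplus>\<^bsub>V\<^esub>i\<in>{..<n + m}. h i) \<oplus>\<^bsub>V\<^esub> h (n + m)"
    using vsum_Suc[OF assms(1), of "n + m" h] h by simp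
  also have "\<dots> = ((\<Oplus>\<^bsub>V\<^esub>i\<in>{..<n}. f i) \<oplus>\<^bsub>V\<^esub> (\<Oplus>\<^bsub>V\<^esub>i\<in>{..<m}. g i)) \<oplus>\<^bsub>V\<^esub> g m"
    using Suc by simp
  finally show ?case using Suc.prems assms by (simp add: vsum_Suc vsum_closed vassoc)
qed

lemma vsum_delta:
  assumes "module K V" "j < n" "v \<in> carrier V"
  shows "(\<Oplus>\<^bsub>V\<^esub>i\<in>{..<n::nat}. if i = j then v else \<zero>\<^bsub>V\<^esub>) = v"
  using assms(2)
proof (induction n)
  case (Suc n)
  show ?case
  proof (cases "j = n")
    case True
    have "(\<Oplus>\<^bsub>V\<^esub>i\<in>{..<n}. if i = j then v else \<zero>\<^bsub>V\<^esub>) = \<zero>\<^bsub>V\<^esub>"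
      by (rule vsum_zero) (use True assms in auto)
    then show ?thesis using True assms by (simp add: vsum_Suc)
  next
    case False
    then show ?thesis using Suc assms by (simp add: vsum_Suc)
  qed
qed simp

lemma span_submodule:
  assumes V [simp]: "module K V" and u [simp]: "\<And>i. i < n \<Longrightarrow> u i \<in> carrier V"
  defines "D \<equiv> {\<Oplus>\<^bsub>V\<^esub>i\<in>{..<n::nat}. c i \<odot>\<^bsub>V\<^esub> u i | c. \<forall>i<n. c i \<in> carrier K}"
  shows "submodule D K V" "\<And>j. j < n \<Longrightarrow> u j \<in> D"
proof -
  have "D \<subseteq> carrier V" by (auto simp: D_def intro!: vsum_closed)
  moreover have "\<zero>\<^bsub>V\<^esub> \<in> D"
  proof -
    have "(\<Oplus>\<^bsub>V\<^esub>i\<in>{..<n}. \<zero> \<odot>\<^bsub>V\<^esub> u i) = \<zero>\<^bsub>V\<^esub>" by (rule vsum_zero) auto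
    then show ?thesis unfolding D_def by (intro CollectI exI[of _ "\<lambda>_. \<zero>"]) auto
  qed
  moreover have "x \<oplus>\<^bsub>V\<^esub> y \<in> D" if "x \<in> D" "y \<in> D" for x y
  proof -
    obtain c d where cd: "\<forall>i<n. c i \<in> carrier K" "\<forall>i<n. d i \<in> carrier K"
      "x = (\<Oplus>\<^bsub>V\<^esub>i\<in>{..<n}. c i \<odot>\<^bsub>V\<^esub> u i)" "y = (\<Oplus>\<^bsub>V\<^esub>i\<in>{..<n}. d i \<odot>\<^bsub>V\<^esub> u i)" using \<open>x \<in> D\<close> \<open>y \<in> D\<close> by (auto simp: D_def)
    have "x \<oplus>\<^bsub>V\<^esub> y = (\<Oplus>\<^bsub>V\<^esub>i\<in>{..<n}. c i \<odot>\<^bsub>V\<^esub> u i \<oplus>\<^bsub>V\<^esub> d i \<odot>\<^bsub>V\<^esub> u i)"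
      unfolding cd(3,4) by (rule vsum_add[symmetric]) (use cd in auto)
    also have "\<dots> = (\<Oplus>\<^bsub>V\<^esub>i\<in>{..<n}. (c i \<oplus> d i) \<odot>\<^bsub>V\<^esub> u i)"
      by (rule vsum_cong) (use cd in \<open>auto simp: add_smult\<close>)
    finally show ?thesis unfolding D_def using cd by auto
  qed
  moreover have "k \<odot>\<^bsub>V\<^esub> y \<in> D" if k: "k \<in> carrier K" and "y \<in> D" for k y
  proof -
    obtain d where cd: "\<forall>i<n. d i \<in> carrier K" "y = (\<Oplus>\<^bsub>V\<^esub>i\<in>{..<n}. d i \<odot>\<^bsub>V\<^esub> u i)" using \<open>y \<in> D\<close> by (auto simp: D_def)
    have "k \<odot>\<^bsub>V\<^esub> y = (\<Oplus>\<^bsub>V\<^esub>i\<in>{..<n}. k \<odot>\<^bsub>V\<^esub> (d i \<odot>\<^bsub>V\<^esub> u i))"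
      unfolding cd by (rule smult_vsum) (use cd k in auto)
    also have "\<dots> = (\<Oplus>\<^bsub>V\<^esub>i\<in>{..<n}. (k \<otimes> d i) \<odot>\<^bsub>V\<^esub> u i)"
      by (rule vsum_cong) (use cd k in \<open>auto simp: smult_smult\<close>)
    finally show ?thesis unfolding D_def using cd k by auto
  qed
  ultimately show "submodule D K V" unfolding submodule_iff[OF V] by blast
  fix j assume j: "j < n"
  have "(\<Oplus>\<^bsub>V\<^esub>i\<in>{..<n}. (if i = j then \<one> else \<zero>) \<odot>\<^bsub>V\<^esub> u i) = (\<Oplus>\<^bsub>V\<^esub>i\<in>{..<n}. if i = j then u j else \<zero>\<^bsub>V\<^esub>)"
    by (rule vsum_cong) auto
  also have "\<dots> = u j" by (rule vsum_delta) (use j in auto)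
  finally show "u j \<in> D" unfolding D_def
    by (intro CollectI exI[of _ "\<lambda>i. if i = j then \<one> else \<zero>"]) auto
qed

lemma functional_eq:
  assumes "module K V" "u \<in> carrier V" "v \<in> carrier V" "\<And>\<phi>. \<phi> \<in> lin K V (scalars K) \<Longrightarrow> \<phi> u = \<phi> v"
  shows "u = v"
proof -
  have "u \<ominus>\<^bsub>V\<^esub> v = \<zero>\<^bsub>V\<^esub>"
  proof (rule functional_separates[OF assms(1)])
    fix \<phi> assume p: "\<phi> \<in> lin K V (scalars K)"
    have "\<phi> v \<in> carrier K" using lin_closed[OF p assms(3)] by simp
    then show "\<phi> (u \<ominus>\<^bsub>V\<^esub> v) = \<zero>" using p assms(4)[OF p] lin_minus[OF p assms(1) _ assms(2,3)]
      vminus_self[of "scalars K" "\<phi> v"] by simp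
  qed (use assms in auto)
  then show ?thesis using assms by simp
qed

lemma bilinI:
  assumes "\<And>v. v \<in> carrier V \<Longrightarrow> f v \<in> lin K W U" "\<And>w. w \<in> carrier W \<Longrightarrow> (\<lambda>v. f v w) \<in> lin K V U"
  shows "f \<in> bilin K V W U"
  using assms by (auto simp: bilin_def)
lemma bilinD:
  assumes "f \<in> bilin K V W U"
  shows "v \<in> carrier V \<Longrightarrow> f v \<in> lin K W U" "w \<in> carrier W \<Longrightarrow> (\<lambda>v. f v w) \<in> lin K V U"
    "v \<in> carrier V \<Longrightarrow> w \<in> carrier W \<Longrightarrow> f v w \<in> carrier U"
  using assms lin_closed by (auto simp: bilin_def)
lemma bilin_simps:
  assumes "f \<in> bilin K V W U"
  shows "u \<in> carrier V \<Longrightarrow> v \<in> carrier V \<Longrightarrow> w \<in> carrier W \<Longrightarrow> f (u \<oplus>\<^bsub>V\<^esub> v) w = f u w \<oplus>\<^bsub>U\<^esub> f v w"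
    "c \<in> carrier K \<Longrightarrow> v \<in> carrier V \<Longrightarrow> w \<in> carrier W \<Longrightarrow> f (c \<odot>\<^bsub>V\<^esub> v) w = c \<odot>\<^bsub>U\<^esub> f v w"
    "v \<in> carrier V \<Longrightarrow> w \<in> carrier W \<Longrightarrow> w' \<in> carrier W \<Longrightarrow> f v (w \<oplus>\<^bsub>W\<^esub> w') = f v w \<oplus>\<^bsub>U\<^esub> f v w'"
    "c \<in> carrier K \<Longrightarrow> v \<in> carrier V \<Longrightarrow> w \<in> carrier W \<Longrightarrow> f v (c \<odot>\<^bsub>W\<^esub> w) = c \<odot>\<^bsub>U\<^esub> f v w"
  using lin_add[OF bilinD(2)[OF assms]] lin_smult[OF bilinD(2)[OF assms]]
    lin_add[OF bilinD(1)[OF assms]] lin_smult[OF bilinD(1)[OF assms]] by blast+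
lemma bilinI':
  assumes "\<And>v w. v \<in> carrier V \<Longrightarrow> w \<in> carrier W \<Longrightarrow> f v w \<in> carrier U"
    "\<And>u v w. u \<in> carrier V \<Longrightarrow> v \<in> carrier V \<Longrightarrow> w \<in> carrier W \<Longrightarrow> f (u \<oplus>\<^bsub>V\<^esub> v) w = f u w \<oplus>\<^bsub>U\<^esub> f v w"
    "\<And>c v w. c \<in> carrier K \<Longrightarrow> v \<in> carrier V \<Longrightarrow> w \<in> carrier W \<Longrightarrow> f (c \<odot>\<^bsub>V\<^esub> v) w = c \<odot>\<^bsub>U\<^esub> f v w"
    "\<And>v w w'. v \<in> carrier V \<Longrightarrow> w \<in> carrier W \<Longrightarrow> w' \<in> carrier W \<Longrightarrow> f v (w \<oplus>\<^bsub>W\<^esub> w') = f v w \<oplus>\<^bsub>U\<^esub> f v w'"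
    "\<And>c v w. c \<in> carrier K \<Longrightarrow> v \<in> carrier V \<Longrightarrow> w \<in> carrier W \<Longrightarrow> f v (c \<odot>\<^bsub>W\<^esub> w) = c \<odot>\<^bsub>U\<^esub> f v w"
  shows "f \<in> bilin K V W U"
  by (intro bilinI linI) (use assms in auto)
lemma bilin_post: "f \<in> bilin K V W U \<Longrightarrow> g \<in> lin K U Y \<Longrightarrow> (\<lambda>v w. g (f v w)) \<in> bilin K V W Y"
  by (rule bilinI) (metis bilinD(1) lin_comp, rule lin_comp[OF bilinD(2)])

definition tsum :: "('k, 'v, 'm) module_scheme \<Rightarrow> ('k, 'w, 'n) module_scheme \<Rightarrow> nat \<Rightarrow> (nat \<Rightarrow> 'v) \<Rightarrow> (nat \<Rightarrow> 'w) \<Rightarrow> ('k, 'v, 'w) tensor" where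
  "tsum V W n x y = (\<lambda>b\<in>bilin K V W (scalars K). \<Oplus>i\<in>{..<n}. b (x i) (y i))"

lemma tensor_carrier:
  "t \<in> carrier (tensor K V W) \<longleftrightarrow>
    (\<exists>n x y. (\<forall>i<n. x i \<in> carrier V \<and> y i \<in> carrier W) \<and> t = tsum V W n x y)"
  unfolding tsum_def tensor_def by simp ((rule ex_cong1)+, auto simp: Pi_iff)

lemma tensor_ops:
  "\<zero>\<^bsub>tensor K V W\<^esub> = (\<lambda>b\<in>bilin K V W (scalars K). \<zero>)"
  "s \<oplus>\<^bsub>tensor K V W\<^esub> t = (\<lambda>b\<in>bilin K V W (scalars K). s b \<oplus> t b)"
  "c \<odot>\<^bsub>tensor K V W\<^esub> t = (\<lambda>b\<in>bilin K V W (scalars K). c \<otimes> t b)"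
  by (auto simp: tensor_def)

lemma tsum_mem: "(\<And>i. i < n \<Longrightarrow> x i \<in> carrier V) \<Longrightarrow> (\<And>i. i < n \<Longrightarrow> y i \<in> carrier W) \<Longrightarrow>
    tsum V W n x y \<in> carrier (tensor K V W)"
  unfolding tensor_carrier by blast

lemma bilin_value_closed: "b \<in> bilin K V W (scalars K) \<Longrightarrow> v \<in> carrier V \<Longrightarrow> w \<in> carrier W \<Longrightarrow> b v w \<in> carrier K"
  using bilinD(3) by fastforce

lemma Ksum_closed: "(\<And>i. i < n \<Longrightarrow> f i \<in> carrier K) \<Longrightarrow> (\<Oplus>i\<in>{..<n::nat}. f i) \<in> carrier K"
  using vsum_closed[of "scalars K" n f] by simp

lemma tensor_val: "t \<in> carrier (tensor K V W) \<Longrightarrow> b \<in> bilin K V W (scalars K) \<Longrightarrow> t b \<in> carrier K"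
  unfolding tensor_carrier tsum_def by (elim exE conjE, hypsubst, simp, rule Ksum_closed, erule bilin_value_closed) auto
lemma tensor_ext: "t \<in> carrier (tensor K V W) \<Longrightarrow> t \<in> extensional (bilin K V W (scalars K))"
  unfolding tensor_carrier tsum_def by auto

lemma vsum_one: "module K V \<Longrightarrow> f 0 \<in> carrier V \<Longrightarrow> (\<Oplus>\<^bsub>V\<^esub>i\<in>{..<1::nat}. f i) = f 0"
  using vsum_Suc[of V 0 f] by simp
lemma Ksum_one: "f 0 \<in> carrier K \<Longrightarrow> (\<Oplus>i\<in>{..<1::nat}. f i) = f 0"
  using vsum_one[of "scalars K" f] by simp

lemma pure_tsum: "v \<in> carrier V \<Longrightarrow> w \<in> carrier W \<Longrightarrow> pure_tensor K V W v w = tsum V W 1 (\<lambda>_. v) (\<lambda>_. w)"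
  unfolding pure_tensor_def tsum_def
  by (rule restrict_ext) (subst Ksum_one, auto simp: bilin_value_closed)
lemma pure_mem [simp]: "v \<in> carrier V \<Longrightarrow> w \<in> carrier W \<Longrightarrow> pure_tensor K V W v w \<in> carrier (tensor K V W)"
  by (simp add: pure_tsum tsum_mem)

lemma tsum_add:
  assumes "\<And>i. i < n \<Longrightarrow> x i \<in> carrier V" "\<And>i. i < n \<Longrightarrow> y i \<in> carrier W"
    "\<And>i. i < m \<Longrightarrow> x' i \<in> carrier V" "\<And>i. i < m \<Longrightarrow> y' i \<in> carrier W"
  shows "tsum V W n x y \<oplus>\<^bsub>tensor K V W\<^esub> tsum V W m x' y' =
    tsum V W (n + m) (\<lambda>i. if i < n then x i else x' (i - n)) (\<lambda>i. if i < n then y i else y' (i - n))"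
  unfolding tensor_ops unfolding tsum_def
proof (rule restrict_ext)
  fix b assume b: "b \<in> bilin K V W (scalars K)"
  have "(\<Oplus>\<^bsub>scalars K\<^esub>i\<in>{..<n + m}. b (if i < n then x i else x' (i - n)) (if i < n then y i else y' (i - n))) =
    (\<Oplus>\<^bsub>scalars K\<^esub>i\<in>{..<n}. b (x i) (y i)) \<oplus>\<^bsub>scalars K\<^esub> (\<Oplus>\<^bsub>scalars K\<^esub>i\<in>{..<m}. b (x' i) (y' i))"
    by (rule vsum_split) (use assms bilin_value_closed[OF b] in auto)
  then show "(\<lambda>b\<in>bilin K V W (scalars K). \<Oplus>i\<in>{..<n}. b (x i) (y i)) b \<oplus>
        (\<lambda>b\<in>bilin K V W (scalars K). \<Oplus>i\<in>{..<m}. b (x' i) (y' i)) b =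
        (\<Oplus>i\<in>{..<n + m}. b (if i < n then x i else x' (i - n)) (if i < n then y i else y' (i - n)))"
    using b by simp
qed

lemma tsum_smult:
  assumes "\<And>i. i < n \<Longrightarrow> x i \<in> carrier V" "\<And>i. i < n \<Longrightarrow> y i \<in> carrier W" "c \<in> carrier K"
  shows "c \<odot>\<^bsub>tensor K V W\<^esub> tsum V W n x y = tsum V W n (\<lambda>i. c \<odot>\<^bsub>V\<^esub> x i) y"
  unfolding tensor_ops unfolding tsum_def
proof (rule restrict_ext)
  fix b assume b: "b \<in> bilin K V W (scalars K)"
  have "c \<odot>\<^bsub>scalars K\<^esub> (\<Oplus>\<^bsub>scalars K\<^esub>i\<in>{..<n}. b (x i) (y i)) = (\<Oplus>\<^bsub>scalars K\<^esub>i\<in>{..<n}. c \<odot>\<^bsub>scalars K\<^esub> b (x i) (y i))"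
    by (rule smult_vsum) (use assms bilin_value_closed[OF b] in auto)
  also have "\<dots> = (\<Oplus>\<^bsub>scalars K\<^esub>i\<in>{..<n}. b (c \<odot>\<^bsub>V\<^esub> x i) (y i))"
    by (rule vsum_cong) (use assms bilin_value_closed[OF b] bilin_simps(2)[OF b] in auto)
  finally show "c \<otimes> (\<lambda>b\<in>bilin K V W (scalars K). \<Oplus>i\<in>{..<n}. b (x i) (y i)) b =
      (\<Oplus>i\<in>{..<n}. b (c \<odot>\<^bsub>V\<^esub> x i) (y i))" using b by simp
qed

lemma tensor_module [simp]:
  assumes V: "module K V"
  shows "module K (tensor K V W)"
proof (rule moduleI')
  let ?T = "tensor K V W" let ?B = "bilin K V W (scalars K)"
  fix s t assume "s \<in> carrier ?T" "t \<in> carrier ?T"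
  then obtain n x y m x' y' where *:
    "s = tsum V W n x y" "t = tsum V W m x' y'"
    "\<forall>i<n. x i \<in> carrier V \<and> y i \<in> carrier W" "\<forall>i<m. x' i \<in> carrier V \<and> y' i \<in> carrier W"
    unfolding tensor_carrier by blast
  show "s \<oplus>\<^bsub>?T\<^esub> t \<in> carrier ?T"
    unfolding *(1,2) using *(3,4) by (subst tsum_add) (auto intro!: tsum_mem)
next
  let ?T = "tensor K V W" let ?B = "bilin K V W (scalars K)"
  fix c t assume c: "c \<in> carrier K" and "t \<in> carrier ?T"
  then obtain n x y where *: "t = tsum V W n x y" "\<forall>i<n. x i \<in> carrier V \<and> y i \<in> carrier W"
    unfolding tensor_carrier by blast
  show "c \<odot>\<^bsub>?T\<^esub> t \<in> carrier ?T"
    unfolding *(1) using *(2) c V by (subst tsum_smult) (auto intro!: tsum_mem)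
next
  let ?T = "tensor K V W"
  have "tsum V W 0 (\<lambda>_. undefined) (\<lambda>_. undefined) = \<zero>\<^bsub>?T\<^esub>"
    unfolding tensor_ops tsum_def using vsum_empty[of "scalars K"] by simp
  then show "\<zero>\<^bsub>?T\<^esub> \<in> carrier ?T" using tsum_mem[of 0] by (metis not_less_zero)
next
  fix t assume t: "t \<in> carrier (tensor K V W)"
  show "\<zero>\<^bsub>tensor K V W\<^esub> \<oplus>\<^bsub>tensor K V W\<^esub> t = t" "\<one> \<odot>\<^bsub>tensor K V W\<^esub> t = t"
    unfolding tensor_ops
    by (rule extensionalityI[OF _ tensor_ext[OF t]], use tensor_val[OF t] in auto)+
qed (auto simp: tensor_ops tensor_val l_distr r_distr a_ac m_ac l_minus r_neg r_minus intro!: restrict_ext)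

lemma tensor_zero: "\<zero>\<^bsub>tensor K V W\<^esub> = tsum V W 0 x y"
  unfolding tensor_ops tsum_def using vsum_empty[of "scalars K"] by simp

lemma tsum_Suc:
  assumes "\<And>i. i < Suc n \<Longrightarrow> x i \<in> carrier V" "\<And>i. i < Suc n \<Longrightarrow> y i \<in> carrier W"
  shows "tsum V W (Suc n) x y = tsum V W n x y \<oplus>\<^bsub>tensor K V W\<^esub> pure_tensor K V W (x n) (y n)"
  unfolding tensor_ops unfolding tsum_def pure_tensor_def
proof (rule restrict_ext)
  fix b assume b: "b \<in> bilin K V W (scalars K)"
  show "(\<Oplus>i\<in>{..<Suc n}. b (x i) (y i)) = (\<lambda>b\<in>bilin K V W (scalars K). \<Oplus>i\<in>{..<n}. b (x i) (y i)) b \<oplus>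
      (\<lambda>b\<in>bilin K V W (scalars K). b (x n) (y n)) b"
    using vsum_Suc[of "scalars K" n "\<lambda>i. b (x i) (y i)"] b bilin_value_closed[OF b] assms by simp
qed

lemma tensor_induct [consumes 1, case_names zero add]:
  assumes "t \<in> carrier (tensor K V W)"
    and "P \<zero>\<^bsub>tensor K V W\<^esub>"
    and "\<And>t v w. t \<in> carrier (tensor K V W) \<Longrightarrow> P t \<Longrightarrow> v \<in> carrier V \<Longrightarrow> w \<in> carrier W \<Longrightarrow>
            P (t \<oplus>\<^bsub>tensor K V W\<^esub> pure_tensor K V W v w)"
  shows "P t"
proof -
  obtain n x y where *: "t = tsum V W n x y" "\<forall>i<n. x i \<in> carrier V \<and> y i \<in> carrier W"
    using assms(1) unfolding tensor_carrier by blast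
  have "P (tsum V W n x y)" using *(2)
  proof (induction n)
    case 0 then show ?case using assms(2) tensor_zero[of V W] by metis
  next
    case (Suc n)
    then show ?case by (subst tsum_Suc) (auto intro!: assms(3) tsum_mem)
  qed
  then show ?thesis using * by simp
qed

lemma lin_eq_on_pure:
  assumes "module K V" "module K U" "f \<in> lin K (tensor K V W) U" "g \<in> lin K (tensor K V W) U"
    and "\<And>v w. v \<in> carrier V \<Longrightarrow> w \<in> carrier W \<Longrightarrow> f (pure_tensor K V W v w) = g (pure_tensor K V W v w)"
    and "t \<in> carrier (tensor K V W)"
  shows "f t = g t"
  using assms(6)
proof (induction rule: tensor_induct)
  case zero then show ?case using assms by simp
next
  case (add t v w)
  then show ?case using assms by (simp add: lin_add[OF assms(3)] lin_add[OF assms(4)])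
qed

lemma lin_tsum:
  assumes "module K V" "module K U" "f \<in> lin K (tensor K V W) U"
    "\<And>i. i < n \<Longrightarrow> x i \<in> carrier V" "\<And>i. i < n \<Longrightarrow> y i \<in> carrier W"
  shows "f (tsum V W n x y) = (\<Oplus>\<^bsub>U\<^esub>i\<in>{..<n}. f (pure_tensor K V W (x i) (y i)))"
  using assms(4,5)
proof (induction n)
  case 0
  show ?case using assms tensor_zero[of V W x y, symmetric] by simp
next
  case (Suc n)
  then show ?case using assms(1-3)
    by (subst tsum_Suc) (simp_all add: lin_add[OF assms(3)] tsum_mem vsum_Suc lin_closed[OF assms(3)])
qed

lemma pure_bilin:
  assumes "module K V" "module K W"
  shows "pure_tensor K V W \<in> bilin K V W (tensor K V W)"
  by (rule bilinI', simp) (auto simp: assms tensor_ops pure_tensor_def bilin_simps intro!: restrict_ext)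

text \<open>
  The value on a tensor must not depend on how it is written as a sum of pure tensors. Functionals on \<open>U\<close>
  decide this: composed with \<open>f\<close> they become bilinear forms, on which the tensor is evaluated by definition.
\<close>
lemma lift_exists:
  assumes V: "module K V" and W: "module K W" and U: "module K U" and f: "f \<in> bilin K V W U"
  shows "\<exists>L\<in>lin K (tensor K V W) U. \<forall>v\<in>carrier V. \<forall>w\<in>carrier W. L (pure_tensor K V W v w) = f v w"
proof -
  define ok where "ok n x y \<longleftrightarrow> (\<forall>i<n::nat. x i \<in> carrier V \<and> y i \<in> carrier W)" for n x y
  define F where "F n x y = (\<Oplus>\<^bsub>U\<^esub>i\<in>{..<n::nat}. f (x i) (y i))" for n x y
  have Fc: "F n x y \<in> carrier U" if "ok n x y" for n x y
    unfolding F_def by (rule vsum_closed) (use that bilinD(3)[OF f] U ok_def in auto)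
  have wd: "F n x y = F m x' y'" if "ok n x y" "ok m x' y'" "tsum V W n x y = tsum V W m x' y'" for n x y m x' y'
  proof (rule functional_eq[OF U Fc[OF that(1)] Fc[OF that(2)]])
    fix \<phi> assume \<phi>: "\<phi> \<in> lin K U (scalars K)"
    have b: "(\<lambda>v w. \<phi> (f v w)) \<in> bilin K V W (scalars K)" by (rule bilin_post[OF f \<phi>])
    have "\<phi> (F n x y) = tsum V W n x y (\<lambda>v w. \<phi> (f v w))" if "ok n x y" for n x y
    proof -
      have "\<phi> (F n x y) = (\<Oplus>\<^bsub>scalars K\<^esub>i\<in>{..<n}. \<phi> (f (x i) (y i)))"
        unfolding F_def by (rule lin_vsum[OF \<phi> U]) (use that bilinD(3)[OF f] ok_def in auto)
      then show ?thesis using b by (simp add: tsum_def)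
    qed
    then show "\<phi> (F n x y) = \<phi> (F m x' y')" using that by simp
  qed
  define L where "L t = (THE u. \<exists>n x y. ok n x y \<and> t = tsum V W n x y \<and> u = F n x y)" for t
  have L: "L (tsum V W n x y) = F n x y" if "ok n x y" for n x y
    unfolding L_def
  proof (rule the_equality)
    show "\<exists>n' x' y'. ok n' x' y' \<and> tsum V W n x y = tsum V W n' x' y' \<and> F n x y = F n' x' y'" using that by blast
  next
    fix u assume "\<exists>n' x' y'. ok n' x' y' \<and> tsum V W n x y = tsum V W n' x' y' \<and> u = F n' x' y'"
    then obtain n' x' y' where "ok n' x' y'" "tsum V W n x y = tsum V W n' x' y'" "u = F n' x' y'" by blast
    then show "u = F n x y" using wd[OF that] by simp
  qed
  have ex: "\<exists>n x y. ok n x y \<and> t = tsum V W n x y" if "t \<in> carrier (tensor K V W)" for t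
    using that unfolding tensor_carrier ok_def by blast
  have "L \<in> lin K (tensor K V W) U"
  proof (rule linI)
    fix t assume "t \<in> carrier (tensor K V W)"
    then show "L t \<in> carrier U" using ex L Fc by metis
  next
    fix s t assume "s \<in> carrier (tensor K V W)" "t \<in> carrier (tensor K V W)"
    then obtain n x y m x' y' where *: "ok n x y" "s = tsum V W n x y" "ok m x' y'" "t = tsum V W m x' y'"
      using ex by meson
    let ?x = "\<lambda>i. if i < n then x i else x' (i - n)" let ?y = "\<lambda>i. if i < n then y i else y' (i - n)"
    have "s \<oplus>\<^bsub>tensor K V W\<^esub> t = tsum V W (n + m) ?x ?y"
      unfolding * by (rule tsum_add) (use * in \<open>auto simp: ok_def\<close>)
    moreover have "ok (n + m) ?x ?y" using * by (auto simp: ok_def)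
    moreover have "F (n + m) ?x ?y = F n x y \<oplus>\<^bsub>U\<^esub> F m x' y'"
      unfolding F_def by (rule vsum_split[OF U]) (use * bilinD(3)[OF f] in \<open>auto simp: ok_def\<close>)
    ultimately show "L (s \<oplus>\<^bsub>tensor K V W\<^esub> t) = L s \<oplus>\<^bsub>U\<^esub> L t" using L * by simp
  next
    fix c t assume c: "c \<in> carrier K" and "t \<in> carrier (tensor K V W)"
    then obtain n x y where *: "ok n x y" "t = tsum V W n x y" using ex by meson
    have "c \<odot>\<^bsub>tensor K V W\<^esub> t = tsum V W n (\<lambda>i. c \<odot>\<^bsub>V\<^esub> x i) y"
      unfolding * by (rule tsum_smult) (use * c in \<open>auto simp: ok_def\<close>)
    moreover have "ok n (\<lambda>i. c \<odot>\<^bsub>V\<^esub> x i) y" using * c V by (auto simp: ok_def)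
    moreover have "F n (\<lambda>i. c \<odot>\<^bsub>V\<^esub> x i) y = c \<odot>\<^bsub>U\<^esub> F n x y"
    proof -
      have "c \<odot>\<^bsub>U\<^esub> F n x y = (\<Oplus>\<^bsub>U\<^esub>i\<in>{..<n}. c \<odot>\<^bsub>U\<^esub> f (x i) (y i))"
        unfolding F_def by (rule smult_vsum) (use U c * bilinD(3)[OF f] ok_def in auto)
      also have "\<dots> = F n (\<lambda>i. c \<odot>\<^bsub>V\<^esub> x i) y"
        unfolding F_def by (rule vsum_cong) (use U c * bilinD(3)[OF f] bilin_simps(2)[OF f] ok_def in auto)
      finally show ?thesis by simp
    qed
    ultimately show "L (c \<odot>\<^bsub>tensor K V W\<^esub> t) = c \<odot>\<^bsub>U\<^esub> L t" using L * by simp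
  qed
  moreover have "L (pure_tensor K V W v w) = f v w" if "v \<in> carrier V" "w \<in> carrier W" for v w
  proof -
    have "L (pure_tensor K V W v w) = F 1 (\<lambda>_. v) (\<lambda>_. w)"
      using that by (simp add: pure_tsum L ok_def)
    also have "\<dots> = f v w" unfolding F_def using bilinD(3)[OF f] that U by (subst vsum_one) simp_all
    finally show ?thesis .
  qed
  ultimately show ?thesis by blast
qed

lemma tensor_lift:
  assumes "module K V" "module K W" "module K U" "f \<in> bilin K V W U"
  shows "tensor_lift K V W U f \<in> lin K (tensor K V W) U"
    and "\<And>v w. v \<in> carrier V \<Longrightarrow> w \<in> carrier W \<Longrightarrow> tensor_lift K V W U f (pure_tensor K V W v w) = f v w"
proof -
  let ?P = "\<lambda>L. L \<in> lin K (tensor K V W) U \<and> L \<in> extensional (carrier (tensor K V W)) \<and>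
       (\<forall>v\<in>carrier V. \<forall>w\<in>carrier W. L (pure_tensor K V W v w) = f v w)"
  obtain L where L: "L \<in> lin K (tensor K V W) U" "\<forall>v\<in>carrier V. \<forall>w\<in>carrier W. L (pure_tensor K V W v w) = f v w"
    using lift_exists[OF assms] by blast
  have "?P (tensor_lift K V W U f)"
    unfolding tensor_lift_def
  proof (rule theI[of ?P])
    show "?P (restrict L (carrier (tensor K V W)))"
      using L assms by (auto intro: lin_cong[OF L(1)])
  next
    fix L' assume L': "?P L'"
    show "L' = restrict L (carrier (tensor K V W))"
    proof (rule extensionalityI)
      fix t assume t: "t \<in> carrier (tensor K V W)"
      have "L' t = L t"
        by (rule lin_eq_on_pure[OF _ _ _ L(1) _ t]) (use L L' assms in auto)
      then show "L' t = restrict L (carrier (tensor K V W)) t" using t by simp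
    qed (use L' in auto)
  qed
  then show "tensor_lift K V W U f \<in> lin K (tensor K V W) U"
     "\<And>v w. v \<in> carrier V \<Longrightarrow> w \<in> carrier W \<Longrightarrow> tensor_lift K V W U f (pure_tensor K V W v w) = f v w"
    by auto
qed

lemma tensor_map:
  assumes "module K V" "module K W" "module K V'" "module K W'" "f \<in> lin K V V'" "g \<in> lin K W W'"
  shows "tensor_map K V W V' W' f g \<in> lin K (tensor K V W) (tensor K V' W')"
    and "\<And>v w. v \<in> carrier V \<Longrightarrow> w \<in> carrier W \<Longrightarrow>
      tensor_map K V W V' W' f g (pure_tensor K V W v w) = pure_tensor K V' W' (f v) (g w)"
proof -
  note p = pure_bilin[OF assms(3,4)]
  have b: "(\<lambda>v w. pure_tensor K V' W' (f v) (g w)) \<in> bilin K V W (tensor K V' W')"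
    by (rule bilinI') (use assms in \<open>auto simp: lin_simps bilin_simps[OF p]\<close>)
  show "tensor_map K V W V' W' f g \<in> lin K (tensor K V W) (tensor K V' W')"
    unfolding tensor_map_def by (rule tensor_lift) (use assms b in auto)
  show "tensor_map K V W V' W' f g (pure_tensor K V W v w) = pure_tensor K V' W' (f v) (g w)"
    if "v \<in> carrier V" "w \<in> carrier W" for v w
    unfolding tensor_map_def by (rule tensor_lift) (use assms b that in auto)
qed

lemma tensor_lift_param:
  assumes "module K V" "module K W" "module K U" "module K Y"
    and G: "\<And>u. u \<in> carrier Y \<Longrightarrow> G u \<in> bilin K V W U"
    and l: "\<And>v w. v \<in> carrier V \<Longrightarrow> w \<in> carrier W \<Longrightarrow> (\<lambda>u. G u v w) \<in> lin K Y U"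
    and t: "t \<in> carrier (tensor K V W)"
  shows "(\<lambda>u. tensor_lift K V W U (G u) t) \<in> lin K Y U"
  using t
proof (induction rule: tensor_induct)
  case zero
  show ?case by (rule lin_cong[OF lin_const_zero[OF assms(3)]])
    (use assms lin_zero[OF tensor_lift(1)[OF assms(1-3) G]] in auto)
next
  case (add t v w)
  show ?case
    by (rule lin_cong[OF lin_plus[OF assms(3) add.IH l[OF add.hyps(2,3)]]])
      (use assms add lin_add[OF tensor_lift(1)[OF assms(1-3) G]] tensor_lift(2)[OF assms(1-3) G] in auto)
qed

text \<open>
  The map \<open>id \<otimes> \<phi> : V \<otimes> A \<rightarrow> V\<close>. Slices replace the tensors themselves from here on.
\<close>
definition slice :: "('k, 'v, 'm) module_scheme \<Rightarrow> ('k, 'a, 'n) module_scheme \<Rightarrow> ('a \<Rightarrow> 'k) \<Rightarrow> ('k, 'v, 'a) tensor \<Rightarrow> 'v" where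
  "slice V A \<phi> = tensor_lift K V A V (\<lambda>v a. \<phi> a \<odot>\<^bsub>V\<^esub> v)"

lemma dual_closed: "\<phi> \<in> lin K A (scalars K) \<Longrightarrow> a \<in> carrier A \<Longrightarrow> \<phi> a \<in> carrier K"
  using lin_closed by fastforce
lemma dual_simps:
  assumes "\<phi> \<in> lin K A (scalars K)"
  shows "a \<in> carrier A \<Longrightarrow> b \<in> carrier A \<Longrightarrow> \<phi> (a \<oplus>\<^bsub>A\<^esub> b) = \<phi> a \<oplus> \<phi> b"
   "c \<in> carrier K \<Longrightarrow> b \<in> carrier A \<Longrightarrow> \<phi> (c \<odot>\<^bsub>A\<^esub> b) = c \<otimes> \<phi> b"
  using lin_add[OF assms] lin_smult[OF assms] by auto

lemma slice:
  assumes "module K V" "module K A" "\<phi> \<in> lin K A (scalars K)"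
  shows "slice V A \<phi> \<in> lin K (tensor K V A) V"
    and "\<And>v a. v \<in> carrier V \<Longrightarrow> a \<in> carrier A \<Longrightarrow> slice V A \<phi> (pure_tensor K V A v a) = \<phi> a \<odot>\<^bsub>V\<^esub> v"
proof -
  have b: "(\<lambda>v a. \<phi> a \<odot>\<^bsub>V\<^esub> v) \<in> bilin K V A V"
    by (rule bilinI') (use assms in \<open>auto simp: dual_closed dual_simps add_smult smult_add smult_smult m_comm\<close>)
  show "slice V A \<phi> \<in> lin K (tensor K V A) V" unfolding slice_def by (rule tensor_lift) (use assms b in auto)
  show "slice V A \<phi> (pure_tensor K V A v a) = \<phi> a \<odot>\<^bsub>V\<^esub> v" if "v \<in> carrier V" "a \<in> carrier A" for v a
    unfolding slice_def by (rule tensor_lift) (use assms b that in auto)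
qed

lemma slice_map:
  assumes "module K V" "module K A" "module K V'" "h \<in> lin K V V'" "\<phi> \<in> lin K A (scalars K)"
    and "t \<in> carrier (tensor K V A)"
  shows "slice V' A \<phi> (tensor_map K V A V' A h id t) = h (slice V A \<phi> t)"
proof -
  note m = tensor_map[OF assms(1,2,3,2,4) lin_id(1)]
  show ?thesis
  proof (rule lin_eq_on_pure[OF assms(1,3) lin_comp[OF m(1) slice(1)[OF assms(3,2,5)]]
         lin_comp[OF slice(1)[OF assms(1,2,5)] assms(4)] _ assms(6)])
  fix v w assume "v \<in> carrier V" "w \<in> carrier A"
  then show "slice V' A \<phi> (tensor_map K V A V' A h id (pure_tensor K V A v w)) = h (slice V A \<phi> (pure_tensor K V A v w))"
    using assms m(2) by (simp add: slice(2) lin_closed[OF assms(4)] lin_smult[OF assms(4)] dual_closed)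
qed
qed

lemma slice_map_right:
  assumes "module K V" "module K A" "module K B" "h \<in> lin K A B" "\<phi> \<in> lin K B (scalars K)"
    and "t \<in> carrier (tensor K V A)"
  shows "slice V B \<phi> (tensor_map K V A V B id h t) = slice V A (\<lambda>a. \<phi> (h a)) t"
proof -
  note m = tensor_map[OF assms(1,2,1,3) lin_id(1) assms(4)]
  note l = lin_comp[OF assms(4,5)]
  show ?thesis
  proof (rule lin_eq_on_pure[OF assms(1,1) lin_comp[OF m(1) slice(1)[OF assms(1,3,5)]]
         slice(1)[OF assms(1,2) l] _ assms(6)])
  fix v w assume "v \<in> carrier V" "w \<in> carrier A"
  then show "slice V B \<phi> (tensor_map K V A V B id h (pure_tensor K V A v w)) = slice V A (\<lambda>a. \<phi> (h a)) (pure_tensor K V A v w)"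
    using assms m(2) slice(2)[OF assms(1,2) l] by (simp add: slice(2) lin_closed[OF assms(4)])
qed
qed

lemma slice_tsum:
  assumes "module K V" "module K A" "\<phi> \<in> lin K A (scalars K)"
    "\<And>i. i < n \<Longrightarrow> x i \<in> carrier V" "\<And>i. i < n \<Longrightarrow> y i \<in> carrier A"
  shows "slice V A \<phi> (tsum V A n x y) = (\<Oplus>\<^bsub>V\<^esub>i\<in>{..<n}. \<phi> (y i) \<odot>\<^bsub>V\<^esub> x i)"
  using assms by (subst lin_tsum[OF assms(1) assms(1) slice(1)])
    (auto simp: slice(2) dual_closed intro!: vsum_cong)

text \<open>
  The heart of the separation theorem, for \<open>t = \<Sum>x\<^sub>i \<otimes> y\<^sub>i\<close> with all slices zero. If the last \<open>y\<^sub>n\<close> is a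
  combination of the others, it can be absorbed into them by changing the \<open>x\<^sub>i\<close>. Otherwise a functional that
  is \<open>1\<close> on \<open>y\<^sub>n\<close> and \<open>0\<close> on the others shows \<open>x\<^sub>n = 0\<close>. In both cases a summand disappears.
\<close>
lemma slices_zero_bilin:
  assumes V: "module K V" and A: "module K A" and b: "b \<in> bilin K V A (scalars K)"
    and "\<And>i. i < n \<Longrightarrow> x i \<in> carrier V" "\<And>i. i < n \<Longrightarrow> y i \<in> carrier A"
    and "\<And>\<phi>. \<phi> \<in> lin K A (scalars K) \<Longrightarrow> (\<Oplus>\<^bsub>V\<^esub>i\<in>{..<n}. \<phi> (y i) \<odot>\<^bsub>V\<^esub> x i) = \<zero>\<^bsub>V\<^esub>"
  shows "(\<Oplus>i\<in>{..<n::nat}. b (x i) (y i)) = \<zero>"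
  using assms(4-6)
proof (induction n arbitrary: x)
  case 0
  show ?case using vsum_empty[of "scalars K"] by simp
next
  case (Suc n)
  note V [simp] A [simp]
  have xy: "\<And>i. i < n \<Longrightarrow> x i \<in> carrier V" "x n \<in> carrier V" "\<And>i. i < n \<Longrightarrow> y i \<in> carrier A" "y n \<in> carrier A"
    using Suc.prems by auto
  note [simp] = xy
  define D where "D = {\<Oplus>\<^bsub>A\<^esub>i\<in>{..<n}. c i \<odot>\<^bsub>A\<^esub> y i | c. \<forall>i<n. c i \<in> carrier K}"
  have bs: "(\<Oplus>i\<in>{..<Suc n}. b (x i) (y i)) = (\<Oplus>i\<in>{..<n}. b (x i) (y i)) \<oplus> b (x n) (y n)"
    using vsum_Suc[of "scalars K" n "\<lambda>i. b (x i) (y i)"] bilin_value_closed[OF b] Suc.prems by simp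
  have ps: "(\<Oplus>\<^bsub>V\<^esub>i\<in>{..<n}. \<phi> (y i) \<odot>\<^bsub>V\<^esub> x i) \<oplus>\<^bsub>V\<^esub> \<phi> (y n) \<odot>\<^bsub>V\<^esub> x n = \<zero>\<^bsub>V\<^esub>"
    if "\<phi> \<in> lin K A (scalars K)" for \<phi>
    using Suc.prems(3)[OF that] vsum_Suc[OF V, of n "\<lambda>i. \<phi> (y i) \<odot>\<^bsub>V\<^esub> x i"] Suc.prems dual_closed[OF that] by simp
  show ?case
  proof (cases "y n \<in> D")
    case True
    then obtain c where c: "\<And>i. i < n \<Longrightarrow> c i \<in> carrier K" "y n = (\<Oplus>\<^bsub>A\<^esub>i\<in>{..<n}. c i \<odot>\<^bsub>A\<^esub> y i)"
      by (auto simp: D_def)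
    note [simp] = c(1)
    define x' where "x' i = x i \<oplus>\<^bsub>V\<^esub> c i \<odot>\<^bsub>V\<^esub> x n" for i
    have "(\<Oplus>i\<in>{..<n}. b (x' i) (y i)) = \<zero>"
    proof (rule Suc.IH)
      fix \<phi> assume \<phi>: "\<phi> \<in> lin K A (scalars K)"
      note [simp] = dual_closed[OF \<phi>]
      have l: "(\<lambda>k. k \<odot>\<^bsub>V\<^esub> x n) \<in> lin K (scalars K) V"
        by (rule linI) (auto simp: add_smult smult_smult)
      have "\<phi> (y n) = (\<Oplus>\<^bsub>scalars K\<^esub>i\<in>{..<n}. \<phi> (c i \<odot>\<^bsub>A\<^esub> y i))"
        unfolding c(2) by (rule lin_vsum[OF \<phi>]) auto
      then have "\<phi> (y n) \<odot>\<^bsub>V\<^esub> x n = (\<Oplus>\<^bsub>scalars K\<^esub>i\<in>{..<n}. \<phi> (c i \<odot>\<^bsub>A\<^esub> y i)) \<odot>\<^bsub>V\<^esub> x n" by simp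
      also have "\<dots> = (\<Oplus>\<^bsub>V\<^esub>i\<in>{..<n}. \<phi> (c i \<odot>\<^bsub>A\<^esub> y i) \<odot>\<^bsub>V\<^esub> x n)"
        by (rule lin_vsum[OF l]) auto
      also have "\<dots> = (\<Oplus>\<^bsub>V\<^esub>i\<in>{..<n}. \<phi> (y i) \<odot>\<^bsub>V\<^esub> (c i \<odot>\<^bsub>V\<^esub> x n))"
        by (rule vsum_cong) (auto simp: dual_simps[OF \<phi>] smult_smult m_comm)
      finally have 1: "\<phi> (y n) \<odot>\<^bsub>V\<^esub> x n = (\<Oplus>\<^bsub>V\<^esub>i\<in>{..<n}. \<phi> (y i) \<odot>\<^bsub>V\<^esub> (c i \<odot>\<^bsub>V\<^esub> x n))" .
      have "(\<Oplus>\<^bsub>V\<^esub>i\<in>{..<n}. \<phi> (y i) \<odot>\<^bsub>V\<^esub> x' i) =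
        (\<Oplus>\<^bsub>V\<^esub>i\<in>{..<n}. \<phi> (y i) \<odot>\<^bsub>V\<^esub> x i \<oplus>\<^bsub>V\<^esub> \<phi> (y i) \<odot>\<^bsub>V\<^esub> (c i \<odot>\<^bsub>V\<^esub> x n))"
        by (rule vsum_cong) (auto simp: x'_def smult_add)
      also have "\<dots> = (\<Oplus>\<^bsub>V\<^esub>i\<in>{..<n}. \<phi> (y i) \<odot>\<^bsub>V\<^esub> x i) \<oplus>\<^bsub>V\<^esub> \<phi> (y n) \<odot>\<^bsub>V\<^esub> x n"
        unfolding 1 by (rule vsum_add) auto
      also have "\<dots> = \<zero>\<^bsub>V\<^esub>" by (rule ps[OF \<phi>])
      finally show "(\<Oplus>\<^bsub>V\<^esub>i\<in>{..<n}. \<phi> (y i) \<odot>\<^bsub>V\<^esub> x' i) = \<zero>\<^bsub>V\<^esub>" .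
    qed (auto simp: x'_def)
    moreover have "(\<Oplus>\<^bsub>scalars K\<^esub>i\<in>{..<n}. b (x' i) (y i)) =
      (\<Oplus>\<^bsub>scalars K\<^esub>i\<in>{..<n}. b (x i) (y i) \<oplus>\<^bsub>scalars K\<^esub> b (x n) (c i \<odot>\<^bsub>A\<^esub> y i))"
      by (rule vsum_cong) (auto simp: x'_def bilin_simps[OF b] bilin_value_closed[OF b])
    moreover have "\<dots> = (\<Oplus>\<^bsub>scalars K\<^esub>i\<in>{..<n}. b (x i) (y i)) \<oplus>\<^bsub>scalars K\<^esub> (\<Oplus>\<^bsub>scalars K\<^esub>i\<in>{..<n}. b (x n) (c i \<odot>\<^bsub>A\<^esub> y i))"
      by (rule vsum_add) (auto simp: bilin_value_closed[OF b])
    moreover have "(\<Oplus>\<^bsub>scalars K\<^esub>i\<in>{..<n}. b (x n) (c i \<odot>\<^bsub>A\<^esub> y i)) = b (x n) (y n)"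
      unfolding c(2) by (rule lin_vsum[OF bilinD(1)[OF b], symmetric]) auto
    ultimately show ?thesis using bs by simp
  next
    case False
    have D: "submodule D K A" unfolding D_def by (rule span_submodule(1)[OF A]) (rule xy(3))
    have yD: "y j \<in> D" if "j < n" for j unfolding D_def by (rule span_submodule(2)[OF A _ that]) (rule xy(3))
    obtain \<phi> where \<phi>: "\<phi> \<in> lin K A (scalars K)" "\<And>d. d \<in> D \<Longrightarrow> \<phi> d = \<zero>" "\<phi> (y n) = \<one>"
      using functional_exists[OF A D, of "y n"] False by auto
    have "(\<Oplus>\<^bsub>V\<^esub>i\<in>{..<n}. \<phi> (y i) \<odot>\<^bsub>V\<^esub> x i) = \<zero>\<^bsub>V\<^esub>"
      by (rule vsum_zero) (use \<phi> yD in auto)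
    then have xn: "x n = \<zero>\<^bsub>V\<^esub>" using ps[OF \<phi>(1)] \<phi>(3) by simp
    have "(\<Oplus>i\<in>{..<n}. b (x i) (y i)) = \<zero>"
    proof (rule Suc.IH)
      fix \<psi> assume \<psi>: "\<psi> \<in> lin K A (scalars K)"
      show "(\<Oplus>\<^bsub>V\<^esub>i\<in>{..<n}. \<psi> (y i) \<odot>\<^bsub>V\<^esub> x i) = \<zero>\<^bsub>V\<^esub>"
        using ps[OF \<psi>] xn dual_closed[OF \<psi>] by (simp add: vsum_closed)
    qed auto
    moreover have "b \<zero>\<^bsub>V\<^esub> (y n) = \<zero>" using lin_zero[OF bilinD(2)[OF b], of "y n"] by simp
    ultimately show ?thesis using bs xn by simp
  qed
qed

lemma slices_separate:
  assumes V: "module K V" and A: "module K A" and t: "t \<in> carrier (tensor K V A)" "t' \<in> carrier (tensor K V A)"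
    and eq: "\<And>\<phi>. \<phi> \<in> lin K A (scalars K) \<Longrightarrow> slice V A \<phi> t = slice V A \<phi> t'"
  shows "t = t'"
proof -
  note V [simp] A [simp]
  define d where "d = t \<ominus>\<^bsub>tensor K V A\<^esub> t'"
  have d: "d \<in> carrier (tensor K V A)" using t by (simp add: d_def)
  have s: "slice V A \<phi> d = \<zero>\<^bsub>V\<^esub>" if p: "\<phi> \<in> lin K A (scalars K)" for \<phi>
    using eq[OF p] t lin_closed[OF slice(1)[OF V A p]] by (simp add: d_def lin_minus[OF slice(1)[OF V A p]])
  obtain n x y where *: "d = tsum V A n x y" "\<forall>i<n. x i \<in> carrier V \<and> y i \<in> carrier A"
    using d unfolding tensor_carrier by blast
  have "(\<Oplus>i\<in>{..<n}. b (x i) (y i)) = \<zero>" if b: "b \<in> bilin K V A (scalars K)" for b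
    by (rule slices_zero_bilin[OF V A b]) (use * s slice_tsum[OF V A, of _ n x y] in auto)
  then have "d = \<zero>\<^bsub>tensor K V A\<^esub>" unfolding *(1) tensor_ops unfolding tsum_def by (auto intro!: restrict_ext)
  then show ?thesis using t by (simp add: d_def)
qed

text \<open>
  For the non-trivial direction, a linear projection \<open>\<pi>\<close> onto \<open>N\<close> fixes all slices of \<open>t\<close>, so \<open>\<pi> \<otimes> id\<close>
  fixes \<open>t\<close>.
\<close>
lemma tensor_sub_image:
  assumes V: "module K V" and A: "module K A" and N: "submodule N K V" and t: "t \<in> carrier (tensor K V A)"
  shows "t \<in> tensor_map K (V\<lparr>carrier := N\<rparr>) A V A id id ` carrier (tensor K (V\<lparr>carrier := N\<rparr>) A) \<longleftrightarrow>
     (\<forall>\<phi>\<in>lin K A (scalars K). slice V A \<phi> t \<in> N)"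
proof -
  let ?N = "V\<lparr>carrier := N\<rparr>"
  have M: "module K ?N" using submodule_module[OF V N] .
  note V [simp] A [simp] M [simp]
  have NV: "N \<subseteq> carrier V" using N by (simp add: submodule_iff)
  have i: "id \<in> lin K ?N V" by (rule linI) (use NV in auto)
  note m = tensor_map[OF M A V A i lin_id(1)]
  show ?thesis
  proof
    assume "t \<in> tensor_map K ?N A V A id id ` carrier (tensor K ?N A)"
    then obtain s where s: "s \<in> carrier (tensor K ?N A)" "t = tensor_map K ?N A V A id id s" by blast
    show "\<forall>\<phi>\<in>lin K A (scalars K). slice V A \<phi> t \<in> N"
    proof
      fix \<phi> assume p: "\<phi> \<in> lin K A (scalars K)"
      show "slice V A \<phi> t \<in> N"
        using slice_map[OF M A V i p s(1)] lin_closed[OF slice(1)[OF M A p] s(1)] s(2) by simp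
    qed
  next
    assume h: "\<forall>\<phi>\<in>lin K A (scalars K). slice V A \<phi> t \<in> N"
    obtain \<pi> where \<pi>: "\<pi> \<in> lin K V V" "\<forall>v\<in>carrier V. \<pi> v \<in> N" "\<forall>n\<in>N. \<pi> n = n"
      using projection_exists[OF V N] by blast
    have \<pi>': "\<pi> \<in> lin K V ?N" by (rule linI) (use \<pi> in \<open>auto simp: lin_simps\<close>)
    note m' = tensor_map[OF V A M A \<pi>' lin_id(1)]
    define s where "s = tensor_map K V A ?N A \<pi> id t"
    have s: "s \<in> carrier (tensor K ?N A)" unfolding s_def by (rule lin_closed[OF m'(1) t])
    have "tensor_map K ?N A V A id id s = t"
    proof (rule slices_separate[OF V A lin_closed[OF m(1) s] t])
      fix \<phi> assume p: "\<phi> \<in> lin K A (scalars K)"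
      have "slice V A \<phi> (tensor_map K ?N A V A id id s) = \<pi> (slice V A \<phi> t)"
        using slice_map[OF M A V i p s] slice_map[OF V A M \<pi>' p t] by (simp add: s_def)
      then show "slice V A \<phi> (tensor_map K ?N A V A id id s) = slice V A \<phi> t" using h p \<pi> by simp
    qed
    then show "t \<in> tensor_map K ?N A V A id id ` carrier (tensor K ?N A)" using s by blast
  qed
qed

text \<open>
  \<open>f \<otimes> g\<close> as a functional on \<open>A \<otimes> B\<close>; composed with a comultiplication it is the convolution of \<open>f\<close> and \<open>g\<close>.
\<close>
definition dual_prod :: "('k, 'a, 'm) module_scheme \<Rightarrow> ('k, 'b, 'n) module_scheme \<Rightarrow> ('a \<Rightarrow> 'k) \<Rightarrow> ('b \<Rightarrow> 'k) \<Rightarrow> ('k, 'a, 'b) tensor \<Rightarrow> 'k" where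
  "dual_prod A B f g = tensor_lift K A B (scalars K) (\<lambda>a b. f a \<otimes> g b)"

lemma dual_prod:
  assumes "module K A" "module K B" "f \<in> lin K A (scalars K)" "g \<in> lin K B (scalars K)"
  shows "dual_prod A B f g \<in> lin K (tensor K A B) (scalars K)"
    and "\<And>a b. a \<in> carrier A \<Longrightarrow> b \<in> carrier B \<Longrightarrow> dual_prod A B f g (pure_tensor K A B a b) = f a \<otimes> g b"
proof -
  have b: "(\<lambda>a b. f a \<otimes> g b) \<in> bilin K A B (scalars K)"
    by (rule bilinI') (use assms in \<open>auto simp: dual_closed dual_simps l_distr r_distr m_ac\<close>)
  show "dual_prod A B f g \<in> lin K (tensor K A B) (scalars K)" unfolding dual_prod_def by (rule tensor_lift) (use assms b in auto)
  show "dual_prod A B f g (pure_tensor K A B a c) = f a \<otimes> g c" if "a \<in> carrier A" "c \<in> carrier B" for a c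
    unfolding dual_prod_def by (rule tensor_lift) (use assms b that in auto)
qed

lemma dual_prod_slice:
  assumes A: "module K A" and B: "module K B" and f: "f \<in> lin K A (scalars K)" and g: "g \<in> lin K B (scalars K)"
    and s: "s \<in> carrier (tensor K A B)"
  shows "dual_prod A B f g s = f (slice A B g s)"
  by (rule lin_eq_on_pure[OF A scalars_module dual_prod(1)[OF A B f g] lin_comp[OF slice(1)[OF A B g] f] _ s])
    (use assms in \<open>auto simp: dual_prod(2) slice(2) dual_closed dual_simps m_comm\<close>)

text \<open>
  Functionals of the form \<open>f \<otimes> g\<close> do not exhaust the dual of \<open>A \<otimes> B\<close>, so this is more than
  \<open>slices_separate\<close>. Applying a functional \<open>l\<close> to the first factor reduces it to separation in \<open>A \<otimes> B\<close>.
\<close>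
lemma double_slices_separate:
  assumes V: "module K V" and A: "module K A" and B: "module K B"
    and t: "t \<in> carrier (tensor K V (tensor K A B))" "t' \<in> carrier (tensor K V (tensor K A B))"
    and eq: "\<And>f g. f \<in> lin K A (scalars K) \<Longrightarrow> g \<in> lin K B (scalars K) \<Longrightarrow>
      slice V (tensor K A B) (dual_prod A B f g) t = slice V (tensor K A B) (dual_prod A B f g) t'"
  shows "t = t'"
proof -
  note V [simp] A [simp] B [simp]
  let ?T = "tensor K A B"
  have T: "module K ?T" by simp
  define ls where "ls l = tensor_lift K V ?T ?T (\<lambda>v s. l v \<odot>\<^bsub>?T\<^esub> s)" for l
  have ls: "ls l \<in> lin K (tensor K V ?T) ?T"
    "\<And>v s. v \<in> carrier V \<Longrightarrow> s \<in> carrier ?T \<Longrightarrow> ls l (pure_tensor K V ?T v s) = l v \<odot>\<^bsub>?T\<^esub> s"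
    if l: "l \<in> lin K V (scalars K)" for l
  proof -
    have b: "(\<lambda>v s. l v \<odot>\<^bsub>?T\<^esub> s) \<in> bilin K V ?T ?T"
      by (rule bilinI') (use l in \<open>auto simp: dual_closed dual_simps add_smult smult_add smult_smult m_comm\<close>)
    show "ls l \<in> lin K (tensor K V ?T) ?T" unfolding ls_def by (rule tensor_lift) (use b in auto)
    show "ls l (pure_tensor K V ?T v s) = l v \<odot>\<^bsub>?T\<^esub> s" if "v \<in> carrier V" "s \<in> carrier ?T" for v s
      unfolding ls_def by (rule tensor_lift) (use b that in auto)
  qed
  have sw: "l (slice V ?T \<Phi> u) = \<Phi> (ls l u)"
    if l: "l \<in> lin K V (scalars K)" and \<Phi>: "\<Phi> \<in> lin K ?T (scalars K)" and u: "u \<in> carrier (tensor K V ?T)" for l \<Phi> u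
    by (rule lin_eq_on_pure[OF V scalars_module lin_comp[OF slice(1)[OF V T \<Phi>] l] lin_comp[OF ls(1)[OF l] \<Phi>] _ u])
      (use l \<Phi> in \<open>simp add: slice(2) ls(2) dual_closed dual_simps m_comm\<close>)
  have lse: "ls l t = ls l t'" if l: "l \<in> lin K V (scalars K)" for l
  proof (rule slices_separate[OF A B])
    fix g assume g: "g \<in> lin K B (scalars K)"
    show "slice A B g (ls l t) = slice A B g (ls l t')"
    proof (rule functional_eq[OF A])
      fix f assume f: "f \<in> lin K A (scalars K)"
      have "f (slice A B g (ls l u)) = l (slice V ?T (dual_prod A B f g) u)" if "u \<in> carrier (tensor K V ?T)" for u
        using sw[OF l dual_prod(1)[OF A B f g] that] dual_prod_slice[OF A B f g, of "ls l u"] lin_closed[OF ls(1)[OF l] that] by simp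
      then show "f (slice A B g (ls l t)) = f (slice A B g (ls l t'))" using eq[OF f g] t by simp
    qed (use lin_closed[OF slice(1)[OF A B g]] lin_closed[OF ls(1)[OF l]] t in auto)
  qed (use lin_closed[OF ls(1)[OF l]] t in auto)
  show ?thesis
  proof (rule slices_separate[OF V T t])
    fix \<Phi> assume \<Phi>: "\<Phi> \<in> lin K ?T (scalars K)"
    show "slice V ?T \<Phi> t = slice V ?T \<Phi> t'"
    proof (rule functional_eq[OF V])
      fix l assume l: "l \<in> lin K V (scalars K)"
      show "l (slice V ?T \<Phi> t) = l (slice V ?T \<Phi> t')"
        unfolding sw[OF l \<Phi> t(1)] sw[OF l \<Phi> t(2)] lse[OF l] ..
    qed (use lin_closed[OF slice(1)[OF V T \<Phi>]] t in auto)
  qed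
qed

lemma assoc_lin:
  assumes V: "module K V" and A: "module K A" and B: "module K B"
  shows "tensor_assoc K V A B \<in> lin K (tensor K (tensor K V A) B) (tensor K V (tensor K A B))"
    and "\<And>f g s. f \<in> lin K A (scalars K) \<Longrightarrow> g \<in> lin K B (scalars K) \<Longrightarrow> s \<in> carrier (tensor K (tensor K V A) B) \<Longrightarrow>
      slice V (tensor K A B) (dual_prod A B f g) (tensor_assoc K V A B s) = slice V A f (slice (tensor K V A) B g s)"
proof -
  note V [simp] A [simp] B [simp]
  let ?T = "tensor K A B" let ?U = "tensor K V ?T" let ?VA = "tensor K V A"
  define G where "G u = (\<lambda>v w. pure_tensor K V ?T v (pure_tensor K A B w u))" for u
  have T: "module K ?T" and VA: "module K ?VA" and U: "module K ?U" by auto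
  note p1 = pure_bilin[OF V T] and p2 = pure_bilin[OF A B]
  have G: "G u \<in> bilin K V A ?U" if "u \<in> carrier B" for u
    unfolding G_def by (rule bilinI') (use that in \<open>auto simp: bilin_simps[OF p1] bilin_simps[OF p2]\<close>)
  have Gl: "(\<lambda>u. G u v w) \<in> lin K B ?U" if "v \<in> carrier V" "w \<in> carrier A" for v w
    unfolding G_def by (rule lin_comp[OF bilinD(1)[OF p2] bilinD(1)[OF p1]]) (use that in auto)
  have b: "(\<lambda>t u. tensor_lift K V A ?U (G u) t) \<in> bilin K ?VA B ?U"
  proof (rule bilinI)
    fix t assume "t \<in> carrier ?VA"
    then show "(\<lambda>u. tensor_lift K V A ?U (G u) t) \<in> lin K B ?U"
      using tensor_lift_param[OF V A U B G Gl] by blast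
  next
    fix u assume "u \<in> carrier B"
    then show "(\<lambda>t. tensor_lift K V A ?U (G u) t) \<in> lin K ?VA ?U"
      using tensor_lift(1)[OF V A U G] by simp
  qed
  have e: "tensor_assoc K V A B = tensor_lift K ?VA B ?U (\<lambda>t u. tensor_lift K V A ?U (G u) t)"
    by (simp add: tensor_assoc_def G_def)
  note L = tensor_lift[OF VA B U b, folded e]
  show "tensor_assoc K V A B \<in> lin K (tensor K ?VA B) ?U" by (rule L)
  fix f g s assume f: "f \<in> lin K A (scalars K)" and g: "g \<in> lin K B (scalars K)" and s: "s \<in> carrier (tensor K ?VA B)"
  note d = dual_prod[OF A B f g]
  show "slice V ?T (dual_prod A B f g) (tensor_assoc K V A B s) = slice V A f (slice ?VA B g s)"
  proof (rule lin_eq_on_pure[OF VA V lin_comp[OF L(1) slice(1)[OF V T d(1)]] lin_comp[OF slice(1)[OF VA B g] slice(1)[OF V A f]] _ s])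
    fix t w assume t: "t \<in> carrier ?VA" and w: "w \<in> carrier B"
    have "slice V ?T (dual_prod A B f g) (tensor_lift K V A ?U (G w) t) = slice V A f (g w \<odot>\<^bsub>?VA\<^esub> t)"
    proof (rule lin_eq_on_pure[OF V V lin_comp[OF tensor_lift(1)[OF V A U G[OF w]] slice(1)[OF V T d(1)]]
           lin_comp[OF lin_scale[OF VA lin_id(2)] slice(1)[OF V A f]] _ t])
      show "g w \<in> carrier K" using g w by (rule dual_closed)
      fix v a assume "v \<in> carrier V" "a \<in> carrier A"
      then show "slice V ?T (dual_prod A B f g) (tensor_lift K V A ?U (G w) (pure_tensor K V A v a)) =
          slice V A f (g w \<odot>\<^bsub>?VA\<^esub> pure_tensor K V A v a)"
        using w f g by (simp add: tensor_lift(2)[OF V A U G[OF w]] lin_smult[OF slice(1)[OF V A f]] slice(2)[OF V A f]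
            dual_closed smult_smult m_comm) (simp add: G_def slice(2)[OF V T d(1)] d(2) m_comm dual_closed)
    qed
    then show "slice V ?T (dual_prod A B f g) (tensor_assoc K V A B (pure_tensor K ?VA B t w)) =
        slice V A f (slice ?VA B g (pure_tensor K ?VA B t w))"
      using t w by (simp add: L(2) slice(2)[OF VA B g])
  qed
qed

text \<open>
  The constructions of modules set their coaction by a record update that mentions the tensor product of the
  very record being updated; all notions of linear algebra ignore such updates.
\<close>
definition same_space :: "('k, 'v, 'm) module_scheme \<Rightarrow> ('k, 'v, 'n) module_scheme \<Rightarrow> bool" where
  "same_space V V' \<longleftrightarrow> carrier V = carrier V' \<and> \<zero>\<^bsub>V\<^esub> = \<zero>\<^bsub>V'\<^esub> \<and> ring.add V = ring.add V' \<and> smult V = smult V'"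

lemma same_lin: assumes "same_space V V'" shows "lin K V W = lin K V' W" "lin K W V = lin K W V'"
  using assms unfolding same_space_def lin_def hom_def by (simp_all del: lin_closed)
lemma same_bilin: assumes "same_space V V'" shows "bilin K V W U = bilin K V' W U"
  using assms by (simp add: bilin_def same_lin[OF assms]) (simp add: same_space_def)
lemma same_tensor: assumes "same_space V V'" shows "tensor K V W = tensor K V' W"
  using assms by (simp add: tensor_def same_bilin[OF assms]) (simp add: same_space_def)
lemma same_slice: assumes "same_space V V'" shows "slice V A = slice V' A"
proof
  fix \<phi>
  have p: "pure_tensor K V A = pure_tensor K V' A"
    by (intro ext) (simp add: pure_tensor_def same_bilin[OF assms])
  show "slice V A \<phi> = slice V' A \<phi>"
    using assms by (simp add: slice_def tensor_lift_def same_tensor[OF assms] same_lin[OF assms] p) (simp add: same_space_def)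
qed
lemma same_finsum: assumes "same_space V V'" shows "finsum V = finsum V'"
  by (rule ext)+ (use assms in \<open>simp add: finsum_def finprod_def same_space_def\<close>)
lemma same_module: assumes "same_space V V'" shows "module K V \<longleftrightarrow> module K V'"
proof -
  have "module K V'" if h: "module K V" and s: "same_space V V'" for V :: "('k, 'x, 'y) module_scheme" and V' :: "('k, 'x, 'z) module_scheme"
  proof -
    note [simp] = s[unfolded same_space_def, THEN conjunct1, symmetric] s[unfolded same_space_def, THEN conjunct2, THEN conjunct1, symmetric]
      s[unfolded same_space_def, THEN conjunct2, THEN conjunct2, THEN conjunct1, symmetric]
      s[unfolded same_space_def, THEN conjunct2, THEN conjunct2, THEN conjunct2, symmetric]
    show ?thesis
      by (rule moduleI') (use h in \<open>auto simp: vac smult_add add_smult smult_smult neg_smult\<close>)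
  qed
  from this[of V V'] this[of V' V] show ?thesis using assms by (auto simp: same_space_def)
qed
lemma same_coaction [simp]: "same_space (P\<lparr>coaction := c\<rparr>) P" by (simp add: same_space_def)
lemmas coaction_update [simp] = same_tensor[OF same_coaction] same_slice[OF same_coaction] same_module[OF same_coaction]
  same_bilin[OF same_coaction] same_lin[OF same_coaction] same_finsum[OF same_coaction]

lemma module_image:
  assumes V: "module K V" and im: "f ` carrier V = carrier Q"
    and "\<And>u v. u \<in> carrier V \<Longrightarrow> v \<in> carrier V \<Longrightarrow> f u \<oplus>\<^bsub>Q\<^esub> f v = f (u \<oplus>\<^bsub>V\<^esub> v)"
    and "\<And>c v. c \<in> carrier K \<Longrightarrow> v \<in> carrier V \<Longrightarrow> c \<odot>\<^bsub>Q\<^esub> f v = f (c \<odot>\<^bsub>V\<^esub> v)"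
    and "\<zero>\<^bsub>Q\<^esub> = f \<zero>\<^bsub>V\<^esub>"
  shows "module K Q" "f \<in> lin K V Q"
proof -
  note V [simp] and [simp] = assms(3-5)
  have m: "f v \<in> carrier Q" if "v \<in> carrier V" for v using im that by blast
  have e: "\<exists>v\<in>carrier V. q = f v" if "q \<in> carrier Q" for q using im that by blast
  show "f \<in> lin K V Q" by (rule linI) (auto simp: m)
  show "module K Q"
  proof (rule moduleI')
    fix x y assume "x \<in> carrier Q" "y \<in> carrier Q"
    then obtain u v where [simp]: "x = f u" "y = f v" "u \<in> carrier V" "v \<in> carrier V" using e by meson
    show "x \<oplus>\<^bsub>Q\<^esub> y \<in> carrier Q" "x \<oplus>\<^bsub>Q\<^esub> y = y \<oplus>\<^bsub>Q\<^esub> x" by (auto simp: m vcomm[of V u v])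
    fix z assume "z \<in> carrier Q"
    then obtain w where [simp]: "z = f w" "w \<in> carrier V" using e by meson
    show "x \<oplus>\<^bsub>Q\<^esub> y \<oplus>\<^bsub>Q\<^esub> z = x \<oplus>\<^bsub>Q\<^esub> (y \<oplus>\<^bsub>Q\<^esub> z)" by (simp add: vassoc)
  next
    fix x y c assume "x \<in> carrier Q" "y \<in> carrier Q" and [simp]: "c \<in> carrier K"
    then obtain u v where [simp]: "x = f u" "y = f v" "u \<in> carrier V" "v \<in> carrier V" using e by meson
    show "c \<odot>\<^bsub>Q\<^esub> (x \<oplus>\<^bsub>Q\<^esub> y) = c \<odot>\<^bsub>Q\<^esub> x \<oplus>\<^bsub>Q\<^esub> c \<odot>\<^bsub>Q\<^esub> y" by (simp add: smult_add)
    fix d assume [simp]: "d \<in> carrier K"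
    show "(c \<oplus> d) \<odot>\<^bsub>Q\<^esub> x = c \<odot>\<^bsub>Q\<^esub> x \<oplus>\<^bsub>Q\<^esub> d \<odot>\<^bsub>Q\<^esub> x" "(c \<otimes> d) \<odot>\<^bsub>Q\<^esub> x = c \<odot>\<^bsub>Q\<^esub> (d \<odot>\<^bsub>Q\<^esub> x)"
      by (simp_all add: add_smult smult_smult)
  next
    fix x c assume "x \<in> carrier Q" and [simp]: "c \<in> carrier K"
    then obtain u where [simp]: "x = f u" "u \<in> carrier V" using e by meson
    show "c \<odot>\<^bsub>Q\<^esub> x \<in> carrier Q" by (simp add: m)
  next
    fix x assume "x \<in> carrier Q"
    then obtain u where [simp]: "x = f u" "u \<in> carrier V" using e by meson
    show "\<zero>\<^bsub>Q\<^esub> \<oplus>\<^bsub>Q\<^esub> x = x" "x \<oplus>\<^bsub>Q\<^esub> (\<ominus> \<one>) \<odot>\<^bsub>Q\<^esub> x = \<zero>\<^bsub>Q\<^esub>" "\<one> \<odot>\<^bsub>Q\<^esub> x = x" by (simp_all add: neg_smult del: assms(5)) (simp_all)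
  next
    show "\<zero>\<^bsub>Q\<^esub> \<in> carrier Q" by (simp add: m)
  qed
qed

end

section \<open>Modules as representations by operators\<close>

text \<open>
  Operators are the elements \<open>Inl g\<close> of a finite group, or the functionals \<open>Inr f\<close> on the coordinate algebra of
  an algebraic group. The definitions stay outside the locale so that a case equation for \<open>H\<close> can be used to
  rewrite them.
\<close>
definition hops :: "'k ring \<Rightarrow> ('k, 'g, 'a) hgroup \<Rightarrow> ('g + ('a \<Rightarrow> 'k)) set" where
  "hops K H = (case H of Finite_Group G \<Rightarrow> Inl ` carrier G | Algebraic_Group A \<Rightarrow> Inr ` lin K A (scalars K))"

definition hopmul :: "'k ring \<Rightarrow> ('k, 'g, 'a) hgroup \<Rightarrow> 'g + ('a \<Rightarrow> 'k) \<Rightarrow> 'g + ('a \<Rightarrow> 'k) \<Rightarrow> 'g + ('a \<Rightarrow> 'k)" where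
  "hopmul K H x y = (case H of Finite_Group G \<Rightarrow> Inl (projl x \<otimes>\<^bsub>G\<^esub> projl y)
     | Algebraic_Group A \<Rightarrow> Inr (\<lambda>a. ground.dual_prod K A A (projr x) (projr y) (comult A a)))"

definition hopone :: "'k ring \<Rightarrow> ('k, 'g, 'a) hgroup \<Rightarrow> 'g + ('a \<Rightarrow> 'k)" where
  "hopone K H = (case H of Finite_Group G \<Rightarrow> Inl \<one>\<^bsub>G\<^esub> | Algebraic_Group A \<Rightarrow> Inr (counit A))"

definition hact :: "'k ring \<Rightarrow> ('k, 'g, 'a) hgroup \<Rightarrow> ('k, 'v, 'g, 'a) hmod \<Rightarrow> 'g + ('a \<Rightarrow> 'k) \<Rightarrow> 'v \<Rightarrow> 'v" where
  "hact K H M x v = (case H of Finite_Group G \<Rightarrow> action M (projl x) v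
     | Algebraic_Group A \<Rightarrow> ground.slice K M A (projr x) (coaction M v))"

text \<open>
  An orbit map is rational if it comes from a tensor \<open>\<Sum>u\<^sub>i \<otimes> c\<^sub>i\<close>: this is what distinguishes comodules among
  the representations of the dual algebra of \<open>A\<close>.
\<close>
definition hrat :: "'k ring \<Rightarrow> ('k, 'g, 'a) hgroup \<Rightarrow> ('k, 'v, 'm) module_scheme \<Rightarrow> ('g + ('a \<Rightarrow> 'k) \<Rightarrow> 'v) \<Rightarrow> bool" where
  "hrat K H V \<phi> = (case H of Finite_Group G \<Rightarrow> True
     | Algebraic_Group A \<Rightarrow> \<exists>n c u. (\<forall>i<n::nat. c i \<in> carrier A \<and> u i \<in> carrier V) \<and>
         (\<forall>f\<in>lin K A (scalars K). \<phi> (Inr f) = (\<Oplus>\<^bsub>V\<^esub>i\<in>{..<n}. f (c i) \<odot>\<^bsub>V\<^esub> u i)))"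

definition hrep :: "'k ring \<Rightarrow> ('k, 'g, 'a) hgroup \<Rightarrow> ('k, 'v, 'm) module_scheme \<Rightarrow> ('g + ('a \<Rightarrow> 'k) \<Rightarrow> 'v \<Rightarrow> 'v) \<Rightarrow> bool" where
  "hrep K H V \<rho> \<longleftrightarrow> module K V \<and> (\<forall>x\<in>hops K H. \<rho> x \<in> lin K V V) \<and> (\<forall>v\<in>carrier V. \<rho> (hopone K H) v = v) \<and>
     (\<forall>x\<in>hops K H. \<forall>y\<in>hops K H. \<forall>v\<in>carrier V. \<rho> (hopmul K H x y) v = \<rho> x (\<rho> y v)) \<and>
     (\<forall>v\<in>carrier V. hrat K H V (\<lambda>x. \<rho> x v))"

text \<open>
  The part of being a module that makes \<open>hact\<close> determine the coaction; the action itself is not constrained.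
\<close>
definition hhspace :: "'k ring \<Rightarrow> ('k, 'g, 'a) hgroup \<Rightarrow> ('k, 'v, 'g, 'a) hmod \<Rightarrow> bool" where
  "hhspace K H M \<longleftrightarrow> module K M \<and> (case H of Finite_Group G \<Rightarrow> True
     | Algebraic_Group A \<Rightarrow> \<forall>v\<in>carrier M. coaction M v \<in> carrier (tensor K M A))"

text \<open>
  The module given by operators; by \<open>slices_separate\<close> at most one coaction has prescribed slices.
\<close>
definition hmk :: "'k ring \<Rightarrow> ('k, 'g, 'a) hgroup \<Rightarrow> ('k, 'v, 'm) module_scheme \<Rightarrow> ('g + ('a \<Rightarrow> 'k) \<Rightarrow> 'v \<Rightarrow> 'v) \<Rightarrow> ('k, 'v, 'g, 'a) hmod" where
  "hmk K H V \<rho> = \<lparr>carrier = carrier V, monoid.mult = undefined, one = undefined, ring.zero = \<zero>\<^bsub>V\<^esub>, ring.add = ring.add V,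
     smult = smult V, action = (\<lambda>g. \<rho> (Inl g)),
     coaction = (case H of Finite_Group G \<Rightarrow> undefined | Algebraic_Group A \<Rightarrow>
       (\<lambda>v. THE t. t \<in> carrier (tensor K V A) \<and> (\<forall>f\<in>lin K A (scalars K). ground.slice K V A f t = \<rho> (Inr f) v)))\<rparr>"

locale hcat = ground K for K :: "'k ring" (structure) +
  fixes H :: "('k, 'g, 'a) hgroup"
  assumes is_hgroup: "is_hgroup K H"
begin

abbreviation "ops \<equiv> hops K H"
abbreviation "opmul \<equiv> hopmul K H"
abbreviation "opone \<equiv> hopone K H"
abbreviation "act \<equiv> hact K H"
abbreviation "rat \<equiv> hrat K H"
abbreviation "rep \<equiv> hrep K H"
abbreviation "hspace \<equiv> hhspace K H"
abbreviation "mk \<equiv> hmk K H"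

lemma alg: assumes "H = Algebraic_Group A"
  shows "module K A" "comult A \<in> lin K A (tensor K A A)" "counit A \<in> lin K A (scalars K)"
proof -
  have "linear_algebraic_group K A" using is_hgroup assms by (simp add: is_hgroup_def)
  then interpret L: linear_algebraic_group K A .
  show "module K A" by (rule L.module)
  show "comult A \<in> lin K A (tensor K A A)" "counit A \<in> lin K A (scalars K)" by (rule L.comult_lin, rule L.counit_lin)
qed

lemma alg_unfold: assumes "H = Algebraic_Group A"
  shows "act M (Inr f) v = slice M A f (coaction M v)"
    "hspace M \<longleftrightarrow> module K M \<and> (\<forall>v\<in>carrier M. coaction M v \<in> carrier (tensor K M A))"
    "ops = Inr ` lin K A (scalars K)"
  by (simp_all add: hact_def hhspace_def hops_def assms)

lemma opmul_closed [simp]: "x \<in> ops \<Longrightarrow> y \<in> ops \<Longrightarrow> opmul x y \<in> ops"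
proof (cases H)
  case (Finite_Group G)
  then have "group G" using is_hgroup by (simp add: is_hgroup_def)
  then interpret group G .
  assume "x \<in> ops" "y \<in> ops" then show ?thesis using Finite_Group by (auto simp: hops_def hopmul_def)
next
  case (Algebraic_Group A)
  note a = alg[OF Algebraic_Group]
  assume "x \<in> ops" "y \<in> ops" then show ?thesis using Algebraic_Group
    by (auto simp: hops_def hopmul_def intro!: lin_comp[OF a(2)] dual_prod(1)[OF a(1) a(1)])
qed

lemma opone_closed [simp]: "opone \<in> ops"
proof (cases H)
  case (Finite_Group G)
  then have "group G" using is_hgroup by (simp add: is_hgroup_def)
  then interpret group G .
  show ?thesis using Finite_Group by (auto simp: hops_def hopone_def)
next
  case (Algebraic_Group A)
  then show ?thesis using alg by (auto simp: hops_def hopone_def)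
qed

lemma hspace_module: "hspace M \<Longrightarrow> module K M" by (simp add: hhspace_def)

text \<open>
  Both sides of the coassociativity law are compared by the functionals \<open>f \<otimes> g\<close>, which turn the one into
  \<open>f \<cdot> (g \<cdot> v)\<close> and the other into \<open>(f * g) \<cdot> v\<close>.
\<close>
lemma coassoc_iff:
  assumes A: "H = Algebraic_Group A" and M: "module K M" and co: "coaction M \<in> lin K M (tensor K M A)" and v: "v \<in> carrier M"
  shows "tensor_assoc K M A A (tensor_map K M A (tensor K M A) A (coaction M) id (coaction M v)) =
           tensor_map K M A M (tensor K A A) id (comult A) (coaction M v) \<longleftrightarrow>
     (\<forall>x\<in>ops. \<forall>y\<in>ops. act M (opmul x y) v = act M x (act M y v))"
proof -
  note a = alg[OF A] and M [simp]
  note a(1) [simp]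
  let ?L = "tensor_map K M A (tensor K M A) A (coaction M) id (coaction M v)"
  let ?R = "tensor_map K M A M (tensor K A A) id (comult A) (coaction M v)"
  have T: "module K (tensor K M A)" "module K (tensor K A A)" by auto
  have cv: "coaction M v \<in> carrier (tensor K M A)" by (rule lin_closed[OF co v])
  note mL = tensor_map[OF M a(1) T(1) a(1) co lin_id(1)]
  note mR = tensor_map[OF M a(1) M T(2) lin_id(1) a(2)]
  have L: "?L \<in> carrier (tensor K (tensor K M A) A)" by (rule lin_closed[OF mL(1) cv])
  have R: "?R \<in> carrier (tensor K M (tensor K A A))" by (rule lin_closed[OF mR(1) cv])
  note as = assoc_lin[OF M a(1) a(1)]
  have LL: "tensor_assoc K M A A ?L \<in> carrier (tensor K M (tensor K A A))" by (rule lin_closed[OF as(1) L])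
  have 1: "slice M (tensor K A A) (dual_prod A A f g) (tensor_assoc K M A A ?L) = act M (Inr f) (act M (Inr g) v)"
    if f: "f \<in> lin K A (scalars K)" and g: "g \<in> lin K A (scalars K)" for f g
    using as(2)[OF f g L] slice_map[OF M a(1) T(1) co g cv] by (simp add: hact_def A)
  have 2: "slice M (tensor K A A) (dual_prod A A f g) ?R = act M (opmul (Inr f) (Inr g)) v"
    if f: "f \<in> lin K A (scalars K)" and g: "g \<in> lin K A (scalars K)" for f g
    using slice_map_right[OF M a(1) T(2) a(2) dual_prod(1)[OF a(1) a(1) f g] cv] by (simp add: hact_def A hopmul_def)
  show ?thesis
  proof
    assume e: "tensor_assoc K M A A ?L = ?R"
    show "\<forall>x\<in>ops. \<forall>y\<in>ops. act M (opmul x y) v = act M x (act M y v)"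
      using 1 2 by (auto simp: hops_def A e)
  next
    assume e: "\<forall>x\<in>ops. \<forall>y\<in>ops. act M (opmul x y) v = act M x (act M y v)"
    show "tensor_assoc K M A A ?L = ?R"
    proof (rule double_slices_separate[OF M a(1) a(1) LL R])
      fix f g assume fg: "f \<in> lin K A (scalars K)" "g \<in> lin K A (scalars K)"
      then show "slice M (tensor K A A) (dual_prod A A f g) (tensor_assoc K M A A ?L) = slice M (tensor K A A) (dual_prod A A f g) ?R"
        using 1[OF fg] 2[OF fg] e by (simp add: hops_def A)
    qed
  qed
qed

lemma hmodule_iff:
  "hmodule K H M \<longleftrightarrow> hspace M \<and> (\<forall>x\<in>ops. act M x \<in> lin K M M) \<and> (\<forall>v\<in>carrier M. act M opone v = v) \<and>
     (\<forall>x\<in>ops. \<forall>y\<in>ops. \<forall>v\<in>carrier M. act M (opmul x y) v = act M x (act M y v))"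
proof (cases H)
  case (Finite_Group G)
  have "act M (Inl g) = action M g" for g by (rule ext) (simp add: hact_def Finite_Group)
  then show ?thesis by (auto simp: hmodule_def hhspace_def hops_def hopone_def hopmul_def hact_def Finite_Group)
next
  case (Algebraic_Group A)
  note a = alg[OF Algebraic_Group]
  have c: "(coaction M \<in> lin K M (tensor K M A)) \<longleftrightarrow> hspace M \<and> (\<forall>x\<in>ops. act M x \<in> lin K M M)" if M: "module K M"
  proof
    assume co: "coaction M \<in> lin K M (tensor K M A)"
    have "act M (Inr f) \<in> lin K M M" if f: "f \<in> lin K A (scalars K)" for f
    proof -
      have "act M (Inr f) = (\<lambda>v. slice M A f (coaction M v))" by (rule ext) (simp add: hact_def Algebraic_Group)
      then show ?thesis using lin_comp[OF co slice(1)[OF M a(1) f]] by simp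
    qed
    then show "hspace M \<and> (\<forall>x\<in>ops. act M x \<in> lin K M M)"
      using M lin_closed[OF co] by (auto simp: hhspace_def hops_def Algebraic_Group)
  next
    assume h: "hspace M \<and> (\<forall>x\<in>ops. act M x \<in> lin K M M)"
    then have co: "coaction M v \<in> carrier (tensor K M A)" if "v \<in> carrier M" for v
      using that by (simp add: hhspace_def Algebraic_Group)
    have l: "act M (Inr f) \<in> lin K M M" if "f \<in> lin K A (scalars K)" for f
      using h that by (simp add: hops_def Algebraic_Group)
    have e: "act M (Inr f) v = slice M A f (coaction M v)" for f v by (simp add: hact_def Algebraic_Group)
    note M [simp]
    show "coaction M \<in> lin K M (tensor K M A)"
    proof (rule linI)
      fix u v assume uv: "u \<in> carrier M" "v \<in> carrier M"
      show "coaction M (u \<oplus>\<^bsub>M\<^esub> v) = coaction M u \<oplus>\<^bsub>tensor K M A\<^esub> coaction M v"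
      proof (rule slices_separate[OF M a(1)])
        fix f assume f: "f \<in> lin K A (scalars K)"
        show "slice M A f (coaction M (u \<oplus>\<^bsub>M\<^esub> v)) = slice M A f (coaction M u \<oplus>\<^bsub>tensor K M A\<^esub> coaction M v)"
          using lin_add[OF l[OF f] uv] uv co by (simp add: e lin_add[OF slice(1)[OF M a(1) f]])
      qed (use uv co in auto)
    next
      fix c v assume uv: "c \<in> carrier K" "v \<in> carrier M"
      show "coaction M (c \<odot>\<^bsub>M\<^esub> v) = c \<odot>\<^bsub>tensor K M A\<^esub> coaction M v"
      proof (rule slices_separate[OF M a(1)])
        fix f assume f: "f \<in> lin K A (scalars K)"
        show "slice M A f (coaction M (c \<odot>\<^bsub>M\<^esub> v)) = slice M A f (c \<odot>\<^bsub>tensor K M A\<^esub> coaction M v)"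
          using lin_smult[OF l[OF f] uv] uv co by (simp add: e lin_smult[OF slice(1)[OF M a(1) f]])
      qed (use uv co in auto)
    qed (use co in auto)
  qed
  have one: "act M opone v = tensor_lift K M A M (\<lambda>w a. counit A a \<odot>\<^bsub>M\<^esub> w) (coaction M v)" for v
    by (simp add: hact_def hopone_def Algebraic_Group slice_def)
  have h: "hmodule K H M \<longleftrightarrow> module K M \<and> coaction M \<in> lin K M (tensor K M A) \<and>
      (\<forall>v\<in>carrier M. act M opone v = v) \<and>
      (\<forall>v\<in>carrier M. tensor_assoc K M A A (tensor_map K M A (tensor K M A) A (coaction M) id (coaction M v)) =
           tensor_map K M A M (tensor K A A) id (comult A) (coaction M v))"
    unfolding one by (auto simp: hmodule_def Algebraic_Group)
  have m: "hspace M \<Longrightarrow> module K M" by (simp add: hhspace_def)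
  show ?thesis
  proof (cases "module K M \<and> coaction M \<in> lin K M (tensor K M A)")
    case True
    then have "hspace M \<and> (\<forall>x\<in>ops. act M x \<in> lin K M M)" using c by simp
    with True show ?thesis unfolding h
      using coassoc_iff[OF Algebraic_Group conjunct1[OF True] conjunct2[OF True]] by auto
  next
    case False
    then have "\<not> (hspace M \<and> (\<forall>x\<in>ops. act M x \<in> lin K M M))" using c m by metis
    with False show ?thesis unfolding h by auto
  qed
qed

lemma hmodule_facts:
  assumes "hmodule K H M"
  shows "module K M" "hspace M" "\<And>x. x \<in> ops \<Longrightarrow> act M x \<in> lin K M M"
    "\<And>x v. x \<in> ops \<Longrightarrow> v \<in> carrier M \<Longrightarrow> act M x v \<in> carrier M"
    "\<And>v. v \<in> carrier M \<Longrightarrow> act M opone v = v"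
    "\<And>x y v. x \<in> ops \<Longrightarrow> y \<in> ops \<Longrightarrow> v \<in> carrier M \<Longrightarrow> act M (opmul x y) v = act M x (act M y v)"
  using assms unfolding hmodule_iff by (auto simp: hspace_module intro: lin_closed)

lemma rat_act:
  assumes "hspace M" "v \<in> carrier M" shows "rat M (\<lambda>x. act M x v)"
proof (cases H)
  case (Algebraic_Group A)
  note a = alg[OF Algebraic_Group]
  have M: "module K M" and "coaction M v \<in> carrier (tensor K M A)" using assms Algebraic_Group by (auto simp: hhspace_def)
  then obtain n x y where *: "\<forall>i<n. x i \<in> carrier M \<and> y i \<in> carrier A" "coaction M v = tsum M A n x y"
    unfolding tensor_carrier by blast
  have "\<forall>f\<in>lin K A (scalars K). act M (Inr f) v = (\<Oplus>\<^bsub>M\<^esub>i\<in>{..<n}. f (y i) \<odot>\<^bsub>M\<^esub> x i)"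
    using * slice_tsum[OF M a(1)] by (simp add: hact_def Algebraic_Group)
  then have "\<exists>n c u. (\<forall>i<n::nat. c i \<in> carrier A \<and> u i \<in> carrier M) \<and>
         (\<forall>f\<in>lin K A (scalars K). act M (Inr f) v = (\<Oplus>\<^bsub>M\<^esub>i\<in>{..<n}. f (c i) \<odot>\<^bsub>M\<^esub> u i))"
    using *(1) by (intro exI[of _ n] exI[of _ y] exI[of _ x]) auto
  then show ?thesis by (simp add: hrat_def Algebraic_Group)
qed (simp add: hrat_def)

lemma mk_same [simp]: "same_space (mk V \<rho>) V" by (simp add: hmk_def same_space_def)
lemma mk_simps [simp]: "carrier (mk V \<rho>) = carrier V" "\<zero>\<^bsub>mk V \<rho>\<^esub> = \<zero>\<^bsub>V\<^esub>" "ring.add (mk V \<rho>) = ring.add V" "smult (mk V \<rho>) = smult V"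
  by (auto simp: hmk_def)
lemma mk_lin [simp]: "lin K (mk V \<rho>) W = lin K V W" "lin K W (mk V \<rho>) = lin K W V" "module K (mk V \<rho>) = module K V"
  by (rule same_lin[OF mk_same] same_module[OF mk_same])+

lemma mk_hmodule:
  assumes "rep V \<rho>"
  shows "hmodule K H (mk V \<rho>)" "\<And>x v. x \<in> ops \<Longrightarrow> v \<in> carrier V \<Longrightarrow> act (mk V \<rho>) x v = \<rho> x v"
proof -
  have V: "module K V" using assms by (simp add: hrep_def)
  have "hspace (mk V \<rho>) \<and> (\<forall>x\<in>ops. \<forall>v\<in>carrier V. act (mk V \<rho>) x v = \<rho> x v)"
  proof (cases H)
    case (Finite_Group G)
    have "hspace (mk V \<rho>) \<longleftrightarrow> module K (mk V \<rho>)" by (simp add: hhspace_def Finite_Group)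
    moreover have "act (mk V \<rho>) (Inl g) v = \<rho> (Inl g) v" for g v by (simp add: hact_def hmk_def Finite_Group)
    moreover have "ops = Inl ` carrier G" by (simp add: hops_def Finite_Group)
    ultimately show ?thesis using V by auto
  next
    case (Algebraic_Group A)
    note a = alg[OF Algebraic_Group]
    let ?P = "\<lambda>v t. t \<in> carrier (tensor K V A) \<and> (\<forall>f\<in>lin K A (scalars K). slice V A f t = \<rho> (Inr f) v)"
    have "?P v (coaction (mk V \<rho>) v)" if v: "v \<in> carrier V" for v
    proof -
      have "rat V (\<lambda>x. \<rho> x v)" using assms v by (simp add: hrep_def)
      then obtain n c u where *: "\<forall>i<n::nat. c i \<in> carrier A \<and> u i \<in> carrier V"
         "\<forall>f\<in>lin K A (scalars K). \<rho> (Inr f) v = (\<Oplus>\<^bsub>V\<^esub>i\<in>{..<n}. f (c i) \<odot>\<^bsub>V\<^esub> u i)"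
        unfolding hrat_def Algebraic_Group by auto
      have t: "?P v (tsum V A n u c)" using * slice_tsum[OF V a(1)] by (auto intro: tsum_mem)
      have e: "coaction (mk V \<rho>) v = (THE t. ?P v t)" by (simp add: hmk_def Algebraic_Group)
      have "?P v (THE t. ?P v t)"
        by (rule theI[of "?P v", OF t], rule slices_separate[OF V a(1)]) (use t in auto)
      then show ?thesis unfolding e .
    qed
    moreover have "hspace (mk V \<rho>) \<longleftrightarrow> module K (mk V \<rho>) \<and> (\<forall>v\<in>carrier (mk V \<rho>). coaction (mk V \<rho>) v \<in> carrier (tensor K (mk V \<rho>) A))"
      unfolding hhspace_def by (simp add: Algebraic_Group)
    moreover have "act (mk V \<rho>) (Inr f) v = slice (mk V \<rho>) A f (coaction (mk V \<rho>) v)" for f v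
      by (simp add: hact_def Algebraic_Group)
    moreover have "ops = Inr ` lin K A (scalars K)" by (simp add: hops_def Algebraic_Group)
    ultimately show ?thesis using V by (auto simp: same_tensor[OF mk_same] same_slice[OF mk_same])
  qed
  then have hs: "hspace (mk V \<rho>)" and e: "\<And>x v. x \<in> ops \<Longrightarrow> v \<in> carrier V \<Longrightarrow> act (mk V \<rho>) x v = \<rho> x v" by auto
  show "\<And>x v. x \<in> ops \<Longrightarrow> v \<in> carrier V \<Longrightarrow> act (mk V \<rho>) x v = \<rho> x v" by (rule e)
  have "act (mk V \<rho>) x \<in> lin K V V" if "x \<in> ops" for x
    by (rule lin_cong[of "\<rho> x"]) (use assms that e in \<open>auto simp: hrep_def\<close>)
  moreover have "\<rho> x v \<in> carrier V" if "x \<in> ops" "v \<in> carrier V" for x v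
    by (rule lin_closed[of "\<rho> x" V V]) (use assms that in \<open>simp_all add: hrep_def\<close>)
  ultimately show "hmodule K H (mk V \<rho>)" unfolding hmodule_iff
    using hs e assms by (auto simp: hrep_def)
qed

text \<open>
  Stated for spaces that are not yet known to be modules: for a quotient, the module laws are transported along
  a map that this lemma recognises as a homomorphism.
\<close>
lemma hom_iff_hspace:
  assumes "hspace M" "hspace N"
  shows "f \<in> hmod_hom K H M N \<longleftrightarrow> f \<in> lin K M N \<and> (\<forall>x\<in>ops. \<forall>v\<in>carrier M. f (act M x v) = act N x (f v))"
proof (cases H)
  case (Finite_Group G)
  then show ?thesis by (auto simp: hmod_hom_def hops_def hact_def)
next
  case (Algebraic_Group A)
  note a = alg[OF Algebraic_Group]
  have MN: "module K M" "module K N" and co: "\<And>v. v \<in> carrier M \<Longrightarrow> coaction M v \<in> carrier (tensor K M A)"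
    "\<And>v. v \<in> carrier N \<Longrightarrow> coaction N v \<in> carrier (tensor K N A)" using assms Algebraic_Group by (auto simp: hhspace_def)
  have "coaction N (f v) = tensor_map K M A N A f id (coaction M v) \<longleftrightarrow> (\<forall>x\<in>ops. f (act M x v) = act N x (f v))"
    if f: "f \<in> lin K M N" and v: "v \<in> carrier M" for v
  proof -
    note m = tensor_map[OF MN(1) a(1) MN(2) a(1) f lin_id(1)]
    have c: "slice N A \<phi> (tensor_map K M A N A f id (coaction M v)) = f (act M (Inr \<phi>) v)" if "\<phi> \<in> lin K A (scalars K)" for \<phi>
      using slice_map[OF MN(1) a(1) MN(2) f that co(1)[OF v]] by (simp add: hact_def Algebraic_Group)
    show ?thesis
    proof
      assume "coaction N (f v) = tensor_map K M A N A f id (coaction M v)"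
      then show "\<forall>x\<in>ops. f (act M x v) = act N x (f v)" using c by (auto simp: hops_def hact_def Algebraic_Group)
    next
      assume h: "\<forall>x\<in>ops. f (act M x v) = act N x (f v)"
      show "coaction N (f v) = tensor_map K M A N A f id (coaction M v)"
      proof (rule slices_separate[OF MN(2) a(1) co(2)[OF lin_closed[OF f v]] lin_closed[OF m(1) co(1)[OF v]]])
        fix \<phi> assume p: "\<phi> \<in> lin K A (scalars K)"
        then have "f (act M (Inr \<phi>) v) = act N (Inr \<phi>) (f v)" using h by (simp add: hops_def Algebraic_Group)
        then show "slice N A \<phi> (coaction N (f v)) = slice N A \<phi> (tensor_map K M A N A f id (coaction M v))"
          unfolding c[OF p] by (simp add: hact_def Algebraic_Group)
      qed
    qed
  qed
  then show ?thesis by (auto simp: hmod_hom_def Algebraic_Group)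
qed

lemma hom_iff:
  assumes "hmodule K H M" "hmodule K H N"
  shows "f \<in> hmod_hom K H M N \<longleftrightarrow> f \<in> lin K M N \<and> (\<forall>x\<in>ops. \<forall>v\<in>carrier M. f (act M x v) = act N x (f v))"
  by (rule hom_iff_hspace) (use assms hmodule_facts in auto)

lemma sub_iff:
  assumes "hmodule K H M"
  shows "hsubmodule K H N M \<longleftrightarrow> submodule N K M \<and> (\<forall>x\<in>ops. \<forall>v\<in>N. act M x v \<in> N)"
proof (cases H)
  case (Finite_Group G)
  then show ?thesis by (auto simp: hsubmodule_def hops_def hact_def)
next
  case (Algebraic_Group A)
  note a = alg[OF Algebraic_Group]
  have M: "module K M" and co: "\<And>v. v \<in> carrier M \<Longrightarrow> coaction M v \<in> carrier (tensor K M A)"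
    using hmodule_facts(2)[OF assms] Algebraic_Group by (auto simp: hhspace_def)
  have "submodule N K M \<Longrightarrow> v \<in> N \<Longrightarrow> v \<in> carrier M" for v by (auto simp: submodule_iff[OF M])
  then have "submodule N K M \<Longrightarrow> v \<in> N \<Longrightarrow> (coaction M v \<in>
           tensor_map K (M\<lparr>carrier := N\<rparr>) A M A id id ` carrier (tensor K (M\<lparr>carrier := N\<rparr>) A)) \<longleftrightarrow>
     (\<forall>\<phi>\<in>lin K A (scalars K). slice M A \<phi> (coaction M v) \<in> N)" for v
    by (intro tensor_sub_image[OF M a(1)] co)
  then show ?thesis
    unfolding hsubmodule_def hops_def hact_def by (auto simp: Algebraic_Group)
qed

lemma sub_hmod_simps [simp]: "carrier (sub_hmod K H M N) = N" "\<zero>\<^bsub>sub_hmod K H M N\<^esub> = \<zero>\<^bsub>M\<^esub>"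
  "ring.add (sub_hmod K H M N) = ring.add M" "smult (sub_hmod K H M N) = smult M"
  by (auto simp: sub_hmod_def Let_def)

lemma sub_hmod:
  assumes h: "hmodule K H M" and N: "hsubmodule K H N M"
  shows "hmodule K H (sub_hmod K H M N)" "\<And>x v. x \<in> ops \<Longrightarrow> v \<in> N \<Longrightarrow> act (sub_hmod K H M N) x v = act M x v"
proof -
  let ?N = "M\<lparr>carrier := N\<rparr>" let ?S = "sub_hmod K H M N"
  note f = hmodule_facts[OF h]
  have Ns: "submodule N K M" "\<And>x v. x \<in> ops \<Longrightarrow> v \<in> N \<Longrightarrow> act M x v \<in> N" using sub_iff[OF h] N by auto
  have NM: "\<And>v. v \<in> N \<Longrightarrow> v \<in> carrier M" using Ns(1) by (auto simp: submodule_iff[OF f(1)])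
  have mN: "module K ?N" by (rule submodule_module[OF f(1) Ns(1)])
  have s: "same_space ?S ?N" by (simp add: same_space_def)
  have "hspace ?S \<and> (\<forall>x\<in>ops. \<forall>v\<in>N. act ?S x v = act M x v)"
  proof (cases H)
    case (Finite_Group G)
    have "hspace ?S \<longleftrightarrow> module K ?S" by (simp add: hhspace_def Finite_Group)
    moreover have "act ?S x v = act M x v" for x v by (simp add: hact_def Finite_Group sub_hmod_def Let_def)
    ultimately show ?thesis using mN by (auto simp: same_module[OF s])
  next
    case (Algebraic_Group A)
    note a = alg[OF Algebraic_Group] and alg_ops = alg_unfold[OF Algebraic_Group]
    have i: "id \<in> lin K ?N M" by (rule linI) (use NM in auto)
    note m = tensor_map[OF mN a(1) f(1) a(1) i lin_id(1)]
    note slm = slice_map[OF mN a(1) f(1) i]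
    let ?P = "\<lambda>v t. t \<in> carrier (tensor K ?N A) \<and> tensor_map K ?N A M A id id t = coaction M v"
    have "?P v (coaction ?S v)" if v: "v \<in> N" for v
    proof -
      obtain t where t: "?P v t" using N v by (auto simp: hsubmodule_def Algebraic_Group)
      have e: "coaction ?S v = (THE t. ?P v t)" by (simp add: sub_hmod_def Let_def Algebraic_Group)
      have "?P v (THE t. ?P v t)"
      proof (rule theI[of "?P v", OF t])
        fix t' assume t': "?P v t'"
        show "t' = t"
        proof (rule slices_separate[OF mN a(1)])
          fix \<phi> assume p: "\<phi> \<in> lin K A (scalars K)"
          show "slice ?N A \<phi> t' = slice ?N A \<phi> t" using slm[OF p, of t] slm[OF p, of t'] t t' by simp
        qed (use t t' in auto)
      qed
      then show ?thesis unfolding e .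
    qed note P = this
    have "act ?S (Inr \<phi>) v = act M (Inr \<phi>) v" if v: "v \<in> N" and p: "\<phi> \<in> lin K A (scalars K)" for v \<phi>
      using P[OF v] slm[OF p, of "coaction ?S v"] by (simp add: alg_ops same_slice[OF s])
    then show ?thesis using mN P
      by (auto simp: alg_ops same_tensor[OF s] same_module[OF s])
  qed
  then have hs: "hspace ?S" and e: "\<And>x v. x \<in> ops \<Longrightarrow> v \<in> N \<Longrightarrow> act ?S x v = act M x v" by auto
  show "\<And>x v. x \<in> ops \<Longrightarrow> v \<in> N \<Longrightarrow> act ?S x v = act M x v" by (rule e)
  have "act ?S x \<in> lin K ?S ?S" if x: "x \<in> ops" for x
    by (rule linI) (use x e Ns(2) NM hspace_module[OF hs] vadd_closed[OF hspace_module[OF hs]] vsmult_closed[OF hspace_module[OF hs]]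
       lin_add[OF f(3)[OF x]] lin_smult[OF f(3)[OF x]] in auto)
  then show "hmodule K H ?S" unfolding hmodule_iff using hs e Ns NM f by auto
qed

lemma sum_hmod_simps [simp]: "carrier (sum_hmod K H M N) = carrier M \<times> carrier N" "\<zero>\<^bsub>sum_hmod K H M N\<^esub> = (\<zero>\<^bsub>M\<^esub>, \<zero>\<^bsub>N\<^esub>)"
  "x \<oplus>\<^bsub>sum_hmod K H M N\<^esub> y = (fst x \<oplus>\<^bsub>M\<^esub> fst y, snd x \<oplus>\<^bsub>N\<^esub> snd y)"
  "c \<odot>\<^bsub>sum_hmod K H M N\<^esub> x = (c \<odot>\<^bsub>M\<^esub> fst x, c \<odot>\<^bsub>N\<^esub> snd x)"
  by (auto simp: sum_hmod_def Let_def split: prod.splits)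

lemma sum_module: "module K M \<Longrightarrow> module K N \<Longrightarrow> module K (sum_hmod K H M N)"
  by (rule moduleI') (auto simp: vac smult_add add_smult smult_smult neg_smult)

lemma sum_hmod:
  fixes M :: "('k, 'v, 'g, 'a) hmod" and N :: "('k, 'w, 'g, 'a) hmod"
  assumes M: "hmodule K H M" and N: "hmodule K H N"
  shows "hmodule K H (sum_hmod K H M N)"
    "\<And>x u w. x \<in> ops \<Longrightarrow> u \<in> carrier M \<Longrightarrow> w \<in> carrier N \<Longrightarrow> act (sum_hmod K H M N) x (u, w) = (act M x u, act N x w)"
proof -
  note fM = hmodule_facts[OF M] and fN = hmodule_facts[OF N]
  note [simp] = fM(1) fN(1)
  let ?S = "sum_hmod K H M N"
  define P :: "('k, 'v \<times> 'w, 'g, 'a) hmod" where "P = \<lparr>carrier = carrier M \<times> carrier N, monoid.mult = undefined, one = undefined,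
       ring.zero = (\<zero>\<^bsub>M\<^esub>, \<zero>\<^bsub>N\<^esub>),
       ring.add = (\<lambda>(x, y) (x', y'). (x \<oplus>\<^bsub>M\<^esub> x', y \<oplus>\<^bsub>N\<^esub> y')),
       smult = (\<lambda>c (x, y). (c \<odot>\<^bsub>M\<^esub> x, c \<odot>\<^bsub>N\<^esub> y)),
       action = (\<lambda>g (x, y). (action M g x, action N g y)),
       coaction = undefined\<rparr>"
  have S: "?S = P\<lparr>coaction := (case H of
        Finite_Group G \<Rightarrow> undefined
      | Algebraic_Group A \<Rightarrow>
          (\<lambda>(x, y). tensor_map K M A P A (\<lambda>u. (u, \<zero>\<^bsub>N\<^esub>)) id (coaction M x)
             \<oplus>\<^bsub>tensor K P A\<^esub> tensor_map K N A P A (\<lambda>w. (\<zero>\<^bsub>M\<^esub>, w)) id (coaction N y)))\<rparr>"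
    unfolding sum_hmod_def Let_def P_def ..
  have mS: "module K ?S" by (rule sum_module) auto
  have sP: "same_space ?S P" unfolding S by simp
  have mP: "module K P" using mS same_module[OF sP] by simp
  have "hspace ?S \<and> (\<forall>x\<in>ops. \<forall>u\<in>carrier M. \<forall>w\<in>carrier N. act ?S x (u, w) = (act M x u, act N x w))"
  proof (cases H)
    case (Finite_Group G)
    have "hspace ?S \<longleftrightarrow> module K ?S" by (simp add: hhspace_def Finite_Group)
    moreover have "act ?S x (u, w) = (act M x u, act N x w)" for x u w by (simp add: hact_def Finite_Group sum_hmod_def Let_def)
    ultimately show ?thesis using mS by auto
  next
    case (Algebraic_Group A)
    note a = alg[OF Algebraic_Group] and alg_ops = alg_unfold[OF Algebraic_Group]
    have i1: "(\<lambda>u. (u, \<zero>\<^bsub>N\<^esub>)) \<in> lin K M P" by (rule linI) (auto simp: P_def)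
    have i2: "(\<lambda>u. (\<zero>\<^bsub>M\<^esub>, u)) \<in> lin K N P" by (rule linI) (auto simp: P_def)
    note m1 = tensor_map[OF fM(1) a(1) mP a(1) i1 lin_id(1)] and m2 = tensor_map[OF fN(1) a(1) mP a(1) i2 lin_id(1)]
    have co: "\<And>v. v \<in> carrier M \<Longrightarrow> coaction M v \<in> carrier (tensor K M A)"
      "\<And>v. v \<in> carrier N \<Longrightarrow> coaction N v \<in> carrier (tensor K N A)"
      using fM(2) fN(2) by (auto simp: alg_ops)
    have cS: "coaction ?S (u, w) = tensor_map K M A P A (\<lambda>u. (u, \<zero>\<^bsub>N\<^esub>)) id (coaction M u)
             \<oplus>\<^bsub>tensor K P A\<^esub> tensor_map K N A P A (\<lambda>w. (\<zero>\<^bsub>M\<^esub>, w)) id (coaction N w)" for u w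
      unfolding S by (simp add: Algebraic_Group)
    have "hspace ?S" using mS mP lin_closed[OF m1(1)] lin_closed[OF m2(1)] co
      by (auto simp: alg_ops cS same_tensor[OF sP])
    moreover have "act ?S (Inr f) (u, w) = (act M (Inr f) u, act N (Inr f) w)"
      if "f \<in> lin K A (scalars K)" "u \<in> carrier M" "w \<in> carrier N" for f u w
    proof -
      have "act ?S (Inr f) (u, w) = (slice M A f (coaction M u), \<zero>\<^bsub>N\<^esub>) \<oplus>\<^bsub>P\<^esub> (\<zero>\<^bsub>M\<^esub>, slice N A f (coaction N w))"
        using that co lin_closed[OF m1(1)] lin_closed[OF m2(1)]
        by (simp add: alg_ops same_slice[OF sP] cS lin_add[OF slice(1)[OF mP a(1)]]
          slice_map[OF fM(1) a(1) mP i1] slice_map[OF fN(1) a(1) mP i2])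
      also have "\<dots> = (act M (Inr f) u, act N (Inr f) w)"
        using that co lin_closed[OF slice(1)[OF fM(1) a(1)]] lin_closed[OF slice(1)[OF fN(1) a(1)]]
        by (simp add: P_def alg_ops)
      finally show ?thesis .
    qed
    ultimately show ?thesis by (auto simp: alg_ops)
  qed
  then have hs: "hspace ?S" and e: "\<And>x u w. x \<in> ops \<Longrightarrow> u \<in> carrier M \<Longrightarrow> w \<in> carrier N \<Longrightarrow> act ?S x (u, w) = (act M x u, act N x w)" by auto
  show "\<And>x u w. x \<in> ops \<Longrightarrow> u \<in> carrier M \<Longrightarrow> w \<in> carrier N \<Longrightarrow> act ?S x (u, w) = (act M x u, act N x w)" by (rule e)
  have "act ?S x \<in> lin K ?S ?S" if x: "x \<in> ops" for x
    by (rule linI) (use x e fM(4) fN(4) lin_add[OF fM(3)[OF x]] lin_smult[OF fM(3)[OF x]] lin_add[OF fN(3)[OF x]] lin_smult[OF fN(3)[OF x]] in auto)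
  then show "hmodule K H ?S" unfolding hmodule_iff using hs e fM fN by auto
qed

lemma power_hmod_simps [simp]: "carrier (power_hmod K H n M) = {..<n} \<rightarrow>\<^sub>E carrier M" "\<zero>\<^bsub>power_hmod K H n M\<^esub> = (\<lambda>i\<in>{..<n}. \<zero>\<^bsub>M\<^esub>)"
  "x \<oplus>\<^bsub>power_hmod K H n M\<^esub> y = (\<lambda>i\<in>{..<n}. x i \<oplus>\<^bsub>M\<^esub> y i)"
  "c \<odot>\<^bsub>power_hmod K H n M\<^esub> x = (\<lambda>i\<in>{..<n}. c \<odot>\<^bsub>M\<^esub> x i)"
  by (auto simp: power_hmod_def Let_def)

lemma power_module: assumes M: "module K M" shows "module K (power_hmod K H n M)"
proof (rule moduleI')
  note M [simp]
  have c: "x i \<in> carrier M" if "x \<in> carrier (power_hmod K H n M)" "i \<in> {..<n}" for x i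
    using that by auto
  fix x assume x: "x \<in> carrier (power_hmod K H n M)"
  have e: "x \<in> extensional {..<n}" using x by (simp add: PiE_def)
  note xc = c[OF x]
  show "\<zero>\<^bsub>power_hmod K H n M\<^esub> \<oplus>\<^bsub>power_hmod K H n M\<^esub> x = x" "\<one> \<odot>\<^bsub>power_hmod K H n M\<^esub> x = x"
    unfolding power_hmod_simps by (rule extensionalityI[OF _ e], use xc in auto)+
  show "x \<oplus>\<^bsub>power_hmod K H n M\<^esub> (\<ominus> \<one>) \<odot>\<^bsub>power_hmod K H n M\<^esub> x = \<zero>\<^bsub>power_hmod K H n M\<^esub>"
    unfolding power_hmod_simps by (rule restrict_ext) (simp add: xc neg_smult)
  show "a \<odot>\<^bsub>power_hmod K H n M\<^esub> x \<in> carrier (power_hmod K H n M)" if "a \<in> carrier K" for a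
    unfolding power_hmod_simps by (rule restrict_PiE_iff[THEN iffD2]) (simp add: xc that)
  show "(a \<oplus> b) \<odot>\<^bsub>power_hmod K H n M\<^esub> x = a \<odot>\<^bsub>power_hmod K H n M\<^esub> x \<oplus>\<^bsub>power_hmod K H n M\<^esub> b \<odot>\<^bsub>power_hmod K H n M\<^esub> x"
    "(a \<otimes> b) \<odot>\<^bsub>power_hmod K H n M\<^esub> x = a \<odot>\<^bsub>power_hmod K H n M\<^esub> (b \<odot>\<^bsub>power_hmod K H n M\<^esub> x)"
    if "a \<in> carrier K" "b \<in> carrier K" for a b
    unfolding power_hmod_simps by (rule restrict_ext, simp add: xc that add_smult smult_smult)+
  fix y assume y: "y \<in> carrier (power_hmod K H n M)"
  note yc = c[OF y]
  show "x \<oplus>\<^bsub>power_hmod K H n M\<^esub> y \<in> carrier (power_hmod K H n M)"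
    unfolding power_hmod_simps by (rule restrict_PiE_iff[THEN iffD2]) (simp add: xc yc)
  show "x \<oplus>\<^bsub>power_hmod K H n M\<^esub> y = y \<oplus>\<^bsub>power_hmod K H n M\<^esub> x"
    unfolding power_hmod_simps by (rule restrict_ext) (simp add: xc yc vcomm)
  show "a \<odot>\<^bsub>power_hmod K H n M\<^esub> (x \<oplus>\<^bsub>power_hmod K H n M\<^esub> y) = a \<odot>\<^bsub>power_hmod K H n M\<^esub> x \<oplus>\<^bsub>power_hmod K H n M\<^esub> a \<odot>\<^bsub>power_hmod K H n M\<^esub> y"
    if "a \<in> carrier K" for a
    unfolding power_hmod_simps by (rule restrict_ext, simp add: xc yc that smult_add)
  fix z assume z: "z \<in> carrier (power_hmod K H n M)"
  show "x \<oplus>\<^bsub>power_hmod K H n M\<^esub> y \<oplus>\<^bsub>power_hmod K H n M\<^esub> z = x \<oplus>\<^bsub>power_hmod K H n M\<^esub> (y \<oplus>\<^bsub>power_hmod K H n M\<^esub> z)"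
    unfolding power_hmod_simps by (rule restrict_ext) (simp add: xc yc c[OF z] vassoc)
next
  show "\<zero>\<^bsub>power_hmod K H n M\<^esub> \<in> carrier (power_hmod K H n M)"
    unfolding power_hmod_simps by (rule restrict_PiE_iff[THEN iffD2]) (simp add: M)
qed

lemma power_hmod:
  fixes M :: "('k, 'v, 'g, 'a) hmod"
  assumes M: "hmodule K H M"
  shows "hmodule K H (power_hmod K H n M)"
    "\<And>x w. x \<in> ops \<Longrightarrow> w \<in> {..<n} \<rightarrow>\<^sub>E carrier M \<Longrightarrow> act (power_hmod K H n M) x w = (\<lambda>i\<in>{..<n}. act M x (w i))"
proof -
  note fM = hmodule_facts[OF M]
  note [simp] = fM(1)
  let ?S = "power_hmod K H n M"
  define P :: "('k, nat \<Rightarrow> 'v, 'g, 'a) hmod" where "P = \<lparr>carrier = {..<n} \<rightarrow>\<^sub>E carrier M, monoid.mult = undefined, one = undefined,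
       ring.zero = (\<lambda>i\<in>{..<n}. \<zero>\<^bsub>M\<^esub>),
       ring.add = (\<lambda>x y. \<lambda>i\<in>{..<n}. x i \<oplus>\<^bsub>M\<^esub> y i),
       smult = (\<lambda>c x. \<lambda>i\<in>{..<n}. c \<odot>\<^bsub>M\<^esub> x i),
       action = (\<lambda>g x. \<lambda>i\<in>{..<n}. action M g (x i)),
       coaction = undefined\<rparr>"
  have S: "?S = P\<lparr>coaction := (case H of
        Finite_Group G \<Rightarrow> undefined
      | Algebraic_Group A \<Rightarrow>
          (\<lambda>x. \<Oplus>\<^bsub>tensor K P A\<^esub>i\<in>{..<n}.
             tensor_map K M A P A (\<lambda>u. \<lambda>j\<in>{..<n}. if j = i then u else \<zero>\<^bsub>M\<^esub>) id
               (coaction M (x i))))\<rparr>"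
    unfolding power_hmod_def Let_def P_def ..
  have mS: "module K ?S" by (rule power_module) auto
  have sP: "same_space ?S P" unfolding S by simp
  have mP: "module K P" using mS same_module[OF sP] by simp
  have Ps [simp]: "carrier P = {..<n} \<rightarrow>\<^sub>E carrier M" "\<And>x y. x \<oplus>\<^bsub>P\<^esub> y = (\<lambda>i\<in>{..<n}. x i \<oplus>\<^bsub>M\<^esub> y i)"
    "\<And>c x. c \<odot>\<^bsub>P\<^esub> x = (\<lambda>i\<in>{..<n}. c \<odot>\<^bsub>M\<^esub> x i)" by (auto simp: P_def)
  have "hspace ?S \<and> (\<forall>x\<in>ops. \<forall>w\<in>carrier P. act ?S x w = (\<lambda>i\<in>{..<n}. act M x (w i)))"
  proof (cases H)
    case (Finite_Group G)
    have "hspace ?S \<longleftrightarrow> module K ?S" by (simp add: hhspace_def Finite_Group)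
    moreover have "act ?S x w = (\<lambda>i\<in>{..<n}. act M x (w i))" for x w by (simp add: hact_def Finite_Group power_hmod_def Let_def)
    ultimately show ?thesis using mS by auto
  next
    case (Algebraic_Group A)
    note a = alg[OF Algebraic_Group] and alg_ops = alg_unfold[OF Algebraic_Group]
    define inj where "inj i = (\<lambda>u. \<lambda>j\<in>{..<n}. if j = i then u else \<zero>\<^bsub>M\<^esub>)" for i
    have i: "inj i \<in> lin K M P" if "i < n" for i
      by (rule linI) (auto simp: inj_def intro!: restrict_ext)
    note m = tensor_map[OF fM(1) a(1) mP a(1) i lin_id(1)]
    have co: "\<And>v. v \<in> carrier M \<Longrightarrow> coaction M v \<in> carrier (tensor K M A)"
      using fM(2) by (auto simp: alg_ops)
    have cS: "coaction ?S w = (\<Oplus>\<^bsub>tensor K P A\<^esub>i\<in>{..<n}. tensor_map K M A P A (inj i) id (coaction M (w i)))" for w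
      unfolding S inj_def by (simp add: Algebraic_Group)
    have tm: "tensor_map K M A P A (inj i) id (coaction M (w i)) \<in> carrier (tensor K P A)"
      if "i < n" "w \<in> carrier P" for i w
      by (rule lin_closed[OF m(1)[OF that(1)] co]) (use that in auto)
    have mT: "module K (tensor K P A)" using mP by simp
    have "coaction ?S w \<in> carrier (tensor K ?S A)" if "w \<in> carrier P" for w
      unfolding cS same_tensor[OF sP] by (rule vsum_closed[OF mT tm[OF _ that]])
    then have "hspace ?S" unfolding alg_ops using mS by simp
    moreover have "act ?S (Inr f) w = (\<lambda>j\<in>{..<n}. act M (Inr f) (w j))"
      if f: "f \<in> lin K A (scalars K)" and w: "w \<in> carrier P" for f w
    proof -
      have s: "slice M A f (coaction M (w i)) \<in> carrier M" if "i < n" for i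
        by (rule lin_closed[OF slice(1)[OF fM(1) a(1) f] co]) (use that w in auto)
      have "act ?S (Inr f) w = slice P A f (\<Oplus>\<^bsub>tensor K P A\<^esub>i\<in>{..<n}. tensor_map K M A P A (inj i) id (coaction M (w i)))"
        by (simp add: alg_ops same_slice[OF sP] cS)
      also have "\<dots> = (\<Oplus>\<^bsub>P\<^esub>i\<in>{..<n}. slice P A f (tensor_map K M A P A (inj i) id (coaction M (w i))))"
        by (rule lin_vsum[OF slice(1)[OF mP a(1) f] mT mP tm]) (use w in auto)
      also have "\<dots> = (\<Oplus>\<^bsub>P\<^esub>i\<in>{..<n}. inj i (slice M A f (coaction M (w i))))"
      proof (rule vsum_cong[OF mP])
        fix k assume k: "k < n"
        then have "w k \<in> carrier M" using w by auto
        then show "slice P A f (tensor_map K M A P A (inj k) id (coaction M (w k))) = inj k (slice M A f (coaction M (w k)))"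
          using slice_map[OF fM(1) a(1) mP i[OF k] f co] by simp
        show "slice P A f (tensor_map K M A P A (inj k) id (coaction M (w k))) \<in> carrier P"
          by (rule lin_closed[OF slice(1)[OF mP a(1) f] tm]) (use k w in auto)
      qed
      also have "\<dots> = (\<lambda>j\<in>{..<n}. act M (Inr f) (w j))" (is "?X0 = ?Y0")
      proof (rule extensionalityI[of _ "{..<n}"])
        have ic: "inj i (slice M A f (coaction M (w i))) \<in> carrier P" if "i < n" for i
          by (rule lin_closed[OF i[OF that] s[OF that]])
        then have "?X0 \<in> carrier P" by (rule vsum_closed[OF mP])
        then show "?X0 \<in> extensional {..<n}" by (simp add: PiE_def)
        fix j assume j: "j \<in> {..<n}"
        have pr: "(\<lambda>z. z j) \<in> lin K P M" by (rule linI) (use j in auto)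
        have "?X0 j = (\<Oplus>\<^bsub>M\<^esub>i\<in>{..<n}. inj i (slice M A f (coaction M (w i))) j)"
          by (rule lin_vsum[OF pr mP fM(1) ic])
        also have "\<dots> = (\<Oplus>\<^bsub>M\<^esub>i\<in>{..<n}. if i = j then slice M A f (coaction M (w j)) else \<zero>\<^bsub>M\<^esub>)"
          by (rule vsum_cong[OF fM(1)]) (use j s in \<open>auto simp: inj_def\<close>)
        also have "\<dots> = slice M A f (coaction M (w j))" by (rule vsum_delta[OF fM(1)]) (use j s in auto)
        finally show "?X0 j = ?Y0 j" using j by (simp add: alg_ops)
      qed auto
      finally show ?thesis .
    qed
    ultimately show ?thesis by (auto simp: alg_ops)
  qed
  then have hs: "hspace ?S" and e: "\<And>x w. x \<in> ops \<Longrightarrow> w \<in> {..<n} \<rightarrow>\<^sub>E carrier M \<Longrightarrow> act ?S x w = (\<lambda>i\<in>{..<n}. act M x (w i))" by auto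
  show "\<And>x w. x \<in> ops \<Longrightarrow> w \<in> {..<n} \<rightarrow>\<^sub>E carrier M \<Longrightarrow> act ?S x w = (\<lambda>i\<in>{..<n}. act M x (w i))" by (rule e)
  have c: "(\<lambda>i\<in>{..<n}. act M x (w i)) \<in> {..<n} \<rightarrow>\<^sub>E carrier M" if "x \<in> ops" "w \<in> {..<n} \<rightarrow>\<^sub>E carrier M" for x w
    using that fM(4) by auto
  have "act ?S x \<in> lin K ?S ?S" if x: "x \<in> ops" for x
  proof (rule linI)
    fix v assume "v \<in> carrier ?S" then show "act ?S x v \<in> carrier ?S" using x e c by simp
  next
    fix u v assume uv: "u \<in> carrier ?S" "v \<in> carrier ?S"
    have i: "u i \<in> carrier M" "v i \<in> carrier M" if "i \<in> {..<n}" for i using uv that by auto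
    have "u \<oplus>\<^bsub>?S\<^esub> v \<in> carrier ?S" using uv mS by (rule_tac vadd_closed)
    then have "act ?S x (u \<oplus>\<^bsub>?S\<^esub> v) = (\<lambda>i\<in>{..<n}. act M x (u i \<oplus>\<^bsub>M\<^esub> v i))"
      using x by (simp add: e cong: restrict_cong)
    also have "\<dots> = (\<lambda>i\<in>{..<n}. act M x (u i) \<oplus>\<^bsub>M\<^esub> act M x (v i))"
      by (rule restrict_ext) (simp add: i lin_add[OF fM(3)[OF x]])
    finally show "act ?S x (u \<oplus>\<^bsub>?S\<^esub> v) = act ?S x u \<oplus>\<^bsub>?S\<^esub> act ?S x v"
      using x uv by (simp add: e cong: restrict_cong)
  next
    fix d v assume uv: "d \<in> carrier K" "v \<in> carrier ?S"
    have i: "v i \<in> carrier M" if "i \<in> {..<n}" for i using uv that by auto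
    have "d \<odot>\<^bsub>?S\<^esub> v \<in> carrier ?S" using uv mS by (rule_tac vsmult_closed)
    then have "act ?S x (d \<odot>\<^bsub>?S\<^esub> v) = (\<lambda>i\<in>{..<n}. act M x (d \<odot>\<^bsub>M\<^esub> v i))"
      using x by (simp add: e cong: restrict_cong)
    also have "\<dots> = (\<lambda>i\<in>{..<n}. d \<odot>\<^bsub>M\<^esub> act M x (v i))"
      by (rule restrict_ext) (simp add: i uv lin_smult[OF fM(3)[OF x]])
    finally show "act ?S x (d \<odot>\<^bsub>?S\<^esub> v) = d \<odot>\<^bsub>?S\<^esub> act ?S x v"
      using x uv by (simp add: e cong: restrict_cong)
  qed
  moreover have "act ?S opone v = v" if "v \<in> carrier ?S" for v
  proof (rule extensionalityI[of _ "{..<n}"])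
    have "v i \<in> carrier M" if "i \<in> {..<n}" for i using \<open>v \<in> carrier ?S\<close> that by auto
    then show "act ?S opone v i = v i" if "i \<in> {..<n}" for i using \<open>v \<in> carrier ?S\<close> that fM(5) by (simp add: e)
  qed (use that e in \<open>simp_all add: PiE_def\<close>)
  moreover have "act ?S (opmul x y) v = act ?S x (act ?S y v)" if "x \<in> ops" "y \<in> ops" "v \<in> carrier ?S" for x y v
  proof -
    have vi: "v i \<in> carrier M" if "i \<in> {..<n}" for i using \<open>v \<in> carrier ?S\<close> that by auto
    have "act ?S (opmul x y) v = (\<lambda>i\<in>{..<n}. act M (opmul x y) (v i))" "act ?S x (act ?S y v) = (\<lambda>i\<in>{..<n}. act M x ((\<lambda>i\<in>{..<n}. act M y (v i)) i))"
      using that e c by simp_all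
    then show ?thesis using that vi fM(6) by (simp cong: restrict_cong)
  qed
  ultimately show "hmodule K H ?S" unfolding hmodule_iff using hs by auto
qed

end

definition transport :: "'k ring \<Rightarrow> ('k, 'g, 'a) hgroup \<Rightarrow> ('v \<Rightarrow> 'w) \<Rightarrow> ('k, 'v, 'g, 'a) hmod \<Rightarrow> ('k, 'w, 'g, 'a) hmod" where
  "transport K H g M = (let g' = inv_into (carrier M) g in
     hmk K H \<lparr>carrier = g ` carrier M, monoid.mult = undefined, one = undefined, ring.zero = g \<zero>\<^bsub>M\<^esub>,
       ring.add = (\<lambda>x y. g (g' x \<oplus>\<^bsub>M\<^esub> g' y)), smult = (\<lambda>c x. g (c \<odot>\<^bsub>M\<^esub> g' x))\<rparr>
       (\<lambda>x w. g (hact K H M x (g' w))))"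

context hcat begin

section \<open>Homomorphisms and simple modules\<close>
lemma rat_cong: "rat V \<phi> \<Longrightarrow> (\<And>x. x \<in> ops \<Longrightarrow> \<phi> x = \<psi> x) \<Longrightarrow> rat V \<psi>"
  unfolding hrat_def hops_def by (cases H) (simp_all add: image_iff)

lemma rat_lin:
  assumes "rat V \<phi>" "h \<in> lin K V W" "module K V" "module K W"
  shows "rat W (\<lambda>x. h (\<phi> x))"
proof (cases H)
  case (Algebraic_Group A)
  then obtain n c u where *: "\<forall>i<n::nat. c i \<in> carrier A \<and> u i \<in> carrier V"
     "\<forall>f\<in>lin K A (scalars K). \<phi> (Inr f) = (\<Oplus>\<^bsub>V\<^esub>i\<in>{..<n}. f (c i) \<odot>\<^bsub>V\<^esub> u i)"
    using assms(1) unfolding hrat_def by auto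
  have "h (\<phi> (Inr f)) = (\<Oplus>\<^bsub>W\<^esub>i\<in>{..<n}. f (c i) \<odot>\<^bsub>W\<^esub> h (u i))" if f: "f \<in> lin K A (scalars K)" for f
  proof -
    have "h (\<phi> (Inr f)) = (\<Oplus>\<^bsub>W\<^esub>i\<in>{..<n}. h (f (c i) \<odot>\<^bsub>V\<^esub> u i))"
      using *(2) f by simp (rule lin_vsum[OF assms(2-4)], use * dual_closed[OF f] assms in auto)
    also have "\<dots> = (\<Oplus>\<^bsub>W\<^esub>i\<in>{..<n}. f (c i) \<odot>\<^bsub>W\<^esub> h (u i))"
      by (rule vsum_cong) (use * dual_closed[OF f] assms lin_closed[OF assms(2)] lin_smult[OF assms(2)] in auto)
    finally show ?thesis .
  qed
  then have "\<exists>n c u. (\<forall>i<n::nat. c i \<in> carrier A \<and> u i \<in> carrier W) \<and>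
         (\<forall>f\<in>lin K A (scalars K). h (\<phi> (Inr f)) = (\<Oplus>\<^bsub>W\<^esub>i\<in>{..<n}. f (c i) \<odot>\<^bsub>W\<^esub> u i))"
    using * lin_closed[OF assms(2)] by (intro exI[of _ n] exI[of _ c] exI[of _ "\<lambda>i. h (u i)"]) auto
  then show ?thesis unfolding hrat_def by (simp add: Algebraic_Group)
qed (simp add: hrat_def)

lemma rat_add:
  assumes "rat V \<phi>" "rat V \<psi>" "module K V"
  shows "rat V (\<lambda>x. \<phi> x \<oplus>\<^bsub>V\<^esub> \<psi> x)"
proof (cases H)
  case (Algebraic_Group A)
  obtain n c u where *: "\<forall>i<n::nat. c i \<in> carrier A \<and> u i \<in> carrier V"
     "\<forall>f\<in>lin K A (scalars K). \<phi> (Inr f) = (\<Oplus>\<^bsub>V\<^esub>i\<in>{..<n}. f (c i) \<odot>\<^bsub>V\<^esub> u i)"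
    using assms(1) Algebraic_Group unfolding hrat_def by auto
  obtain m d w where **: "\<forall>i<m::nat. d i \<in> carrier A \<and> w i \<in> carrier V"
     "\<forall>f\<in>lin K A (scalars K). \<psi> (Inr f) = (\<Oplus>\<^bsub>V\<^esub>i\<in>{..<m}. f (d i) \<odot>\<^bsub>V\<^esub> w i)"
    using assms(2) Algebraic_Group unfolding hrat_def by auto
  let ?c = "\<lambda>i. if i < n then c i else d (i - n)" and ?u = "\<lambda>i. if i < n then u i else w (i - n)"
  have "(\<Oplus>\<^bsub>V\<^esub>i\<in>{..<n+m}. f (?c i) \<odot>\<^bsub>V\<^esub> ?u i) = \<phi> (Inr f) \<oplus>\<^bsub>V\<^esub> \<psi> (Inr f)" if f: "f \<in> lin K A (scalars K)" for f
    unfolding bspec[OF *(2) f] bspec[OF **(2) f]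
    by (rule vsum_split[OF assms(3)]) (use * ** dual_closed[OF f] assms in auto)
  then have "\<exists>n c u. (\<forall>i<n::nat. c i \<in> carrier A \<and> u i \<in> carrier V) \<and>
         (\<forall>f\<in>lin K A (scalars K). \<phi> (Inr f) \<oplus>\<^bsub>V\<^esub> \<psi> (Inr f) = (\<Oplus>\<^bsub>V\<^esub>i\<in>{..<n}. f (c i) \<odot>\<^bsub>V\<^esub> u i))"
    using * ** by (intro exI[of _ "n+m"] exI[of _ ?c] exI[of _ ?u]) auto
  then show ?thesis unfolding hrat_def by (simp add: Algebraic_Group)
qed (simp add: hrat_def)

lemma rat_zero: "module K V \<Longrightarrow> rat V (\<lambda>x. \<zero>\<^bsub>V\<^esub>)"
proof (cases H)
  case (Algebraic_Group A)
  assume "module K V"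
  then have "\<exists>n c u. (\<forall>i<n::nat. c i \<in> carrier A \<and> u i \<in> carrier V) \<and>
         (\<forall>f\<in>lin K A (scalars K). \<zero>\<^bsub>V\<^esub> = (\<Oplus>\<^bsub>V\<^esub>i\<in>{..<n}. f (c i) \<odot>\<^bsub>V\<^esub> u i))"
    by (intro exI[of _ 0]) auto
  then show ?thesis unfolding hrat_def by (simp add: Algebraic_Group)
qed (simp add: hrat_def)

lemma homD:
  assumes "f \<in> hmod_hom K H M N" "hmodule K H M" "hmodule K H N"
  shows "f \<in> lin K M N" "\<And>x v. x \<in> ops \<Longrightarrow> v \<in> carrier M \<Longrightarrow> f (act M x v) = act N x (f v)"
  using assms hom_iff by blast+

lemma homI:
  assumes "hmodule K H M" "hmodule K H N" "f \<in> lin K M N"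
    "\<And>x v. x \<in> ops \<Longrightarrow> v \<in> carrier M \<Longrightarrow> f (act M x v) = act N x (f v)"
  shows "f \<in> hmod_hom K H M N"
  using assms hom_iff by blast

lemma hom_comp:
  assumes "f \<in> hmod_hom K H M N" "g \<in> hmod_hom K H N L" "hmodule K H M" "hmodule K H N" "hmodule K H L"
  shows "(\<lambda>v. g (f v)) \<in> hmod_hom K H M L"
  by (rule homI) (use assms homD[OF assms(1,3,4)] homD[OF assms(2,4,5)] lin_comp lin_closed in auto)

lemma bij_lin_inverse:
  assumes "f \<in> lin K M N" "bij_betw f (carrier M) (carrier N)" "module K M" "module K N"
  shows "inv_into (carrier M) f \<in> lin K N M"
proof (rule linI)
  let ?g = "inv_into (carrier M) f"
  have c: "?g w \<in> carrier M" and r: "f (?g w) = w" if "w \<in> carrier N" for w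
    using assms(2) that by (auto simp: bij_betw_def inv_into_into f_inv_into_f)
  have l: "?g (f v) = v" if "v \<in> carrier M" for v using assms(2) that by (simp add: bij_betw_def)
  show "?g w \<in> carrier M" if "w \<in> carrier N" for w using c that .
  show "?g (u \<oplus>\<^bsub>N\<^esub> v) = ?g u \<oplus>\<^bsub>M\<^esub> ?g v" if "u \<in> carrier N" "v \<in> carrier N" for u v
    using l[of "?g u \<oplus>\<^bsub>M\<^esub> ?g v"] lin_add[OF assms(1), of "?g u" "?g v"] that c r assms by simp
  show "?g (k \<odot>\<^bsub>N\<^esub> v) = k \<odot>\<^bsub>M\<^esub> ?g v" if "k \<in> carrier K" "v \<in> carrier N" for k v
    using l[of "k \<odot>\<^bsub>M\<^esub> ?g v"] lin_smult[OF assms(1), of k "?g v"] that c r assms by simp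
qed

lemma hom_inverse:
  assumes f: "f \<in> hmod_hom K H M N" and b: "bij_betw f (carrier M) (carrier N)" and M: "hmodule K H M" and N: "hmodule K H N"
  shows "inv_into (carrier M) f \<in> hmod_hom K H N M" "bij_betw (inv_into (carrier M) f) (carrier N) (carrier M)"
proof -
  note fh = homD[OF f M N] and m = hmodule_facts[OF M] and n = hmodule_facts[OF N]
  show "bij_betw (inv_into (carrier M) f) (carrier N) (carrier M)" using b by (rule bij_betw_inv_into)
  show "inv_into (carrier M) f \<in> hmod_hom K H N M"
  proof (rule homI[OF N M bij_lin_inverse[OF fh(1) b m(1) n(1)]])
    fix x w assume x: "x \<in> ops" and w: "w \<in> carrier N"
    let ?g = "inv_into (carrier M) f"
    have c: "?g w \<in> carrier M" and r: "f (?g w) = w" using b w by (auto simp: bij_betw_def inv_into_into f_inv_into_f)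
    have "?g (f (act M x (?g w))) = act M x (?g w)" using b m(4)[OF x c] by (simp add: bij_betw_def)
    then show "?g (act N x w) = act M x (?g w)" using fh(2)[OF x c] r by simp
  qed
qed

lemma hmod_iso_sym: "hmod_iso K H M N \<Longrightarrow> hmodule K H M \<Longrightarrow> hmodule K H N \<Longrightarrow> hmod_iso K H N M"
  unfolding hmod_iso_def using hom_inverse by blast
lemma hmod_iso_trans: "hmod_iso K H M N \<Longrightarrow> hmod_iso K H N L \<Longrightarrow> hmodule K H M \<Longrightarrow> hmodule K H N \<Longrightarrow> hmodule K H L \<Longrightarrow> hmod_iso K H M L"
proof -
  assume h: "hmod_iso K H M N" "hmod_iso K H N L" "hmodule K H M" "hmodule K H N" "hmodule K H L"
  then obtain f g where *: "f \<in> hmod_hom K H M N" "bij_betw f (carrier M) (carrier N)" "g \<in> hmod_hom K H N L" "bij_betw g (carrier N) (carrier L)"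
    by (auto simp: hmod_iso_def)
  have "bij_betw (\<lambda>v. g (f v)) (carrier M) (carrier L)" using bij_betw_trans[OF *(2,4)] by (simp add: comp_def)
  then show ?thesis using hom_comp[OF *(1,3) h(3-5)] by (auto simp: hmod_iso_def)
qed

lemma lin_inj_iff:
  assumes "f \<in> lin K M N" "module K M" "module K N" "\<And>v. v \<in> carrier M \<Longrightarrow> f v = \<zero>\<^bsub>N\<^esub> \<Longrightarrow> v = \<zero>\<^bsub>M\<^esub>"
  shows "inj_on f (carrier M)"
proof (rule inj_onI)
  fix u v assume uv: "u \<in> carrier M" "v \<in> carrier M" "f u = f v"
  have "f (u \<ominus>\<^bsub>M\<^esub> v) = \<zero>\<^bsub>N\<^esub>" using lin_minus[OF assms(1-3) uv(1,2)] uv lin_closed[OF assms(1)] assms by simp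
  then have "u \<ominus>\<^bsub>M\<^esub> v = \<zero>\<^bsub>M\<^esub>" by (intro assms(4)) (use uv assms(2) in simp)
  then show "u = v" using uv assms(2) by simp
qed

lemma kernel_submodule:
  assumes f: "f \<in> hmod_hom K H M N" and M: "hmodule K H M" and N: "hmodule K H N"
  shows "hsubmodule K H {v \<in> carrier M. f v = \<zero>\<^bsub>N\<^esub>} M"
proof -
  note fh = homD[OF f M N] and m = hmodule_facts[OF M] and n = hmodule_facts[OF N]
  have "act N x \<zero>\<^bsub>N\<^esub> = \<zero>\<^bsub>N\<^esub>" if "x \<in> ops" for x using lin_zero[OF n(3)[OF that]] n by simp
  then show ?thesis
    using m n fh lin_add[OF fh(1)] lin_smult[OF fh(1)] lin_zero[OF fh(1)] unfolding sub_iff[OF M] submodule_iff[OF m(1)] by auto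
qed

lemma image_submodule:
  assumes f: "f \<in> hmod_hom K H M N" and M: "hmodule K H M" and N: "hmodule K H N" and L: "hsubmodule K H L M"
  shows "hsubmodule K H (f ` L) N"
proof -
  note fh = homD[OF f M N] and m = hmodule_facts[OF M] and n = hmodule_facts[OF N]
  have s: "L \<subseteq> carrier M" "\<zero>\<^bsub>M\<^esub> \<in> L" "\<forall>x\<in>L. \<forall>y\<in>L. x \<oplus>\<^bsub>M\<^esub> y \<in> L"
    "\<forall>c\<in>carrier K. \<forall>x\<in>L. c \<odot>\<^bsub>M\<^esub> x \<in> L" "\<forall>x\<in>ops. \<forall>v\<in>L. act M x v \<in> L"
    using L unfolding sub_iff[OF M] submodule_iff[OF m(1)] by auto
  show ?thesis unfolding sub_iff[OF N] submodule_iff[OF n(1)]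
  proof (intro conjI ballI)
    show "f ` L \<subseteq> carrier N" using s lin_closed[OF fh(1)] by auto
    have "f \<zero>\<^bsub>M\<^esub> = \<zero>\<^bsub>N\<^esub>" using lin_zero[OF fh(1)] m n by simp
    then show "\<zero>\<^bsub>N\<^esub> \<in> f ` L" using s(2) by (metis imageI)
  next
    fix x y assume "x \<in> f ` L" "y \<in> f ` L"
    then obtain u v where uv: "x = f u" "y = f v" "u \<in> L" "v \<in> L" by blast
    then have "x \<oplus>\<^bsub>N\<^esub> y = f (u \<oplus>\<^bsub>M\<^esub> v)" using lin_add[OF fh(1)] s(1) by (simp add: subset_iff)
    then show "x \<oplus>\<^bsub>N\<^esub> y \<in> f ` L" using uv s(3) by simp
  next
    fix c x assume c: "c \<in> carrier K" and "x \<in> f ` L"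
    then obtain u where uv: "x = f u" "u \<in> L" by blast
    then have "c \<odot>\<^bsub>N\<^esub> x = f (c \<odot>\<^bsub>M\<^esub> u)" using lin_smult[OF fh(1)] s(1) c by (simp add: subset_iff)
    then show "c \<odot>\<^bsub>N\<^esub> x \<in> f ` L" using uv s(4) c by simp
  next
    fix x w assume x: "x \<in> ops" and "w \<in> f ` L"
    then obtain u where uv: "w = f u" "u \<in> L" by blast
    then have "act N x w = f (act M x u)" using fh(2)[OF x] s(1) by (simp add: subset_iff)
    then show "act N x w \<in> f ` L" using uv s(5) x by simp
  qed
qed

lemma carrier_hsubmodule: "hmodule K H M \<Longrightarrow> hsubmodule K H (carrier M) M"
  using hmodule_facts[of M] unfolding sub_iff by (auto simp: submodule_iff)

lemma simple_hmodule: "simple K H S \<Longrightarrow> hmodule K H S" by (simp add: simple_def)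

lemma schur:
  assumes S: "simple K H S" and T: "simple K H T" and f: "f \<in> hmod_hom K H S T" and nz: "\<exists>s\<in>carrier S. f s \<noteq> \<zero>\<^bsub>T\<^esub>"
  shows "bij_betw f (carrier S) (carrier T)"
proof -
  note hS = simple_hmodule[OF S] and hT = simple_hmodule[OF T]
  note fh = homD[OF f hS hT] and m = hmodule_facts[OF hS] and n = hmodule_facts[OF hT]
  have "{v \<in> carrier S. f v = \<zero>\<^bsub>T\<^esub>} = {\<zero>\<^bsub>S\<^esub>} \<or> {v \<in> carrier S. f v = \<zero>\<^bsub>T\<^esub>} = carrier S"
    using S kernel_submodule[OF f hS hT] by (simp add: simple_def)
  then have "{v \<in> carrier S. f v = \<zero>\<^bsub>T\<^esub>} = {\<zero>\<^bsub>S\<^esub>}" using nz by blast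
  then have 1: "inj_on f (carrier S)" by (intro lin_inj_iff[OF fh(1) m(1) n(1)]) blast
  have "f ` carrier S = {\<zero>\<^bsub>T\<^esub>} \<or> f ` carrier S = carrier T"
    using T image_submodule[OF f hS hT carrier_hsubmodule[OF hS]] by (simp add: simple_def)
  then have "f ` carrier S = carrier T" using nz by blast
  then show ?thesis using 1 by (simp add: bij_betw_def)
qed

lemma simple_hom_zero:
  assumes S: "simple K H S" and T: "simple K H T" and n: "\<not> hmod_iso K H S T"
  shows "f \<in> hmod_hom K H S T \<Longrightarrow> s \<in> carrier S \<Longrightarrow> f s = \<zero>\<^bsub>T\<^esub>"
    "f' \<in> hmod_hom K H T S \<Longrightarrow> t \<in> carrier T \<Longrightarrow> f' t = \<zero>\<^bsub>S\<^esub>"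
proof -
  assume "f \<in> hmod_hom K H S T" "s \<in> carrier S" then show "f s = \<zero>\<^bsub>T\<^esub>"
    using schur[OF S T] n by (auto simp: hmod_iso_def)
next
  assume "f' \<in> hmod_hom K H T S" "t \<in> carrier T" then show "f' t = \<zero>\<^bsub>S\<^esub>"
    using schur[OF T S, of f'] n hmod_iso_sym[of T S] simple_hmodule[OF S] simple_hmodule[OF T] by (auto simp: hmod_iso_def)
qed

lemma simple_iso:
  assumes S: "simple K H S" and T: "hmodule K H T" and f: "f \<in> hmod_hom K H S T" and b: "bij_betw f (carrier S) (carrier T)"
  shows "simple K H T"
proof -
  note hS = simple_hmodule[OF S]
  note fh = homD[OF f hS T] and m = hmodule_facts[OF hS] and n = hmodule_facts[OF T]
  let ?g = "inv_into (carrier S) f"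
  note g = hom_inverse[OF f b hS T]
  have z: "f \<zero>\<^bsub>S\<^esub> = \<zero>\<^bsub>T\<^esub>" using lin_zero[OF fh(1)] m n by simp
  have inj: "inj_on f (carrier S)" and im: "f ` carrier S = carrier T" using b by (auto simp: bij_betw_def)
  have "carrier T \<noteq> {\<zero>\<^bsub>T\<^esub>}"
  proof
    assume e: "carrier T = {\<zero>\<^bsub>T\<^esub>}"
    have "v = \<zero>\<^bsub>S\<^esub>" if "v \<in> carrier S" for v
      using inj_onD[OF inj, of v "\<zero>\<^bsub>S\<^esub>"] that im e z m by auto
    then show False using S m by (auto simp: simple_def)
  qed
  moreover have "N = {\<zero>\<^bsub>T\<^esub>} \<or> N = carrier T" if N: "hsubmodule K H N T" for N
  proof -
    have NT: "N \<subseteq> carrier T" using N unfolding sub_iff[OF T] submodule_iff[OF n(1)] by auto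
    have "hsubmodule K H (?g ` N) S" by (rule image_submodule[OF g(1) T hS N])
    then have "?g ` N = {\<zero>\<^bsub>S\<^esub>} \<or> ?g ` N = carrier S" using S by (simp add: simple_def)
    moreover have "f ` ?g ` N = N" using NT im by (force simp: image_image f_inv_into_f subset_iff)
    ultimately show ?thesis using z im by (metis image_empty image_insert)
  qed
  ultimately show ?thesis using T by (simp add: simple_def)
qed

text \<open>
  Homomorphisms are compared on the carrier only, which avoids the normalisation in \<open>End_alg\<close>.
\<close>
definition scalar_end :: "('k, 'v, 'g, 'a) hmod \<Rightarrow> bool" where
  "scalar_end M \<longleftrightarrow> (\<forall>f\<in>hmod_hom K H M M. \<exists>c\<in>carrier K. \<forall>v\<in>carrier M. f v = c \<odot>\<^bsub>M\<^esub> v)"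

lemma scalar_hom: "hmodule K H M \<Longrightarrow> c \<in> carrier K \<Longrightarrow> (\<lambda>v. c \<odot>\<^bsub>M\<^esub> v) \<in> hmod_hom K H M M"
proof (rule homI)
  assume M: "hmodule K H M" and c: "c \<in> carrier K"
  note m = hmodule_facts[OF M]
  show "(\<lambda>v. c \<odot>\<^bsub>M\<^esub> v) \<in> lin K M M" by (rule lin_scale[OF m(1) lin_id(2) c])
  show "c \<odot>\<^bsub>M\<^esub> act M x v = act M x (c \<odot>\<^bsub>M\<^esub> v)" if "x \<in> ops" "v \<in> carrier M" for x v
    using lin_smult[OF m(3)] that c by simp
qed

lemma hom_cong:
  assumes M: "hmodule K H M" and N: "hmodule K H N" and f: "f \<in> hmod_hom K H M N"
    and e: "\<And>v. v \<in> carrier M \<Longrightarrow> f v = g v"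
  shows "g \<in> hmod_hom K H M N"
proof (rule homI[OF M N])
  note fh = homD[OF f M N] and m = hmodule_facts[OF M]
  show "g \<in> lin K M N" by (rule lin_cong[OF fh(1) m(1) e])
  show "g (act M x v) = act N x (g v)" if "x \<in> ops" "v \<in> carrier M" for x v
    using fh(2)[OF that] e[OF that(2)] e[OF m(4)[OF that]] by simp
qed

text \<open>
  An isomorphism \<open>h\<close> of algebras sends \<open>f\<close> and \<open>h(f) \<cdot> 1\<close> to the same scalar.
\<close>
lemma scalar_end_of_End_iso_field:
  assumes M: "hmodule K H M" and "End_iso_field K H M"
  shows "scalar_end M"
  unfolding scalar_end_def
proof
  fix f assume f: "f \<in> hmod_hom K H M M"
  note m = hmodule_facts[OF M]
  let ?E = "End_alg K H M"
  obtain h where h: "h \<in> ring_iso ?E K" "\<forall>c\<in>carrier K. \<forall>f\<in>carrier ?E. h (c \<odot>\<^bsub>?E\<^esub> f) = c \<otimes> h f"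
    using assms(2) by (auto simp: End_iso_field_def)
  have mem: "restrict g (carrier M) \<in> carrier ?E" if "g \<in> hmod_hom K H M M" for g
    using hom_cong[OF M M that] by (simp add: End_alg_def)
  let ?f = "restrict f (carrier M)"
  have fE: "?f \<in> carrier ?E" by (rule mem[OF f])
  have oneE: "\<one>\<^bsub>?E\<^esub> \<in> carrier ?E"
    using mem[OF scalar_hom[OF M one_closed]] m by (simp add: End_alg_def cong: restrict_cong)
  define c where "c = h ?f"
  have c: "c \<in> carrier K" using h(1) fE by (auto simp: c_def ring_iso_def ring_hom_def)
  have cE: "c \<odot>\<^bsub>?E\<^esub> \<one>\<^bsub>?E\<^esub> \<in> carrier ?E"
    using mem[OF scalar_hom[OF M c]] by (simp add: End_alg_def cong: restrict_cong)
  have "h (c \<odot>\<^bsub>?E\<^esub> \<one>\<^bsub>?E\<^esub>) = c \<otimes> h \<one>\<^bsub>?E\<^esub>" using h(2) c oneE by simp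
  also have "h \<one>\<^bsub>?E\<^esub> = \<one>" using h(1) by (simp add: ring_iso_def ring_hom_def)
  finally have "h (c \<odot>\<^bsub>?E\<^esub> \<one>\<^bsub>?E\<^esub>) = h ?f" using c by (simp add: c_def)
  moreover have "inj_on h (carrier ?E)" using h(1) by (simp add: ring_iso_def bij_betw_def)
  ultimately have "c \<odot>\<^bsub>?E\<^esub> \<one>\<^bsub>?E\<^esub> = ?f" using cE fE by (auto dest: inj_onD)
  then have e: "(\<lambda>v\<in>carrier M. c \<odot>\<^bsub>M\<^esub> v) = ?f" by (simp add: End_alg_def cong: restrict_cong)
  have "f v = c \<odot>\<^bsub>M\<^esub> v" if "v \<in> carrier M" for v using fun_cong[OF e, of v] that by simp
  then show "\<exists>c\<in>carrier K. \<forall>v\<in>carrier M. f v = c \<odot>\<^bsub>M\<^esub> v" using c by blast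
qed

lemma End_scalar_of_scalar_end:
  assumes M: "hmodule K H M" and "scalar_end M"
  shows "End_scalar K H M"
proof -
  have s: "(\<lambda>v\<in>carrier M. c \<odot>\<^bsub>M\<^esub> (if v \<in> carrier M then v else undefined)) = (\<lambda>v\<in>carrier M. c \<odot>\<^bsub>M\<^esub> v)" for c
    by (rule restrict_ext) simp
  have 1: "f \<in> {(\<lambda>v\<in>carrier M. c \<odot>\<^bsub>M\<^esub> v) | c. c \<in> carrier K}"
    if f: "f \<in> hmod_hom K H M M" "f \<in> extensional (carrier M)" for f
  proof -
    obtain c where c: "c \<in> carrier K" "\<forall>v\<in>carrier M. f v = c \<odot>\<^bsub>M\<^esub> v" using assms(2) f by (auto simp: scalar_end_def)
    have "f = (\<lambda>v\<in>carrier M. c \<odot>\<^bsub>M\<^esub> v)" by (rule extensionalityI[OF f(2)]) (use c in auto)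
    then show ?thesis using c by blast
  qed
  have 2: "(\<lambda>v\<in>carrier M. c \<odot>\<^bsub>M\<^esub> v) \<in> hmod_hom K H M M" if "c \<in> carrier K" for c
    by (rule hom_cong[OF M M scalar_hom[OF M that]]) simp
  have E: "carrier (End_alg K H M) = hmod_hom K H M M \<inter> extensional (carrier M)"
    "c \<odot>\<^bsub>End_alg K H M\<^esub> \<one>\<^bsub>End_alg K H M\<^esub> = (\<lambda>v\<in>carrier M. c \<odot>\<^bsub>M\<^esub> v)" for c
    by (auto simp: End_alg_def s)
  show ?thesis unfolding End_scalar_def E using 1 2 by auto
qed

lemma scalar_end_iso:
  assumes M: "hmodule K H M" and N: "hmodule K H N" and f: "f \<in> hmod_hom K H M N" "bij_betw f (carrier M) (carrier N)" and e: "scalar_end M"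
  shows "scalar_end N"
  unfolding scalar_end_def
proof
  fix h assume h: "h \<in> hmod_hom K H N N"
  let ?g = "inv_into (carrier M) f"
  note g = hom_inverse[OF f M N]
  have "(\<lambda>v. ?g (h (f v))) \<in> hmod_hom K H M M"
    by (rule hom_comp[OF hom_comp[OF f(1) h] g(1)]) (use M N in auto)
  then obtain c where c: "c \<in> carrier K" "\<forall>v\<in>carrier M. ?g (h (f v)) = c \<odot>\<^bsub>M\<^esub> v" using e by (auto simp: scalar_end_def)
  have "h w = c \<odot>\<^bsub>N\<^esub> w" if w: "w \<in> carrier N" for w
  proof -
    have gw: "?g w \<in> carrier M" "f (?g w) = w" using f(2) w by (auto simp: bij_betw_def inv_into_into f_inv_into_f)
    have hw: "h w \<in> carrier N" using lin_closed[OF homD(1)[OF h N N] w] .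
    have "?g (h w) = c \<odot>\<^bsub>M\<^esub> ?g w" using c gw by metis
    then have "f (?g (h w)) = c \<odot>\<^bsub>N\<^esub> w" using lin_smult[OF homD(1)[OF f(1) M N] c(1) gw(1)] gw by simp
    moreover have "f (?g (h w)) = h w" using hw f(2) by (simp add: bij_betw_def f_inv_into_f)
    ultimately show ?thesis by simp
  qed
  then show "\<exists>c\<in>carrier K. \<forall>v\<in>carrier N. h v = c \<odot>\<^bsub>N\<^esub> v" using c by blast
qed

text \<open>
  Transport of structure along an injective map, used to move simple modules to another type.
\<close>
lemma transport:
  fixes M :: "('k, 'v, 'g, 'a) hmod" and g :: "'v \<Rightarrow> 'w"
  assumes M: "hmodule K H M" and inj: "inj_on g (carrier M)"
  shows "hmodule K H (transport K H g M)" "g \<in> hmod_hom K H M (transport K H g M)" "bij_betw g (carrier M) (carrier (transport K H g M))"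
    "carrier (transport K H g M) = g ` carrier M"
proof -
  note m = hmodule_facts[OF M]
  let ?g = "inv_into (carrier M) g"
  define V :: "('k, 'w) module" where "V = \<lparr>carrier = g ` carrier M, monoid.mult = undefined, one = undefined, ring.zero = g \<zero>\<^bsub>M\<^esub>,
       ring.add = (\<lambda>x y. g (?g x \<oplus>\<^bsub>M\<^esub> ?g y)), smult = (\<lambda>c x. g (c \<odot>\<^bsub>M\<^esub> ?g x))\<rparr>"
  define \<rho> where "\<rho> = (\<lambda>x w. g (act M x (?g w)))"
  have e: "transport K H g M = mk V \<rho>" by (simp add: transport_def Let_def V_def \<rho>_def)
  have V: "carrier V = g ` carrier M" by (simp add: V_def)
  have l: "?g (g v) = v" if "v \<in> carrier M" for v using inj that by simp
  have *: "g ` carrier M = carrier V" "\<And>u v. u \<in> carrier M \<Longrightarrow> v \<in> carrier M \<Longrightarrow> g u \<oplus>\<^bsub>V\<^esub> g v = g (u \<oplus>\<^bsub>M\<^esub> v)"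
    "\<And>c v. c \<in> carrier K \<Longrightarrow> v \<in> carrier M \<Longrightarrow> c \<odot>\<^bsub>V\<^esub> g v = g (c \<odot>\<^bsub>M\<^esub> v)" "\<zero>\<^bsub>V\<^esub> = g \<zero>\<^bsub>M\<^esub>"
    by (simp_all add: V_def l)
  note mV = module_image[OF m(1) *]
  have r: "\<rho> x (g v) = g (act M x v)" if "v \<in> carrier M" for x v using that by (simp add: \<rho>_def l)
  have Ve: "\<exists>v\<in>carrier M. w = g v" if "w \<in> carrier V" for w using that V by auto
  have "rep V \<rho>" unfolding hrep_def
  proof (intro conjI ballI)
    show "module K V" by (rule mV)
    fix x assume x: "x \<in> ops"
    have b: "bij_betw g (carrier M) (carrier V)" using inj V by (simp add: bij_betw_def)
    show "\<rho> x \<in> lin K V V" unfolding \<rho>_def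
      by (rule lin_comp[OF lin_comp[OF bij_lin_inverse[OF mV(2) b m(1) mV(1)] m(3)[OF x]] mV(2)])
    fix y w assume y: "y \<in> ops" and "w \<in> carrier V"
    then obtain v where "v \<in> carrier M" "w = g v" using Ve by blast
    then show "\<rho> (opmul x y) w = \<rho> x (\<rho> y w)" using x y by (simp add: r m)
  next
    fix w assume "w \<in> carrier V"
    then obtain v where v: "v \<in> carrier M" "w = g v" using Ve by blast
    show "\<rho> opone w = w" using v by (simp add: r m)
    show "rat V (\<lambda>x. \<rho> x w)" using rat_lin[OF rat_act[OF m(2) v(1)] mV(2) m(1) mV(1)] v by (simp add: r)
  qed
  note k = mk_hmodule[OF this]
  show hm: "hmodule K H (transport K H g M)" unfolding e by (rule k)
  show c: "carrier (transport K H g M) = g ` carrier M" by (simp add: e V)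
  show "bij_betw g (carrier M) (carrier (transport K H g M))" using inj c by (simp add: bij_betw_def)
  show "g \<in> hmod_hom K H M (transport K H g M)"
    by (rule homI[OF M hm]) (use mV(2) k(2) V r in \<open>auto simp: e\<close>)
qed

lemma vsum_submodule:
  assumes "module K V" "submodule N K V" "\<And>i. i < n \<Longrightarrow> f i \<in> N"
  shows "(\<Oplus>\<^bsub>V\<^esub>i\<in>{..<n::nat}. f i) \<in> N"
  using assms(3)
proof (induction n)
  case (Suc n)
  have "\<And>i. i < Suc n \<Longrightarrow> f i \<in> carrier V" using Suc.prems assms(2) by (auto simp: submodule_iff[OF assms(1)])
  then show ?case using Suc assms(2) by (simp add: vsum_Suc[OF assms(1)]) (auto simp: submodule_iff[OF assms(1)])
qed (use assms in \<open>auto simp: submodule_iff\<close>)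

lemma simple_generated:
  assumes S: "simple K H S" and N: "hsubmodule K H N S" and v: "v \<in> N" "v \<noteq> \<zero>\<^bsub>S\<^esub>"
  shows "N = carrier S"
  using assms by (auto simp: simple_def)

text \<open>
  A simple module is generated by any \<open>v \<noteq> 0\<close>. The images of \<open>v\<close> under the operators span a
  finite-dimensional space: there are finitely many of them for a finite group, and for an algebraic group
  they are \<open>\<Sum>f(c\<^sub>i) u\<^sub>i\<close> with finitely many fixed vectors \<open>u\<^sub>i\<close>.
\<close>
lemma simple_coords:
  fixes S :: "('k, 'v, 'g, 'a) hmod"
  assumes S: "simple K H S"
  shows "\<exists>n (u :: nat \<Rightarrow> 'v). (\<forall>i<n. u i \<in> carrier S) \<and>
    (\<forall>w\<in>carrier S. \<exists>c. (\<forall>i<n. c i \<in> carrier K) \<and> w = (\<Oplus>\<^bsub>S\<^esub>i\<in>{..<n}. c i \<odot>\<^bsub>S\<^esub> u i))"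
proof -
  note hS = simple_hmodule[OF S]
  note m = hmodule_facts[OF hS]
  note [simp] = m(1)
  have "\<exists>v\<in>carrier S. v \<noteq> \<zero>\<^bsub>S\<^esub>"
  proof (rule ccontr)
    assume "\<not> ?thesis"
    then have "carrier S = {\<zero>\<^bsub>S\<^esub>}" using vzero_closed[OF m(1)] by blast
    then show False using S by (simp add: simple_def)
  qed
  then obtain v where v: "v \<in> carrier S" "v \<noteq> \<zero>\<^bsub>S\<^esub>" by blast
  show ?thesis
  proof (cases H)
    case (Finite_Group G)
    then have G: "group G" "finite (carrier G)" using is_hgroup by (auto simp: is_hgroup_def)
    have opsF: "ops = Inl ` carrier G" "opone = Inl \<one>\<^bsub>G\<^esub>" "opmul (Inl g) (Inl h) = Inl (g \<otimes>\<^bsub>G\<^esub> h)" for g h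
      by (auto simp: hops_def hopone_def hopmul_def Finite_Group)
    obtain e where e: "bij_betw e {..<card (carrier G)} (carrier G)"
      using ex_bij_betw_nat_finite[OF G(2)] by (auto simp: atLeast0LessThan)
    let ?n = "card (carrier G)"
    define u where "u i = act S (Inl (e i)) v" for i
    have eG: "e i \<in> carrier G" if "i < ?n" for i using e that by (auto simp: bij_betw_def)
    have u: "u i \<in> carrier S" if "i < ?n" for i unfolding u_def by (rule m(4)) (use v eG that opsF in auto)
    define N where "N = {\<Oplus>\<^bsub>S\<^esub>i\<in>{..<?n}. c i \<odot>\<^bsub>S\<^esub> u i | c. \<forall>i<?n. c i \<in> carrier K}"
    have sN: "submodule N K S" unfolding N_def by (rule span_submodule(1)[OF m(1)]) (rule u)
    have uN: "u j \<in> N" if "j < ?n" for j unfolding N_def by (rule span_submodule(2)[OF m(1) _ that]) (rule u)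
    have gN: "act S (Inl g) v \<in> N" if "g \<in> carrier G" for g
    proof -
      have "g \<in> e ` {..<?n}" using e that by (simp add: bij_betw_def)
      then obtain j where j: "j < ?n" "g = e j" by blast
      show ?thesis using uN[OF j(1)] j(2) by (simp add: u_def)
    qed
    have "act S x w \<in> N" if x: "x \<in> ops" and w: "w \<in> N" for x w
    proof -
      obtain g where g: "x = Inl g" "g \<in> carrier G" using x opsF by auto
      obtain c where c: "\<forall>i<?n. c i \<in> carrier K" "w = (\<Oplus>\<^bsub>S\<^esub>i\<in>{..<?n}. c i \<odot>\<^bsub>S\<^esub> u i)" using w by (auto simp: N_def)
      have "act S x w = (\<Oplus>\<^bsub>S\<^esub>i\<in>{..<?n}. act S x (c i \<odot>\<^bsub>S\<^esub> u i))"
        unfolding c by (rule lin_vsum[OF m(3)[OF x]]) (use c u in auto)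
      also have "\<dots> \<in> N"
      proof (rule vsum_submodule[OF m(1) sN])
        fix i assume i: "i < ?n"
        have "Inl (e i) \<in> ops" using eG[OF i] opsF by auto
        then have "act S x (u i) = act S (Inl (g \<otimes>\<^bsub>G\<^esub> e i)) v"
          unfolding u_def using m(6)[OF x _ v(1), of "Inl (e i)"] opsF(3) g(1) by simp
        also have "\<dots> \<in> N" by (rule gN) (use G(1) g eG[OF i] in \<open>auto intro: group.is_monoid monoid.m_closed\<close>)
        finally have "c i \<odot>\<^bsub>S\<^esub> act S x (u i) \<in> N" using sN c i by (auto simp: submodule_iff)
        then show "act S x (c i \<odot>\<^bsub>S\<^esub> u i) \<in> N" using lin_smult[OF m(3)[OF x]] c i u by simp
      qed
      finally show ?thesis .
    qed
    then have "hsubmodule K H N S" using sub_iff[OF hS] sN by blast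
    moreover have "v \<in> N" using gN[of "\<one>\<^bsub>G\<^esub>"] m(5)[OF v(1)] opsF G(1) group.is_monoid monoid.one_closed by force
    ultimately have NS: "N = carrier S" using simple_generated[OF S] v by blast
    have "\<exists>c. (\<forall>i<?n. c i \<in> carrier K) \<and> w = (\<Oplus>\<^bsub>S\<^esub>i\<in>{..<?n}. c i \<odot>\<^bsub>S\<^esub> u i)" if "w \<in> carrier S" for w
    proof -
      have "w \<in> N" using that NS by simp
      then show ?thesis unfolding N_def by blast
    qed
    then show ?thesis using u by (intro exI[of _ ?n] exI[of _ u]) blast
  next
    case (Algebraic_Group A)
    note a = alg[OF Algebraic_Group] and alg_ops = alg_unfold[OF Algebraic_Group]
    have "rat S (\<lambda>x. act S x v)" by (rule rat_act[OF m(2) v(1)])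
    then obtain n c u where *: "\<forall>i<n::nat. c i \<in> carrier A \<and> u i \<in> carrier S"
        "\<forall>f\<in>lin K A (scalars K). act S (Inr f) v = (\<Oplus>\<^bsub>S\<^esub>i\<in>{..<n}. f (c i) \<odot>\<^bsub>S\<^esub> u i)"
      unfolding hrat_def using Algebraic_Group by auto
    define N where "N = {act S x v | x. x \<in> ops}"
    have "submodule N K S" unfolding submodule_iff[OF m(1)]
    proof (intro conjI ballI)
      show "N \<subseteq> carrier S" using m(4) v by (auto simp: N_def)
      have z: "(\<lambda>_. \<zero>) \<in> lin K A (scalars K)" using lin_const_zero[of "scalars K" A] by simp
      have "act S (Inr (\<lambda>_. \<zero>)) v = \<zero>\<^bsub>S\<^esub>" unfolding bspec[OF *(2) z] by (rule vsum_zero) (use * in auto)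
      then show "\<zero>\<^bsub>S\<^esub> \<in> N" using z unfolding N_def alg_ops(3) by force
    next
      fix x y assume "x \<in> N" "y \<in> N"
      then obtain f g where fg: "f \<in> lin K A (scalars K)" "g \<in> lin K A (scalars K)" "x = act S (Inr f) v" "y = act S (Inr g) v"
        unfolding N_def alg_ops(3) by auto
      have s: "(\<lambda>a. f a \<oplus> g a) \<in> lin K A (scalars K)" using lin_plus[OF scalars_module fg(1,2)] by simp
      have "x \<oplus>\<^bsub>S\<^esub> y = (\<Oplus>\<^bsub>S\<^esub>i\<in>{..<n}. f (c i) \<odot>\<^bsub>S\<^esub> u i \<oplus>\<^bsub>S\<^esub> g (c i) \<odot>\<^bsub>S\<^esub> u i)"
        unfolding fg(3,4) bspec[OF *(2) fg(1)] bspec[OF *(2) fg(2)]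
        by (rule vsum_add[symmetric]) (use * dual_closed[OF fg(1)] dual_closed[OF fg(2)] in auto)
      also have "\<dots> = (\<Oplus>\<^bsub>S\<^esub>i\<in>{..<n}. (f (c i) \<oplus> g (c i)) \<odot>\<^bsub>S\<^esub> u i)"
        by (rule vsum_cong) (use * dual_closed[OF fg(1)] dual_closed[OF fg(2)] in \<open>auto simp: add_smult\<close>)
      also have "\<dots> = act S (Inr (\<lambda>a. f a \<oplus> g a)) v" using *(2) s by simp
      finally show "x \<oplus>\<^bsub>S\<^esub> y \<in> N" using s unfolding N_def alg_ops(3) by blast
    next
      fix k x assume k: "k \<in> carrier K" and "x \<in> N"
      then obtain f where fg: "f \<in> lin K A (scalars K)" "x = act S (Inr f) v"
        unfolding N_def alg_ops(3) by auto
      have s: "(\<lambda>a. k \<otimes> f a) \<in> lin K A (scalars K)" using lin_scale[OF scalars_module fg(1) k] by simp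
      have "k \<odot>\<^bsub>S\<^esub> x = (\<Oplus>\<^bsub>S\<^esub>i\<in>{..<n}. k \<odot>\<^bsub>S\<^esub> (f (c i) \<odot>\<^bsub>S\<^esub> u i))"
        unfolding fg(2) bspec[OF *(2) fg(1)]
        by (rule smult_vsum) (use * k dual_closed[OF fg(1)] in auto)
      also have "\<dots> = (\<Oplus>\<^bsub>S\<^esub>i\<in>{..<n}. (k \<otimes> f (c i)) \<odot>\<^bsub>S\<^esub> u i)"
        by (rule vsum_cong) (use * k dual_closed[OF fg(1)] in \<open>auto simp: smult_smult\<close>)
      also have "\<dots> = act S (Inr (\<lambda>a. k \<otimes> f a)) v" using *(2) s by simp
      finally show "k \<odot>\<^bsub>S\<^esub> x \<in> N" using s unfolding N_def alg_ops(3) by blast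
    qed
    moreover have "act S x w \<in> N" if x: "x \<in> ops" and w: "w \<in> N" for x w
    proof -
      obtain y where "y \<in> ops" "w = act S y v" using w by (auto simp: N_def)
      then have "act S x w = act S (opmul x y) v" "opmul x y \<in> ops" using m(6) x v by auto
      then show ?thesis unfolding N_def by blast
    qed
    ultimately have "hsubmodule K H N S" using sub_iff[OF hS] by blast
    moreover have "v \<in> N" using m(5)[OF v(1)] opone_closed unfolding N_def by (metis (mono_tags, lifting) mem_Collect_eq)
    ultimately have N: "N = carrier S" using simple_generated[OF S] v by blast
    have "\<exists>d. (\<forall>i<n. d i \<in> carrier K) \<and> w = (\<Oplus>\<^bsub>S\<^esub>i\<in>{..<n}. d i \<odot>\<^bsub>S\<^esub> u i)" if "w \<in> carrier S" for w
    proof -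
      have "w \<in> N" using that N by simp
      then obtain f where f: "f \<in> lin K A (scalars K)" "w = act S (Inr f) v" unfolding N_def alg_ops(3) by auto
      then show ?thesis using * dual_closed[OF f(1)] by (intro exI[of _ "\<lambda>i. f (c i)"]) auto
    qed
    then show ?thesis using * by (intro exI[of _ n] exI[of _ u]) auto
  qed
qed

lemma simple_inj:
  assumes S: "simple K H S"
  shows "\<exists>g :: 'v \<Rightarrow> nat \<Rightarrow> 'k. inj_on g (carrier (S :: ('k, 'v, 'g, 'a) hmod))"
proof -
  obtain n u where *: "\<forall>i<n. u i \<in> carrier S"
    "\<forall>w\<in>carrier S. \<exists>c. (\<forall>i<n. c i \<in> carrier K) \<and> w = (\<Oplus>\<^bsub>S\<^esub>i\<in>{..<n::nat}. c i \<odot>\<^bsub>S\<^esub> u i)"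
    using simple_coords[OF S] by blast
  define g where "g w = (SOME c. (\<forall>i<n. c i \<in> carrier K) \<and> w = (\<Oplus>\<^bsub>S\<^esub>i\<in>{..<n}. c i \<odot>\<^bsub>S\<^esub> u i))" for w
  have e: "w = (\<Oplus>\<^bsub>S\<^esub>i\<in>{..<n}. g w i \<odot>\<^bsub>S\<^esub> u i)" if "w \<in> carrier S" for w
    using someI_ex[OF bspec[OF *(2) that], folded g_def] by simp
  have "inj_on g (carrier S)"
  proof (rule inj_onI)
    fix v w assume h: "v \<in> carrier S" "w \<in> carrier S" "g v = g w"
    show "v = w" using e[OF h(1)] e[OF h(2)] unfolding h(3) by (rule trans[OF _ sym])
  qed
  then show ?thesis by blast
qed

text \<open>
  The isomorphism theorem in the form that avoids any work with cosets later. The coset maps \<open>k\<close> and the map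
  \<open>k v \<mapsto> p v\<close> are handled entirely through \<open>k v = {w. p w = p v}\<close>.
\<close>
lemma quot_iso:
  fixes M :: "('k, 'v, 'g, 'a) hmod"
  assumes M: "hmodule K H M" and Y: "hmodule K H Y" and p: "p \<in> hmod_hom K H M Y" and sur: "p ` carrier M = carrier Y"
    and N: "N = {v \<in> carrier M. p v = \<zero>\<^bsub>Y\<^esub>}"
  shows "hmod_iso K H (quot_hmod K H M N) Y"
proof -
  note m = hmodule_facts[OF M] and y = hmodule_facts[OF Y] and ph = homD[OF p M Y]
  note [simp] = m(1) y(1)
  let ?Q = "quot_hmod K H M N"
  define Q0 :: "('k, 'v set, 'g, 'a) hmod" where "Q0 =
      \<lparr>carrier = a_rcosets\<^bsub>M\<^esub> N, monoid.mult = undefined, one = undefined,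
       ring.zero = N, ring.add = set_add M,
       smult = (\<lambda>c C. \<Union>x\<in>C. N +>\<^bsub>M\<^esub> (c \<odot>\<^bsub>M\<^esub> x)),
       action = (\<lambda>g C. \<Union>x\<in>C. N +>\<^bsub>M\<^esub> (action M g x)),
       coaction = undefined\<rparr>"
  have Q: "?Q = Q0\<lparr>coaction := (case H of
        Finite_Group G \<Rightarrow> undefined
      | Algebraic_Group A \<Rightarrow>
          (\<lambda>C. tensor_map K M A Q0 A (\<lambda>x. N +>\<^bsub>M\<^esub> x) id (coaction M (SOME x. x \<in> C))))\<rparr>"
    unfolding quot_hmod_def Let_def Q0_def ..
  have sQ: "same_space ?Q Q0" unfolding Q by simp
  define k where "k v = N +>\<^bsub>M\<^esub> v" for v
  have pm: "p (u \<ominus>\<^bsub>M\<^esub> v) = p u \<ominus>\<^bsub>Y\<^esub> p v" if "u \<in> carrier M" "v \<in> carrier M" for u v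
    using lin_minus[OF ph(1)] that by simp
  have pc: "p v \<in> carrier Y" if "v \<in> carrier M" for v using lin_closed[OF ph(1) that] .
  have k: "k v = {w \<in> carrier M. p w = p v}" if v: "v \<in> carrier M" for v
  proof
    show "k v \<subseteq> {w \<in> carrier M. p w = p v}"
      unfolding k_def a_r_coset_def' N using v pc lin_add[OF ph(1)] by auto
    show "{w \<in> carrier M. p w = p v} \<subseteq> k v"
    proof
      fix w assume w: "w \<in> {w \<in> carrier M. p w = p v}"
      then have "w \<ominus>\<^bsub>M\<^esub> v \<in> N" unfolding N using v pm pc by auto
      moreover have "w = (w \<ominus>\<^bsub>M\<^esub> v) \<oplus>\<^bsub>M\<^esub> v" using w v by (simp add: a_minus_def vassoc)
      ultimately show "w \<in> k v" unfolding k_def a_r_coset_def' by blast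
    qed
  qed
  have ke: "k u = k v \<longleftrightarrow> p u = p v" if "u \<in> carrier M" "v \<in> carrier M" for u v
    using k[OF that(1)] k[OF that(2)] that by auto
  have Qc: "k ` carrier M = carrier Q0"
    by (auto simp: Q0_def A_RCOSETS_def' k_def)
  have ka: "k u \<oplus>\<^bsub>Q0\<^esub> k v = k (u \<oplus>\<^bsub>M\<^esub> v)" if uv: "u \<in> carrier M" "v \<in> carrier M" for u v
  proof -
    have "k u \<oplus>\<^bsub>Q0\<^esub> k v = {a \<oplus>\<^bsub>M\<^esub> b | a b. a \<in> k u \<and> b \<in> k v}"
      by (auto simp: Q0_def set_add_def')
    also have "\<dots> = k (u \<oplus>\<^bsub>M\<^esub> v)"
    proof
      show "{a \<oplus>\<^bsub>M\<^esub> b | a b. a \<in> k u \<and> b \<in> k v} \<subseteq> k (u \<oplus>\<^bsub>M\<^esub> v)"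
        using uv by (auto simp: k lin_add[OF ph(1)])
      show "k (u \<oplus>\<^bsub>M\<^esub> v) \<subseteq> {a \<oplus>\<^bsub>M\<^esub> b | a b. a \<in> k u \<and> b \<in> k v}"
      proof
        fix w assume "w \<in> k (u \<oplus>\<^bsub>M\<^esub> v)"
        then have w: "w \<in> carrier M" "p w = p u \<oplus>\<^bsub>Y\<^esub> p v" using uv by (auto simp: k lin_add[OF ph(1)])
        have "w = (w \<ominus>\<^bsub>M\<^esub> v) \<oplus>\<^bsub>M\<^esub> v" using w uv by (simp add: a_minus_def vassoc)
        moreover have "w \<ominus>\<^bsub>M\<^esub> v \<in> k u" using w uv pm pc by (auto simp: k a_minus_def vassoc)
        moreover have "v \<in> k v" using uv by (simp add: k)
        ultimately show "w \<in> {a \<oplus>\<^bsub>M\<^esub> b | a b. a \<in> k u \<and> b \<in> k v}" by blast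
      qed
    qed
    finally show ?thesis .
  qed
  have kop: "(\<Union>x\<in>k v. k (f x)) = k (f v)" if v: "v \<in> carrier M" and f: "\<And>w. w \<in> k v \<Longrightarrow> k (f w) = k (f v)" for f v
  proof -
    have "v \<in> k v" using k[OF v] v by simp
    moreover have "(\<Union>x\<in>k v. k (f x)) = (\<Union>x\<in>k v. k (f v))" by (rule SUP_cong[OF refl f])
    ultimately show ?thesis by auto
  qed
  have ks: "c \<odot>\<^bsub>Q0\<^esub> k v = k (c \<odot>\<^bsub>M\<^esub> v)" if v: "v \<in> carrier M" and c: "c \<in> carrier K" for c v
  proof -
    have "(\<Union>x\<in>k v. k (c \<odot>\<^bsub>M\<^esub> x)) = k (c \<odot>\<^bsub>M\<^esub> v)"
      by (rule kop[OF v]) (use v c in \<open>auto simp: k[OF v] ke lin_smult[OF ph(1)]\<close>)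
    then show ?thesis by (simp add: Q0_def k_def)
  qed
  have kz: "\<zero>\<^bsub>Q0\<^esub> = k \<zero>\<^bsub>M\<^esub>" using lin_zero[OF ph(1)] by (simp add: k) (simp add: Q0_def N)
  note mQ0 = module_image[OF m(1) Qc ka ks kz]
  have mQ: "module K ?Q" using mQ0 same_module[OF sQ] by simp
  have kact: "k (act M x w) = k (act M x v)" if x: "x \<in> ops" and v: "v \<in> carrier M" and w: "w \<in> k v" for x v w
    using that m(4)[OF x] ph(2)[OF x] by (simp add: ke k)
  have "hspace ?Q \<and> (\<forall>x\<in>ops. \<forall>v\<in>carrier M. act ?Q x (k v) = k (act M x v))"
  proof (cases H)
    case (Finite_Group G)
    have 1: "hspace ?Q \<longleftrightarrow> module K ?Q" by (simp add: hhspace_def Finite_Group)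
    have 2: "act ?Q x C = (\<Union>v\<in>C. N +>\<^bsub>M\<^esub> (act M x v))" for x C
      by (simp add: hact_def Finite_Group quot_hmod_def Let_def)
    show ?thesis
    proof (intro conjI ballI)
      show "hspace ?Q" using 1 mQ by simp
      fix x v assume "x \<in> ops" "v \<in> carrier M"
      then show "act ?Q x (k v) = k (act M x v)" using kop[of v "act M x"] kact unfolding 2 by (simp add: k_def)
    qed
  next
    case (Algebraic_Group A)
    note a = alg[OF Algebraic_Group] and alg_ops = alg_unfold[OF Algebraic_Group]
    note tm = tensor_map[OF m(1) a(1) mQ0(1) a(1) mQ0(2) lin_id(1)]
    have cQ: "coaction ?Q C = tensor_map K M A Q0 A k id (coaction M (SOME x. x \<in> C))" for C
      unfolding Q k_def[abs_def] by (simp add: Algebraic_Group)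
    have co: "coaction M v \<in> carrier (tensor K M A)" if "v \<in> carrier M" for v using m(2) that by (simp add: alg_ops)
    have so: "(SOME x. x \<in> k v) \<in> k v" if "v \<in> carrier M" for v
      by (rule someI[of _ v]) (use that k in simp)
    have soM: "(SOME x. x \<in> k v) \<in> carrier M" if "v \<in> carrier M" for v using so[OF that] k[OF that] by auto
    have Qe: "\<exists>v\<in>carrier M. C = k v" if "C \<in> carrier Q0" for C using that Qc by blast
    have "coaction ?Q C \<in> carrier (tensor K ?Q A)" if C: "C \<in> carrier Q0" for C
      using Qe[OF C] by (auto simp: cQ same_tensor[OF sQ] intro!: lin_closed[OF tm(1)] co soM)
    moreover have "carrier ?Q = carrier Q0" using sQ by (simp add: same_space_def)
    ultimately have "hspace ?Q" using mQ by (simp add: alg_ops)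
    moreover have "act ?Q (Inr f) (k v) = k (act M (Inr f) v)" if f: "f \<in> lin K A (scalars K)" and v: "v \<in> carrier M" for f v
    proof -
      have "act ?Q (Inr f) (k v) = k (act M (Inr f) (SOME x. x \<in> k v))"
        using slice_map[OF m(1) a(1) mQ0(1) mQ0(2) f co[OF soM[OF v]]] by (simp add: alg_ops(1) same_slice[OF sQ] cQ)
      then show ?thesis using kact[OF _ v so[OF v], of "Inr f"] f by (simp add: alg_ops(3))
    qed
    ultimately show ?thesis by (auto simp: alg_ops(3))
  qed
  then have hQ: "hspace ?Q" and aQ: "\<And>x v. x \<in> ops \<Longrightarrow> v \<in> carrier M \<Longrightarrow> act ?Q x (k v) = k (act M x v)" by auto
  define f where "f C = p (SOME x. x \<in> C)" for C
  have fk: "f (k v) = p v" if v: "v \<in> carrier M" for v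
  proof -
    have "(SOME x. x \<in> k v) \<in> k v" by (rule someI[of _ v]) (use that k in simp)
    then show ?thesis using k[OF v] by (simp add: f_def)
  qed
  have cQ: "carrier ?Q = k ` carrier M" using sQ Qc by (simp add: same_space_def)
  have sQs: "u \<oplus>\<^bsub>?Q\<^esub> v = u \<oplus>\<^bsub>Q0\<^esub> v" "c \<odot>\<^bsub>?Q\<^esub> u = c \<odot>\<^bsub>Q0\<^esub> u" for u v c using sQ by (auto simp: same_space_def)
  have "f \<in> lin K ?Q Y"
    by (rule linI) (auto simp: cQ fk pc sQs ka ks lin_add[OF ph(1)] lin_smult[OF ph(1)])
  moreover have "f (act ?Q x C) = act Y x (f C)" if "x \<in> ops" "C \<in> carrier ?Q" for x C
    using that by (auto simp: cQ aQ fk m(4) ph(2))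
  ultimately have "f \<in> hmod_hom K H ?Q Y" using hom_iff_hspace[OF hQ y(2)] by blast
  moreover have "bij_betw f (carrier ?Q) (carrier Y)"
    unfolding bij_betw_def
  proof
    show "inj_on f (carrier ?Q)" unfolding cQ by (rule inj_onI, elim imageE) (simp add: fk ke)
    show "f ` carrier ?Q = carrier Y" unfolding cQ image_image sur[symmetric] by (rule image_cong) (auto simp: fk)
  qed
  ultimately show ?thesis by (auto simp: hmod_iso_def)
qed

section \<open>Extensions and cocycles\<close>

text \<open>
  Choosing a linear section of an extension of \<open>S\<close> by \<open>T\<close> identifies it with \<open>T \<times> S\<close>, on which an operator
  \<open>x\<close> acts by \<open>(t, s) \<mapsto> (x t + z x s, x s)\<close>. The conditions on \<open>z\<close> say that this is a module; another
  section changes \<open>z\<close> by a coboundary.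
\<close>
definition cocycle :: "('k, 's, 'g, 'a) hmod \<Rightarrow> ('k, 't, 'g, 'a) hmod \<Rightarrow> ('g + ('a \<Rightarrow> 'k) \<Rightarrow> 's \<Rightarrow> 't) \<Rightarrow> bool" where
  "cocycle S T z \<longleftrightarrow> (\<forall>x\<in>ops. z x \<in> lin K S T) \<and> (\<forall>s\<in>carrier S. z opone s = \<zero>\<^bsub>T\<^esub>) \<and>
     (\<forall>x\<in>ops. \<forall>y\<in>ops. \<forall>s\<in>carrier S. z (opmul x y) s = act T x (z y s) \<oplus>\<^bsub>T\<^esub> z x (act S y s)) \<and>
     (\<forall>s\<in>carrier S. rat T (\<lambda>x. z x s))"

definition coboundary :: "('k, 's, 'g, 'a) hmod \<Rightarrow> ('k, 't, 'g, 'a) hmod \<Rightarrow> ('g + ('a \<Rightarrow> 'k) \<Rightarrow> 's \<Rightarrow> 't) \<Rightarrow> bool" where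
  "coboundary S T z \<longleftrightarrow> (\<exists>h\<in>lin K S T. \<forall>x\<in>ops. \<forall>s\<in>carrier S. z x s = act T x (h s) \<ominus>\<^bsub>T\<^esub> h (act S x s))"

lemma cocycleD:
  assumes "cocycle S T z"
  shows "\<And>x. x \<in> ops \<Longrightarrow> z x \<in> lin K S T" "\<And>x s. x \<in> ops \<Longrightarrow> s \<in> carrier S \<Longrightarrow> z x s \<in> carrier T"
    "\<And>s. s \<in> carrier S \<Longrightarrow> z opone s = \<zero>\<^bsub>T\<^esub>"
    "\<And>x y s. x \<in> ops \<Longrightarrow> y \<in> ops \<Longrightarrow> s \<in> carrier S \<Longrightarrow> z (opmul x y) s = act T x (z y s) \<oplus>\<^bsub>T\<^esub> z x (act S y s)"
    "\<And>s. s \<in> carrier S \<Longrightarrow> rat T (\<lambda>x. z x s)"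
  using assms lin_closed[of "z _" S T] by (auto simp: cocycle_def)

lemma coboundary_cong: "coboundary S T z \<Longrightarrow> (\<And>x s. x \<in> ops \<Longrightarrow> s \<in> carrier S \<Longrightarrow> z x s = z' x s) \<Longrightarrow> coboundary S T z'"
  unfolding coboundary_def by auto

lemma cocycle_cong: "cocycle S T z \<Longrightarrow> (\<And>x s. x \<in> ops \<Longrightarrow> s \<in> carrier S \<Longrightarrow> z x s = z' x s) \<Longrightarrow> hmodule K H S \<Longrightarrow> cocycle S T z'"
proof -
  assume z: "cocycle S T z" and e: "\<And>x s. x \<in> ops \<Longrightarrow> s \<in> carrier S \<Longrightarrow> z x s = z' x s" and S: "hmodule K H S"
  note z = cocycleD[OF z] and m = hmodule_facts[OF S]
  show ?thesis unfolding cocycle_def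
  proof (intro conjI ballI)
    show "z' x \<in> lin K S T" if "x \<in> ops" for x by (rule lin_cong[OF z(1)[OF that] m(1) e[OF that]])
    show "z' opone s = \<zero>\<^bsub>T\<^esub>" if "s \<in> carrier S" for s using z(3)[OF that] e[OF opone_closed that] by simp
    show "z' (opmul x y) s = act T x (z' y s) \<oplus>\<^bsub>T\<^esub> z' x (act S y s)" if "x \<in> ops" "y \<in> ops" "s \<in> carrier S" for x y s
      using z(4)[OF that] that m(4) by (simp add: e[symmetric])
    show "rat T (\<lambda>x. z' x s)" if "s \<in> carrier S" for s by (rule rat_cong[OF z(5)[OF that] e[OF _ that]])
  qed
qed

lemma act_zero: "hmodule K H T \<Longrightarrow> x \<in> ops \<Longrightarrow> act T x \<zero>\<^bsub>T\<^esub> = \<zero>\<^bsub>T\<^esub>"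
  using lin_zero[OF hmodule_facts(3)] hmodule_facts(1) by blast

lemma cocycle_zero: "hmodule K H S \<Longrightarrow> hmodule K H T \<Longrightarrow> cocycle S T (\<lambda>x s. \<zero>\<^bsub>T\<^esub>)"
  using hmodule_facts(1)[of T] unfolding cocycle_def by (auto simp: rat_zero act_zero)

lemma cocycle_add:
  assumes "hmodule K H S" "hmodule K H T" "cocycle S T z" "cocycle S T z'"
  shows "cocycle S T (\<lambda>x s. z x s \<oplus>\<^bsub>T\<^esub> z' x s)"
proof -
  note m = hmodule_facts[OF assms(1)] and t = hmodule_facts[OF assms(2)]
  note z = cocycleD[OF assms(3)] and z' = cocycleD[OF assms(4)]
  show ?thesis unfolding cocycle_def
  proof (intro conjI ballI)
    fix x assume x: "x \<in> ops"
    show "(\<lambda>s. z x s \<oplus>\<^bsub>T\<^esub> z' x s) \<in> lin K S T" by (rule lin_plus[OF t(1) z(1)[OF x] z'(1)[OF x]])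
    fix y s assume y: "y \<in> ops" and s: "s \<in> carrier S"
    show "z (opmul x y) s \<oplus>\<^bsub>T\<^esub> z' (opmul x y) s =
       act T x (z y s \<oplus>\<^bsub>T\<^esub> z' y s) \<oplus>\<^bsub>T\<^esub> (z x (act S y s) \<oplus>\<^bsub>T\<^esub> z' x (act S y s))"
      using x y s z(2) z'(2) m(4) t(1,4) by (simp add: z(4) z'(4) lin_add[OF t(3)] vac)
  next
    fix s assume s: "s \<in> carrier S"
    show "z opone s \<oplus>\<^bsub>T\<^esub> z' opone s = \<zero>\<^bsub>T\<^esub>" using s t(1) by (simp add: z(3) z'(3))
    show "rat T (\<lambda>x. z x s \<oplus>\<^bsub>T\<^esub> z' x s)" by (rule rat_add[OF z(5)[OF s] z'(5)[OF s] t(1)])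
  qed
qed

lemma cocycle_map:
  assumes S: "hmodule K H S" and T: "hmodule K H T" and S': "hmodule K H S'" and T': "hmodule K H T'"
    and z: "cocycle S T z" and f: "f \<in> hmod_hom K H S' S" and g: "g \<in> hmod_hom K H T T'"
  shows "cocycle S' T' (\<lambda>x s. g (z x (f s)))"
proof -
  note m = hmodule_facts[OF S] and t = hmodule_facts[OF T] and m' = hmodule_facts[OF S'] and t' = hmodule_facts[OF T']
  note z = cocycleD[OF z] and f = homD[OF f S' S] and g = homD[OF g T T']
  note fc = lin_closed[OF f(1)] and gc = lin_closed[OF g(1)]
  show ?thesis unfolding cocycle_def
  proof (intro conjI ballI)
    fix x assume x: "x \<in> ops"
    show "(\<lambda>s. g (z x (f s))) \<in> lin K S' T'" by (rule lin_comp[OF lin_comp[OF f(1) z(1)[OF x]] g(1)])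
    fix y s assume y: "y \<in> ops" and s: "s \<in> carrier S'"
    show "g (z (opmul x y) (f s)) = act T' x (g (z y (f s))) \<oplus>\<^bsub>T'\<^esub> g (z x (f (act S' y s)))"
      using x y s z(2) fc m(4) t(4) by (simp add: z(4) lin_add[OF g(1)] f(2) g(2))
  next
    fix s assume s: "s \<in> carrier S'"
    show "g (z opone (f s)) = \<zero>\<^bsub>T'\<^esub>" using s fc lin_zero[OF g(1) t(1) t'(1)] by (simp add: z(3))
    show "rat T' (\<lambda>x. g (z x (f s)))" by (rule rat_lin[OF z(5)[OF fc[OF s]] g(1) t(1) t'(1)])
  qed
qed

lemma cocycle_smult:
  assumes "hmodule K H S" "hmodule K H T" "cocycle S T z" "c \<in> carrier K"
  shows "cocycle S T (\<lambda>x s. c \<odot>\<^bsub>T\<^esub> z x s)"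
proof -
  have i: "(\<lambda>s. s) \<in> hmod_hom K H S S" by (rule homI[OF assms(1,1) lin_id(2)]) simp
  show ?thesis by (rule cocycle_map[OF assms(1,2,1,2,3) i scalar_hom[OF assms(2,4)]])
qed

lemma coboundary_map:
  assumes S: "hmodule K H S" and T: "hmodule K H T" and S': "hmodule K H S'" and T': "hmodule K H T'"
    and z: "coboundary S T z" and f: "f \<in> hmod_hom K H S' S" and g: "g \<in> hmod_hom K H T T'"
  shows "coboundary S' T' (\<lambda>x s. g (z x (f s)))"
proof -
  note m = hmodule_facts[OF S] and t = hmodule_facts[OF T] and m' = hmodule_facts[OF S'] and t' = hmodule_facts[OF T']
  note f = homD[OF f S' S] and g = homD[OF g T T']
  note fc = lin_closed[OF f(1)] and gc = lin_closed[OF g(1)]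
  obtain h where h: "h \<in> lin K S T" "\<forall>x\<in>ops. \<forall>s\<in>carrier S. z x s = act T x (h s) \<ominus>\<^bsub>T\<^esub> h (act S x s)"
    using z by (auto simp: coboundary_def)
  note hc = lin_closed[OF h(1)]
  show ?thesis unfolding coboundary_def
  proof (intro bexI ballI)
    show "(\<lambda>s. g (h (f s))) \<in> lin K S' T'" by (rule lin_comp[OF lin_comp[OF f(1) h(1)] g(1)])
    fix x s assume "x \<in> ops" "s \<in> carrier S'"
    then show "g (z x (f s)) = act T' x (g (h (f s))) \<ominus>\<^bsub>T'\<^esub> g (h (f (act S' x s)))"
      using fc hc m(4) t(4) by (simp add: h(2) lin_minus[OF g(1) t(1) t'(1)] f(2) g(2))
  qed
qed

lemma coboundary_smult:
  assumes "hmodule K H S" "hmodule K H T" "coboundary S T z" "c \<in> carrier K"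
  shows "coboundary S T (\<lambda>x s. c \<odot>\<^bsub>T\<^esub> z x s)"
proof -
  have i: "(\<lambda>s. s) \<in> hmod_hom K H S S" by (rule homI[OF assms(1,1) lin_id(2)]) simp
  show ?thesis by (rule coboundary_map[OF assms(1,2,1,2,3) i scalar_hom[OF assms(2,4)]])
qed

lemma vshuffle:
  assumes "module K V" "a \<in> carrier V" "b \<in> carrier V" "c \<in> carrier V" "d \<in> carrier V"
  shows "(a \<ominus>\<^bsub>V\<^esub> b) \<oplus>\<^bsub>V\<^esub> (c \<ominus>\<^bsub>V\<^esub> d) = (a \<oplus>\<^bsub>V\<^esub> c) \<ominus>\<^bsub>V\<^esub> (b \<oplus>\<^bsub>V\<^esub> d)"
  using assms by (simp add: a_minus_def vneg_add vac)

lemma coboundary_add: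
  assumes "hmodule K H S" "hmodule K H T" "coboundary S T z" "coboundary S T z'"
  shows "coboundary S T (\<lambda>x s. z x s \<oplus>\<^bsub>T\<^esub> z' x s)"
proof -
  note m = hmodule_facts[OF assms(1)] and t = hmodule_facts[OF assms(2)]
  obtain h where h: "h \<in> lin K S T" "\<forall>x\<in>ops. \<forall>s\<in>carrier S. z x s = act T x (h s) \<ominus>\<^bsub>T\<^esub> h (act S x s)"
    using assms(3) by (auto simp: coboundary_def)
  obtain h' where h': "h' \<in> lin K S T" "\<forall>x\<in>ops. \<forall>s\<in>carrier S. z' x s = act T x (h' s) \<ominus>\<^bsub>T\<^esub> h' (act S x s)"
    using assms(4) by (auto simp: coboundary_def)
  note hc = lin_closed[OF h(1)] lin_closed[OF h'(1)]
  show ?thesis unfolding coboundary_def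
  proof (intro bexI ballI)
    show "(\<lambda>s. h s \<oplus>\<^bsub>T\<^esub> h' s) \<in> lin K S T" by (rule lin_plus[OF t(1) h(1) h'(1)])
    fix x s assume "x \<in> ops" "s \<in> carrier S"
    then show "z x s \<oplus>\<^bsub>T\<^esub> z' x s = act T x (h s \<oplus>\<^bsub>T\<^esub> h' s) \<ominus>\<^bsub>T\<^esub> (h (act S x s) \<oplus>\<^bsub>T\<^esub> h' (act S x s))"
      using hc m(4) t(1,4) by (simp add: h(2) h'(2) lin_add[OF t(3)] vshuffle)
  qed
qed

abbreviation cohomologous where "cohomologous S T z z' \<equiv> coboundary S T (\<lambda>x s. z x s \<ominus>\<^bsub>T\<^esub> z' x s)"

lemma cohomologous_sym:
  assumes "hmodule K H S" "hmodule K H T" "cocycle S T z" "cocycle S T z'" "cohomologous S T z z'"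
  shows "cohomologous S T z' z"
  by (rule coboundary_cong[OF coboundary_smult[OF assms(1,2,5), of "\<ominus> \<one>"]])
    (use cocycleD(2)[OF assms(3)] cocycleD(2)[OF assms(4)] hmodule_facts(1)[OF assms(2)] in \<open>auto simp: neg_smult a_minus_def vneg_add vcomm\<close>)

lemma cohomologous_trans:
  assumes "hmodule K H S" "hmodule K H T" "cocycle S T z" "cocycle S T z'" "cocycle S T z''" "cohomologous S T z z'" "cohomologous S T z' z''"
  shows "cohomologous S T z z''"
  by (rule coboundary_cong[OF coboundary_add[OF assms(1,2,6,7)]])
    (use cocycleD(2)[OF assms(3)] cocycleD(2)[OF assms(4)] cocycleD(2)[OF assms(5)] hmodule_facts(1)[OF assms(2)] in \<open>simp add: a_minus_def vassoc\<close>)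

lemma cohomologous_add:
  assumes "hmodule K H S" "hmodule K H T" "cocycle S T z" "cocycle S T z'" "cocycle S T w" "cocycle S T w'" "cohomologous S T z w" "cohomologous S T z' w'"
  shows "cohomologous S T (\<lambda>x s. z x s \<oplus>\<^bsub>T\<^esub> z' x s) (\<lambda>x s. w x s \<oplus>\<^bsub>T\<^esub> w' x s)"
  by (rule coboundary_cong[OF coboundary_add[OF assms(1,2,7,8)]], rule vshuffle)
    (use cocycleD(2)[OF assms(3)] cocycleD(2)[OF assms(4)] cocycleD(2)[OF assms(5)] cocycleD(2)[OF assms(6)] hmodule_facts(1)[OF assms(2)] in auto)

lemma cohomologous_smult:
  assumes "hmodule K H S" "hmodule K H T" "cocycle S T z" "cocycle S T w" "cohomologous S T z w" "c \<in> carrier K"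
  shows "cohomologous S T (\<lambda>x s. c \<odot>\<^bsub>T\<^esub> z x s) (\<lambda>x s. c \<odot>\<^bsub>T\<^esub> w x s)"
  by (rule coboundary_cong[OF coboundary_smult[OF assms(1,2,5,6)]])
    (use cocycleD(2)[OF assms(3)] cocycleD(2)[OF assms(4)] assms(6) hmodule_facts(1)[OF assms(2)] in \<open>auto simp: smult_minus\<close>)

text \<open>
  Linear independence of the classes of \<open>z 0, \<dots>, z (n - 1)\<close> in \<open>Ext\<^sup>1(S, T)\<close>.
\<close>
definition indep_cocycles where
  "indep_cocycles S T n z \<longleftrightarrow> (\<forall>i<n::nat. cocycle S T (z i)) \<and>
    (\<forall>c. (\<forall>i<n. c i \<in> carrier K) \<longrightarrow> coboundary S T (\<lambda>x s. \<Oplus>\<^bsub>T\<^esub>i\<in>{..<n}. c i \<odot>\<^bsub>T\<^esub> z i x s) \<longrightarrow> (\<forall>i<n. c i = \<zero>))"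

lemma indep_cocyclesD:
  assumes "indep_cocycles S T n z"
  shows "i < n \<Longrightarrow> cocycle S T (z i)"
    "(\<And>i. i < n \<Longrightarrow> c i \<in> carrier K) \<Longrightarrow> coboundary S T (\<lambda>x s. \<Oplus>\<^bsub>T\<^esub>i\<in>{..<n}. c i \<odot>\<^bsub>T\<^esub> z i x s) \<Longrightarrow> i < n \<Longrightarrow> c i = \<zero>"
  using assms by (simp_all add: indep_cocycles_def)

lemma indep_cocycles_not_coboundary:
  assumes z: "indep_cocycles S T n z" and T: "hmodule K H T" and i: "i < n"
  shows "\<not> coboundary S T (z i)"
proof
  assume co: "coboundary S T (z i)"
  note t = hmodule_facts(1)[OF T]
  let ?c = "\<lambda>j. if j = i then \<one> else \<zero>"
  have zj: "z j x s \<in> carrier T" if "j < n" "x \<in> ops" "s \<in> carrier S" for j x s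
    by (rule cocycleD(2)[OF indep_cocyclesD(1)[OF z that(1)] that(2,3)])
  have "coboundary S T (\<lambda>x s. \<Oplus>\<^bsub>T\<^esub>j\<in>{..<n}. ?c j \<odot>\<^bsub>T\<^esub> z j x s)"
  proof (rule coboundary_cong[OF co])
    fix x s assume xs: "x \<in> ops" "s \<in> carrier S"
    have "(\<Oplus>\<^bsub>T\<^esub>j\<in>{..<n}. ?c j \<odot>\<^bsub>T\<^esub> z j x s) = (\<Oplus>\<^bsub>T\<^esub>j\<in>{..<n}. if j = i then z i x s else \<zero>\<^bsub>T\<^esub>)"
      by (rule vsum_cong) (use zj[OF _ xs] t in auto)
    also have "\<dots> = z i x s" by (rule vsum_delta[OF t i zj[OF i xs]])
    finally show "z i x s = (\<Oplus>\<^bsub>T\<^esub>j\<in>{..<n}. ?c j \<odot>\<^bsub>T\<^esub> z j x s)" by simp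
  qed
  from this i have "?c i = \<zero>" by (rule indep_cocyclesD(2)[OF z, rotated]) simp
  then show False by simp
qed

lemma indep_cocycles_3:
  assumes z: "indep_cocycles S T 3 z" and T: "hmodule K H T" and k: "a \<in> carrier K" "b \<in> carrier K" "c \<in> carrier K"
    and co: "coboundary S T (\<lambda>x s. a \<odot>\<^bsub>T\<^esub> z 0 x s \<oplus>\<^bsub>T\<^esub> (b \<odot>\<^bsub>T\<^esub> z 1 x s \<oplus>\<^bsub>T\<^esub> c \<odot>\<^bsub>T\<^esub> z 2 x s))"
  shows "a = \<zero> \<and> b = \<zero> \<and> c = \<zero>"
proof -
  note t = hmodule_facts(1)[OF T]
  let ?c = "\<lambda>i::nat. if i = 0 then a else if i = 1 then b else c"
  have "coboundary S T (\<lambda>x s. \<Oplus>\<^bsub>T\<^esub>i\<in>{..<3}. ?c i \<odot>\<^bsub>T\<^esub> z i x s)"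
  proof (rule coboundary_cong[OF co])
    fix x s assume xs: "x \<in> ops" "s \<in> carrier S"
    have m: "z i x s \<in> carrier T" if "i < 3" for i using cocycleD(2)[OF indep_cocyclesD(1)[OF z that] xs] .
    show "a \<odot>\<^bsub>T\<^esub> z 0 x s \<oplus>\<^bsub>T\<^esub> (b \<odot>\<^bsub>T\<^esub> z 1 x s \<oplus>\<^bsub>T\<^esub> c \<odot>\<^bsub>T\<^esub> z 2 x s) = (\<Oplus>\<^bsub>T\<^esub>i\<in>{..<3}. ?c i \<odot>\<^bsub>T\<^esub> z i x s)"
      using m[of 0] m[of 1] m[of 2] t k by (simp add: numeral_3_eq_3 numeral_2_eq_2 vsum_Suc vassoc m[unfolded numeral_3_eq_3])
  qed
  from this have c0: "?c i = \<zero>" if "i < 3" for i by (rule indep_cocyclesD(2)[OF z, rotated, OF _ that]) (use k in simp)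
  from c0[of 0] c0[of 1] c0[of 2] show ?thesis by simp
qed

lemma indep_cocycles_2:
  assumes z: "indep_cocycles S T 2 z" and T: "hmodule K H T" and k: "a \<in> carrier K" "b \<in> carrier K"
    and co: "coboundary S T (\<lambda>x s. a \<odot>\<^bsub>T\<^esub> z 0 x s \<oplus>\<^bsub>T\<^esub> b \<odot>\<^bsub>T\<^esub> z 1 x s)"
  shows "a = \<zero> \<and> b = \<zero>"
proof -
  note t = hmodule_facts(1)[OF T]
  let ?c = "\<lambda>i::nat. if i = 0 then a else b"
  have "coboundary S T (\<lambda>x s. \<Oplus>\<^bsub>T\<^esub>i\<in>{..<2}. ?c i \<odot>\<^bsub>T\<^esub> z i x s)"
  proof (rule coboundary_cong[OF co])
    fix x s assume xs: "x \<in> ops" "s \<in> carrier S"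
    have m: "z i x s \<in> carrier T" if "i < 2" for i using cocycleD(2)[OF indep_cocyclesD(1)[OF z that] xs] .
    show "a \<odot>\<^bsub>T\<^esub> z 0 x s \<oplus>\<^bsub>T\<^esub> b \<odot>\<^bsub>T\<^esub> z 1 x s = (\<Oplus>\<^bsub>T\<^esub>i\<in>{..<2}. ?c i \<odot>\<^bsub>T\<^esub> z i x s)"
      using m[of 0] m[of 1] t k by (simp add: numeral_2_eq_2 vsum_Suc m[unfolded numeral_2_eq_2])
  qed
  from this have c0: "?c i = \<zero>" if "i < 2" for i by (rule indep_cocyclesD(2)[OF z, rotated, OF _ that]) (use k in simp)
  from c0[of 0] c0[of 1] show ?thesis by simp
qed

text \<open>
  A short exact sequence \<open>0 \<rightarrow> T \<rightarrow> E \<rightarrow> S \<rightarrow> 0\<close> of modules, with maps \<open>i\<close> and \<open>q\<close>, together with a linear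
  splitting (a section \<open>j\<close> of \<open>q\<close> and the retraction \<open>r\<close> of \<open>i\<close>) and the cocycle \<open>z\<close> that measures
  the failure of \<open>j\<close> to commute with the operators.
\<close>
definition split_data where
  "split_data E S T i q j r z \<longleftrightarrow> hmodule K H E \<and> hmodule K H S \<and> hmodule K H T \<and> i \<in> hmod_hom K H T E \<and> q \<in> hmod_hom K H E S \<and>
     j \<in> lin K S E \<and> r \<in> lin K E T \<and> (\<forall>s\<in>carrier S. q (j s) = s \<and> r (j s) = \<zero>\<^bsub>T\<^esub>) \<and>
     (\<forall>t\<in>carrier T. q (i t) = \<zero>\<^bsub>S\<^esub> \<and> r (i t) = t) \<and> (\<forall>e\<in>carrier E. e = j (q e) \<oplus>\<^bsub>E\<^esub> i (r e)) \<and>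
     (\<forall>x\<in>ops. \<forall>s\<in>carrier S. z x s \<in> carrier T \<and> act E x (j s) = j (act S x s) \<oplus>\<^bsub>E\<^esub> i (z x s))"

lemma split_dataD:
  assumes "split_data E S T i q j r z"
  shows "hmodule K H E" "hmodule K H S" "hmodule K H T" "i \<in> hmod_hom K H T E" "q \<in> hmod_hom K H E S"
     "j \<in> lin K S E" "r \<in> lin K E T" "\<And>s. s \<in> carrier S \<Longrightarrow> q (j s) = s" "\<And>s. s \<in> carrier S \<Longrightarrow> r (j s) = \<zero>\<^bsub>T\<^esub>"
     "\<And>t. t \<in> carrier T \<Longrightarrow> q (i t) = \<zero>\<^bsub>S\<^esub>" "\<And>t. t \<in> carrier T \<Longrightarrow> r (i t) = t"
     "\<And>e. e \<in> carrier E \<Longrightarrow> j (q e) \<oplus>\<^bsub>E\<^esub> i (r e) = e"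
     "\<And>x s. x \<in> ops \<Longrightarrow> s \<in> carrier S \<Longrightarrow> z x s \<in> carrier T"
     "\<And>x s. x \<in> ops \<Longrightarrow> s \<in> carrier S \<Longrightarrow> act E x (j s) = j (act S x s) \<oplus>\<^bsub>E\<^esub> i (z x s)"
  using assms unfolding split_data_def by (auto dest: bspec)

lemma ses_split_data:
  assumes E: "hmodule K H E" and S: "hmodule K H S" and T: "hmodule K H T" and i: "i \<in> hmod_hom K H T E" "inj_on i (carrier T)"
    and q: "q \<in> hmod_hom K H E S" "q ` carrier E = carrier S" and ex: "i ` carrier T = {e \<in> carrier E. q e = \<zero>\<^bsub>S\<^esub>}"
  shows "\<exists>j r z. split_data E S T i q j r z \<and> cocycle S T z"
proof -
  note e = hmodule_facts[OF E] and m = hmodule_facts[OF S] and t = hmodule_facts[OF T]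
  note [simp] = e(1) m(1) t(1)
  note ih = homD[OF i(1) T E] and qh = homD[OF q(1) E S]
  note ic = lin_closed[OF ih(1)] and qc = lin_closed[OF qh(1)]
  obtain j where j: "j \<in> lin K S E" "\<And>s. s \<in> carrier S \<Longrightarrow> q (j s) = s"
    using section_exists[OF e(1) m(1) qh(1) q(2)] by blast
  note sc = lin_closed[OF j(1)]
  define r where "r v = inv_into (carrier T) i (v \<ominus>\<^bsub>E\<^esub> j (q v))" for v
  have rk: "v \<ominus>\<^bsub>E\<^esub> j (q v) \<in> i ` carrier T" if "v \<in> carrier E" for v
    unfolding ex using that qc sc j(2) by (simp add: lin_minus[OF qh(1)])
  have rc: "r v \<in> carrier T" and ir: "i (r v) = v \<ominus>\<^bsub>E\<^esub> j (q v)" if "v \<in> carrier E" for v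
    unfolding r_def using rk[OF that] by (auto simp: inv_into_into f_inv_into_f)
  have inj: "a = b" if "i a = i b" "a \<in> carrier T" "b \<in> carrier T" for a b using that i(2) by (auto dest: inj_onD)
  have rl: "r \<in> lin K E T"
  proof (rule linI)
    fix u v assume uv: "u \<in> carrier E" "v \<in> carrier E"
    show "r (u \<oplus>\<^bsub>E\<^esub> v) = r u \<oplus>\<^bsub>T\<^esub> r v"
      by (rule inj) (use uv rc qc sc in \<open>simp_all add: ir lin_add[OF ih(1)] lin_add[OF qh(1)] lin_add[OF j(1)] vshuffle\<close>)
  next
    fix c v assume uv: "c \<in> carrier K" "v \<in> carrier E"
    show "r (c \<odot>\<^bsub>E\<^esub> v) = c \<odot>\<^bsub>T\<^esub> r v"
      by (rule inj) (use uv rc qc sc in \<open>simp_all add: ir lin_smult[OF ih(1)] lin_smult[OF qh(1)] lin_smult[OF j(1)] smult_minus\<close>)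
  qed (rule rc)
  have qi: "q (i v) = \<zero>\<^bsub>S\<^esub>" if "v \<in> carrier T" for v using ex that by blast
  have ri: "r (i v) = v" if "v \<in> carrier T" for v
    by (rule inj) (use that ic rc lin_zero[OF j(1)] in \<open>simp_all add: ir qi\<close>)
  have rs: "r (j s) = \<zero>\<^bsub>T\<^esub>" if "s \<in> carrier S" for s
    by (rule inj) (use that sc rc lin_zero[OF ih(1)] in \<open>simp_all add: ir j(2)\<close>)
  have dec: "j (q v) \<oplus>\<^bsub>E\<^esub> i (r v) = v" if "v \<in> carrier E" for v using that qc sc by (simp add: ir)
  define z where "z x s = r (act E x (j s))" for x s
  have zc: "z x s \<in> carrier T" if "x \<in> ops" "s \<in> carrier S" for x s unfolding z_def using that rc e(4) sc by simp
  have az: "act E x (j s) = j (act S x s) \<oplus>\<^bsub>E\<^esub> i (z x s)" if "x \<in> ops" "s \<in> carrier S" for x s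
    using dec[of "act E x (j s)"] that e(4) sc by (simp add: z_def qh(2) j(2))
  have "split_data E S T i q j r z" unfolding split_data_def
    using E S T i q j rl rs qi ri dec zc az by auto
  moreover have "cocycle S T z" unfolding cocycle_def
  proof (intro conjI ballI)
    fix x assume x: "x \<in> ops"
    show "z x \<in> lin K S T" unfolding z_def[abs_def] by (rule lin_comp[OF lin_comp[OF j(1) e(3)[OF x]] rl])
    fix y s assume y: "y \<in> ops" and s: "s \<in> carrier S"
    have "z (opmul x y) s = r (act E x (act E y (j s)))" using x y s sc by (simp add: z_def e(6))
    also have "\<dots> = r (act E x (j (act S y s)) \<oplus>\<^bsub>E\<^esub> i (act T x (z y s)))"
      using x y s sc m(4) zc ic by (simp add: az[OF y s] lin_add[OF e(3)] ih(2))
    also have "\<dots> = z x (act S y s) \<oplus>\<^bsub>T\<^esub> act T x (z y s)"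
      using x y s sc m(4) e(4) t(4) zc ic by (simp add: lin_add[OF rl] ri z_def[of x])
    finally show "z (opmul x y) s = act T x (z y s) \<oplus>\<^bsub>T\<^esub> z x (act S y s)"
      using x y s zc m(4) t(4) by (simp add: vcomm)
  next
    fix s assume s: "s \<in> carrier S"
    show "z opone s = \<zero>\<^bsub>T\<^esub>" using s sc e(5) by (simp add: z_def rs)
    show "rat T (\<lambda>x. z x s)" unfolding z_def by (rule rat_lin[OF rat_act[OF e(2) sc[OF s]] rl e(1) t(1)])
  qed
  ultimately show ?thesis by blast
qed

lemma vmove:
  assumes "module K V" "a \<in> carrier V" "b \<in> carrier V" "c \<in> carrier V" "d \<in> carrier V"
  shows "(a \<ominus>\<^bsub>V\<^esub> b = c \<ominus>\<^bsub>V\<^esub> d) \<longleftrightarrow> (d \<oplus>\<^bsub>V\<^esub> a = b \<oplus>\<^bsub>V\<^esub> c)"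
proof
  note assms [simp]
  assume e: "a \<ominus>\<^bsub>V\<^esub> b = c \<ominus>\<^bsub>V\<^esub> d"
  have "d \<oplus>\<^bsub>V\<^esub> a = (d \<oplus>\<^bsub>V\<^esub> b) \<oplus>\<^bsub>V\<^esub> (a \<ominus>\<^bsub>V\<^esub> b)" by (simp add: a_minus_def vac)
  also have "\<dots> = b \<oplus>\<^bsub>V\<^esub> c" unfolding e by (simp add: a_minus_def vac)
  finally show "d \<oplus>\<^bsub>V\<^esub> a = b \<oplus>\<^bsub>V\<^esub> c" .
next
  note assms [simp]
  assume e: "d \<oplus>\<^bsub>V\<^esub> a = b \<oplus>\<^bsub>V\<^esub> c"
  have "a \<ominus>\<^bsub>V\<^esub> b = \<ominus>\<^bsub>V\<^esub> b \<oplus>\<^bsub>V\<^esub> (\<ominus>\<^bsub>V\<^esub> d \<oplus>\<^bsub>V\<^esub> (d \<oplus>\<^bsub>V\<^esub> a))" by (simp add: a_minus_def vcomm)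
  also have "\<dots> = c \<ominus>\<^bsub>V\<^esub> d" unfolding e by (simp add: a_minus_def vlcomm vcomm)
  finally show "a \<ominus>\<^bsub>V\<^esub> b = c \<ominus>\<^bsub>V\<^esub> d" .
qed

text \<open>
  A homomorphism \<open>f\<close> of extensions over \<open>\<alpha>\<close> has the form \<open>f (j s) = j' s + i' (h s)\<close>, and \<open>f\<close> commutes with
  the operators exactly if \<open>h\<close> exhibits \<open>\<alpha> z - z'\<close> as a coboundary. With \<open>\<alpha>\<close> the identity, a scalar, or
  the addition \<open>T \<times> T \<rightarrow> T\<close>, this computes equivalence, scalar multiplication and the Baer sum.
\<close>
lemma ext_hom_iff:
  assumes Y: "split_data E S T i q j r z" and Y': "split_data E' S T' i' q' j' r' z'" and \<alpha>: "\<alpha> \<in> hmod_hom K H T T'"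
  shows "(\<exists>f\<in>hmod_hom K H E E'. (\<forall>t\<in>carrier T. f (i t) = i' (\<alpha> t)) \<and> (\<forall>e\<in>carrier E. q' (f e) = q e)) \<longleftrightarrow>
    coboundary S T' (\<lambda>x s. \<alpha> (z x s) \<ominus>\<^bsub>T'\<^esub> z' x s)"
proof -
  note d = split_dataD[OF Y] and d' = split_dataD[OF Y']
  note e = hmodule_facts[OF d(1)] and m = hmodule_facts[OF d(2)] and t = hmodule_facts[OF d(3)]
    and e' = hmodule_facts[OF d'(1)] and t' = hmodule_facts[OF d'(3)]
  note [simp] = e(1) m(1) t(1) e'(1) t'(1)
  note ih = homD[OF d(4,3,1)] and qh = homD[OF d(5,1,2)] and ih' = homD[OF d'(4,3,1)] and qh' = homD[OF d'(5,1,2)]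
    and \<alpha>h = homD[OF \<alpha> d(3) d'(3)]
  note cl = lin_closed[OF ih(1)] lin_closed[OF qh(1)] lin_closed[OF ih'(1)] lin_closed[OF qh'(1)] lin_closed[OF \<alpha>h(1)]
    lin_closed[OF d(6)] lin_closed[OF d(7)] lin_closed[OF d'(6)] lin_closed[OF d'(7)] d(13) d'(13) e(4) m(4) t(4) e'(4) t'(4)
  have inj': "a = b" if "i' a = i' b" "a \<in> carrier T'" "b \<in> carrier T'" for a b
    using that d'(11) by metis
  show ?thesis
  proof
    assume "\<exists>f\<in>hmod_hom K H E E'. (\<forall>t\<in>carrier T. f (i t) = i' (\<alpha> t)) \<and> (\<forall>e\<in>carrier E. q' (f e) = q e)"
    then obtain f where f: "f \<in> hmod_hom K H E E'" "\<And>t. t \<in> carrier T \<Longrightarrow> f (i t) = i' (\<alpha> t)"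
       "\<And>e. e \<in> carrier E \<Longrightarrow> q' (f e) = q e" by blast
    note fh = homD[OF f(1) d(1) d'(1)]
    define h where "h s = r' (f (j s))" for s
    have hl: "h \<in> lin K S T'" unfolding h_def[abs_def] by (rule lin_comp[OF lin_comp[OF d(6) fh(1)] d'(7)])
    note cl = cl lin_closed[OF fh(1)] lin_closed[OF hl]
    have fs: "f (j s) = j' s \<oplus>\<^bsub>E'\<^esub> i' (h s)" if "s \<in> carrier S" for s
      using d'(12)[of "f (j s)"] that cl by (simp add: f(3) d(8) h_def)
    have "\<alpha> (z x s) \<ominus>\<^bsub>T'\<^esub> z' x s = act T' x (h s) \<ominus>\<^bsub>T'\<^esub> h (act S x s)" if x: "x \<in> ops" and s: "s \<in> carrier S" for x s
    proof -
      have "f (act E x (j s)) = j' (act S x s) \<oplus>\<^bsub>E'\<^esub> i' (h (act S x s) \<oplus>\<^bsub>T'\<^esub> \<alpha> (z x s))"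
        using x s cl by (simp add: d(14) lin_add[OF fh(1)] fs f(2) lin_add[OF ih'(1)] vassoc)
      moreover have "act E' x (f (j s)) = j' (act S x s) \<oplus>\<^bsub>E'\<^esub> i' (z' x s \<oplus>\<^bsub>T'\<^esub> act T' x (h s))"
        using x s cl by (simp add: fs lin_add[OF e'(3)] d'(14) ih'(2)[symmetric] lin_add[OF ih'(1)] vassoc)
      ultimately have "i' (h (act S x s) \<oplus>\<^bsub>T'\<^esub> \<alpha> (z x s)) = i' (z' x s \<oplus>\<^bsub>T'\<^esub> act T' x (h s))"
        using fh(2)[OF x, of "j s"] x s cl by simp
      then have "h (act S x s) \<oplus>\<^bsub>T'\<^esub> \<alpha> (z x s) = z' x s \<oplus>\<^bsub>T'\<^esub> act T' x (h s)" by (rule inj') (use x s cl in auto)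
      then show ?thesis using vmove[OF t'(1), of "\<alpha> (z x s)" "z' x s" "act T' x (h s)" "h (act S x s)"] x s cl by simp
    qed
    then show "coboundary S T' (\<lambda>x s. \<alpha> (z x s) \<ominus>\<^bsub>T'\<^esub> z' x s)" unfolding coboundary_def using hl by blast
  next
    assume "coboundary S T' (\<lambda>x s. \<alpha> (z x s) \<ominus>\<^bsub>T'\<^esub> z' x s)"
    then obtain h where hl: "h \<in> lin K S T'" and h: "\<And>x s. x \<in> ops \<Longrightarrow> s \<in> carrier S \<Longrightarrow>
       \<alpha> (z x s) \<ominus>\<^bsub>T'\<^esub> z' x s = act T' x (h s) \<ominus>\<^bsub>T'\<^esub> h (act S x s)" by (auto simp: coboundary_def)
    note cl = cl lin_closed[OF hl]
    have h': "h (act S x s) \<oplus>\<^bsub>T'\<^esub> \<alpha> (z x s) = z' x s \<oplus>\<^bsub>T'\<^esub> act T' x (h s)" if "x \<in> ops" "s \<in> carrier S" for x s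
      using h[OF that] vmove[OF t'(1), of "\<alpha> (z x s)" "z' x s" "act T' x (h s)" "h (act S x s)"] that cl by simp
    define f where "f v = j' (q v) \<oplus>\<^bsub>E'\<^esub> i' (\<alpha> (r v) \<oplus>\<^bsub>T'\<^esub> h (q v))" for v
    have fl: "f \<in> lin K E E'" unfolding f_def[abs_def]
      by (rule lin_plus[OF e'(1) lin_comp[OF qh(1) d'(6)] lin_comp[OF lin_plus[OF t'(1) lin_comp[OF d(7) \<alpha>h(1)] lin_comp[OF qh(1) hl]] ih'(1)]])
    have "f \<in> hmod_hom K H E E'"
    proof (rule homI[OF d(1) d'(1) fl])
      fix x v assume x: "x \<in> ops" and v: "v \<in> carrier E"
      define s where "s = q v" define u where "u = r v"
      have s: "s \<in> carrier S" and u: "u \<in> carrier T" and ve: "v = j s \<oplus>\<^bsub>E\<^esub> i u" using v cl d(12) by (auto simp: s_def u_def)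
      have "act E x v = j (act S x s) \<oplus>\<^bsub>E\<^esub> i (z x s \<oplus>\<^bsub>T\<^esub> act T x u)"
        unfolding ve using x s u cl by (simp add: lin_add[OF e(3)] d(14) ih(2)[symmetric] lin_add[OF ih(1)] vassoc)
      then have a: "q (act E x v) = act S x s" "r (act E x v) = z x s \<oplus>\<^bsub>T\<^esub> act T x u"
        using x s u cl by (simp_all add: lin_add[OF qh(1)] lin_add[OF d(7)] d(8-11))
      have "f (act E x v) = j' (act S x s) \<oplus>\<^bsub>E'\<^esub> i' (act T' x (\<alpha> u) \<oplus>\<^bsub>T'\<^esub> (h (act S x s) \<oplus>\<^bsub>T'\<^esub> \<alpha> (z x s)))"
        unfolding f_def a using x s u cl by (simp add: lin_add[OF \<alpha>h(1)] \<alpha>h(2) vac)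
      also have "\<dots> = j' (act S x s) \<oplus>\<^bsub>E'\<^esub> i' (act T' x (\<alpha> u) \<oplus>\<^bsub>T'\<^esub> (z' x s \<oplus>\<^bsub>T'\<^esub> act T' x (h s)))"
        using x s by (simp add: h')
      also have "\<dots> = act E' x (f v)"
        unfolding f_def s_def[symmetric] u_def[symmetric] using x s u cl
        by (simp add: lin_add[OF e'(3)] d'(14) ih'(2)[symmetric] lin_add[OF t'(3)] lin_add[OF ih'(1)] vac)
      finally show "f (act E x v) = act E' x (f v)" .
    qed
    moreover have "f (i v) = i' (\<alpha> v)" if "v \<in> carrier T" for v
      using that cl lin_zero[OF d'(6)] lin_zero[OF hl] by (simp add: f_def d(10,11))
    moreover have "q' (f v) = q v" if "v \<in> carrier E" for v
      using that cl by (simp add: f_def lin_add[OF qh'(1)] d'(8,10))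
    ultimately show "\<exists>f\<in>hmod_hom K H E E'. (\<forall>t\<in>carrier T. f (i t) = i' (\<alpha> t)) \<and> (\<forall>e\<in>carrier E. q' (f e) = q e)" by blast
  qed
qed

text \<open>
  A homomorphic section differs from the linear section \<open>j\<close> by \<open>i \<circ> h\<close>, up to sign the same \<open>h\<close> as in the definition
  of a coboundary.
\<close>
lemma split_iff:
  assumes Y: "split_data E S T i q j r z"
  shows "(\<exists>s\<in>hmod_hom K H S E. \<forall>x\<in>carrier S. q (s x) = x) \<longleftrightarrow> coboundary S T z"
proof -
  note d = split_dataD[OF Y]
  note e = hmodule_facts[OF d(1)] and m = hmodule_facts[OF d(2)] and t = hmodule_facts[OF d(3)]
  note [simp] = e(1) m(1) t(1)
  note ih = homD[OF d(4,3,1)] and qh = homD[OF d(5,1,2)]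
  note cl = lin_closed[OF ih(1)] lin_closed[OF qh(1)] lin_closed[OF d(6)] lin_closed[OF d(7)] d(13) e(4) m(4) t(4)
  have inj: "a = b" if "i a = i b" "a \<in> carrier T" "b \<in> carrier T" for a b using that d(11) by metis
  show ?thesis
  proof
    assume "\<exists>s\<in>hmod_hom K H S E. \<forall>x\<in>carrier S. q (s x) = x"
    then obtain f where f: "f \<in> hmod_hom K H S E" "\<And>s. s \<in> carrier S \<Longrightarrow> q (f s) = s" by blast
    note fh = homD[OF f(1) d(2,1)]
    define h where "h s = (\<ominus> \<one>) \<odot>\<^bsub>T\<^esub> r (f s)" for s
    have hl: "h \<in> lin K S T" unfolding h_def[abs_def] by (rule lin_scale[OF t(1) lin_comp[OF fh(1) d(7)]]) simp
    note cl = cl lin_closed[OF fh(1)] lin_closed[OF hl]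
    have rh: "r (f s) = \<ominus>\<^bsub>T\<^esub> h s" if "s \<in> carrier S" for s using that cl by (simp add: h_def neg_smult)
    have fs: "f s = j s \<oplus>\<^bsub>E\<^esub> i (\<ominus>\<^bsub>T\<^esub> h s)" if "s \<in> carrier S" for s
      using d(12)[of "f s"] that cl by (simp add: f(2) rh)
    have "z x s = act T x (h s) \<ominus>\<^bsub>T\<^esub> h (act S x s)" if x: "x \<in> ops" and s: "s \<in> carrier S" for x s
    proof -
      have "act E x (f s) = j (act S x s) \<oplus>\<^bsub>E\<^esub> i (z x s \<oplus>\<^bsub>T\<^esub> \<ominus>\<^bsub>T\<^esub> act T x (h s))"
        using x s cl by (simp add: fs lin_add[OF e(3)] d(14) ih(2)[symmetric] lin_neg[OF t(3)] lin_add[OF ih(1)] vassoc)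
      then have "i (\<ominus>\<^bsub>T\<^esub> h (act S x s)) = i (z x s \<oplus>\<^bsub>T\<^esub> \<ominus>\<^bsub>T\<^esub> act T x (h s))"
        using fh(2)[OF x s] fs[of "act S x s"] x s cl by simp
      then have "\<ominus>\<^bsub>T\<^esub> h (act S x s) = z x s \<oplus>\<^bsub>T\<^esub> \<ominus>\<^bsub>T\<^esub> act T x (h s)" by (rule inj) (use x s cl in auto)
      then have "act T x (h s) \<oplus>\<^bsub>T\<^esub> \<ominus>\<^bsub>T\<^esub> h (act S x s) = z x s" using x s cl by (simp add: vcomm)
      then show ?thesis by (simp add: a_minus_def)
    qed
    then show "coboundary S T z" unfolding coboundary_def using hl by blast
  next
    assume "coboundary S T z"
    then obtain h where hl: "h \<in> lin K S T" and h: "\<And>x s. x \<in> ops \<Longrightarrow> s \<in> carrier S \<Longrightarrow>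
       z x s = act T x (h s) \<ominus>\<^bsub>T\<^esub> h (act S x s)" by (auto simp: coboundary_def)
    note cl = cl lin_closed[OF hl]
    define f where "f s = j s \<ominus>\<^bsub>E\<^esub> i (h s)" for s
    have fl: "f \<in> lin K S E" unfolding f_def[abs_def] by (rule lin_diff[OF e(1) d(6) lin_comp[OF hl ih(1)]])
    have "f \<in> hmod_hom K H S E"
    proof (rule homI[OF d(2,1) fl])
      fix x s assume x: "x \<in> ops" and s: "s \<in> carrier S"
      have "act E x (f s) = (j (act S x s) \<oplus>\<^bsub>E\<^esub> (i (act T x (h s)) \<ominus>\<^bsub>E\<^esub> i (h (act S x s)))) \<ominus>\<^bsub>E\<^esub> i (act T x (h s))"
        using x s cl by (simp add: f_def lin_minus[OF e(3)] d(14) h lin_minus[OF ih(1)] ih(2))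
      also have "\<dots> = f (act S x s)" using x s cl by (simp add: f_def a_minus_def vac)
      finally show "f (act S x s) = act E x (f s)" by simp
    qed
    moreover have "q (f s) = s" if "s \<in> carrier S" for s using that cl by (simp add: f_def lin_minus[OF qh(1)] d(8,10))
    ultimately show "\<exists>s\<in>hmod_hom K H S E. \<forall>x\<in>carrier S. q (s x) = x" by blast
  qed
qed

definition cocycle_ext :: "('k, 's, 'g, 'a) hmod \<Rightarrow> ('k, 't, 'g, 'a) hmod \<Rightarrow> ('g + ('a \<Rightarrow> 'k) \<Rightarrow> 's \<Rightarrow> 't) \<Rightarrow> ('k, 't \<times> 's, 'g, 'a) hmod" where
  "cocycle_ext S T z = mk (sum_hmod K H T S) (\<lambda>x p. (act T x (fst p) \<oplus>\<^bsub>T\<^esub> z x (snd p), act S x (snd p)))"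

lemma cocycle_ext:
  assumes S: "hmodule K H S" and T: "hmodule K H T" and z: "cocycle S T z"
  shows "split_data (cocycle_ext S T z) S T (\<lambda>t. (t, \<zero>\<^bsub>S\<^esub>)) snd (\<lambda>s. (\<zero>\<^bsub>T\<^esub>, s)) fst z" "carrier (cocycle_ext S T z) = carrier T \<times> carrier S"
proof -
  note m = hmodule_facts[OF S] and t = hmodule_facts[OF T] and z = cocycleD[OF z]
  note [simp] = m(1) t(1)
  note cl = m(4) t(4) z(2)
  let ?V = "sum_hmod K H T S" let ?\<rho> = "\<lambda>x p. (act T x (fst p) \<oplus>\<^bsub>T\<^esub> z x (snd p), act S x (snd p))"
  have V: "module K ?V" by (rule sum_module) auto
  have i1: "(\<lambda>t. (t, \<zero>\<^bsub>S\<^esub>)) \<in> lin K T ?V" and i2: "(\<lambda>s. (\<zero>\<^bsub>T\<^esub>, s)) \<in> lin K S ?V"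
    by (rule linI; simp)+
  have "rep ?V ?\<rho>" unfolding hrep_def
  proof (intro conjI ballI)
    show "module K ?V" by (rule V)
    fix x assume x: "x \<in> ops"
    show "?\<rho> x \<in> lin K ?V ?V"
    proof (rule linI)
      fix p p' assume "p \<in> carrier ?V" "p' \<in> carrier ?V"
      then show "?\<rho> x (p \<oplus>\<^bsub>?V\<^esub> p') = ?\<rho> x p \<oplus>\<^bsub>?V\<^esub> ?\<rho> x p'"
        using x cl by (auto simp: lin_add[OF m(3)] lin_add[OF t(3)] lin_add[OF z(1)] vac)
    next
      fix c p assume "c \<in> carrier K" "p \<in> carrier ?V"
      then show "?\<rho> x (c \<odot>\<^bsub>?V\<^esub> p) = c \<odot>\<^bsub>?V\<^esub> ?\<rho> x p"
        using x cl by (auto simp: lin_smult[OF m(3)] lin_smult[OF t(3)] lin_smult[OF z(1)] smult_add)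
    qed (use x cl in auto)
    fix y p assume y: "y \<in> ops" and "p \<in> carrier ?V"
    then show "?\<rho> (opmul x y) p = ?\<rho> x (?\<rho> y p)"
      using x cl by (auto simp: m(6) t(6) z(4) lin_add[OF t(3)] vac)
  next
    fix p assume p: "p \<in> carrier ?V"
    then show "?\<rho> opone p = p" by (auto simp: m(5) t(5) z(3))
    obtain a b where ab: "p = (a, b)" "a \<in> carrier T" "b \<in> carrier S" using p by auto
    have "rat ?V (\<lambda>x. ((act T x a, \<zero>\<^bsub>S\<^esub>) \<oplus>\<^bsub>?V\<^esub> (z x b, \<zero>\<^bsub>S\<^esub>)) \<oplus>\<^bsub>?V\<^esub> (\<zero>\<^bsub>T\<^esub>, act S x b))"
      by (intro rat_add V rat_lin[OF _ i1] rat_lin[OF _ i2] rat_act m t z ab)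
    then show "rat ?V (\<lambda>x. ?\<rho> x p)"
      by (rule rat_cong) (use ab cl in auto)
  qed
  note k = mk_hmodule[OF this, folded cocycle_ext_def]
  show c: "carrier (cocycle_ext S T z) = carrier T \<times> carrier S" by (simp add: cocycle_ext_def)
  have o: "u \<oplus>\<^bsub>cocycle_ext S T z\<^esub> v = u \<oplus>\<^bsub>?V\<^esub> v" "d \<odot>\<^bsub>cocycle_ext S T z\<^esub> u = d \<odot>\<^bsub>?V\<^esub> u" for u v d by (simp_all add: cocycle_ext_def)
  have l: "lin K (cocycle_ext S T z) W = lin K ?V W" "lin K W (cocycle_ext S T z) = lin K W ?V" for W :: "('k, 'z, 'y) module_scheme"
    by (simp_all add: cocycle_ext_def)
  have ls: "fst \<in> lin K ?V T" "snd \<in> lin K ?V S" by (rule linI; auto)+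
  have h1: "(\<lambda>t. (t, \<zero>\<^bsub>S\<^esub>)) \<in> hmod_hom K H T (cocycle_ext S T z)"
    by (rule homI[OF T k(1)]) (use i1 cl lin_zero[OF z(1)] act_zero[OF S] in \<open>auto simp: l k(2)\<close>)
  have h2: "snd \<in> hmod_hom K H (cocycle_ext S T z) S"
    by (rule homI[OF k(1) S]) (use ls in \<open>auto simp: l c k(2)\<close>)
  show "split_data (cocycle_ext S T z) S T (\<lambda>t. (t, \<zero>\<^bsub>S\<^esub>)) snd (\<lambda>s. (\<zero>\<^bsub>T\<^esub>, s)) fst z"
    unfolding split_data_def using k(1) S T h1 h2 i2 ls cl act_zero[OF T] by (auto simp: l c o k(2))
qed

lemma extensions_iff:
  assumes "hmodule K H S" "hmodule K H T"
  shows "(E, i, q) \<in> Defs.extensions K H S T \<longleftrightarrow> hmodule K H E \<and> i \<in> hmod_hom K H T E \<and> inj_on i (carrier T) \<and>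
     q \<in> hmod_hom K H E S \<and> q ` carrier E = carrier S \<and> i ` carrier T = {e \<in> carrier E. q e = \<zero>\<^bsub>S\<^esub>}"
  by (auto simp: Defs.extensions_def a_kernel_def')

text \<open>
  Different choices are cohomologous, so an arbitrary one will do.
\<close>
definition ext_cocycle where
  "ext_cocycle S T Y = (SOME z. cocycle S T z \<and> (\<exists>j r. split_data (fst Y) S T (fst (snd Y)) (snd (snd Y)) j r z))"

lemma ext_cocycle:
  assumes S: "hmodule K H S" and T: "hmodule K H T" and Y: "(E, i, q) \<in> Defs.extensions K H S T"
  shows "cocycle S T (ext_cocycle S T (E, i, q))" "\<exists>j r. split_data E S T i q j r (ext_cocycle S T (E, i, q))"
proof -
  have "\<exists>z. cocycle S T z \<and> (\<exists>j r. split_data E S T i q j r z)"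
    using ses_split_data[of E S T i q] Y S T unfolding extensions_iff[OF S T] by blast
  then have "cocycle S T (ext_cocycle S T (E, i, q)) \<and> (\<exists>j r. split_data E S T i q j r (ext_cocycle S T (E, i, q)))"
    unfolding ext_cocycle_def fst_conv snd_conv by (rule someI_ex)
  then show "cocycle S T (ext_cocycle S T (E, i, q))" "\<exists>j r. split_data E S T i q j r (ext_cocycle S T (E, i, q))" by auto
qed

lemma id_hom: "hmodule K H T \<Longrightarrow> (\<lambda>t. t) \<in> hmod_hom K H T T"
  by (rule homI) (auto simp: lin_id)

lemma equiv_iff:
  assumes S: "hmodule K H S" and T: "hmodule K H T" and Y: "(E, i, q) \<in> Defs.extensions K H S T" and Y': "(E', i', q') \<in> Defs.extensions K H S T"
  shows "((E, i, q), (E', i', q')) \<in> ext_equiv K H S T \<longleftrightarrow> cohomologous S T (ext_cocycle S T (E, i, q)) (ext_cocycle S T (E', i', q'))"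
proof -
  obtain j r j' r' where "split_data E S T i q j r (ext_cocycle S T (E, i, q))" "split_data E' S T i' q' j' r' (ext_cocycle S T (E', i', q'))"
    using ext_cocycle(2)[OF S T Y] ext_cocycle(2)[OF S T Y'] by blast
  from ext_hom_iff[OF this id_hom[OF T]] show ?thesis using Y Y' by (simp add: ext_equiv_def)
qed

lemma split_ext_iff:
  assumes S: "hmodule K H S" and T: "hmodule K H T" and Y: "(E, i, q) \<in> Defs.extensions K H S T"
  shows "split_ext K H S (E, i, q) \<longleftrightarrow> coboundary S T (ext_cocycle S T (E, i, q))"
proof -
  obtain j r where "split_data E S T i q j r (ext_cocycle S T (E, i, q))" using ext_cocycle(2)[OF S T Y] by blast
  from split_iff[OF this] show ?thesis by (simp add: split_ext_def)
qed

lemma scale_iff: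
  assumes S: "hmodule K H S" and T: "hmodule K H T" and Y: "(E, i, q) \<in> Defs.extensions K H S T" and Y': "(E', i', q') \<in> Defs.extensions K H S T"
    and c: "c \<in> carrier K"
  shows "ext_scale K H T c (E, i, q) (E', i', q') \<longleftrightarrow> cohomologous S T (\<lambda>x s. c \<odot>\<^bsub>T\<^esub> ext_cocycle S T (E, i, q) x s) (ext_cocycle S T (E', i', q'))"
proof -
  obtain j r j' r' where "split_data E S T i q j r (ext_cocycle S T (E, i, q))" "split_data E' S T i' q' j' r' (ext_cocycle S T (E', i', q'))"
    using ext_cocycle(2)[OF S T Y] ext_cocycle(2)[OF S T Y'] by blast
  from ext_hom_iff[OF this scalar_hom[OF T c]] show ?thesis by (simp add: ext_scale_def)
qed

text \<open>
  The fibre product of two extensions of \<open>S\<close> by \<open>T\<close> is an extension by \<open>T \<times> T\<close>, with the pair of cocycles as its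
  cocycle. The Baer sum is its push-out along the addition of \<open>T\<close>.
\<close>
lemma baer_split_data:
  assumes Y: "split_data E S T i q j r z" and Y': "split_data E' S T i' q' j' r' z'"
  defines "P \<equiv> {(e, e') \<in> carrier E \<times> carrier E'. q e = q' e'}"
  shows "split_data (sub_hmod K H (sum_hmod K H E E') P) S (sum_hmod K H T T) (\<lambda>p. (i (fst p), i' (snd p))) (\<lambda>e. q (fst e))
    (\<lambda>s. (j s, j' s)) (\<lambda>e. (r (fst e), r' (snd e))) (\<lambda>x s. (z x s, z' x s))"
proof -
  note d = split_dataD[OF Y] and d' = split_dataD[OF Y']
  note e = hmodule_facts[OF d(1)] and m = hmodule_facts[OF d(2)] and t = hmodule_facts[OF d(3)] and e' = hmodule_facts[OF d'(1)]
  note [simp] = e(1) m(1) t(1) e'(1)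
  note ih = homD[OF d(4,3,1)] and qh = homD[OF d(5,1,2)] and ih' = homD[OF d'(4,3,1)] and qh' = homD[OF d'(5,1,2)]
  note cl = lin_closed[OF ih(1)] lin_closed[OF qh(1)] lin_closed[OF ih'(1)] lin_closed[OF qh'(1)]
    lin_closed[OF d(6)] lin_closed[OF d(7)] lin_closed[OF d'(6)] lin_closed[OF d'(7)] d(13) d'(13) e(4) m(4) t(4) e'(4)
  let ?EE = "sum_hmod K H E E'" let ?TT = "sum_hmod K H T T" let ?P = "sub_hmod K H ?EE P"
  note EE = sum_hmod[OF d(1) d'(1)] and TT = sum_hmod[OF d(3) d(3)]
  have mEE: "module K ?EE" by (rule sum_module) auto
  have P: "hsubmodule K H P ?EE" unfolding sub_iff[OF EE(1)] submodule_iff[OF mEE]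
  proof (intro conjI ballI)
    show "\<zero>\<^bsub>?EE\<^esub> \<in> P" using lin_zero[OF qh(1)] lin_zero[OF qh'(1)] by (simp add: P_def)
    fix u assume u: "u \<in> P"
    fix v assume v: "v \<in> P"
    show "u \<oplus>\<^bsub>?EE\<^esub> v \<in> P" using u v by (auto simp: P_def lin_add[OF qh(1)] lin_add[OF qh'(1)])
  next
    fix c u assume "c \<in> carrier K" "u \<in> P"
    then show "c \<odot>\<^bsub>?EE\<^esub> u \<in> P" by (auto simp: P_def lin_smult[OF qh(1)] lin_smult[OF qh'(1)])
  next
    fix x u assume "x \<in> ops" "u \<in> P"
    then show "act ?EE x u \<in> P" using cl by (auto simp: P_def EE(2) qh(2) qh'(2))
  qed (auto simp: P_def)
  note sP = sub_hmod[OF EE(1) P]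
  have Pc: "fst p \<in> carrier E" "snd p \<in> carrier E'" "q' (snd p) = q (fst p)" if "p \<in> P" for p using that by (auto simp: P_def)
  have aP: "act ?P x p = (act E x (fst p), act E' x (snd p))" if "x \<in> ops" "p \<in> P" for x p
    using sP(2)[OF that] EE(2)[OF that(1) Pc(1,2)[OF that(2)]] by simp
  have 1: "(\<lambda>p. (i (fst p), i' (snd p))) \<in> hmod_hom K H ?TT ?P"
  proof (rule homI[OF TT(1) sP(1)])
    show "(\<lambda>p. (i (fst p), i' (snd p))) \<in> lin K ?TT ?P"
      by (rule linI) (use cl in \<open>auto simp: P_def d(10) d'(10) lin_add[OF ih(1)] lin_add[OF ih'(1)] lin_smult[OF ih(1)] lin_smult[OF ih'(1)]\<close>)
    fix x p assume x: "x \<in> ops" and "p \<in> carrier ?TT"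
    then obtain a b where ab: "p = (a, b)" "a \<in> carrier T" "b \<in> carrier T" by auto
    have "(i a, i' b) \<in> P" using ab cl by (simp add: P_def d(10) d'(10))
    then show "(i (fst (act ?TT x p)), i' (snd (act ?TT x p))) = act ?P x (i (fst p), i' (snd p))"
      using x ab by (simp add: TT(2) aP ih(2) ih'(2))
  qed
  have 2: "(\<lambda>e. q (fst e)) \<in> hmod_hom K H ?P S"
    by (rule homI[OF sP(1) d(2)], rule linI) (use cl Pc in \<open>auto simp: aP lin_add[OF qh(1)] lin_smult[OF qh(1)] qh(2)\<close>)
  have 3: "(\<lambda>s. (j s, j' s)) \<in> lin K S ?P"
    by (rule linI) (use cl in \<open>auto simp: P_def d(8) d'(8) lin_add[OF d(6)] lin_add[OF d'(6)] lin_smult[OF d(6)] lin_smult[OF d'(6)]\<close>)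
  have 4: "(\<lambda>e. (r (fst e), r' (snd e))) \<in> lin K ?P ?TT"
    by (rule linI) (use cl Pc in \<open>auto simp: lin_add[OF d(7)] lin_add[OF d'(7)] lin_smult[OF d(7)] lin_smult[OF d'(7)]\<close>)
  have sPm: "(j s, j' s) \<in> P" if "s \<in> carrier S" for s using that cl by (simp add: P_def d(8) d'(8))
  have dec: "j (q (fst p)) \<oplus>\<^bsub>E\<^esub> i (r (fst p)) = fst p" "j' (q (fst p)) \<oplus>\<^bsub>E'\<^esub> i' (r' (snd p)) = snd p" if "p \<in> P" for p
    using d(12)[OF Pc(1)[OF that]] d'(12)[OF Pc(2)[OF that]] Pc(3)[OF that] by simp_all
  show ?thesis unfolding split_data_def
  proof (intro conjI ballI)
    fix e assume "e \<in> carrier ?P"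
    then show "e = (j (q (fst e)), j' (q (fst e))) \<oplus>\<^bsub>?P\<^esub> (i (fst (r (fst e), r' (snd e))), i' (snd (r (fst e), r' (snd e))))"
      using dec[of e] by simp
  qed (use sP(1) d(2) TT(1) 1 2 3 4 cl sPm in \<open>auto simp: d(8-11) d'(8-11) aP d(14) d'(14)\<close>)
qed

lemma baer_iff:
  assumes S: "hmodule K H S" and T: "hmodule K H T" and Y: "(E, i, q) \<in> Defs.extensions K H S T" and Y': "(E', i', q') \<in> Defs.extensions K H S T"
    and Y'': "(E'', i'', q'') \<in> Defs.extensions K H S T"
  shows "baer_sum K H T (E, i, q) (E', i', q') (E'', i'', q'') \<longleftrightarrow>
    cohomologous S T (\<lambda>x s. ext_cocycle S T (E, i, q) x s \<oplus>\<^bsub>T\<^esub> ext_cocycle S T (E', i', q') x s) (ext_cocycle S T (E'', i'', q''))"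
proof -
  obtain j r j' r' j'' r'' where s: "split_data E S T i q j r (ext_cocycle S T (E, i, q))" "split_data E' S T i' q' j' r' (ext_cocycle S T (E', i', q'))"
    "split_data E'' S T i'' q'' j'' r'' (ext_cocycle S T (E'', i'', q''))"
    using ext_cocycle(2)[OF S T Y] ext_cocycle(2)[OF S T Y'] ext_cocycle(2)[OF S T Y''] by blast
  note t = hmodule_facts[OF T]
  have a: "(\<lambda>p. fst p \<oplus>\<^bsub>T\<^esub> snd p) \<in> hmod_hom K H (sum_hmod K H T T) T"
    by (rule homI[OF sum_hmod(1)[OF T T] T], rule linI)
      (use t in \<open>auto simp: vac smult_add sum_hmod(2)[OF T T] lin_add[OF t(3)]\<close>)
  show ?thesis
    using ext_hom_iff[OF baer_split_data[OF s(1,2)] s(3) a]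
    by (simp add: baer_sum_def Let_def)
qed

text \<open>
  Equivalence classes of extensions are indexed by cocycles; \<open>ext_class_eq\<close> below identifies the fibres of this indexing.
\<close>
definition ext_class where "ext_class S T z = {Y \<in> Defs.extensions K H S T. cohomologous S T (ext_cocycle S T Y) z}"

context
  fixes S :: "('k, 's, 'g, 'a) hmod" and T :: "('k, 't, 'g, 'a) hmod"
  assumes S: "hmodule K H S" and T: "hmodule K H T"
begin

lemma ext_cocycle_cocycle: "Y \<in> Defs.extensions K H S T \<Longrightarrow> cocycle S T (ext_cocycle S T Y)"
  using ext_cocycle(1)[OF S T] by (cases Y) auto
lemma equiv_iff': "Y \<in> Defs.extensions K H S T \<Longrightarrow> Y' \<in> Defs.extensions K H S T \<Longrightarrow> (Y, Y') \<in> ext_equiv K H S T \<longleftrightarrow> cohomologous S T (ext_cocycle S T Y) (ext_cocycle S T Y')"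
  by (cases Y, cases Y') (simp only: equiv_iff[OF S T])

lemma ext_exists: "cocycle S T z \<Longrightarrow> \<exists>Y\<in>Defs.extensions K H S T. cohomologous S T (ext_cocycle S T Y) z"
proof -
  assume z: "cocycle S T z"
  note s = cocycle_ext[OF S T z]
  note d = split_dataD[OF s(1)]
  note m = hmodule_facts[OF S] and t = hmodule_facts[OF T]
  let ?i = "\<lambda>t. (t, \<zero>\<^bsub>S\<^esub>)"
  have Y: "(cocycle_ext S T z, ?i, snd) \<in> Defs.extensions K H S T"
    unfolding extensions_iff[OF S T]
  proof (intro conjI)
    show "snd ` carrier (cocycle_ext S T z) = carrier S" using vzero_closed[OF t(1)] by (auto simp: s(2) snd_image_times)
    show "?i ` carrier T = {e \<in> carrier (cocycle_ext S T z). snd e = \<zero>\<^bsub>S\<^esub>}" using m(1) by (auto simp: s(2))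
    show "inj_on ?i (carrier T)" by (auto simp: inj_on_def)
  qed (rule d)+
  obtain j r where s': "split_data (cocycle_ext S T z) S T ?i snd j r (ext_cocycle S T (cocycle_ext S T z, ?i, snd))"
    using ext_cocycle(2)[OF S T Y] by blast
  have "cohomologous S T (ext_cocycle S T (cocycle_ext S T z, ?i, snd)) z"
    using ext_hom_iff[OF s' s(1) id_hom[OF T]] id_hom[OF d(1)] by auto
  then show ?thesis using Y by blast
qed

lemma ext_class_nonempty: "cocycle S T z \<Longrightarrow> ext_class S T z \<noteq> {}" using ext_exists[of z] unfolding ext_class_def by blast

lemma ext_class_eq: "cocycle S T z \<Longrightarrow> cocycle S T z' \<Longrightarrow> ext_class S T z = ext_class S T z' \<longleftrightarrow> cohomologous S T z z'"
proof
  assume z: "cocycle S T z" "cocycle S T z'" and "ext_class S T z = ext_class S T z'"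
  then obtain Y where Y: "Y \<in> Defs.extensions K H S T" "cohomologous S T (ext_cocycle S T Y) z" "cohomologous S T (ext_cocycle S T Y) z'"
    using ext_exists[OF z(1)] unfolding ext_class_def by blast
  show "cohomologous S T z z'"
    by (rule cohomologous_trans[OF S T z(1) ext_cocycle_cocycle[OF Y(1)] z(2) cohomologous_sym[OF S T ext_cocycle_cocycle[OF Y(1)] z(1) Y(2)] Y(3)])
next
  assume z: "cocycle S T z" "cocycle S T z'" and c: "cohomologous S T z z'"
  note c' = cohomologous_sym[OF S T z c]
  show "ext_class S T z = ext_class S T z'"
    using cohomologous_trans[OF S T ext_cocycle_cocycle z _ c] cohomologous_trans[OF S T ext_cocycle_cocycle z(2,1) _ c'] by (auto simp: ext_class_def)
qed

lemma class_eq_ext_class: "Y \<in> Defs.extensions K H S T \<Longrightarrow> ext_equiv K H S T `` {Y} = ext_class S T (ext_cocycle S T Y)"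
proof -
  assume Y: "Y \<in> Defs.extensions K H S T"
  have "(Y, Y') \<in> ext_equiv K H S T \<Longrightarrow> Y' \<in> Defs.extensions K H S T" for Y' by (cases Y, cases Y') (auto simp: ext_equiv_def)
  note r = this
  show ?thesis
  proof (rule Set.set_eqI)
    fix Y'
    show "Y' \<in> ext_equiv K H S T `` {Y} \<longleftrightarrow> Y' \<in> ext_class S T (ext_cocycle S T Y)"
    proof (cases "Y' \<in> Defs.extensions K H S T")
      case True
      then show ?thesis
        using equiv_iff'[OF Y True] cohomologous_sym[OF S T ext_cocycle_cocycle[OF Y] ext_cocycle_cocycle[OF True]] cohomologous_sym[OF S T ext_cocycle_cocycle[OF True] ext_cocycle_cocycle[OF Y]]
        unfolding ext_class_def by blast
    next
      case False
      then show ?thesis using r unfolding ext_class_def by blast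
    qed
  qed
qed

lemma Ext1_carrier: "carrier (Ext1 K H S T) = {ext_class S T z | z. cocycle S T z}"
proof
  have c: "carrier (Ext1 K H S T) = Defs.extensions K H S T // ext_equiv K H S T" by (simp add: Ext1_def)
  show "carrier (Ext1 K H S T) \<subseteq> {ext_class S T z | z. cocycle S T z}"
  proof
    fix C assume "C \<in> carrier (Ext1 K H S T)"
    then have "C \<in> Defs.extensions K H S T // ext_equiv K H S T" by (simp only: c)
    then obtain Y where Y: "C = ext_equiv K H S T `` {Y}" "Y \<in> Defs.extensions K H S T" by (rule quotientE)
    then show "C \<in> {ext_class S T z | z. cocycle S T z}" using class_eq_ext_class[OF Y(2)] ext_cocycle_cocycle[OF Y(2)] by blast
  qed
  show "{ext_class S T z | z. cocycle S T z} \<subseteq> carrier (Ext1 K H S T)"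
  proof
    fix C assume "C \<in> {ext_class S T z | z. cocycle S T z}"
    then obtain z where z: "cocycle S T z" "C = ext_class S T z" by blast
    obtain Y where Y: "Y \<in> Defs.extensions K H S T" "cohomologous S T (ext_cocycle S T Y) z" using ext_exists[OF z(1)] by blast
    then have "C = ext_equiv K H S T `` {Y}" using class_eq_ext_class[OF Y(1)] ext_class_eq[OF ext_cocycle_cocycle[OF Y(1)] z(1)] z by simp
    then show "C \<in> carrier (Ext1 K H S T)" unfolding c using Y(1) by (simp add: quotientI)
  qed
qed

lemma Ext1_zero: "\<zero>\<^bsub>Ext1 K H S T\<^esub> = ext_class S T (\<lambda>x s. \<zero>\<^bsub>T\<^esub>)"
proof -
  have "split_ext K H S Y \<longleftrightarrow> cohomologous S T (ext_cocycle S T Y) (\<lambda>x s. \<zero>\<^bsub>T\<^esub>)" if Y: "Y \<in> Defs.extensions K H S T" for Y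
  proof -
    have "split_ext K H S Y \<longleftrightarrow> coboundary S T (ext_cocycle S T Y)" using split_ext_iff[OF S T] Y by (cases Y) auto
    also have "\<dots> \<longleftrightarrow> cohomologous S T (ext_cocycle S T Y) (\<lambda>x s. \<zero>\<^bsub>T\<^esub>)"
      using coboundary_cong[of S T "ext_cocycle S T Y" "\<lambda>x s. ext_cocycle S T Y x s \<ominus>\<^bsub>T\<^esub> \<zero>\<^bsub>T\<^esub>"] coboundary_cong[of S T "\<lambda>x s. ext_cocycle S T Y x s \<ominus>\<^bsub>T\<^esub> \<zero>\<^bsub>T\<^esub>" "ext_cocycle S T Y"]
        cocycleD(2)[OF ext_cocycle_cocycle[OF Y]] hmodule_facts(1)[OF T] by auto
    finally show ?thesis .
  qed
  then have "{Y \<in> Defs.extensions K H S T. split_ext K H S Y} = ext_class S T (\<lambda>x s. \<zero>\<^bsub>T\<^esub>)"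
    unfolding ext_class_def by blast
  then show ?thesis by (simp add: Ext1_def)
qed

lemma Ext1_add:
  assumes z: "cocycle S T z" and z': "cocycle S T z'"
  shows "ext_class S T z \<oplus>\<^bsub>Ext1 K H S T\<^esub> ext_class S T z' = ext_class S T (\<lambda>x s. z x s \<oplus>\<^bsub>T\<^esub> z' x s)"
proof -
  let ?z = "ext_cocycle S T"
  have b: "baer_sum K H T Y Y' Z \<longleftrightarrow> cohomologous S T (\<lambda>x s. ?z Y x s \<oplus>\<^bsub>T\<^esub> ?z Y' x s) (?z Z)"
    if "Y \<in> Defs.extensions K H S T" "Y' \<in> Defs.extensions K H S T" "Z \<in> Defs.extensions K H S T" for Y Y' Z
    using that by (cases Y, cases Y', cases Z) (simp only: baer_iff[OF S T])
  have e: "baer_sum K H T Y Y' Z \<longleftrightarrow> cohomologous S T (?z Z) (\<lambda>x s. z x s \<oplus>\<^bsub>T\<^esub> z' x s)"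
    if Y: "Y \<in> ext_class S T z" and Y': "Y' \<in> ext_class S T z'" and Z: "Z \<in> Defs.extensions K H S T" for Y Y' Z
  proof -
    have Ye: "Y \<in> Defs.extensions K H S T" "cohomologous S T (?z Y) z" and Ye': "Y' \<in> Defs.extensions K H S T" "cohomologous S T (?z Y') z'"
      using Y Y' unfolding ext_class_def by blast+
    note c = ext_cocycle_cocycle[OF Ye(1)] ext_cocycle_cocycle[OF Ye'(1)] ext_cocycle_cocycle[OF Z]
    note s1 = cocycle_add[OF S T c(1,2)] and s2 = cocycle_add[OF S T z z']
    have d: "cohomologous S T (\<lambda>x s. ?z Y x s \<oplus>\<^bsub>T\<^esub> ?z Y' x s) (\<lambda>x s. z x s \<oplus>\<^bsub>T\<^esub> z' x s)"
      by (rule cohomologous_add[OF S T c(1,2) z z' Ye(2) Ye'(2)])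
    show ?thesis unfolding b[OF Ye(1) Ye'(1) Z]
    proof
      assume a: "cohomologous S T (\<lambda>x s. ?z Y x s \<oplus>\<^bsub>T\<^esub> ?z Y' x s) (?z Z)"
      show "cohomologous S T (?z Z) (\<lambda>x s. z x s \<oplus>\<^bsub>T\<^esub> z' x s)"
        by (rule cohomologous_trans[OF S T c(3) s1 s2 cohomologous_sym[OF S T s1 c(3) a] d])
    next
      assume a: "cohomologous S T (?z Z) (\<lambda>x s. z x s \<oplus>\<^bsub>T\<^esub> z' x s)"
      show "cohomologous S T (\<lambda>x s. ?z Y x s \<oplus>\<^bsub>T\<^esub> ?z Y' x s) (?z Z)"
        by (rule cohomologous_trans[OF S T s1 s2 c(3) d cohomologous_sym[OF S T c(3) s2 a]])
    qed
  qed
  obtain Y Y' where "Y \<in> ext_class S T z" "Y' \<in> ext_class S T z'" using ext_class_nonempty[OF z] ext_class_nonempty[OF z'] by blast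
  then have "{Z \<in> Defs.extensions K H S T. \<exists>Y\<in>ext_class S T z. \<exists>Y'\<in>ext_class S T z'. baer_sum K H T Y Y' Z} = ext_class S T (\<lambda>x s. z x s \<oplus>\<^bsub>T\<^esub> z' x s)"
    using e unfolding ext_class_def[of S T "\<lambda>x s. z x s \<oplus>\<^bsub>T\<^esub> z' x s"] by blast
  then show ?thesis by (simp add: Ext1_def)
qed

lemma Ext1_smult:
  assumes z: "cocycle S T z" and k: "k \<in> carrier K"
  shows "k \<odot>\<^bsub>Ext1 K H S T\<^esub> ext_class S T z = ext_class S T (\<lambda>x s. k \<odot>\<^bsub>T\<^esub> z x s)"
proof -
  let ?z = "ext_cocycle S T"
  have b: "ext_scale K H T k Y Z \<longleftrightarrow> cohomologous S T (\<lambda>x s. k \<odot>\<^bsub>T\<^esub> ?z Y x s) (?z Z)"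
    if "Y \<in> Defs.extensions K H S T" "Z \<in> Defs.extensions K H S T" for Y Z
    using that k by (cases Y, cases Z) (simp only: scale_iff[OF S T])
  have e: "ext_scale K H T k Y Z \<longleftrightarrow> cohomologous S T (?z Z) (\<lambda>x s. k \<odot>\<^bsub>T\<^esub> z x s)"
    if Y: "Y \<in> ext_class S T z" and Z: "Z \<in> Defs.extensions K H S T" for Y Z
  proof -
    have Ye: "Y \<in> Defs.extensions K H S T" "cohomologous S T (?z Y) z" using Y unfolding ext_class_def by blast+
    note c = ext_cocycle_cocycle[OF Ye(1)] ext_cocycle_cocycle[OF Z]
    note s1 = cocycle_smult[OF S T c(1) k] and s2 = cocycle_smult[OF S T z k]
    have d: "cohomologous S T (\<lambda>x s. k \<odot>\<^bsub>T\<^esub> ?z Y x s) (\<lambda>x s. k \<odot>\<^bsub>T\<^esub> z x s)"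
      by (rule cohomologous_smult[OF S T c(1) z Ye(2) k])
    show ?thesis unfolding b[OF Ye(1) Z]
    proof
      assume a: "cohomologous S T (\<lambda>x s. k \<odot>\<^bsub>T\<^esub> ?z Y x s) (?z Z)"
      show "cohomologous S T (?z Z) (\<lambda>x s. k \<odot>\<^bsub>T\<^esub> z x s)"
        by (rule cohomologous_trans[OF S T c(2) s1 s2 cohomologous_sym[OF S T s1 c(2) a] d])
    next
      assume a: "cohomologous S T (?z Z) (\<lambda>x s. k \<odot>\<^bsub>T\<^esub> z x s)"
      show "cohomologous S T (\<lambda>x s. k \<odot>\<^bsub>T\<^esub> ?z Y x s) (?z Z)"
        by (rule cohomologous_trans[OF S T s1 s2 c(2) d cohomologous_sym[OF S T c(2) s2 a]])
    qed
  qed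
  obtain Y where "Y \<in> ext_class S T z" using ext_class_nonempty[OF z] by blast
  then have "{Z \<in> Defs.extensions K H S T. \<exists>Y\<in>ext_class S T z. ext_scale K H T k Y Z} = ext_class S T (\<lambda>x s. k \<odot>\<^bsub>T\<^esub> z x s)"
    using e unfolding ext_class_def[of S T "\<lambda>x s. k \<odot>\<^bsub>T\<^esub> z x s"] by blast
  then show ?thesis by (simp add: Ext1_def)
qed

lemma ext_class_cong: "(\<And>x s. x \<in> ops \<Longrightarrow> s \<in> carrier S \<Longrightarrow> z x s = z' x s) \<Longrightarrow> ext_class S T z = ext_class S T z'"
  unfolding ext_class_def using coboundary_cong[of S T] by (intro Collect_cong conj_cong refl iffI) (erule coboundary_cong, simp)+

text \<open>
  The structure of an abelian monoid is what is needed to compute with finite sums in \<open>Ext\<^sup>1(S, T)\<close>; it is inherited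
  from the cocycles.
\<close>
lemma Ext1_abelian: "abelian_monoid (Ext1 K H S T)"
proof (rule abelian_monoidI)
  note t = hmodule_facts(1)[OF T] and [simp] = hmodule_facts(1)[OF T]
  show "\<zero>\<^bsub>Ext1 K H S T\<^esub> \<in> carrier (Ext1 K H S T)" using cocycle_zero[OF S T] by (auto simp: Ext1_carrier Ext1_zero)
  fix C D assume "C \<in> carrier (Ext1 K H S T)" "D \<in> carrier (Ext1 K H S T)"
  then obtain z w where z: "cocycle S T z" "C = ext_class S T z" and w: "cocycle S T w" "D = ext_class S T w" by (auto simp: Ext1_carrier)
  show "C \<oplus>\<^bsub>Ext1 K H S T\<^esub> D \<in> carrier (Ext1 K H S T)"
    using cocycle_add[OF S T z(1) w(1)] by (auto simp: Ext1_carrier Ext1_add z w)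
  show "C \<oplus>\<^bsub>Ext1 K H S T\<^esub> D = D \<oplus>\<^bsub>Ext1 K H S T\<^esub> C"
    unfolding z(2) w(2) Ext1_add[OF z(1) w(1)] Ext1_add[OF w(1) z(1)]
    by (rule ext_class_cong) (use cocycleD(2)[OF z(1)] cocycleD(2)[OF w(1)] in \<open>simp add: vcomm\<close>)
  show "\<zero>\<^bsub>Ext1 K H S T\<^esub> \<oplus>\<^bsub>Ext1 K H S T\<^esub> C = C"
    unfolding z(2) Ext1_zero Ext1_add[OF cocycle_zero[OF S T] z(1)]
    by (rule ext_class_cong) (use cocycleD(2)[OF z(1)] in simp)
  fix F assume "F \<in> carrier (Ext1 K H S T)"
  then obtain y where y: "cocycle S T y" "F = ext_class S T y" by (auto simp: Ext1_carrier)
  show "C \<oplus>\<^bsub>Ext1 K H S T\<^esub> D \<oplus>\<^bsub>Ext1 K H S T\<^esub> F = C \<oplus>\<^bsub>Ext1 K H S T\<^esub> (D \<oplus>\<^bsub>Ext1 K H S T\<^esub> F)"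
    unfolding z(2) w(2) y(2) Ext1_add[OF z(1) w(1)] Ext1_add[OF w(1) y(1)]
      Ext1_add[OF cocycle_add[OF S T z(1) w(1)] y(1)] Ext1_add[OF z(1) cocycle_add[OF S T w(1) y(1)]]
    by (rule ext_class_cong) (use cocycleD(2)[OF z(1)] cocycleD(2)[OF w(1)] cocycleD(2)[OF y(1)] in \<open>simp add: vassoc\<close>)
qed

lemma ext_class_zero_iff: "cocycle S T z \<Longrightarrow> ext_class S T z = \<zero>\<^bsub>Ext1 K H S T\<^esub> \<longleftrightarrow> coboundary S T z"
proof -
  assume z: "cocycle S T z"
  show ?thesis unfolding Ext1_zero ext_class_eq[OF z cocycle_zero[OF S T]]
    using coboundary_cong[of S T z "\<lambda>x s. z x s \<ominus>\<^bsub>T\<^esub> \<zero>\<^bsub>T\<^esub>"] coboundary_cong[of S T "\<lambda>x s. z x s \<ominus>\<^bsub>T\<^esub> \<zero>\<^bsub>T\<^esub>" z]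
        cocycleD(2)[OF z] hmodule_facts(1)[OF T] by auto
qed

lemma Ext1_nontrivial_cocycle:
  assumes "Ext1_nontrivial K H S T" shows "\<exists>z. cocycle S T z \<and> \<not> coboundary S T z"
proof (rule ccontr)
  assume n: "\<not> ?thesis"
  have "carrier (Ext1 K H S T) = {\<zero>\<^bsub>Ext1 K H S T\<^esub>}"
  proof
    show "carrier (Ext1 K H S T) \<subseteq> {\<zero>\<^bsub>Ext1 K H S T\<^esub>}" using n ext_class_zero_iff by (auto simp: Ext1_carrier)
    show "{\<zero>\<^bsub>Ext1 K H S T\<^esub>} \<subseteq> carrier (Ext1 K H S T)" using cocycle_zero[OF S T] by (auto simp: Ext1_carrier Ext1_zero)
  qed
  then show False using assms by (simp add: Ext1_nontrivial_def)
qed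

lemma Ext1_elem: "C \<in> carrier (Ext1 K H S T) \<Longrightarrow> \<exists>z. cocycle S T z \<and> C = ext_class S T z"
  by (auto simp: Ext1_carrier)

lemma Ext1_sum:
  assumes z: "\<And>i. i < n \<Longrightarrow> cocycle S T (z i)" and c: "\<And>i. i < n \<Longrightarrow> c i \<in> carrier K"
  shows "cocycle S T (\<lambda>x s. \<Oplus>\<^bsub>T\<^esub>i\<in>{..<n::nat}. c i \<odot>\<^bsub>T\<^esub> z i x s)"
    and "(\<Oplus>\<^bsub>Ext1 K H S T\<^esub>i\<in>{..<n}. c i \<odot>\<^bsub>Ext1 K H S T\<^esub> ext_class S T (z i)) =
      ext_class S T (\<lambda>x s. \<Oplus>\<^bsub>T\<^esub>i\<in>{..<n}. c i \<odot>\<^bsub>T\<^esub> z i x s)"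
proof -
  let ?E = "Ext1 K H S T"
  note t = hmodule_facts(1)[OF T]
  interpret E: abelian_monoid ?E by (rule Ext1_abelian)
  have "cocycle S T (\<lambda>x s. \<Oplus>\<^bsub>T\<^esub>i\<in>{..<n}. c i \<odot>\<^bsub>T\<^esub> z i x s) \<and>
    (\<Oplus>\<^bsub>?E\<^esub>i\<in>{..<n}. c i \<odot>\<^bsub>?E\<^esub> ext_class S T (z i)) = ext_class S T (\<lambda>x s. \<Oplus>\<^bsub>T\<^esub>i\<in>{..<n}. c i \<odot>\<^bsub>T\<^esub> z i x s)"
    using z c
  proof (induction n)
    case 0
    show ?case using cocycle_zero[OF S T] t by (simp add: Ext1_zero)
  next
    case (Suc n)
    let ?s = "\<lambda>x s. \<Oplus>\<^bsub>T\<^esub>i\<in>{..<n}. c i \<odot>\<^bsub>T\<^esub> z i x s" and ?n = "\<lambda>x s. c n \<odot>\<^bsub>T\<^esub> z n x s"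
    have IH: "cocycle S T ?s" "(\<Oplus>\<^bsub>?E\<^esub>i\<in>{..<n}. c i \<odot>\<^bsub>?E\<^esub> ext_class S T (z i)) = ext_class S T ?s" using Suc by auto
    have m: "c i \<odot>\<^bsub>?E\<^esub> ext_class S T (z i) \<in> carrier ?E" "cocycle S T (\<lambda>x s. c i \<odot>\<^bsub>T\<^esub> z i x s)" if "i < Suc n" for i
      using cocycle_smult[OF S T Suc.prems[OF that]] Ext1_smult[OF Suc.prems[OF that]] by (auto simp: Ext1_carrier)
    have p: "?n x s \<oplus>\<^bsub>T\<^esub> ?s x s = (\<Oplus>\<^bsub>T\<^esub>i\<in>{..<Suc n}. c i \<odot>\<^bsub>T\<^esub> z i x s)" if "x \<in> ops" "s \<in> carrier S" for x s
      using cocycleD(2)[OF m(2) that] cocycleD(2)[OF IH(1) that] t by (simp add: vsum_Suc vcomm)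
    have "(\<Oplus>\<^bsub>?E\<^esub>i\<in>{..<Suc n}. c i \<odot>\<^bsub>?E\<^esub> ext_class S T (z i)) = c n \<odot>\<^bsub>?E\<^esub> ext_class S T (z n) \<oplus>\<^bsub>?E\<^esub> ext_class S T ?s"
      unfolding lessThan_Suc IH(2)[symmetric] by (rule E.finsum_insert) (use m in auto)
    also have "\<dots> = ext_class S T (\<lambda>x s. ?n x s \<oplus>\<^bsub>T\<^esub> ?s x s)"
      unfolding Ext1_smult[OF Suc.prems[OF lessI]] by (rule Ext1_add[OF m(2)[OF lessI] IH(1)])
    also have "\<dots> = ext_class S T (\<lambda>x s. \<Oplus>\<^bsub>T\<^esub>i\<in>{..<Suc n}. c i \<odot>\<^bsub>T\<^esub> z i x s)" by (rule ext_class_cong[OF p])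
    finally show ?case using cocycle_cong[OF cocycle_add[OF S T m(2)[OF lessI] IH(1)] p S] by simp
  qed
  then show "cocycle S T (\<lambda>x s. \<Oplus>\<^bsub>T\<^esub>i\<in>{..<n}. c i \<odot>\<^bsub>T\<^esub> z i x s)"
    "(\<Oplus>\<^bsub>?E\<^esub>i\<in>{..<n}. c i \<odot>\<^bsub>?E\<^esub> ext_class S T (z i)) = ext_class S T (\<lambda>x s. \<Oplus>\<^bsub>T\<^esub>i\<in>{..<n}. c i \<odot>\<^bsub>T\<^esub> z i x s)" by blast+
qed

lemma independent_cocycles_exist:
  assumes "dim_ge K (Ext1 K H S T) n"
  shows "\<exists>z. indep_cocycles S T n z"
proof -
  let ?E = "Ext1 K H S T"
  interpret E: abelian_monoid ?E by (rule Ext1_abelian)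
  obtain B where B: "B \<subseteq> carrier ?E" "finite B" "card B = n" and
    ind: "\<And>c. c \<in> B \<rightarrow> carrier K \<Longrightarrow> (\<Oplus>\<^bsub>?E\<^esub>b\<in>B. c b \<odot>\<^bsub>?E\<^esub> b) = \<zero>\<^bsub>?E\<^esub> \<Longrightarrow> \<forall>b\<in>B. c b = \<zero>"
    using assms by (auto simp: dim_ge_def)
  obtain e where e: "bij_betw e {..<n} B"
    using ex_bij_betw_nat_finite[OF B(2)] B(3) by (auto simp: atLeast0LessThan)
  then have eB: "e ` {..<n} = B" "inj_on e {..<n}" by (auto simp: bij_betw_def)
  have "\<exists>z. cocycle S T z \<and> e i = ext_class S T z" if "i < n" for i
  proof (rule Ext1_elem)
    show "e i \<in> carrier ?E" using that eB(1) B(1) by blast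
  qed
  then have "\<exists>z. \<forall>i. i < n \<longrightarrow> cocycle S T (z i) \<and> e i = ext_class S T (z i)" by (intro choice) blast
  then obtain z where z: "\<And>i. i < n \<Longrightarrow> cocycle S T (z i)" "\<And>i. i < n \<Longrightarrow> e i = ext_class S T (z i)" by blast
  have "\<forall>i<n. c i = \<zero>"
    if c: "\<And>i. i < n \<Longrightarrow> c i \<in> carrier K" and co: "coboundary S T (\<lambda>x s. \<Oplus>\<^bsub>T\<^esub>i\<in>{..<n}. c i \<odot>\<^bsub>T\<^esub> z i x s)" for c
  proof -
    have sum: "cocycle S T (\<lambda>x s. \<Oplus>\<^bsub>T\<^esub>i\<in>{..<n}. c i \<odot>\<^bsub>T\<^esub> z i x s)"
      "(\<Oplus>\<^bsub>?E\<^esub>i\<in>{..<n}. c i \<odot>\<^bsub>?E\<^esub> ext_class S T (z i)) = ext_class S T (\<lambda>x s. \<Oplus>\<^bsub>T\<^esub>i\<in>{..<n}. c i \<odot>\<^bsub>T\<^esub> z i x s)"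
      by (rule Ext1_sum, erule z(1), erule c)+
    define f where "f b = c (inv_into {..<n} e b)" for b
    have fe: "f (e i) = c i" if "i < n" for i using eB(2) that by (simp add: f_def)
    have f: "f \<in> B \<rightarrow> carrier K" unfolding eB(1)[symmetric] using fe c by auto
    have mem: "f (e i) \<odot>\<^bsub>?E\<^esub> e i \<in> carrier ?E" if "i < n" for i
      using cocycle_smult[OF S T z(1) c, OF that that] Ext1_smult[OF z(1) c, OF that that]
      unfolding fe[OF that] unfolding z(2)[OF that] by (auto simp: Ext1_carrier)
    have "(\<Oplus>\<^bsub>?E\<^esub>b\<in>B. f b \<odot>\<^bsub>?E\<^esub> b) = (\<Oplus>\<^bsub>?E\<^esub>i\<in>{..<n}. f (e i) \<odot>\<^bsub>?E\<^esub> e i)"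
      unfolding eB(1)[symmetric] by (rule E.finsum_reindex) (use mem eB(2) in auto)
    also have "\<dots> = (\<Oplus>\<^bsub>?E\<^esub>i\<in>{..<n}. c i \<odot>\<^bsub>?E\<^esub> ext_class S T (z i))"
      by (rule E.finsum_cong') (use mem fe z(2) in auto)
    also have "\<dots> = \<zero>\<^bsub>?E\<^esub>" unfolding sum(2) using ext_class_zero_iff[OF sum(1)] co by simp
    finally have "\<forall>b\<in>B. f b = \<zero>" by (rule ind[OF f])
    then show ?thesis using fe eB(1) by auto
  qed
  then show ?thesis unfolding indep_cocycles_def using z(1) by (intro exI[of _ z]) simp
qed

end

section \<open>String modules\<close>

text \<open>
  A scalar multiple that is defined even for vectors outside \<open>M\<close> if the scalar is zero. It lets the
  matrix entries between different simple modules, all of which are zero, appear in uniform formulas.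
\<close>
definition gsmult :: "('k, 'v, 'm) module_scheme \<Rightarrow> 'k \<Rightarrow> 'v \<Rightarrow> 'v" where
  "gsmult M c v = (if c = \<zero> then \<zero>\<^bsub>M\<^esub> else c \<odot>\<^bsub>M\<^esub> v)"

lemma gsmult_0 [simp]: "gsmult M \<zero> v = \<zero>\<^bsub>M\<^esub>" by (simp add: gsmult_def)
lemma gsmult_eq: "module K M \<Longrightarrow> v \<in> carrier M \<Longrightarrow> gsmult M c v = c \<odot>\<^bsub>M\<^esub> v"
  by (simp add: gsmult_def)

lemma direct_projection:
  assumes M: "hmodule K H M" and N: "hsubmodule K H N M" and L: "hsubmodule K H L M"
    and int: "N \<inter> L = {\<zero>\<^bsub>M\<^esub>}" and sum: "\<And>v. v \<in> carrier M \<Longrightarrow> \<exists>n\<in>N. \<exists>l\<in>L. v = n \<oplus>\<^bsub>M\<^esub> l"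
  shows "\<exists>\<pi>\<in>hmod_hom K H M M. (\<forall>v\<in>carrier M. \<pi> v \<in> N) \<and> (\<forall>n\<in>N. \<pi> n = n) \<and> (\<forall>l\<in>L. \<pi> l = \<zero>\<^bsub>M\<^esub>)"
proof -
  note m = hmodule_facts[OF M]
  have Ns: "N \<subseteq> carrier M" "\<zero>\<^bsub>M\<^esub> \<in> N" "\<And>x v. x \<in> ops \<Longrightarrow> v \<in> N \<Longrightarrow> act M x v \<in> N" and sN: "submodule N K M"
    using N unfolding sub_iff[OF M] submodule_iff[OF m(1)] by auto
  have Ls: "L \<subseteq> carrier M" "\<zero>\<^bsub>M\<^esub> \<in> L" "\<And>x v. x \<in> ops \<Longrightarrow> v \<in> L \<Longrightarrow> act M x v \<in> L" and sL: "submodule L K M"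
    using L unfolding sub_iff[OF M] submodule_iff[OF m(1)] by auto
  obtain \<pi> where \<pi>: "\<pi> \<in> lin K M M" "\<And>n l. n \<in> N \<Longrightarrow> l \<in> L \<Longrightarrow> \<pi> (n \<oplus>\<^bsub>M\<^esub> l) = n"
    using direct_sum_projection[OF m(1) sN sL int sum] by blast
  have "\<pi> \<in> hmod_hom K H M M"
  proof (rule homI[OF M M \<pi>(1)])
    fix x v assume x: "x \<in> ops" and v: "v \<in> carrier M"
    then obtain n l where *: "v = n \<oplus>\<^bsub>M\<^esub> l" "n \<in> N" "l \<in> L" using sum by blast
    have c: "n \<in> carrier M" "l \<in> carrier M" using * Ns Ls by auto
    show "\<pi> (act M x v) = act M x (\<pi> v)" using * \<pi>(2) Ns(3) Ls(3) x c by (simp add: lin_add[OF m(3)])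
  qed
  moreover have "\<pi> v \<in> N" if "v \<in> carrier M" for v using sum[OF that] \<pi>(2) by auto
  moreover have "\<pi> n = n" if "n \<in> N" for n
    using \<pi>(2)[OF that Ls(2)] vrzero[OF m(1), of n] that Ns(1) by auto
  moreover have "\<pi> l = \<zero>\<^bsub>M\<^esub>" if "l \<in> L" for l
    using \<pi>(2)[OF Ns(2) that] vlzero[OF m(1), of l] that Ls(1) by auto
  ultimately show ?thesis by blast
qed

text \<open>
  The projection onto a direct summand is a scalar, hence \<open>0\<close> or the identity.
\<close>
lemma indecomposable_of_scalar_end:
  assumes M: "hmodule K H M" and e: "scalar_end M" and nz: "carrier M \<noteq> {\<zero>\<^bsub>M\<^esub>}"
  shows "indecomposable K H M"
  unfolding indecomposable_def
proof (intro conjI M nz allI impI)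
  fix N L assume h: "hsubmodule K H N M \<and> hsubmodule K H L M \<and> N <+>\<^bsub>M\<^esub> L = carrier M \<and> N \<inter> L = {\<zero>\<^bsub>M\<^esub>}"
  note m = hmodule_facts[OF M]
  have sub: "N \<subseteq> carrier M" "L \<subseteq> carrier M" "\<zero>\<^bsub>M\<^esub> \<in> N" "\<zero>\<^bsub>M\<^esub> \<in> L" using h unfolding sub_iff[OF M] submodule_iff[OF m(1)] by auto
  have "\<exists>n\<in>N. \<exists>l\<in>L. v = n \<oplus>\<^bsub>M\<^esub> l" if "v \<in> carrier M" for v
  proof -
    have "v \<in> N <+>\<^bsub>M\<^esub> L" using h that by simp
    then show ?thesis by (auto simp: set_add_def')
  qed
  then obtain \<pi> where \<pi>: "\<pi> \<in> hmod_hom K H M M" "\<forall>n\<in>N. \<pi> n = n" "\<forall>l\<in>L. \<pi> l = \<zero>\<^bsub>M\<^esub>"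
    using direct_projection[OF M _ _ _, of N L] h by blast
  obtain c where c: "c \<in> carrier K" "\<forall>v\<in>carrier M. \<pi> v = c \<odot>\<^bsub>M\<^esub> v" using e \<pi>(1) by (auto simp: scalar_end_def)
  show "N = {\<zero>\<^bsub>M\<^esub>} \<or> L = {\<zero>\<^bsub>M\<^esub>}"
  proof (cases "c = \<zero>")
    case True
    have "n = \<zero>\<^bsub>M\<^esub>" if "n \<in> N" for n
    proof -
      have "n = c \<odot>\<^bsub>M\<^esub> n" using \<pi>(2) c(2) that sub(1) by fastforce
      then show ?thesis using True that sub(1) m(1) by (auto simp: subset_iff)
    qed
    then show ?thesis using sub by blast
  next
    case False
    have "l = \<zero>\<^bsub>M\<^esub>" if "l \<in> L" for l
    proof -
      have "c \<odot>\<^bsub>M\<^esub> l = \<zero>\<^bsub>M\<^esub>" using \<pi>(3) c(2) that sub(2) by fastforce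
      then show ?thesis using False that sub(2) m(1) c(1) by auto
    qed
    then show ?thesis using sub by blast
  qed
qed

lemma kernel_maximal:
  assumes M: "hmodule K H M" and S: "simple K H S" and f: "f \<in> hmod_hom K H M S" and sur: "f ` carrier M = carrier S"
  shows "maximal_hsubmodule K H {v \<in> carrier M. f v = \<zero>\<^bsub>S\<^esub>} M"
  unfolding maximal_hsubmodule_def
proof (intro conjI allI impI)
  note hS = simple_hmodule[OF S]
  note m = hmodule_facts[OF M] and s = hmodule_facts[OF hS] and fh = homD[OF f M hS]
  note [simp] = m(1) s(1)
  show "hsubmodule K H {v \<in> carrier M. f v = \<zero>\<^bsub>S\<^esub>} M" by (rule kernel_submodule[OF f M hS])
  show "{v \<in> carrier M. f v = \<zero>\<^bsub>S\<^esub>} \<noteq> carrier M"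
  proof
    assume "{v \<in> carrier M. f v = \<zero>\<^bsub>S\<^esub>} = carrier M"
    then have "f ` carrier M \<subseteq> {\<zero>\<^bsub>S\<^esub>}" by blast
    then have "carrier S = {\<zero>\<^bsub>S\<^esub>}" using sur vzero_closed[OF s(1)] by auto
    then show False using S by (simp add: simple_def)
  qed
  fix L assume L: "hsubmodule K H L M \<and> {v \<in> carrier M. f v = \<zero>\<^bsub>S\<^esub>} \<subseteq> L"
  have Ls: "L \<subseteq> carrier M" "\<And>x y. x \<in> L \<Longrightarrow> y \<in> L \<Longrightarrow> x \<oplus>\<^bsub>M\<^esub> y \<in> L"
    using L unfolding sub_iff[OF M] submodule_iff[OF m(1)] by auto
  have "f ` L = {\<zero>\<^bsub>S\<^esub>} \<or> f ` L = carrier S" using image_submodule[OF f M hS] L S by (simp add: simple_def)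
  then show "L = {v \<in> carrier M. f v = \<zero>\<^bsub>S\<^esub>} \<or> L = carrier M"
  proof
    assume "f ` L = {\<zero>\<^bsub>S\<^esub>}"
    then have "L \<subseteq> {v \<in> carrier M. f v = \<zero>\<^bsub>S\<^esub>}" using Ls(1) by blast
    then show ?thesis using L by blast
  next
    assume e: "f ` L = carrier S"
    have "v \<in> L" if v: "v \<in> carrier M" for v
    proof -
      have "f v \<in> f ` L" using e lin_closed[OF fh(1) v] by simp
      then obtain l where l: "l \<in> L" "f v = f l" by blast
      then have "v \<ominus>\<^bsub>M\<^esub> l \<in> L" using L v Ls(1) lin_minus[OF fh(1)] lin_closed[OF fh(1)] by (auto simp: subset_iff)
      then have "l \<oplus>\<^bsub>M\<^esub> (v \<ominus>\<^bsub>M\<^esub> l) \<in> L" using l Ls by blast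
      then show ?thesis using v l Ls(1) by (simp add: subset_iff)
    qed
    then show ?thesis using Ls(1) by blast
  qed
qed

end

text \<open>
  A string of simple modules as described at the beginning, with cocycles \<open>b i\<close> from \<open>P i\<close> to \<open>Q i\<close> and \<open>a i\<close>
  from \<open>P (i + 1)\<close> to \<open>Q i\<close>. Two of the \<open>P i\<close> (or of the \<open>Q i\<close>) are required to be equal or not isomorphic, so
  that scalars between equal ones make sense. An element is a sequence of pairs of components; the
  bijection \<open>dec\<close> encodes such sequences in a type \<open>'w\<close>, which can be chosen to be a fixed type.

  The assumption \<open>independent\<close> is the consequence of linear independence that the endomorphism argument uses:
  a relation \<open>c1 b\<^sub>j + c2 a\<^sub>j\<^sub>-\<^sub>1 = c3 b\<^sub>i + c4 a\<^sub>i\<close> in \<open>Ext\<^sup>1(P\<^sub>j, Q\<^sub>i)\<close>, in which a coefficient is zero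
  unless its class belongs to this group, forces \<open>c1 = c3\<close> and \<open>c2 = c4\<close>, and
  \<open>c1 = 0\<close> off the diagonal in row and column \<open>0\<close>.
\<close>
locale hstring = hcat K H for K :: "'k ring" (structure) and H :: "('k, 'g, 'a) hgroup" +
  fixes P Q :: "nat \<Rightarrow> ('k, 'u, 'g, 'a) hmod"
    and a b :: "nat \<Rightarrow> 'g + ('a \<Rightarrow> 'k) \<Rightarrow> 'u \<Rightarrow> 'u"
    and dec :: "'w \<Rightarrow> nat \<Rightarrow> 'u \<times> 'u" and enc :: "(nat \<Rightarrow> 'u \<times> 'u) \<Rightarrow> 'w"
  assumes dec_enc [simp]: "dec (enc g) = g" and enc_dec [simp]: "enc (dec w) = w"
    and simpleP: "simple K H (P i)" and simpleQ: "simple K H (Q i)"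
    and scalar_endP: "scalar_end (P i)" and scalar_endQ: "scalar_end (Q i)"
    and homPQ: "f \<in> hmod_hom K H (P i) (Q j) \<Longrightarrow> u \<in> carrier (P i) \<Longrightarrow> f u = \<zero>\<^bsub>Q j\<^esub>"
    and homQP: "f \<in> hmod_hom K H (Q j) (P i) \<Longrightarrow> u \<in> carrier (Q j) \<Longrightarrow> f u = \<zero>\<^bsub>P i\<^esub>"
    and homPP: "P i = P j \<or> (\<forall>f\<in>hmod_hom K H (P i) (P j). \<forall>u\<in>carrier (P i). f u = \<zero>\<^bsub>P j\<^esub>)"
    and homQQ: "Q i = Q j \<or> (\<forall>f\<in>hmod_hom K H (Q i) (Q j). \<forall>u\<in>carrier (Q i). f u = \<zero>\<^bsub>Q j\<^esub>)"
    and cocb: "cocycle (P i) (Q i) (b i)" and coca: "cocycle (P (Suc i)) (Q i) (a i)"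
    and nontrivial: "\<not> coboundary (P i) (Q i) (b i)"
    and independent: "\<lbrakk>c1 \<in> carrier K; c2 \<in> carrier K; c3 \<in> carrier K; c4 \<in> carrier K;
       c1 \<noteq> \<zero> \<Longrightarrow> Q j = Q i; c2 \<noteq> \<zero> \<Longrightarrow> 0 < j \<and> Q (j - 1) = Q i; c3 \<noteq> \<zero> \<Longrightarrow> P i = P j; c4 \<noteq> \<zero> \<Longrightarrow> P (Suc i) = P j;
       coboundary (P j) (Q i) (\<lambda>x u. (gsmult (Q i) c1 (b j x u) \<oplus>\<^bsub>Q i\<^esub> gsmult (Q i) c2 (a (j - 1) x u)) \<ominus>\<^bsub>Q i\<^esub>
          (gsmult (Q i) c3 (b i x u) \<oplus>\<^bsub>Q i\<^esub> gsmult (Q i) c4 (a i x u)))\<rbrakk>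
       \<Longrightarrow> c1 = c3 \<and> c2 = c4 \<and> (i = 0 \<or> j = 0 \<longrightarrow> i \<noteq> j \<longrightarrow> c1 = \<zero>)"
begin

lemma hP: "hmodule K H (P i)" and hQ: "hmodule K H (Q i)"
  using simpleP simpleQ by (auto intro: simple_hmodule)
lemmas fP = hmodule_facts[OF hP] and fQ = hmodule_facts[OF hQ]
lemmas fb = cocycleD[OF cocb] and fa = cocycleD[OF coca]
lemmas [simp] = fP(1) fQ(1)
lemmas cls = fP(4) fQ(4) fb(2) fa(2)

abbreviation "p w i \<equiv> fst (dec w i)"
abbreviation "q w i \<equiv> snd (dec w i)"

lemma decI: "(\<And>i. p w i = p w' i) \<Longrightarrow> (\<And>i. q w i = q w' i) \<Longrightarrow> w = w'"
proof -
  assume "\<And>i. p w i = p w' i" "\<And>i. q w i = q w' i"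
  then have "dec w = dec w'" by (intro ext prod_eqI) auto
  then have "enc (dec w) = enc (dec w')" by simp
  then show ?thesis by simp
qed

definition V :: "nat \<Rightarrow> ('k, 'w) module" where
  "V m = \<lparr>carrier = {w. \<forall>i. p w i \<in> carrier (P i) \<and> q w i \<in> carrier (Q i) \<and> (m \<le> i \<longrightarrow> dec w i = (\<zero>\<^bsub>P i\<^esub>, \<zero>\<^bsub>Q i\<^esub>))},
     monoid.mult = undefined, one = undefined, ring.zero = enc (\<lambda>i. (\<zero>\<^bsub>P i\<^esub>, \<zero>\<^bsub>Q i\<^esub>)),
     ring.add = (\<lambda>w w'. enc (\<lambda>i. (p w i \<oplus>\<^bsub>P i\<^esub> p w' i, q w i \<oplus>\<^bsub>Q i\<^esub> q w' i))),
     smult = (\<lambda>c w. enc (\<lambda>i. (c \<odot>\<^bsub>P i\<^esub> p w i, c \<odot>\<^bsub>Q i\<^esub> q w i)))\<rparr>"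

text \<open>
  The action is diagonal on the top and the bottom; \<open>Q i\<close> also receives the contributions of its two neighbours \<open>P i\<close>
  and \<open>P (i + 1)\<close>. The formula does not mention \<open>m\<close>, so \<open>M m\<close> is a submodule of \<open>M (m + 1)\<close>.
\<close>
definition \<rho> :: "'g + ('a \<Rightarrow> 'k) \<Rightarrow> 'w \<Rightarrow> 'w" where
  "\<rho> x w = enc (\<lambda>i. (act (P i) x (p w i), act (Q i) x (q w i) \<oplus>\<^bsub>Q i\<^esub> (b i x (p w i) \<oplus>\<^bsub>Q i\<^esub> a i x (p w (Suc i)))))"

definition M :: "nat \<Rightarrow> ('k, 'w, 'g, 'a) hmod" where "M m = mk (V m) \<rho>"

definition ip :: "nat \<Rightarrow> 'u \<Rightarrow> 'w" where
  "ip j u = enc (\<lambda>i. (if i = j then u else \<zero>\<^bsub>P i\<^esub>, \<zero>\<^bsub>Q i\<^esub>))"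
definition iq :: "nat \<Rightarrow> 'u \<Rightarrow> 'w" where
  "iq j u = enc (\<lambda>i. (\<zero>\<^bsub>P i\<^esub>, if i = j then u else \<zero>\<^bsub>Q i\<^esub>))"

lemma pq_ops [simp]:
  "p (w \<oplus>\<^bsub>V m\<^esub> w') i = p w i \<oplus>\<^bsub>P i\<^esub> p w' i" "q (w \<oplus>\<^bsub>V m\<^esub> w') i = q w i \<oplus>\<^bsub>Q i\<^esub> q w' i"
  "p (c \<odot>\<^bsub>V m\<^esub> w) i = c \<odot>\<^bsub>P i\<^esub> p w i" "q (c \<odot>\<^bsub>V m\<^esub> w) i = c \<odot>\<^bsub>Q i\<^esub> q w i"
  "p \<zero>\<^bsub>V m\<^esub> i = \<zero>\<^bsub>P i\<^esub>" "q \<zero>\<^bsub>V m\<^esub> i = \<zero>\<^bsub>Q i\<^esub>"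
  "p (ip j u) i = (if i = j then u else \<zero>\<^bsub>P i\<^esub>)" "q (ip j u) i = \<zero>\<^bsub>Q i\<^esub>"
  "p (iq j u) i = \<zero>\<^bsub>P i\<^esub>" "q (iq j u) i = (if i = j then u else \<zero>\<^bsub>Q i\<^esub>)"
  "p (\<rho> x w) i = act (P i) x (p w i)"
  "q (\<rho> x w) i = act (Q i) x (q w i) \<oplus>\<^bsub>Q i\<^esub> (b i x (p w i) \<oplus>\<^bsub>Q i\<^esub> a i x (p w (Suc i)))"
  by (simp_all add: V_def ip_def iq_def \<rho>_def)

lemma V_iff: "w \<in> carrier (V m) \<longleftrightarrow> (\<forall>i. p w i \<in> carrier (P i) \<and> q w i \<in> carrier (Q i) \<and>
    (m \<le> i \<longrightarrow> p w i = \<zero>\<^bsub>P i\<^esub> \<and> q w i = \<zero>\<^bsub>Q i\<^esub>))"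
  by (auto simp: V_def prod_eq_iff)
lemma VI: "(\<And>i. p w i \<in> carrier (P i)) \<Longrightarrow> (\<And>i. q w i \<in> carrier (Q i)) \<Longrightarrow>
    (\<And>i. m \<le> i \<Longrightarrow> p w i = \<zero>\<^bsub>P i\<^esub>) \<Longrightarrow> (\<And>i. m \<le> i \<Longrightarrow> q w i = \<zero>\<^bsub>Q i\<^esub>) \<Longrightarrow> w \<in> carrier (V m)"
  by (simp add: V_iff)
lemma VD [simp]: "w \<in> carrier (V m) \<Longrightarrow> p w i \<in> carrier (P i)" "w \<in> carrier (V m) \<Longrightarrow> q w i \<in> carrier (Q i)"
  and VZ: "w \<in> carrier (V m) \<Longrightarrow> m \<le> i \<Longrightarrow> p w i = \<zero>\<^bsub>P i\<^esub>" "w \<in> carrier (V m) \<Longrightarrow> m \<le> i \<Longrightarrow> q w i = \<zero>\<^bsub>Q i\<^esub>"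
  by (auto simp: V_iff)

lemma zeros [simp]: "x \<in> ops \<Longrightarrow> act (P i) x \<zero>\<^bsub>P i\<^esub> = \<zero>\<^bsub>P i\<^esub>" "x \<in> ops \<Longrightarrow> act (Q i) x \<zero>\<^bsub>Q i\<^esub> = \<zero>\<^bsub>Q i\<^esub>"
  "x \<in> ops \<Longrightarrow> b i x \<zero>\<^bsub>P i\<^esub> = \<zero>\<^bsub>Q i\<^esub>" "x \<in> ops \<Longrightarrow> a i x \<zero>\<^bsub>P (Suc i)\<^esub> = \<zero>\<^bsub>Q i\<^esub>"
  by (erule act_zero[OF hP] act_zero[OF hQ] lin_zero[OF fb(1) fP(1) fQ(1)] lin_zero[OF fa(1) fP(1) fQ(1)])+

lemma V_module [simp]: "module K (V m)"
proof (rule moduleI')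
  fix x y assume x: "x \<in> carrier (V m)" and y: "y \<in> carrier (V m)"
  show "x \<oplus>\<^bsub>V m\<^esub> y \<in> carrier (V m)" using x y VZ[OF x] VZ[OF y] by (intro VI) simp_all
  show "x \<oplus>\<^bsub>V m\<^esub> y = y \<oplus>\<^bsub>V m\<^esub> x" using x y by (intro decI) (simp_all add: vcomm)
  fix z assume z: "z \<in> carrier (V m)"
  show "x \<oplus>\<^bsub>V m\<^esub> y \<oplus>\<^bsub>V m\<^esub> z = x \<oplus>\<^bsub>V m\<^esub> (y \<oplus>\<^bsub>V m\<^esub> z)" using x y z by (intro decI) (simp_all add: vassoc)
next
  fix c x y assume c: "c \<in> carrier K" and x: "x \<in> carrier (V m)" and y: "y \<in> carrier (V m)"
  show "c \<odot>\<^bsub>V m\<^esub> (x \<oplus>\<^bsub>V m\<^esub> y) = c \<odot>\<^bsub>V m\<^esub> x \<oplus>\<^bsub>V m\<^esub> c \<odot>\<^bsub>V m\<^esub> y"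
    using c x y by (intro decI) (simp_all add: smult_add)
next
  fix c d x assume c: "c \<in> carrier K" and x: "x \<in> carrier (V m)" and d: "d \<in> carrier K"
  show "(c \<oplus> d) \<odot>\<^bsub>V m\<^esub> x = c \<odot>\<^bsub>V m\<^esub> x \<oplus>\<^bsub>V m\<^esub> d \<odot>\<^bsub>V m\<^esub> x" using c d x by (intro decI) (simp_all add: add_smult)
  show "(c \<otimes> d) \<odot>\<^bsub>V m\<^esub> x = c \<odot>\<^bsub>V m\<^esub> (d \<odot>\<^bsub>V m\<^esub> x)" using c d x by (intro decI) (simp_all add: smult_smult)
next
  fix x assume x: "x \<in> carrier (V m)"
  show "\<zero>\<^bsub>V m\<^esub> \<oplus>\<^bsub>V m\<^esub> x = x" "x \<oplus>\<^bsub>V m\<^esub> (\<ominus> \<one>) \<odot>\<^bsub>V m\<^esub> x = \<zero>\<^bsub>V m\<^esub>" "\<one> \<odot>\<^bsub>V m\<^esub> x = x"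
    using x by (intro decI; simp add: neg_smult)+
next
  show "\<zero>\<^bsub>V m\<^esub> \<in> carrier (V m)" by (intro VI) simp_all
  show "c \<odot>\<^bsub>V m\<^esub> x \<in> carrier (V m)" if "c \<in> carrier K" "x \<in> carrier (V m)" for c x
    using that VZ[OF that(2)] by (intro VI) simp_all
qed

lemma ip_mem [simp]: "j < m \<Longrightarrow> u \<in> carrier (P j) \<Longrightarrow> ip j u \<in> carrier (V m)"
  and iq_mem [simp]: "j < m \<Longrightarrow> u \<in> carrier (Q j) \<Longrightarrow> iq j u \<in> carrier (V m)"
  by (rule VI; auto)+
lemma ip_lin: "j < m \<Longrightarrow> ip j \<in> lin K (P j) (V m)"
  and iq_lin: "j < m \<Longrightarrow> iq j \<in> lin K (Q j) (V m)"
  by (rule linI; (simp; fail)?; rule decI; auto)+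
lemma p_lin: "(\<lambda>w. p w i) \<in> lin K (V m) (P i)" and q_lin: "(\<lambda>w. q w i) \<in> lin K (V m) (Q i)"
  by (rule linI; simp)+

lemma \<rho>_mem [simp]: "x \<in> ops \<Longrightarrow> w \<in> carrier (V m) \<Longrightarrow> \<rho> x w \<in> carrier (V m)"
  by (rule VI) (auto simp: cls VZ)

text \<open>
  Truncations build an element of \<open>V m\<close> from its components one index at a time; they replace a formula with finite sums.
\<close>
definition trunc :: "nat \<Rightarrow> 'w \<Rightarrow> 'w" where "trunc k w = enc (\<lambda>i. if i < k then dec w i else (\<zero>\<^bsub>P i\<^esub>, \<zero>\<^bsub>Q i\<^esub>))"
lemma trunc_pq [simp]: "p (trunc k w) i = (if i < k then p w i else \<zero>\<^bsub>P i\<^esub>)" "q (trunc k w) i = (if i < k then q w i else \<zero>\<^bsub>Q i\<^esub>)"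
  by (auto simp: trunc_def)
lemma trunc_mem [simp]: "w \<in> carrier (V m) \<Longrightarrow> trunc k w \<in> carrier (V m)" by (rule VI) (auto simp: VZ)
lemma trunc_0: "trunc 0 w = \<zero>\<^bsub>V m\<^esub>" by (rule decI) auto
lemma trunc_m: "w \<in> carrier (V m) \<Longrightarrow> trunc m w = w" by (rule decI) (auto simp: VZ)
lemma trunc_Suc: "w \<in> carrier (V m) \<Longrightarrow> trunc (Suc k) w = trunc k w \<oplus>\<^bsub>V m\<^esub> (ip k (p w k) \<oplus>\<^bsub>V m\<^esub> iq k (q w k))"
  by (rule decI) (auto simp: less_Suc_eq)

lemma V_eq:
  assumes "module K W" "f \<in> lin K (V m) W" "g \<in> lin K (V m) W"
    "\<And>j u. j < m \<Longrightarrow> u \<in> carrier (P j) \<Longrightarrow> f (ip j u) = g (ip j u)"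
    "\<And>j u. j < m \<Longrightarrow> u \<in> carrier (Q j) \<Longrightarrow> f (iq j u) = g (iq j u)" and w: "w \<in> carrier (V m)"
  shows "f w = g w"
proof -
  have "k \<le> m \<Longrightarrow> f (trunc k w) = g (trunc k w)" for k
  proof (induction k)
    case 0
    show ?case using lin_zero[OF assms(2)] lin_zero[OF assms(3)] assms(1) by (simp add: trunc_0[of w m])
  next
    case (Suc k)
    then show ?case using w assms(4,5) by (simp add: trunc_Suc[OF w] lin_add[OF assms(2)] lin_add[OF assms(3)])
  qed
  from this[of m] show ?thesis using w by (simp add: trunc_m)
qed

lemma rep_V: "rep (V m) \<rho>"
  unfolding hrep_def
proof (intro conjI ballI)
  show "module K (V m)" by simp
  fix x assume x: "x \<in> ops"
  show "\<rho> x \<in> lin K (V m) (V m)"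
  proof (rule linI)
    fix u v assume "u \<in> carrier (V m)" "v \<in> carrier (V m)"
    then show "\<rho> x (u \<oplus>\<^bsub>V m\<^esub> v) = \<rho> x u \<oplus>\<^bsub>V m\<^esub> \<rho> x v"
      using x by (intro decI) (simp_all add: cls lin_add[OF fP(3)] lin_add[OF fQ(3)] lin_add[OF fb(1)] lin_add[OF fa(1)] vac)
  next
    fix c v assume "c \<in> carrier K" "v \<in> carrier (V m)"
    then show "\<rho> x (c \<odot>\<^bsub>V m\<^esub> v) = c \<odot>\<^bsub>V m\<^esub> \<rho> x v"
      using x by (intro decI) (simp_all add: cls lin_smult[OF fP(3)] lin_smult[OF fQ(3)] lin_smult[OF fb(1)] lin_smult[OF fa(1)] smult_add)
  qed (use x in simp)
  fix y w assume y: "y \<in> ops" and w: "w \<in> carrier (V m)"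
  show "\<rho> (opmul x y) w = \<rho> x (\<rho> y w)"
    using x y w by (intro decI) (simp_all add: cls fP(6) fQ(6) fb(4) fa(4) lin_add[OF fQ(3)] vac)
next
  fix w assume w: "w \<in> carrier (V m)"
  show "\<rho> opone w = w" using w by (intro decI) (simp_all add: fP(5) fQ(5) fb(3) fa(3))
  have "k \<le> m \<Longrightarrow> rat (V m) (\<lambda>x. trunc k (\<rho> x w))" for k
  proof (induction k)
    case 0
    show ?case by (simp add: trunc_0[of _ m] rat_zero)
  next
    case (Suc k)
    have 1: "rat (V m) (\<lambda>x. ip k (act (P k) x (p w k)))"
      by (rule rat_lin[OF rat_act ip_lin]) (use w Suc fP(2) in auto)
    have 2: "rat (V m) (\<lambda>x. iq k (act (Q k) x (q w k) \<oplus>\<^bsub>Q k\<^esub> (b k x (p w k) \<oplus>\<^bsub>Q k\<^esub> a k x (p w (Suc k)))))"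
      by (rule rat_lin[OF rat_add[OF rat_act rat_add[OF fb(5) fa(5)]] iq_lin]) (use w Suc fQ(2) in auto)
    have "rat (V m) (\<lambda>x. trunc k (\<rho> x w) \<oplus>\<^bsub>V m\<^esub> (ip k (act (P k) x (p w k)) \<oplus>\<^bsub>V m\<^esub>
         iq k (act (Q k) x (q w k) \<oplus>\<^bsub>Q k\<^esub> (b k x (p w k) \<oplus>\<^bsub>Q k\<^esub> a k x (p w (Suc k))))))"
      by (rule rat_add[OF _ rat_add[OF 1 2]]) (use Suc in auto)
    then show ?case by (rule rat_cong) (simp add: trunc_Suc[OF \<rho>_mem[OF _ w]])
  qed
  from this[of m] show "rat (V m) (\<lambda>x. \<rho> x w)" by (rule rat_cong) (auto simp: trunc_m w)
qed

lemma hM: "hmodule K H (M m)" and actM [simp]: "x \<in> ops \<Longrightarrow> w \<in> carrier (V m) \<Longrightarrow> act (M m) x w = \<rho> x w"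
  unfolding M_def by (rule mk_hmodule[OF rep_V])+
lemma M_simps [simp]: "carrier (M m) = carrier (V m)" "\<zero>\<^bsub>M m\<^esub> = \<zero>\<^bsub>V m\<^esub>" "ring.add (M m) = ring.add (V m)" "smult (M m) = smult (V m)"
  by (simp_all add: M_def)
lemma M_lin [simp]: "lin K (M m) W = lin K (V m) W" "lin K W (M m) = lin K W (V m)" "module K (M m)"
  by (simp_all add: M_def)

lemma M_embed: "(\<lambda>w. w) \<in> hmod_hom K H (M m) (M (Suc m))"
proof -
  have s: "w \<in> carrier (V m) \<Longrightarrow> w \<in> carrier (V (Suc m))" for w by (rule VI) (auto simp: VZ)
  have l: "(\<lambda>w. w) \<in> lin K (V m) (V (Suc m))"
  proof (rule linI)
    show "x \<oplus>\<^bsub>V m\<^esub> y = x \<oplus>\<^bsub>V (Suc m)\<^esub> y" for x y by (rule decI) simp_all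
    show "c \<odot>\<^bsub>V m\<^esub> y = c \<odot>\<^bsub>V (Suc m)\<^esub> y" for c y by (rule decI) simp_all
  qed (rule s)
  show ?thesis by (rule homI[OF hM hM]) (use l s in simp_all)
qed

lemma p_hom: "(\<lambda>w. p w i) \<in> hmod_hom K H (M m) (P i)"
  by (rule homI[OF hM hP]) (auto simp: p_lin)
lemma iq_hom: "j < m \<Longrightarrow> iq j \<in> hmod_hom K H (Q j) (M m)"
  by (rule homI[OF hQ hM]) (auto simp: iq_lin cls intro!: decI)

lemma \<rho>_ip:
  assumes "j < m" "u \<in> carrier (P j)" "x \<in> ops"
  shows "\<rho> x (ip j u) = ip j (act (P j) x u) \<oplus>\<^bsub>V m\<^esub> (iq j (b j x u) \<oplus>\<^bsub>V m\<^esub> (if j = 0 then \<zero>\<^bsub>V m\<^esub> else iq (j - 1) (a (j - 1) x u)))"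
proof (cases j)
  case 0
  then show ?thesis using assms by (intro decI) (auto simp: cls)
next
  case (Suc k)
  have "a k x u \<in> carrier (Q k)" using assms Suc fa(2) by simp
  then show ?thesis using assms unfolding Suc by (intro decI) (auto simp: cls)
qed

text \<open>
  Between different simple modules the scalar is zero, and \<open>gsmult\<close> still describes the homomorphism.
\<close>
lemma scalar_Q:
  assumes "f \<in> hmod_hom K H (Q j) (Q i)"
  shows "\<exists>c\<in>carrier K. (c \<noteq> \<zero> \<longrightarrow> Q j = Q i) \<and> (\<forall>t\<in>carrier (Q j). f t = gsmult (Q i) c t)"
proof (cases "Q j = Q i")
  case True
  then have "\<exists>c\<in>carrier K. \<forall>t\<in>carrier (Q i). f t = c \<odot>\<^bsub>Q i\<^esub> t" using scalar_endQ[of i] assms unfolding scalar_end_def by metis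
  then show ?thesis using True by (auto simp: gsmult_eq)
next
  case False
  then show ?thesis using homQQ[of j i] assms by (intro bexI[of _ \<zero>]) (auto simp: gsmult_def)
qed
lemma scalar_P:
  assumes "f \<in> hmod_hom K H (P j) (P i)"
  shows "\<exists>c\<in>carrier K. (c \<noteq> \<zero> \<longrightarrow> P i = P j) \<and> (\<forall>t\<in>carrier (P j). f t = gsmult (P i) c t)"
proof (cases "P j = P i")
  case True
  then have "\<exists>c\<in>carrier K. \<forall>t\<in>carrier (P i). f t = c \<odot>\<^bsub>P i\<^esub> t" using scalar_endP[of i] assms unfolding scalar_end_def by metis
  then show ?thesis using True by (auto simp: gsmult_eq)
next
  case False
  then show ?thesis using homPP[of j i] assms by (intro bexI[of _ \<zero>]) (auto simp: gsmult_def)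
qed

lemma simple_nonzero: "simple K H S \<Longrightarrow> \<exists>v\<in>carrier S. v \<noteq> \<zero>\<^bsub>S\<^esub>"
  using hmodule_facts(1)[OF simple_hmodule[of S]] vzero_closed[of S] unfolding simple_def by blast

text \<open>
  The endomorphism argument: the scalars \<open>A i j\<close> and \<open>B i j\<close> of the top and the bottom components satisfy a relation in
  every \<open>Ext\<^sup>1(P\<^sub>j, Q\<^sub>i)\<close>, for which the components \<open>h i j : P\<^sub>j \<rightarrow> Q\<^sub>i\<close> provide the coboundary. Once
  these relations have made both matrices scalar, they say that \<open>h i j\<close> is a homomorphism, hence zero.
\<close>
lemma scalar_end_M: "scalar_end (M m)"
  unfolding scalar_end_def
proof
  fix \<phi> assume \<phi>: "\<phi> \<in> hmod_hom K H (M m) (M m)"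
  note ph = homD[OF \<phi> hM hM, unfolded M_lin M_simps]
  have pc [simp]: "\<phi> w \<in> carrier (V m)" if "w \<in> carrier (V m)" for w by (rule lin_closed[OF ph(1) that])
  have pmc [simp]: "p (\<phi> w) i \<in> carrier (P i)" "q (\<phi> w) i \<in> carrier (Q i)" if "w \<in> carrier (V m)" for w i
    using VD[OF pc[OF that]] .
  have pr: "\<phi> (\<rho> x w) = \<rho> x (\<phi> w)" if "x \<in> ops" "w \<in> carrier (V m)" for x w using ph(2)[OF that] that by simp
  have pQ: "p (\<phi> (iq j t)) i = \<zero>\<^bsub>P i\<^esub>" if "j < m" "t \<in> carrier (Q j)" for i j t
    by (rule homQP[OF hom_comp[OF hom_comp[OF iq_hom[OF that(1)] \<phi> hQ hM hM] p_hom hQ hM hP] that(2)])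
  have rq: "\<rho> x (iq j t) = iq j (act (Q j) x t)" if "x \<in> ops" "t \<in> carrier (Q j)" for x j t by (rule decI) (use that in \<open>auto simp: cls\<close>)
  have hB: "(\<lambda>t. q (\<phi> (iq j t)) i) \<in> hmod_hom K H (Q j) (Q i)" if j: "j < m" for i j
  proof (rule homI[OF hQ hQ])
    show "(\<lambda>t. q (\<phi> (iq j t)) i) \<in> lin K (Q j) (Q i)" by (rule lin_comp[OF lin_comp[OF iq_lin[OF j] ph(1)] q_lin])
    fix x t assume x: "x \<in> ops" and t: "t \<in> carrier (Q j)"
    have "\<phi> (iq j (act (Q j) x t)) = \<rho> x (\<phi> (iq j t))" using pr[OF x iq_mem[OF j t]] rq[OF x t] by simp
    then show "q (\<phi> (iq j (act (Q j) x t))) i = act (Q i) x (q (\<phi> (iq j t)) i)"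
      using x j t VD(2)[OF pc[OF iq_mem[OF j t]], of i] by (simp add: pQ cls)
  qed
  have "\<exists>c. c \<in> carrier K \<and> (c \<noteq> \<zero> \<longrightarrow> Q j = Q i) \<and> (j < m \<longrightarrow> (\<forall>t\<in>carrier (Q j). q (\<phi> (iq j t)) i = gsmult (Q i) c t))" for i j
    using scalar_Q[OF hB, of j i] by (cases "j < m") auto
  note exB = this
  define B where "B i j = (SOME c. c \<in> carrier K \<and> (c \<noteq> \<zero> \<longrightarrow> Q j = Q i) \<and> (j < m \<longrightarrow> (\<forall>t\<in>carrier (Q j). q (\<phi> (iq j t)) i = gsmult (Q i) c t)))" for i j
  have BB: "B i j \<in> carrier K \<and> (B i j \<noteq> \<zero> \<longrightarrow> Q j = Q i) \<and> (j < m \<longrightarrow> (\<forall>t\<in>carrier (Q j). q (\<phi> (iq j t)) i = gsmult (Q i) (B i j) t))" for i j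
    unfolding B_def by (rule someI_ex[OF exB])
  then have B: "\<And>i j. B i j \<in> carrier K" "\<And>i j. B i j \<noteq> \<zero> \<Longrightarrow> Q j = Q i"
    "\<And>i j t. j < m \<Longrightarrow> t \<in> carrier (Q j) \<Longrightarrow> q (\<phi> (iq j t)) i = gsmult (Q i) (B i j) t" by blast+
  have pip: "\<phi> (\<rho> x (ip j u)) = \<phi> (ip j (act (P j) x u)) \<oplus>\<^bsub>V m\<^esub> (\<phi> (iq j (b j x u)) \<oplus>\<^bsub>V m\<^esub>
      (if j = 0 then \<zero>\<^bsub>V m\<^esub> else \<phi> (iq (j - 1) (a (j - 1) x u))))"
    if j: "j < m" and u: "u \<in> carrier (P j)" and x: "x \<in> ops" for j u x
  proof (cases j)
    case 0
    then show ?thesis unfolding \<rho>_ip[OF j u x] using j u x by (simp add: cls lin_add[OF ph(1)])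
  next
    case (Suc k)
    have "a k x u \<in> carrier (Q k)" using u Suc x fa(2) by simp
    then show ?thesis unfolding \<rho>_ip[OF j u x] using j u x Suc by (simp add: cls lin_add[OF ph(1)])
  qed
  have aQ: "a (j - 1) x u \<in> carrier (Q (j - 1))" if "j \<noteq> 0" "u \<in> carrier (P j)" "x \<in> ops" for j u x
    using that fa(2)[of x u "j - 1"] by simp
  have hA: "(\<lambda>u. p (\<phi> (ip j u)) i) \<in> hmod_hom K H (P j) (P i)" if j: "j < m" for i j
  proof (rule homI[OF hP hP])
    show "(\<lambda>u. p (\<phi> (ip j u)) i) \<in> lin K (P j) (P i)" by (rule lin_comp[OF lin_comp[OF ip_lin[OF j] ph(1)] p_lin])
    fix x u assume x: "x \<in> ops" and u: "u \<in> carrier (P j)"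
    have "p (\<phi> (\<rho> x (ip j u))) i = p (\<phi> (ip j (act (P j) x u))) i"
      unfolding pip[OF j u x] using j u x aQ[OF _ u x] by (auto simp: pQ cls)
    then show "p (\<phi> (ip j (act (P j) x u))) i = act (P i) x (p (\<phi> (ip j u)) i)"
      using pr[OF x ip_mem[OF j u]] by simp
  qed
  have "\<exists>c. c \<in> carrier K \<and> (c \<noteq> \<zero> \<longrightarrow> P i = P j) \<and> (j < m \<longrightarrow> (\<forall>t\<in>carrier (P j). p (\<phi> (ip j t)) i = gsmult (P i) c t))" for i j
    using scalar_P[OF hA, of j i] by (cases "j < m") auto
  note exA = this
  define A where "A i j = (SOME c. c \<in> carrier K \<and> (c \<noteq> \<zero> \<longrightarrow> P i = P j) \<and> (j < m \<longrightarrow> (\<forall>t\<in>carrier (P j). p (\<phi> (ip j t)) i = gsmult (P i) c t)))" for i j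
  have AA: "A i j \<in> carrier K \<and> (A i j \<noteq> \<zero> \<longrightarrow> P i = P j) \<and> (j < m \<longrightarrow> (\<forall>t\<in>carrier (P j). p (\<phi> (ip j t)) i = gsmult (P i) (A i j) t))" for i j
    unfolding A_def by (rule someI_ex[OF exA])
  then have A: "\<And>i j. A i j \<in> carrier K" "\<And>i j. A i j \<noteq> \<zero> \<Longrightarrow> P i = P j"
    "\<And>i j t. j < m \<Longrightarrow> t \<in> carrier (P j) \<Longrightarrow> p (\<phi> (ip j t)) i = gsmult (P i) (A i j) t" by blast+
  have gsz: "gsmult (P i) (A i j) u \<in> carrier (P i)" "b i x (gsmult (P i) (A i j) u) = gsmult (Q i) (A i j) (b i x u)"
    "i = Suc k \<Longrightarrow> a k x (gsmult (P i) (A i j) u) = gsmult (Q k) (A i j) (a k x u)"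
    if u: "u \<in> carrier (P j)" and x: "x \<in> ops" for i j k u x
  proof -
    have u': "u \<in> carrier (P i)" if "A i j \<noteq> \<zero>" using A(2)[OF that] u by simp
    show "gsmult (P i) (A i j) u \<in> carrier (P i)" using u' A(1)[of i j] by (auto simp: gsmult_def)
    show "b i x (gsmult (P i) (A i j) u) = gsmult (Q i) (A i j) (b i x u)"
      using x lin_smult[OF fb(1)[OF x] A(1) u'] by (auto simp: gsmult_def)
    assume i: "i = Suc k"
    show "a k x (gsmult (P i) (A i j) u) = gsmult (Q k) (A i j) (a k x u)"
      using x lin_smult[OF fa(1)[OF x] A(1) u'[unfolded i]] unfolding i by (auto simp: gsmult_def)
  qed
  define h where "h i j u = q (\<phi> (ip j u)) i" for i j u
  have hl: "h i j \<in> lin K (P j) (Q i)" if "j < m" for i j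
    unfolding h_def[abs_def] by (rule lin_comp[OF lin_comp[OF ip_lin[OF that] ph(1)] q_lin])
  \<comment> \<open>\<open>P 0\<close> has only one neighbour, so \<open>a (j - 1)\<close> must not contribute for \<open>j = 0\<close>.\<close>
  define c2 where "c2 i j = (if j = 0 then \<zero> else B i (j - 1))" for i j
  have c2K: "c2 i j \<in> carrier K" for i j using B(1) by (simp add: c2_def)
  have c2m: "gsmult (Q i) (c2 i j) (a (j - 1) x u) \<in> carrier (Q i)" if "u \<in> carrier (P j)" "x \<in> ops" for i j x u
    using aQ[OF _ that] B(1)[of i "j - 1"] B(2)[of i "j - 1"] by (auto simp: gsmult_def c2_def)
  have Bm: "gsmult (Q i) (B i j) (b j x u) \<in> carrier (Q i)" if "u \<in> carrier (P j)" "x \<in> ops" for i j x u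
    using fb(2)[OF that(2,1)] B(1)[of i j] B(2)[of i j] by (auto simp: gsmult_def)
  have Am: "gsmult (Q i) (A i j) (b i x u) \<in> carrier (Q i)" "gsmult (Q i) (A (Suc i) j) (a i x u) \<in> carrier (Q i)"
    if "u \<in> carrier (P j)" "x \<in> ops" for i j x u
    using fb(2)[OF that(2)] fa(2)[OF that(2)] that A(1)[of i j] A(2)[of i j] A(1)[of "Suc i" j] A(2)[of "Suc i" j] by (auto simp: gsmult_def)
  have key: "h i j (act (P j) x u) \<oplus>\<^bsub>Q i\<^esub> (gsmult (Q i) (B i j) (b j x u) \<oplus>\<^bsub>Q i\<^esub> gsmult (Q i) (c2 i j) (a (j - 1) x u)) =
     act (Q i) x (h i j u) \<oplus>\<^bsub>Q i\<^esub> (gsmult (Q i) (A i j) (b i x u) \<oplus>\<^bsub>Q i\<^esub> gsmult (Q i) (A (Suc i) j) (a i x u))"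
    if j: "j < m" and u: "u \<in> carrier (P j)" and x: "x \<in> ops" for i j u x
  proof -
    have "q (\<phi> (\<rho> x (ip j u))) i = h i j (act (P j) x u) \<oplus>\<^bsub>Q i\<^esub> (gsmult (Q i) (B i j) (b j x u) \<oplus>\<^bsub>Q i\<^esub> gsmult (Q i) (c2 i j) (a (j - 1) x u))"
    proof (cases "j = 0")
      case True
      then show ?thesis unfolding pip[OF j u x] using j u x Bm[OF u x, of i] by (simp add: cls B(3) h_def c2_def)
    next
      case False
      then have "j - 1 < m" using j by simp
      then show ?thesis unfolding pip[OF j u x] using False j u x aQ[OF False u x] B(3)[OF \<open>j - 1 < m\<close>] by (simp add: cls B(3) h_def c2_def)
    qed
    moreover have "q (\<rho> x (\<phi> (ip j u))) i = act (Q i) x (h i j u) \<oplus>\<^bsub>Q i\<^esub> (gsmult (Q i) (A i j) (b i x u) \<oplus>\<^bsub>Q i\<^esub> gsmult (Q i) (A (Suc i) j) (a i x u))"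
      using j u x by (simp add: A(3) gsz h_def)
    ultimately show ?thesis using pr[OF x ip_mem[OF j u]] by simp
  qed
  \<comment> \<open>Rows beyond \<open>m\<close> are zero; they enter because \<open>A (i + 1) j\<close> occurs in the relation for \<open>i = m - 1\<close>.\<close>
  have AZ: "A i j = \<zero>" if i: "m \<le> i" and j: "j < m" for i j
  proof (rule ccontr)
    assume nz: "A i j \<noteq> \<zero>"
    obtain u where u: "u \<in> carrier (P j)" "u \<noteq> \<zero>\<^bsub>P j\<^esub>" using simple_nonzero[OF simpleP] by blast
    have e: "P i = P j" by (rule A(2)[OF nz])
    have "p (\<phi> (ip j u)) i = \<zero>\<^bsub>P i\<^esub>" using VZ(1)[OF pc[OF ip_mem[OF j u(1)]] i] .
    then have "A i j \<odot>\<^bsub>P i\<^esub> u = \<zero>\<^bsub>P i\<^esub>" using A(3)[OF j u(1), of i] nz by (simp add: gsmult_def)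
    then show False using u nz A(1)[of i j] e by simp
  qed
  have ind: "B i j = A i j \<and> c2 i j = A (Suc i) j \<and> (i = 0 \<or> j = 0 \<longrightarrow> i \<noteq> j \<longrightarrow> B i j = \<zero>)" if j: "j < m" for i j
  proof (rule independent)
    show "coboundary (P j) (Q i) (\<lambda>x u. (gsmult (Q i) (B i j) (b j x u) \<oplus>\<^bsub>Q i\<^esub> gsmult (Q i) (c2 i j) (a (j - 1) x u)) \<ominus>\<^bsub>Q i\<^esub>
          (gsmult (Q i) (A i j) (b i x u) \<oplus>\<^bsub>Q i\<^esub> gsmult (Q i) (A (Suc i) j) (a i x u)))"
      unfolding coboundary_def
    proof (intro bexI[OF _ hl[OF j]] ballI)
      fix x u assume x: "x \<in> ops" and u: "u \<in> carrier (P j)"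
      show "(gsmult (Q i) (B i j) (b j x u) \<oplus>\<^bsub>Q i\<^esub> gsmult (Q i) (c2 i j) (a (j - 1) x u)) \<ominus>\<^bsub>Q i\<^esub>
          (gsmult (Q i) (A i j) (b i x u) \<oplus>\<^bsub>Q i\<^esub> gsmult (Q i) (A (Suc i) j) (a i x u)) = act (Q i) x (h i j u) \<ominus>\<^bsub>Q i\<^esub> h i j (act (P j) x u)"
        using key[OF j u x, of i] x u c2m[OF u x] Bm[OF u x] Am[OF u x] lin_closed[OF hl[OF j]]
        by (subst vmove) (auto simp: cls vcomm)
    qed
  qed (use A B c2K in \<open>auto simp: c2_def split: if_splits\<close>)
  \<comment> \<open>\<open>B (i + 1) (k + 1) = A (i + 1) (k + 1) = B i k\<close> moves every entry along its diagonal to row or column \<open>0\<close>.\<close>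
  have diag: "i < m \<Longrightarrow> j < m \<Longrightarrow> B i j = (if i = j then B 0 0 else \<zero>)" for i j
  proof (induction i arbitrary: j)
    case 0
    then show ?case using ind[of j 0] by auto
  next
    case (Suc i)
    show ?case
    proof (cases j)
      case 0
      then show ?thesis using ind[of 0 "Suc i"] Suc.prems by auto
    next
      case (Suc k)
      have "B (Suc i) (Suc k) = A (Suc i) (Suc k)" using ind[of "Suc k" "Suc i"] Suc.prems Suc by auto
      also have "\<dots> = c2 i (Suc k)" using ind[of "Suc k" i] Suc.prems Suc by auto
      also have "\<dots> = B i k" by (simp add: c2_def)
      finally show ?thesis using Suc.IH[of k] Suc.prems Suc by auto
    qed
  qed
  define c where "c = B 0 0"
  have cK: "c \<in> carrier K" using B(1) by (simp add: c_def)
  have Bc: "B i j = (if i = j then c else \<zero>)" if "j < m" for i j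
  proof (cases "i < m")
    case True then show ?thesis using diag[of i j] that by (simp add: c_def)
  next
    case False
    then have "B i j = \<zero>" using ind[OF that, of i] AZ[of i j] that by auto
    then show ?thesis using False that by auto
  qed
  have Ac: "A i j = (if i = j then c else \<zero>)" if "j < m" for i j using ind[OF that, of i] Bc[OF that, of i] by simp
  have h0: "h i j u = \<zero>\<^bsub>Q i\<^esub>" if j: "j < m" and u: "u \<in> carrier (P j)" for i j u
  proof (rule homPQ[OF homI[OF hP hQ hl[OF j]] u])
    fix x u assume x: "x \<in> ops" and u: "u \<in> carrier (P j)"
    have 1: "gsmult (Q i) (B i j) (b j x u) = gsmult (Q i) (A i j) (b i x u)" using Ac[OF j] Bc[OF j] by (auto simp: gsmult_def)
    have 2: "gsmult (Q i) (c2 i j) (a (j - 1) x u) = gsmult (Q i) (A (Suc i) j) (a i x u)"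
      using ind[OF j, of i] Ac[OF j, of "Suc i"] by (auto simp: gsmult_def)
    have "h i j (act (P j) x u) \<oplus>\<^bsub>Q i\<^esub> (gsmult (Q i) (A i j) (b i x u) \<oplus>\<^bsub>Q i\<^esub> gsmult (Q i) (A (Suc i) j) (a i x u)) =
      act (Q i) x (h i j u) \<oplus>\<^bsub>Q i\<^esub> (gsmult (Q i) (A i j) (b i x u) \<oplus>\<^bsub>Q i\<^esub> gsmult (Q i) (A (Suc i) j) (a i x u))"
      using key[OF j u x, of i] unfolding 1 2 .
    then have "(gsmult (Q i) (A i j) (b i x u) \<oplus>\<^bsub>Q i\<^esub> gsmult (Q i) (A (Suc i) j) (a i x u)) \<oplus>\<^bsub>Q i\<^esub> h i j (act (P j) x u) =
      (gsmult (Q i) (A i j) (b i x u) \<oplus>\<^bsub>Q i\<^esub> gsmult (Q i) (A (Suc i) j) (a i x u)) \<oplus>\<^bsub>Q i\<^esub> act (Q i) x (h i j u)"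
      using Am[OF u x] lin_closed[OF hl[OF j]] u x by (simp add: cls vcomm)
    then show "h i j (act (P j) x u) = act (Q i) x (h i j u)"
      using Am[OF u x] lin_closed[OF hl[OF j]] u x by (simp add: cls)
  qed
  have "\<phi> w = c \<odot>\<^bsub>V m\<^esub> w" if w: "w \<in> carrier (V m)" for w
  proof (rule V_eq[OF V_module ph(1) lin_scale[OF V_module lin_id(2) cK] _ _ w])
    fix j u assume j: "j < m" and u: "u \<in> carrier (P j)"
    show "\<phi> (ip j u) = c \<odot>\<^bsub>V m\<^esub> ip j u"
      by (rule decI) (use j u cK h0[OF j u, unfolded h_def] in \<open>auto simp: A(3) Ac gsmult_def\<close>)
  next
    fix j u assume j: "j < m" and u: "u \<in> carrier (Q j)"
    show "\<phi> (iq j u) = c \<odot>\<^bsub>V m\<^esub> iq j u"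
      by (rule decI) (use j u cK in \<open>auto simp: pQ B(3) Bc gsmult_def\<close>)
  qed
  then show "\<exists>c\<in>carrier K. \<forall>v\<in>carrier (M m). \<phi> v = c \<odot>\<^bsub>M m\<^esub> v" using cK by auto
qed

text \<open>
  Such a homomorphism is a scalar \<open>C j\<close> on each \<open>Q\<^sub>j\<close>, and restricting it to the extensions gives the relation
  \<open>C\<^sub>j b\<^sub>j + C\<^sub>j\<^sub>-\<^sub>1 a\<^sub>j\<^sub>-\<^sub>1 = 0\<close> in \<open>Ext\<^sup>1(P\<^sub>j, Q\<^sub>i)\<close>. By induction on \<open>j\<close> the second term vanishes, and as \<open>b\<^sub>j\<close>
  does not split, so does \<open>C\<^sub>j\<close>.
\<close>
lemma hom_M_Q:
  assumes \<pi>: "\<pi> \<in> hmod_hom K H (M m) (Q i)" and j: "j < m" and t: "t \<in> carrier (Q j)"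
  shows "\<pi> (iq j t) = \<zero>\<^bsub>Q i\<^esub>"
proof -
  note ph = homD[OF \<pi> hM hQ, unfolded M_lin M_simps]
  have "\<exists>c. c \<in> carrier K \<and> (c \<noteq> \<zero> \<longrightarrow> Q j = Q i) \<and> (j < m \<longrightarrow> (\<forall>t\<in>carrier (Q j). \<pi> (iq j t) = gsmult (Q i) c t))" for j
    using scalar_Q[OF hom_comp[OF iq_hom \<pi> hQ hM hQ], of j] by (cases "j < m") auto
  note exC = this
  define C where "C j = (SOME c. c \<in> carrier K \<and> (c \<noteq> \<zero> \<longrightarrow> Q j = Q i) \<and> (j < m \<longrightarrow> (\<forall>t\<in>carrier (Q j). \<pi> (iq j t) = gsmult (Q i) c t)))" for j
  have CC: "C j \<in> carrier K \<and> (C j \<noteq> \<zero> \<longrightarrow> Q j = Q i) \<and> (j < m \<longrightarrow> (\<forall>t\<in>carrier (Q j). \<pi> (iq j t) = gsmult (Q i) (C j) t))" for j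
    unfolding C_def by (rule someI_ex[OF exC])
  then have C: "\<And>j. C j \<in> carrier K" "\<And>j. C j \<noteq> \<zero> \<Longrightarrow> Q j = Q i"
    "\<And>j t. j < m \<Longrightarrow> t \<in> carrier (Q j) \<Longrightarrow> \<pi> (iq j t) = gsmult (Q i) (C j) t" by blast+
  have "j < m \<Longrightarrow> C j = \<zero>" for j
  proof (induction j rule: less_induct)
    case (less j)
    show ?case
    proof (rule ccontr)
      assume nz: "C j \<noteq> \<zero>"
      have e: "Q j = Q i" by (rule C(2)[OF nz])
      have hl: "(\<lambda>u. \<pi> (ip j u)) \<in> lin K (P j) (Q i)" by (rule lin_comp[OF ip_lin[OF less.prems] ph(1)])
      have "C j \<odot>\<^bsub>Q i\<^esub> b j x u = act (Q i) x (\<pi> (ip j u)) \<ominus>\<^bsub>Q i\<^esub> \<pi> (ip j (act (P j) x u))"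
        if x: "x \<in> ops" and u: "u \<in> carrier (P j)" for x u
      proof -
        have bq: "b j x u \<in> carrier (Q i)" using fb(2)[OF x u] e by simp
        have "\<pi> (if j = 0 then \<zero>\<^bsub>V m\<^esub> else iq (j - 1) (a (j - 1) x u)) = \<zero>\<^bsub>Q i\<^esub>"
        proof (cases "j = 0")
          case True then show ?thesis using lin_zero[OF ph(1)] by simp
        next
          case False
          then have "j - 1 < j" "j - 1 < m" using less.prems by auto
          then have "C (j - 1) = \<zero>" using less.IH by blast
          moreover have "a (j - 1) x u \<in> carrier (Q (j - 1))" using False u x fa(2)[of x u "j - 1"] by simp
          ultimately show ?thesis using False C(3)[OF \<open>j - 1 < m\<close>] by (simp add: gsmult_def)
        qed
        moreover have "(if j = 0 then \<zero>\<^bsub>V m\<^esub> else iq (j - 1) (a (j - 1) x u)) \<in> carrier (V m)"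
          using less.prems u x fa(2)[of x u "j - 1"] by auto
        ultimately have "\<pi> (\<rho> x (ip j u)) = \<pi> (ip j (act (P j) x u)) \<oplus>\<^bsub>Q i\<^esub> C j \<odot>\<^bsub>Q i\<^esub> b j x u"
          unfolding \<rho>_ip[OF less.prems u x] using less.prems u x C(3)[OF less.prems] nz bq C(1)
          by (simp add: lin_add[OF ph(1)] cls gsmult_def lin_closed[OF ph(1)])
        moreover have "\<pi> (\<rho> x (ip j u)) = act (Q i) x (\<pi> (ip j u))" using ph(2)[OF x, of "ip j u"] less.prems u x by simp
        ultimately have "act (Q i) x (\<pi> (ip j u)) = \<pi> (ip j (act (P j) x u)) \<oplus>\<^bsub>Q i\<^esub> C j \<odot>\<^bsub>Q i\<^esub> b j x u" by simp
        then show ?thesis using lin_closed[OF hl] u x bq C(1) by (simp add: cls a_minus_def vac)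
      qed
      then have "coboundary (P j) (Q i) (\<lambda>x u. C j \<odot>\<^bsub>Q i\<^esub> b j x u)" unfolding coboundary_def by (intro bexI[OF _ hl]) auto
      then have "coboundary (P j) (Q i) (\<lambda>x u. inv (C j) \<odot>\<^bsub>Q i\<^esub> (C j \<odot>\<^bsub>Q i\<^esub> b j x u))"
        by (rule coboundary_smult[OF hP hQ]) (use inv_smult(2)[OF fQ(1) C(1) nz vzero_closed[OF fQ(1)]] in blast)
      then have "coboundary (P j) (Q i) (b j)" by (rule coboundary_cong) (use fb(2) e inv_smult(1)[OF fQ(1) C(1) nz] in metis)
      then show False using nontrivial[of j] e by simp
    qed
  qed
  then show ?thesis using C(3)[OF j t] j by (simp add: gsmult_def)
qed

definition N :: "nat \<Rightarrow> 'w set" where "N m = {w \<in> carrier (V m). \<forall>i. p w i = \<zero>\<^bsub>P i\<^esub>}"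

text \<open>
  The kernels of the projections onto the \<open>P\<^sub>i\<close> are maximal and meet in the bottom \<open>N m\<close>. Conversely, if a maximal submodule
  \<open>L\<close> does not contain \<open>Q\<^sub>j\<close>, then \<open>M m\<close> is the direct sum of \<open>Q\<^sub>j\<close> and \<open>L\<close>, and the projection to \<open>Q\<^sub>j\<close>
  contradicts \<open>hom_M_Q\<close>.
\<close>
lemma Rad_M: "Rad K H (M m) = N m"
proof
  show "Rad K H (M m) \<subseteq> N m"
  proof
    fix w assume w: "w \<in> Rad K H (M m)"
    then have wV: "w \<in> carrier (V m)" by (simp add: Rad_def)
    have "p w i = \<zero>\<^bsub>P i\<^esub>" for i
    proof (cases "i < m")
      case True
      have "(\<lambda>w. p w i) ` carrier (M m) = carrier (P i)"
      proof
        show "carrier (P i) \<subseteq> (\<lambda>w. p w i) ` carrier (M m)"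
        proof
          fix u assume "u \<in> carrier (P i)"
          then have "ip i u \<in> carrier (M m)" "u = p (ip i u) i" using True by auto
          then show "u \<in> (\<lambda>w. p w i) ` carrier (M m)" by blast
        qed
      qed auto
      from kernel_maximal[OF hM simpleP p_hom this] w show ?thesis unfolding Rad_def by blast
    qed (use wV VZ in auto)
    then show "w \<in> N m" using wV by (simp add: N_def)
  qed
  show "N m \<subseteq> Rad K H (M m)"
  proof
    fix w assume w: "w \<in> N m"
    then have wV: "w \<in> carrier (V m)" and wp: "\<And>i. p w i = \<zero>\<^bsub>P i\<^esub>" by (auto simp: N_def)
    have "w \<in> L" if L: "maximal_hsubmodule K H L (M m)" for L
    proof -
      have hL: "hsubmodule K H L (M m)" and Lmax: "\<And>L'. hsubmodule K H L' (M m) \<Longrightarrow> L \<subseteq> L' \<Longrightarrow> L' = L \<or> L' = carrier (M m)"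
        using L by (auto simp: maximal_hsubmodule_def)
      have Ls: "L \<subseteq> carrier (V m)" "\<zero>\<^bsub>V m\<^esub> \<in> L" "\<And>x y. x \<in> L \<Longrightarrow> y \<in> L \<Longrightarrow> x \<oplus>\<^bsub>V m\<^esub> y \<in> L"
        "\<And>c x. c \<in> carrier K \<Longrightarrow> x \<in> L \<Longrightarrow> c \<odot>\<^bsub>V m\<^esub> x \<in> L" "\<And>x v. x \<in> ops \<Longrightarrow> v \<in> L \<Longrightarrow> \<rho> x v \<in> L"
        using hL unfolding sub_iff[OF hM] submodule_iff[OF M_lin(3)] by (auto simp: subset_iff)
      have iqL: "iq j t \<in> L" if j: "j < m" and t: "t \<in> carrier (Q j)" for j t
      proof (rule ccontr)
        assume n: "iq j t \<notin> L"
        note iqh = iq_hom[OF j]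
        note il = iq_lin[OF j]
        let ?I = "iq j ` carrier (Q j)"
        have hI: "hsubmodule K H ?I (M m)" by (rule image_submodule[OF iqh hQ hM carrier_hsubmodule[OF hQ]])
        have rq: "\<rho> x (iq j t) = iq j (act (Q j) x t)" if "x \<in> ops" "t \<in> carrier (Q j)" for x t by (rule decI) (use that in \<open>auto simp: cls\<close>)
        have "hsubmodule K H {s \<in> carrier (Q j). iq j s \<in> L} (Q j)"
          unfolding sub_iff[OF hQ] submodule_iff[OF fQ(1)]
        proof (intro conjI ballI)
          have "iq j \<zero>\<^bsub>Q j\<^esub> = \<zero>\<^bsub>V m\<^esub>" using lin_zero[OF il] by simp
          then show "\<zero>\<^bsub>Q j\<^esub> \<in> {s \<in> carrier (Q j). iq j s \<in> L}" using Ls(2) by simp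
          fix x s assume "x \<in> ops" "s \<in> {s \<in> carrier (Q j). iq j s \<in> L}"
          then show "act (Q j) x s \<in> {s \<in> carrier (Q j). iq j s \<in> L}" using Ls(5)[of x "iq j s"] rq[of x s] by (simp add: cls)
        qed (use Ls(3,4) in \<open>auto simp: lin_add[OF il] lin_smult[OF il]\<close>)
        then have "{s \<in> carrier (Q j). iq j s \<in> L} = {\<zero>\<^bsub>Q j\<^esub>} \<or> {s \<in> carrier (Q j). iq j s \<in> L} = carrier (Q j)"
          using simpleQ[of j] by (simp add: simple_def)
        then have z: "{s \<in> carrier (Q j). iq j s \<in> L} = {\<zero>\<^bsub>Q j\<^esub>}" using n t by blast
        have int: "?I \<inter> L = {\<zero>\<^bsub>M m\<^esub>}"
        proof (rule Set.set_eqI)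
          fix x
          show "x \<in> ?I \<inter> L \<longleftrightarrow> x \<in> {\<zero>\<^bsub>M m\<^esub>}"
          proof
            assume "x \<in> ?I \<inter> L"
            then obtain s where s: "x = iq j s" "s \<in> carrier (Q j)" "iq j s \<in> L" by blast
            then have "s = \<zero>\<^bsub>Q j\<^esub>" using z by blast
            then show "x \<in> {\<zero>\<^bsub>M m\<^esub>}" using s lin_zero[OF il] by simp
          next
            assume "x \<in> {\<zero>\<^bsub>M m\<^esub>}"
            then have "x = iq j \<zero>\<^bsub>Q j\<^esub>" "x \<in> L" using lin_zero[OF il] Ls(2) by auto
            then show "x \<in> ?I \<inter> L" using vzero_closed[OF fQ(1)] by blast
          qed
        qed
        define L' where "L' = {u \<oplus>\<^bsub>V m\<^esub> v | u v. u \<in> ?I \<and> v \<in> L}"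
        have Is: "?I \<subseteq> carrier (V m)" "\<zero>\<^bsub>V m\<^esub> \<in> ?I" "\<And>x y. x \<in> ?I \<Longrightarrow> y \<in> ?I \<Longrightarrow> x \<oplus>\<^bsub>V m\<^esub> y \<in> ?I"
           "\<And>c x. c \<in> carrier K \<Longrightarrow> x \<in> ?I \<Longrightarrow> c \<odot>\<^bsub>V m\<^esub> x \<in> ?I" "\<And>x v. x \<in> ops \<Longrightarrow> v \<in> ?I \<Longrightarrow> \<rho> x v \<in> ?I"
          using hI unfolding sub_iff[OF hM] submodule_iff[OF M_lin(3)] by (auto simp: subset_iff rq cls)
        have L'I: "u \<oplus>\<^bsub>V m\<^esub> v \<in> L'" if "u \<in> ?I" "v \<in> L" for u v using that unfolding L'_def by blast
        have L'E: "\<exists>u v. w = u \<oplus>\<^bsub>V m\<^esub> v \<and> u \<in> ?I \<and> v \<in> L \<and> u \<in> carrier (V m) \<and> v \<in> carrier (V m)" if "w \<in> L'" for w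
          using that Is(1) Ls(1) unfolding L'_def by blast
        have \<rho>l: "\<rho> x \<in> lin K (V m) (V m)" if "x \<in> ops" for x using rep_V[of m] that by (simp add: hrep_def)
        have hL': "hsubmodule K H L' (M m)" unfolding sub_iff[OF hM] submodule_iff[OF M_lin(3)] M_simps
        proof (intro conjI ballI)
          show sub: "L' \<subseteq> carrier (V m)" using L'E by fastforce
          show "\<zero>\<^bsub>V m\<^esub> \<in> L'" using L'I[OF Is(2) Ls(2)] by simp
          fix x assume "x \<in> L'"
          then obtain u v where x: "x = u \<oplus>\<^bsub>V m\<^esub> v" "u \<in> ?I" "v \<in> L" "u \<in> carrier (V m)" "v \<in> carrier (V m)" using L'E by blast
          fix y assume "y \<in> L'"
          then obtain u' v' where y: "y = u' \<oplus>\<^bsub>V m\<^esub> v'" "u' \<in> ?I" "v' \<in> L" "u' \<in> carrier (V m)" "v' \<in> carrier (V m)" using L'E by blast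
          have "x \<oplus>\<^bsub>V m\<^esub> y = (u \<oplus>\<^bsub>V m\<^esub> u') \<oplus>\<^bsub>V m\<^esub> (v \<oplus>\<^bsub>V m\<^esub> v')" using x y by (simp add: vac)
          then show "x \<oplus>\<^bsub>V m\<^esub> y \<in> L'" using L'I[OF Is(3)[OF x(2) y(2)] Ls(3)[OF x(3) y(3)]] by simp
        next
          fix c x assume c: "c \<in> carrier K" and "x \<in> L'"
          then obtain u v where x: "x = u \<oplus>\<^bsub>V m\<^esub> v" "u \<in> ?I" "v \<in> L" "u \<in> carrier (V m)" "v \<in> carrier (V m)" using L'E by blast
          then show "c \<odot>\<^bsub>V m\<^esub> x \<in> L'" using L'I[OF Is(4)[OF c x(2)] Ls(4)[OF c x(3)]] c by (simp add: smult_add)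
        next
          fix y x assume c: "y \<in> ops" and "x \<in> L'"
          then obtain u v where x: "x = u \<oplus>\<^bsub>V m\<^esub> v" "u \<in> ?I" "v \<in> L" "u \<in> carrier (V m)" "v \<in> carrier (V m)" using L'E by blast
          then show "act (M m) y x \<in> L'" using L'I[OF Is(5)[OF c x(2)] Ls(5)[OF c x(3)]] c by (simp add: lin_add[OF \<rho>l])
        qed
        have "L \<subseteq> L'"
        proof
          fix v assume "v \<in> L"
          then show "v \<in> L'" using L'I[OF Is(2), of v] Ls(1) by (auto simp: subset_iff)
        qed
        moreover have "iq j t \<in> L'" using L'I[OF _ Ls(2), of "iq j t"] j t by auto
        ultimately have L'V: "L' = carrier (V m)" using Lmax[OF hL'] n by auto
        have "\<exists>n\<in>?I. \<exists>l\<in>L. v = n \<oplus>\<^bsub>M m\<^esub> l" if "v \<in> carrier (M m)" for v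
        proof -
          have "v \<in> L'" using that L'V by simp
          then show ?thesis unfolding L'_def M_simps by blast
        qed
        then obtain \<pi> where \<pi>: "\<pi> \<in> hmod_hom K H (M m) (M m)" "\<And>v. v \<in> carrier (V m) \<Longrightarrow> \<pi> v \<in> ?I" "\<And>n. n \<in> ?I \<Longrightarrow> \<pi> n = n"
          using direct_projection[OF hM hI hL int] by auto
        note ph = homD[OF \<pi>(1) hM hM, unfolded M_lin M_simps]
        have "(\<lambda>w. q (\<pi> w) j) \<in> hmod_hom K H (M m) (Q j)"
        proof (rule homI[OF hM hQ])
          show "(\<lambda>w. q (\<pi> w) j) \<in> lin K (M m) (Q j)" using lin_comp[OF ph(1) q_lin] by simp
          fix x w assume x: "x \<in> ops" and w: "w \<in> carrier (M m)"
          then obtain s where s: "\<pi> w = iq j s" "s \<in> carrier (Q j)" using \<pi>(2)[of w] by auto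
          have "\<pi> (act (M m) x w) = iq j (act (Q j) x s)" using ph(2)[OF x, of w] w x j s rq[OF x s(2)] by simp
          then show "q (\<pi> (act (M m) x w)) j = act (Q j) x (q (\<pi> w) j)" using s by simp
        qed
        then have "q (\<pi> (iq j t)) j = \<zero>\<^bsub>Q j\<^esub>" using hom_M_Q[OF _ j t, of _ j] by simp
        then have "t = \<zero>\<^bsub>Q j\<^esub>" using \<pi>(3)[of "iq j t"] t by simp
        then show False using n lin_zero[OF il] Ls(2) by simp
      qed
      have "k \<le> m \<Longrightarrow> trunc k w \<in> L" for k
      proof (induction k)
        case 0 then show ?case using Ls(2) by (simp add: trunc_0[of w m])
      next
        case (Suc k)
        have ip0: "ip k (p w k) = \<zero>\<^bsub>V m\<^esub>" by (rule decI) (auto simp: wp)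
        have "trunc (Suc k) w = trunc k w \<oplus>\<^bsub>V m\<^esub> iq k (q w k)" using Suc wV by (simp add: trunc_Suc[OF wV] ip0)
        then show ?case using Suc iqL[of k "q w k"] wV Ls(3) by simp
      qed
      from this[of m] show "w \<in> L" using trunc_m[OF wV] by simp
    qed
    then show "w \<in> Rad K H (M m)" using wV by (simp add: Rad_def)
  qed
qed

lemma M_nonzero: "1 \<le> m \<Longrightarrow> carrier (M m) \<noteq> {\<zero>\<^bsub>M m\<^esub>}"
proof
  assume m: "1 \<le> m" and e: "carrier (M m) = {\<zero>\<^bsub>M m\<^esub>}"
  obtain u where u: "u \<in> carrier (P 0)" "u \<noteq> \<zero>\<^bsub>P 0\<^esub>" using simple_nonzero[OF simpleP] by blast
  have "ip 0 u \<in> carrier (M m)" using m u by simp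
  then have "ip 0 u = \<zero>\<^bsub>V m\<^esub>" unfolding e by simp
  then have "p (ip 0 u) 0 = \<zero>\<^bsub>P 0\<^esub>" by (simp only: pq_ops)
  then show False using u by simp
qed

lemma embedded: "embedded_sequence K H M (\<lambda>_ w. w)"
  unfolding embedded_sequence_def using indecomposable_of_scalar_end[OF hM scalar_end_M M_nonzero] M_embed by auto

lemma End_scalar_M: "End_scalar K H (M m)" by (rule End_scalar_of_scalar_end[OF hM scalar_end_M])

end

section \<open>Radical and top of a string module\<close>

text \<open>
  A bijection between \<open>nat \<Rightarrow> 'k\<close> and the sequences of pairs of elements of \<open>nat \<Rightarrow> 'k\<close>, by which the strings
  over modules on this type live on the same type.
\<close>
definition seq_dec :: "(nat \<Rightarrow> 'k) \<Rightarrow> nat \<Rightarrow> (nat \<Rightarrow> 'k) \<times> (nat \<Rightarrow> 'k)" where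
  "seq_dec w i = (\<lambda>n. w (2 * prod_encode (i, n)), \<lambda>n. w (2 * prod_encode (i, n) + 1))"
definition seq_enc :: "(nat \<Rightarrow> (nat \<Rightarrow> 'k) \<times> (nat \<Rightarrow> 'k)) \<Rightarrow> nat \<Rightarrow> 'k" where
  "seq_enc f k = (case prod_decode (k div 2) of (i, n) \<Rightarrow> if even k then fst (f i) n else snd (f i) n)"

lemma seq_dec_enc: "seq_dec (seq_enc f) = f"
  by (rule ext, rule prod_eqI) (auto simp: seq_dec_def seq_enc_def)
lemma seq_enc_dec: "seq_enc (seq_dec w) = w"
proof
  fix k
  obtain i n where e: "prod_decode (k div 2) = (i, n)" by (cases "prod_decode (k div 2)")
  then have "prod_encode (i, n) = k div 2" by (metis prod_decode_inverse)
  then show "seq_enc (seq_dec w) k = w k" using e by (auto simp: seq_enc_def seq_dec_def)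
qed

context hcat begin

lemma tuple_hom:
  assumes L: "hmodule K H L" and S: "hmodule K H S" and f: "\<And>i. i < n \<Longrightarrow> f i \<in> hmod_hom K H L S"
  shows "(\<lambda>w. \<lambda>i\<in>{..<n}. f i w) \<in> hmod_hom K H L (power_hmod K H n S)"
proof -
  note pw = power_hmod[where n = n, OF S] and l = hmodule_facts[OF L]
  note fh = homD[OF f L S]
  note fc = lin_closed[OF fh(1)]
  have mem: "(\<lambda>i\<in>{..<n}. f i w) \<in> {..<n} \<rightarrow>\<^sub>E carrier S" if "w \<in> carrier L" for w
    by (rule restrict_PiE_iff[THEN iffD2]) (use fc that in auto)
  show ?thesis
  proof (rule homI[OF L pw(1) linI])
    show "(\<lambda>i\<in>{..<n}. f i w) \<in> carrier (power_hmod K H n S)" if "w \<in> carrier L" for w using mem[OF that] by simp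
    show "(\<lambda>i\<in>{..<n}. f i (u \<oplus>\<^bsub>L\<^esub> w)) = (\<lambda>i\<in>{..<n}. f i u) \<oplus>\<^bsub>power_hmod K H n S\<^esub> (\<lambda>i\<in>{..<n}. f i w)"
      if "u \<in> carrier L" "w \<in> carrier L" for u w
      unfolding power_hmod_simps by (rule restrict_ext) (simp add: lin_add[OF fh(1)] that)
    show "(\<lambda>i\<in>{..<n}. f i (c \<odot>\<^bsub>L\<^esub> w)) = c \<odot>\<^bsub>power_hmod K H n S\<^esub> (\<lambda>i\<in>{..<n}. f i w)"
      if "c \<in> carrier K" "w \<in> carrier L" for c w
      unfolding power_hmod_simps by (rule restrict_ext) (simp add: lin_smult[OF fh(1)] that)
    show "(\<lambda>i\<in>{..<n}. f i (act L x w)) = act (power_hmod K H n S) x (\<lambda>i\<in>{..<n}. f i w)"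
      if x: "x \<in> ops" and w: "w \<in> carrier L" for x w
      unfolding pw(2)[OF x mem[OF w]] by (rule restrict_ext) (simp add: fh(2) x w)
  qed
qed

lemma pair_hom:
  assumes L: "hmodule K H L" and R: "hmodule K H R" and S: "hmodule K H S"
    and f: "f \<in> hmod_hom K H L R" and g: "g \<in> hmod_hom K H L S"
  shows "(\<lambda>w. (f w, g w)) \<in> hmod_hom K H L (sum_hmod K H R S)"
proof -
  note fh = homD[OF f L R] and gh = homD[OF g L S] and sw = sum_hmod[OF R S]
  note c = lin_closed[OF fh(1)] lin_closed[OF gh(1)]
  show ?thesis
    by (rule homI[OF L sw(1) linI])
      (auto simp: c lin_add[OF fh(1)] lin_add[OF gh(1)] lin_smult[OF fh(1)] lin_smult[OF gh(1)] fh(2) gh(2) sw(2))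
qed

lemma bij_lin_zero_iff:
  assumes "f \<in> lin K V W" "bij_betw f (carrier V) (carrier W)" "module K V" "module K W" "v \<in> carrier V"
  shows "f v = \<zero>\<^bsub>W\<^esub> \<longleftrightarrow> v = \<zero>\<^bsub>V\<^esub>"
  using inj_on_eq_iff[OF bij_betw_imp_inj_on[OF assms(2)] assms(5) vzero_closed[OF assms(3)]] lin_zero[OF assms(1,3,4)]
  by simp

lemma restrict_eq_iff: "(\<lambda>i\<in>{..<n::nat}. f i) = (\<lambda>i\<in>{..<n}. g i) \<longleftrightarrow> (\<forall>i<n. f i = g i)"
  by (auto simp: restrict_def fun_eq_iff)

end

context hstring begin

lemma N_sub: "hsubmodule K H (N m) (M m)"
  unfolding sub_iff[OF hM] submodule_iff[OF M_lin(3)] by (auto simp: N_def)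

lemma q_hom_N: "(\<lambda>w. q w i) \<in> hmod_hom K H (sub_hmod K H (M m) (N m)) (Q i)"
proof -
  note S = sub_hmod[OF hM N_sub]
  have NV: "w \<in> carrier (V m)" "\<And>i. p w i = \<zero>\<^bsub>P i\<^esub>" if "w \<in> N m" for w using that by (auto simp: N_def)
  show ?thesis
  proof (rule homI[OF S(1) hQ linI])
    fix x w assume x: "x \<in> ops" and "w \<in> carrier (sub_hmod K H (M m) (N m))"
    then have w: "w \<in> N m" by simp
    show "q (act (sub_hmod K H (M m) (N m)) x w) i = act (Q i) x (q w i)"
      unfolding S(2)[OF x w] actM[OF x NV(1)[OF w]] using x NV[OF w] by (simp add: cls)
  qed (use VD(2)[OF NV(1)] in auto)
qed

lemma N_iso:
  assumes QT: "\<And>i. Q i = T'" and theta_hom: "\<theta> \<in> hmod_hom K H T' T" and bij: "bij_betw \<theta> (carrier T') (carrier T)" and T: "hmodule K H T"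
  shows "hmod_iso K H (sub_hmod K H (M m) (N m)) (power_hmod K H m T)"
proof -
  have T': "hmodule K H T'" using hQ[of 0] QT by simp
  note S = sub_hmod[OF hM N_sub[of m]]
  define f where "f w = (\<lambda>i\<in>{..<m}. \<theta> (q w i))" for w
  have qT: "q w i \<in> carrier T'" if "w \<in> N m" for w i using that VD(2)[of w m i] by (simp add: N_def QT)
  have qh: "(\<lambda>w. q w i) \<in> hmod_hom K H (sub_hmod K H (M m) (N m)) T'" for i
    unfolding QT[of i, symmetric] by (rule q_hom_N)
  have "f \<in> hmod_hom K H (sub_hmod K H (M m) (N m)) (power_hmod K H m T)"
    unfolding f_def[abs_def]
    by (rule tuple_hom[OF S(1) T]) (rule hom_comp[OF qh theta_hom S(1) T' T])
  moreover have "bij_betw f (N m) ({..<m} \<rightarrow>\<^sub>E carrier T)"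
    unfolding bij_betw_def
  proof
    show "inj_on f (N m)"
    proof (rule inj_onI)
      fix u w assume uw: "u \<in> N m" "w \<in> N m" "f u = f w"
      have uwV: "u \<in> carrier (V m)" "w \<in> carrier (V m)" using uw by (auto simp: N_def)
      show "u = w"
      proof (rule decI)
        show "p u i = p w i" for i using uw by (simp add: N_def)
        show "q u i = q w i" for i
        proof (cases "i < m")
          case True
          have "\<theta> (q u i) = \<theta> (q w i)" using uw(3) True by (simp add: f_def restrict_eq_iff)
          then show ?thesis using bij qT[OF uw(1)] qT[OF uw(2)] by (auto simp: bij_betw_def dest: inj_onD)
        next
          case False
          then show ?thesis using VZ(2)[OF uwV(1)] VZ(2)[OF uwV(2)] by simp
        qed
      qed
    qed
    show "f ` N m = {..<m} \<rightarrow>\<^sub>E carrier T"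
    proof
      show "f ` N m \<subseteq> {..<m} \<rightarrow>\<^sub>E carrier T"
      proof
        fix y assume "y \<in> f ` N m"
        then obtain w where w: "y = f w" "w \<in> N m" by blast
        show "y \<in> {..<m} \<rightarrow>\<^sub>E carrier T"
          unfolding w(1) f_def by (rule restrict_PiE_iff[THEN iffD2]) (use qT[OF w(2)] bij in \<open>auto simp: bij_betw_def\<close>)
      qed
      show "{..<m} \<rightarrow>\<^sub>E carrier T \<subseteq> f ` N m"
      proof
        fix y assume y: "y \<in> {..<m} \<rightarrow>\<^sub>E carrier T"
        let ?g = "inv_into (carrier T') \<theta>"
        have yc: "y i \<in> carrier T" if "i < m" for i using y that by auto
        have gy: "?g (y i) \<in> carrier T'" "\<theta> (?g (y i)) = y i" if "i < m" for i
          using bij yc[OF that] by (auto simp: bij_betw_def inv_into_into f_inv_into_f)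
        define w where "w = enc (\<lambda>i. (\<zero>\<^bsub>P i\<^esub>, if i < m then ?g (y i) else \<zero>\<^bsub>Q i\<^esub>))"
        have pq: "p w i = \<zero>\<^bsub>P i\<^esub>" "q w i = (if i < m then ?g (y i) else \<zero>\<^bsub>Q i\<^esub>)" for i by (auto simp: w_def)
        have "w \<in> carrier (V m)" by (rule VI) (use gy fQ(1)[of 0] hmodule_facts(1)[OF T'] in \<open>auto simp: pq QT\<close>)
        then have wN: "w \<in> N m" by (simp add: N_def pq)
        have "f w = y" by (rule extensionalityI[of _ "{..<m}"]) (use y gy in \<open>auto simp: f_def pq PiE_def\<close>)
        then show "y \<in> f ` N m" using wN by blast
      qed
    qed
  qed
  ultimately show "hmod_iso K H (sub_hmod K H (M m) (N m)) (power_hmod K H m T)"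
    unfolding hmod_iso_def by auto
qed

text \<open>
  A homomorphism that depends only on the components in the top, and faithfully so, induces an isomorphism on the quotient by the bottom.
\<close>
lemma quot_iso_top:
  assumes Y: "hmodule K H Y" and f: "f \<in> hmod_hom K H (M m) Y"
    and ker: "\<And>w. w \<in> carrier (V m) \<Longrightarrow> f w = \<zero>\<^bsub>Y\<^esub> \<longleftrightarrow> (\<forall>i<m. p w i = \<zero>\<^bsub>P i\<^esub>)"
    and sur: "\<And>y. y \<in> carrier Y \<Longrightarrow> \<exists>g. (\<forall>i<m. g i \<in> carrier (P i)) \<and> (\<forall>w\<in>carrier (V m). (\<forall>i<m. p w i = g i) \<longrightarrow> f w = y)"
  shows "hmod_iso K H (quot_hmod K H (M m) (N m)) Y"
proof (rule quot_iso[OF hM Y f])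
  show "f ` carrier (M m) = carrier Y"
  proof
    show "f ` carrier (M m) \<subseteq> carrier Y" using lin_closed[OF homD(1)[OF f hM Y]] by blast
    show "carrier Y \<subseteq> f ` carrier (M m)"
    proof
      fix y assume "y \<in> carrier Y"
      then obtain g where g: "\<forall>i<m. g i \<in> carrier (P i)" "\<forall>w\<in>carrier (V m). (\<forall>i<m. p w i = g i) \<longrightarrow> f w = y" using sur by blast
      define w where "w = enc (\<lambda>i. (if i < m then g i else \<zero>\<^bsub>P i\<^esub>, \<zero>\<^bsub>Q i\<^esub>))"
      have pq: "q w i = \<zero>\<^bsub>Q i\<^esub>" "p w i = (if i < m then g i else \<zero>\<^bsub>P i\<^esub>)" for i by (auto simp: w_def)
      have "w \<in> carrier (V m)" by (rule VI) (use g(1) in \<open>auto simp: pq\<close>)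
      moreover from this have "f w = y" using g(2) pq by simp
      ultimately show "y \<in> f ` carrier (M m)" by auto
    qed
  qed
  have "w \<in> N m \<longleftrightarrow> w \<in> carrier (M m) \<and> f w = \<zero>\<^bsub>Y\<^esub>" for w
    using ker[of w] VZ(1)[of w m] by (auto simp: N_def not_less[symmetric])
  then show "N m = {v \<in> carrier (M m). f v = \<zero>\<^bsub>Y\<^esub>}" by blast
qed

lemma quot_iso_power:
  assumes PS: "\<And>i. P i = S'" and theta_hom: "\<theta> \<in> hmod_hom K H S' S" and bij: "bij_betw \<theta> (carrier S') (carrier S)" and S: "hmodule K H S"
  shows "hmod_iso K H (quot_hmod K H (M m) (N m)) (power_hmod K H m S)"
proof -
  have S': "hmodule K H S'" using hP[of 0] PS by simp
  note zero = bij_lin_zero_iff[OF homD(1)[OF theta_hom S' S] bij hmodule_facts(1)[OF S'] hmodule_facts(1)[OF S]]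
  have pS: "p w i \<in> carrier S'" if "w \<in> carrier (V m)" for w i using VD(1)[OF that, of i] by (simp add: PS)
  have ph: "(\<lambda>w. p w i) \<in> hmod_hom K H (M m) S'" for i unfolding PS[of i, symmetric] by (rule p_hom)
  show ?thesis
  proof (rule quot_iso_top[OF power_hmod(1)[OF S]])
    show "(\<lambda>w. \<lambda>i\<in>{..<m}. \<theta> (p w i)) \<in> hmod_hom K H (M m) (power_hmod K H m S)"
      by (rule tuple_hom[OF hM S]) (rule hom_comp[OF ph theta_hom hM S' S])
    show "(\<lambda>i\<in>{..<m}. \<theta> (p w i)) = \<zero>\<^bsub>power_hmod K H m S\<^esub> \<longleftrightarrow> (\<forall>i<m. p w i = \<zero>\<^bsub>P i\<^esub>)" if "w \<in> carrier (V m)" for w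
      by (simp add: restrict_eq_iff PS zero[OF pS[OF that]])
    fix y assume "y \<in> carrier (power_hmod K H m S)"
    then have y: "y \<in> {..<m} \<rightarrow>\<^sub>E carrier S" by simp
    let ?g = "\<lambda>i. inv_into (carrier S') \<theta> (y i)"
    have yc: "y i \<in> carrier S" if "i < m" for i using y that by auto
    have "?g i \<in> carrier S'" "\<theta> (?g i) = y i" if "i < m" for i
      using bij yc[OF that] by (auto simp: bij_betw_def inv_into_into f_inv_into_f)
    moreover from this have "(\<lambda>i\<in>{..<m}. \<theta> (p w i)) = y" if "\<forall>i<m. p w i = ?g i" for w
      by (intro extensionalityI[of _ "{..<m}"]) (use y that in \<open>auto simp: PiE_def\<close>)
    ultimately show "\<exists>g. (\<forall>i<m. g i \<in> carrier (P i)) \<and> (\<forall>w\<in>carrier (V m). (\<forall>i<m. p w i = g i) \<longrightarrow> (\<lambda>i\<in>{..<m}. \<theta> (p w i)) = y)"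
      by (intro exI[of _ ?g]) (simp add: PS)
  qed
qed

lemma quot_iso_sum:
  assumes P0: "P 0 = R'" and PS: "\<And>i. P (Suc i) = S'" and theta_hom: "\<theta> \<in> hmod_hom K H S' S" and bij: "bij_betw \<theta> (carrier S') (carrier S)" and S: "hmodule K H S"
   and et: "\<eta> \<in> hmod_hom K H R' R" and bijR: "bij_betw \<eta> (carrier R') (carrier R)" and R: "hmodule K H R" and m: "1 \<le> m"
  shows "hmod_iso K H (quot_hmod K H (M m) (N m)) (sum_hmod K H R (power_hmod K H (m - 1) S))"
proof -
  have S': "hmodule K H S'" and R': "hmodule K H R'" using hP[of "Suc 0"] hP[of 0] P0 PS by simp_all
  obtain k where k: "m = Suc k" using m by (cases m) auto
  note zero = bij_lin_zero_iff[OF homD(1)[OF theta_hom S' S] bij hmodule_facts(1)[OF S'] hmodule_facts(1)[OF S]]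
    and zeroR = bij_lin_zero_iff[OF homD(1)[OF et R' R] bijR hmodule_facts(1)[OF R'] hmodule_facts(1)[OF R]]
  have pS: "p w (Suc i) \<in> carrier S'" and pR: "p w 0 \<in> carrier R'" if "w \<in> carrier (V m)" for w i
    using VD(1)[OF that, of "Suc i"] VD(1)[OF that, of 0] by (simp_all add: PS P0)
  note pw = power_hmod(1)[where n = k, OF S]
  have pS_hom: "(\<lambda>w. p w (Suc i)) \<in> hmod_hom K H (M m) S'" for i unfolding PS[of i, symmetric] by (rule p_hom)
  have pR_hom: "(\<lambda>w. p w 0) \<in> hmod_hom K H (M m) R'" unfolding P0[symmetric] by (rule p_hom)
  have "hmod_iso K H (quot_hmod K H (M m) (N m)) (sum_hmod K H R (power_hmod K H k S))"
  proof (rule quot_iso_top[OF sum_hmod(1)[OF R pw]])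
    show "(\<lambda>w. (\<eta> (p w 0), \<lambda>i\<in>{..<k}. \<theta> (p w (Suc i)))) \<in> hmod_hom K H (M m) (sum_hmod K H R (power_hmod K H k S))"
      by (intro pair_hom[OF hM R pw] tuple_hom[OF hM S] hom_comp[OF pR_hom et hM R' R]
        hom_comp[OF pS_hom theta_hom hM S' S])
    show "(\<eta> (p w 0), \<lambda>i\<in>{..<k}. \<theta> (p w (Suc i))) = \<zero>\<^bsub>sum_hmod K H R (power_hmod K H k S)\<^esub> \<longleftrightarrow> (\<forall>i<m. p w i = \<zero>\<^bsub>P i\<^esub>)"
      if "w \<in> carrier (V m)" for w
      by (simp add: restrict_eq_iff PS P0 zero[OF pS[OF that]] zeroR[OF pR[OF that]] k All_less_Suc2)
    fix y assume "y \<in> carrier (sum_hmod K H R (power_hmod K H k S))"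
    then obtain y0 y1 where y: "y = (y0, y1)" "y0 \<in> carrier R" "y1 \<in> {..<k} \<rightarrow>\<^sub>E carrier S" by auto
    let ?g = "\<lambda>i. case i of 0 \<Rightarrow> inv_into (carrier R') \<eta> y0 | Suc i \<Rightarrow> inv_into (carrier S') \<theta> (y1 i)"
    have yc: "y1 i \<in> carrier S" if "i < k" for i using y(3) that by auto
    have gS: "?g (Suc i) \<in> carrier S'" "\<theta> (?g (Suc i)) = y1 i" if "i < k" for i
      using bij yc[OF that] by (auto simp: bij_betw_def inv_into_into f_inv_into_f)
    have gR: "?g 0 \<in> carrier R'" "\<eta> (?g 0) = y0"
      using bijR y(2) by (auto simp: bij_betw_def inv_into_into f_inv_into_f)
    have "(\<lambda>i\<in>{..<k}. \<theta> (p w (Suc i))) = y1" if "\<forall>i<m. p w i = ?g i" for w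
      by (rule extensionalityI[of _ "{..<k}"]) (use y(3) gS that in \<open>auto simp: PiE_def k\<close>)
    moreover have "\<eta> (p w 0) = y0" if "\<forall>i<m. p w i = ?g i" for w using that gR k by simp
    moreover have "?g i \<in> carrier (P i)" if "i < m" for i using gS(1) gR(1) that by (cases i) (simp_all add: P0 PS k)
    ultimately show "\<exists>g. (\<forall>i<m. g i \<in> carrier (P i)) \<and>
        (\<forall>w\<in>carrier (V m). (\<forall>i<m. p w i = g i) \<longrightarrow> (\<eta> (p w 0), \<lambda>i\<in>{..<k}. \<theta> (p w (Suc i))) = y)"
      unfolding y(1) by (intro exI[of _ ?g]) blast
  qed
  then show ?thesis by (simp add: k)
qed

end

context hcat begin

section \<open>Copies of simple modules and the three cases\<close>

text \<open>
  Coordinates embed a simple module into \<open>nat \<Rightarrow> 'k\<close>; its copy consists of these coordinate functions. Cocycles between simple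
  modules carry over to their copies.
\<close>
definition coords :: "('k, 'v, 'g, 'a) hmod \<Rightarrow> 'v \<Rightarrow> nat \<Rightarrow> 'k" where
  "coords S = (SOME g. inj_on g (carrier S))"
definition copy :: "('k, 'v, 'g, 'a) hmod \<Rightarrow> ('k, nat \<Rightarrow> 'k, 'g, 'a) hmod" where
  "copy S = transport K H (coords S) S"
definition coords_inv :: "('k, 'v, 'g, 'a) hmod \<Rightarrow> (nat \<Rightarrow> 'k) \<Rightarrow> 'v" where
  "coords_inv S = inv_into (carrier S) (coords S)"

lemma copy:
  assumes S: "simple K H S"
  shows "coords S \<in> hmod_hom K H S (copy S)" "bij_betw (coords S) (carrier S) (carrier (copy S))"
    "coords_inv S \<in> hmod_hom K H (copy S) S" "bij_betw (coords_inv S) (carrier (copy S)) (carrier S)"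
    "simple K H (copy S)" "hmodule K H (copy S)" "scalar_end S \<Longrightarrow> scalar_end (copy S)" "\<And>v. v \<in> carrier S \<Longrightarrow> coords_inv S (coords S v) = v"
proof -
  note hS = simple_hmodule[OF S]
  have inj: "inj_on (coords S) (carrier S)" unfolding coords_def by (rule someI_ex[OF simple_inj[OF S]])
  note t = transport[OF hS inj, folded copy_def]
  show "coords S \<in> hmod_hom K H S (copy S)" "bij_betw (coords S) (carrier S) (carrier (copy S))" "hmodule K H (copy S)" by (rule t)+
  show "coords_inv S \<in> hmod_hom K H (copy S) S" "bij_betw (coords_inv S) (carrier (copy S)) (carrier S)"
    unfolding coords_inv_def by (rule hom_inverse[OF t(2,3) hS t(1)])+
  show "simple K H (copy S)" by (rule simple_iso[OF S t(1) t(2,3)])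
  show "scalar_end S \<Longrightarrow> scalar_end (copy S)" by (rule scalar_end_iso[OF hS t(1) t(2,3)])
  show "coords_inv S (coords S v) = v" if "v \<in> carrier S" for v unfolding coords_inv_def using inj that by simp
qed

lemma copy_iso: "simple K H S \<Longrightarrow> hmod_iso K H S (copy S)"
  using copy(1,2) by (auto simp: hmod_iso_def)

lemma copy_noniso:
  assumes S: "simple K H S" and T: "simple K H T" and n: "\<not> hmod_iso K H S T"
  shows "\<not> hmod_iso K H (copy S) (copy T)"
proof
  assume i: "hmod_iso K H (copy S) (copy T)"
  note h = simple_hmodule[OF S] simple_hmodule[OF T] copy(6)[OF S] copy(6)[OF T]
  have "hmod_iso K H S (copy T)" by (rule hmod_iso_trans[OF copy_iso[OF S] i h(1,3,4)])
  moreover have "hmod_iso K H (copy T) T" by (rule hmod_iso_sym[OF copy_iso[OF T] h(2,4)])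
  ultimately show False using n hmod_iso_trans[of S "copy T" T] h by blast
qed

lemma copy_hom_zero:
  assumes S: "simple K H S" and T: "simple K H T" and n: "\<not> hmod_iso K H S T"
  shows "f \<in> hmod_hom K H (copy S) (copy T) \<Longrightarrow> u \<in> carrier (copy S) \<Longrightarrow> f u = \<zero>\<^bsub>copy T\<^esub>"
    "f' \<in> hmod_hom K H (copy T) (copy S) \<Longrightarrow> u' \<in> carrier (copy T) \<Longrightarrow> f' u' = \<zero>\<^bsub>copy S\<^esub>"
    "copy S \<noteq> copy T"
proof -
  note c = copy_noniso[OF S T n]
  show "f \<in> hmod_hom K H (copy S) (copy T) \<Longrightarrow> u \<in> carrier (copy S) \<Longrightarrow> f u = \<zero>\<^bsub>copy T\<^esub>"
    by (rule simple_hom_zero(1)[OF copy(5)[OF S] copy(5)[OF T] c])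
  show "f' \<in> hmod_hom K H (copy T) (copy S) \<Longrightarrow> u' \<in> carrier (copy T) \<Longrightarrow> f' u' = \<zero>\<^bsub>copy S\<^esub>"
    by (rule simple_hom_zero(2)[OF copy(5)[OF S] copy(5)[OF T] c])
  show "copy S \<noteq> copy T"
  proof
    assume e: "copy S = copy T"
    have "hmod_iso K H (copy S) (copy S)" unfolding hmod_iso_def
      by (rule bexI[OF _ id_hom[OF copy(6)[OF S]]]) (simp add: bij_betw_def)
    then show False using c e by simp
  qed
qed

definition copy_cocycle where "copy_cocycle S T z = (\<lambda>x s. coords T (z x (coords_inv S s)))"

lemma copy_cocycle_cocycle: "simple K H S \<Longrightarrow> simple K H T \<Longrightarrow> cocycle S T z \<Longrightarrow> cocycle (copy S) (copy T) (copy_cocycle S T z)"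
  unfolding copy_cocycle_def by (rule cocycle_map[OF simple_hmodule simple_hmodule copy(6) copy(6) _ copy(3) copy(1)])

lemma copy_cocycle_coboundary:
  assumes S: "simple K H S" and T: "simple K H T" and c: "coboundary (copy S) (copy T) w"
  shows "coboundary S T (\<lambda>x s. coords_inv T (w x (coords S s)))"
  by (rule coboundary_map[OF copy(6)[OF S] copy(6)[OF T] simple_hmodule[OF S] simple_hmodule[OF T] c copy(1)[OF S] copy(3)[OF T]])

lemma copy_nonsplit:
  assumes S: "simple K H S" and T: "simple K H T" and z: "\<exists>z. cocycle S T z \<and> \<not> coboundary S T z"
  shows "\<exists>z. cocycle (copy S) (copy T) z \<and> \<not> coboundary (copy S) (copy T) z"
proof -
  obtain z where z: "cocycle S T z" "\<not> coboundary S T z" using z by blast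
  have "\<not> coboundary (copy S) (copy T) (copy_cocycle S T z)"
  proof
    assume "coboundary (copy S) (copy T) (copy_cocycle S T z)"
    from copy_cocycle_coboundary[OF S T this] have "coboundary S T z"
      by (rule coboundary_cong) (use cocycleD(2)[OF z(1)] copy(8)[OF S] copy(8)[OF T] in \<open>simp add: copy_cocycle_def\<close>)
    then show False using z by simp
  qed
  with copy_cocycle_cocycle[OF S T z(1)] show ?thesis by (intro exI conjI)
qed

lemma copy_indep_cocycles:
  assumes S: "simple K H S" and T: "simple K H T" and z: "indep_cocycles S T n z"
  shows "\<exists>w. indep_cocycles (copy S) (copy T) n w"
proof (rule exI)
  note hS = simple_hmodule[OF S] and hT = simple_hmodule[OF T]
  have zi: "cocycle S T (z i)" if "i < n" for i using z that by (simp add: indep_cocycles_def)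
  note t = hmodule_facts(1)[OF hT] and t' = hmodule_facts(1)[OF copy(6)[OF T]]
  note l = homD(1)[OF copy(3)[OF T] copy(6)[OF T] hT] and tl = lin_closed[OF homD(1)[OF copy(1)[OF T] hT copy(6)[OF T]]]
  have "\<forall>i<n. c i = \<zero>" if c: "\<forall>i<n. c i \<in> carrier K"
     and co: "coboundary (copy S) (copy T) (\<lambda>x s. \<Oplus>\<^bsub>copy T\<^esub>i\<in>{..<n}. c i \<odot>\<^bsub>copy T\<^esub> copy_cocycle S T (z i) x s)" for c
  proof -
    have "coboundary S T (\<lambda>x s. \<Oplus>\<^bsub>T\<^esub>i\<in>{..<n}. c i \<odot>\<^bsub>T\<^esub> z i x s)"
    proof (rule coboundary_cong[OF copy_cocycle_coboundary[OF S T co]])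
      fix x s assume xs: "x \<in> ops" "s \<in> carrier S"
      have zc: "z i x s \<in> carrier T" if "i < n" for i using cocycleD(2)[OF zi[OF that] xs] .
      have e: "copy_cocycle S T (z i) x (coords S s) = coords T (z i x s)" for i using xs by (simp add: copy_cocycle_def copy(8)[OF S])
      have "coords_inv T (\<Oplus>\<^bsub>copy T\<^esub>i\<in>{..<n}. c i \<odot>\<^bsub>copy T\<^esub> copy_cocycle S T (z i) x (coords S s)) =
        (\<Oplus>\<^bsub>T\<^esub>i\<in>{..<n}. coords_inv T (c i \<odot>\<^bsub>copy T\<^esub> copy_cocycle S T (z i) x (coords S s)))"
        by (rule lin_vsum[OF l t' t]) (use c zc t' tl in \<open>simp add: e\<close>)
      also have "\<dots> = (\<Oplus>\<^bsub>T\<^esub>i\<in>{..<n}. c i \<odot>\<^bsub>T\<^esub> z i x s)"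
        by (rule vsum_cong[OF t]) (use c zc t tl in \<open>simp_all add: e lin_smult[OF l] copy(8)[OF T]\<close>)
      finally show "coords_inv T (\<Oplus>\<^bsub>copy T\<^esub>i\<in>{..<n}. c i \<odot>\<^bsub>copy T\<^esub> copy_cocycle S T (z i) x (coords S s)) = (\<Oplus>\<^bsub>T\<^esub>i\<in>{..<n}. c i \<odot>\<^bsub>T\<^esub> z i x s)" .
    qed
    from this have "c i = \<zero>" if "i < n" for i by (rule indep_cocyclesD(2)[OF z, rotated, OF _ that]) (use c in simp)
    then show ?thesis by blast
  qed
  then show "indep_cocycles (copy S) (copy T) n (\<lambda>i. copy_cocycle S T (z i))"
    unfolding indep_cocycles_def by (intro conjI allI impI copy_cocycle_cocycle[OF S T zi]) auto
qed

lemma coboundary_scaled: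
  assumes S: "hmodule K H S" and T: "hmodule K H T" and z: "cocycle S T z" and n: "\<not> coboundary S T z" and c: "c \<in> carrier K" "d \<in> carrier K"
    and e: "coboundary S T (\<lambda>x s. c \<odot>\<^bsub>T\<^esub> z x s \<ominus>\<^bsub>T\<^esub> d \<odot>\<^bsub>T\<^esub> z x s)"
  shows "c = d"
proof (rule ccontr)
  assume "c \<noteq> d"
  then have nz: "c \<ominus> d \<noteq> \<zero>" "c \<ominus> d \<in> carrier K" using c by auto
  note t = hmodule_facts(1)[OF T]
  have i: "inv (c \<ominus> d) \<in> carrier K" using inv_smult(2)[OF t nz(2,1) vzero_closed[OF t]] .
  have "coboundary S T z"
    by (rule coboundary_cong[OF coboundary_smult[OF S T e i]])
      (use cocycleD(2)[OF z] c t inv_smult(1)[OF t nz(2,1)] in \<open>simp add: minus_smult[symmetric]\<close>)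
  then show False using n by simp
qed

text \<open>
  The strings for the first two cases: \<open>R\<close> at the beginning followed by copies of \<open>S\<close>, where \<open>R = S\<close> is allowed.
\<close>
lemma kronecker_string:
  fixes R S T :: "('k, nat \<Rightarrow> 'k, 'g, 'a) hmod"
  assumes R: "simple K H R" "scalar_end R" and S: "simple K H S" "scalar_end S" and T: "simple K H T" "scalar_end T"
    and RT: "\<not> hmod_iso K H R T" and ST: "\<not> hmod_iso K H S T" and RS: "R = S \<or> \<not> hmod_iso K H R S"
    and g: "cocycle R T g" "\<not> coboundary R T g" and al: "cocycle S T al" and be: "cocycle S T be" "\<not> coboundary S T be"
    and ind: "\<And>i j c1 c2 c3 c4. \<lbrakk>c1 \<in> carrier K; c2 \<in> carrier K; c3 \<in> carrier K; c4 \<in> carrier K;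
       c2 \<noteq> \<zero> \<Longrightarrow> 0 < j; c3 \<noteq> \<zero> \<Longrightarrow> (if i = 0 then R else S) = (if j = 0 then R else S); c4 \<noteq> \<zero> \<Longrightarrow> S = (if j = 0 then R else S);
       coboundary (if j = 0 then R else S) T (\<lambda>x u. (gsmult T c1 ((if j = 0 then g else be) x u) \<oplus>\<^bsub>T\<^esub> gsmult T c2 (al x u)) \<ominus>\<^bsub>T\<^esub>
          (gsmult T c3 ((if i = 0 then g else be) x u) \<oplus>\<^bsub>T\<^esub> gsmult T c4 (al x u)))\<rbrakk>
       \<Longrightarrow> c1 = c3 \<and> c2 = c4 \<and> (i = (0::nat) \<or> j = (0::nat) \<longrightarrow> i \<noteq> j \<longrightarrow> c1 = \<zero>)"
  shows "hstring K H (\<lambda>i. if i = 0 then R else S) (\<lambda>i. T) (\<lambda>i. al) (\<lambda>i. if i = 0 then g else be) seq_dec seq_enc"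
proof (intro hstring.intro hcat_axioms hstring_axioms.intro)
  note z = simple_hom_zero[OF R(1) T(1) RT] simple_hom_zero[OF S(1) T(1) ST]
  show "f \<in> hmod_hom K H (if i = 0 then R else S) T \<Longrightarrow> u \<in> carrier (if i = 0 then R else S) \<Longrightarrow> f u = \<zero>\<^bsub>T\<^esub>" for f u i
    using z by (auto split: if_splits)
  show "f \<in> hmod_hom K H T (if i = 0 then R else S) \<Longrightarrow> u \<in> carrier T \<Longrightarrow> f u = \<zero>\<^bsub>if i = 0 then R else S\<^esub>" for f u i
    using z by (auto split: if_splits)
  show "(if i = 0 then R else S) = (if j = 0 then R else S) \<or>
     (\<forall>f\<in>hmod_hom K H (if i = 0 then R else S) (if j = 0 then R else S). \<forall>u\<in>carrier (if i = 0 then R else S). f u = \<zero>\<^bsub>if j = 0 then R else S\<^esub>)" for i j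
    using RS simple_hom_zero[OF R(1) S(1)] by auto
  fix i j :: nat and c1 c2 c3 c4
  assume h: "c1 \<in> carrier K" "c2 \<in> carrier K" "c3 \<in> carrier K" "c4 \<in> carrier K" "c1 \<noteq> \<zero> \<Longrightarrow> T = T"
    "c2 \<noteq> \<zero> \<Longrightarrow> 0 < j \<and> T = T" "c3 \<noteq> \<zero> \<Longrightarrow> (if i = 0 then R else S) = (if j = 0 then R else S)"
    "c4 \<noteq> \<zero> \<Longrightarrow> (if Suc i = 0 then R else S) = (if j = 0 then R else S)"
    "coboundary (if j = 0 then R else S) T (\<lambda>x u. (gsmult T c1 ((if j = 0 then g else be) x u) \<oplus>\<^bsub>T\<^esub> gsmult T c2 (al x u)) \<ominus>\<^bsub>T\<^esub>
          (gsmult T c3 ((if i = 0 then g else be) x u) \<oplus>\<^bsub>T\<^esub> gsmult T c4 (al x u)))"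
  show "c1 = c3 \<and> c2 = c4 \<and> (i = 0 \<or> j = 0 \<longrightarrow> i \<noteq> j \<longrightarrow> c1 = \<zero>)"
    by (rule ind[OF h(1-4) _ h(7) _ h(9)]) (use h(6,8) in auto)
qed (use R S T g al be in \<open>auto simp: seq_dec_enc seq_enc_dec\<close>)

lemma vcombine3:
  assumes V: "module K V" and c: "c1 \<in> carrier K" "c2 \<in> carrier K" "c3 \<in> carrier K" "c4 \<in> carrier K" and v: "x \<in> carrier V" "y \<in> carrier V" "z \<in> carrier V"
  shows "(c1 \<odot>\<^bsub>V\<^esub> x \<oplus>\<^bsub>V\<^esub> c2 \<odot>\<^bsub>V\<^esub> z) \<ominus>\<^bsub>V\<^esub> (c3 \<odot>\<^bsub>V\<^esub> y \<oplus>\<^bsub>V\<^esub> c4 \<odot>\<^bsub>V\<^esub> z) = (c1 \<odot>\<^bsub>V\<^esub> x \<ominus>\<^bsub>V\<^esub> c3 \<odot>\<^bsub>V\<^esub> y) \<oplus>\<^bsub>V\<^esub> (c2 \<ominus> c4) \<odot>\<^bsub>V\<^esub> z"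
  using assms by (simp add: vshuffle minus_smult)

text \<open>
  With three independent classes, the exceptional class \<open>w 0\<close> sits at the beginning of the string; the
  coefficients of \<open>w 0\<close>, \<open>w 1\<close> and \<open>w 2\<close> in the relation must vanish separately.
\<close>
theorem modules_of_case_i:
  fixes S :: "('k, 's, 'g, 'a) hmod" and T :: "('k, 't, 'g, 'a) hmod"
  assumes "case_i K H S T"
  shows "\<exists>(M :: nat \<Rightarrow> ('k, nat \<Rightarrow> 'k, 'g, 'a) hmod) e. embedded_sequence K H M e \<and>
         (\<forall>m\<ge>1.
            hmod_iso K H (sub_hmod K H (M m) (Rad K H (M m))) (power_hmod K H m T) \<and>
            hmod_iso K H (quot_hmod K H (M m) (Rad K H (M m))) (power_hmod K H m S) \<and>
            End_scalar K H (M m))"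
proof -
  have S: "simple K H S" and T: "simple K H T" and n: "\<not> hmod_iso K H S T" and e: "End_iso_field K H S" "End_iso_field K H T"
    and d: "dim_ge K (Ext1 K H S T) 3" using assms by (auto simp: case_i_def)
  note hS = simple_hmodule[OF S] and hT = simple_hmodule[OF T]
  note eS = copy(7)[OF S scalar_end_of_End_iso_field[OF hS e(1)]] and eT = copy(7)[OF T scalar_end_of_End_iso_field[OF hT e(2)]]
  let ?S = "copy S" and ?T = "copy T"
  obtain z0 where "indep_cocycles S T 3 z0" using independent_cocycles_exist[OF hS hT d] by blast
  from copy_indep_cocycles[OF S T this] obtain w where w: "indep_cocycles ?S ?T 3 w" by blast
  let ?g = "w 0" and ?be = "w 1" and ?al = "w 2"
  have z: "cocycle ?S ?T ?g" "cocycle ?S ?T ?be" "cocycle ?S ?T ?al" using w by (auto simp: indep_cocycles_def)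
  note ind = indep_cocycles_3[OF w copy(6)[OF T]]
  note zc = cocycleD(2)[OF z(1)] cocycleD(2)[OF z(2)] cocycleD(2)[OF z(3)]
  note t = hmodule_facts(1)[OF copy(6)[OF T]]
  note [simp] = t
  have ng: "\<not> coboundary ?S ?T ?g" and nb: "\<not> coboundary ?S ?T ?be" by (rule indep_cocycles_not_coboundary[OF w copy(6)[OF T]], simp)+
  note nST = copy_noniso[OF S T n]
  have hs: "hstring K H (\<lambda>i. if i = 0 then ?S else ?S) (\<lambda>i. ?T) (\<lambda>i. ?al) (\<lambda>i. if i = 0 then ?g else ?be) seq_dec seq_enc"
  proof (rule kronecker_string[OF copy(5)[OF S] eS copy(5)[OF S] eS copy(5)[OF T] eT nST nST _ z(1) ng z(3,2) nb])
    fix i j :: nat and c1 c2 c3 c4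
    assume c: "c1 \<in> carrier K" "c2 \<in> carrier K" "c3 \<in> carrier K" "c4 \<in> carrier K" and c2: "c2 \<noteq> \<zero> \<Longrightarrow> 0 < j"
      and co: "coboundary (if j = 0 then ?S else ?S) ?T (\<lambda>x u. (gsmult ?T c1 ((if j = 0 then ?g else ?be) x u) \<oplus>\<^bsub>?T\<^esub> gsmult ?T c2 (?al x u)) \<ominus>\<^bsub>?T\<^esub>
          (gsmult ?T c3 ((if i = 0 then ?g else ?be) x u) \<oplus>\<^bsub>?T\<^esub> gsmult ?T c4 (?al x u)))"
    define ag where "ag = (if j = 0 then c1 else \<zero>) \<ominus> (if i = 0 then c3 else \<zero>)"
    define ab where "ab = (if j = 0 then \<zero> else c1) \<ominus> (if i = 0 then \<zero> else c3)"
    have agb: "ag \<in> carrier K" "ab \<in> carrier K" using c by (auto simp: ag_def ab_def)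
    have "coboundary ?S ?T (\<lambda>x s. ag \<odot>\<^bsub>?T\<^esub> ?g x s \<oplus>\<^bsub>?T\<^esub> (ab \<odot>\<^bsub>?T\<^esub> ?be x s \<oplus>\<^bsub>?T\<^esub> (c2 \<ominus> c4) \<odot>\<^bsub>?T\<^esub> ?al x s))"
    proof (rule coboundary_cong[OF co[unfolded if_cancel]])
      fix x s assume xs: "x \<in> ops" "s \<in> carrier ?S"
      let ?j = "(if j = 0 then ?g else ?be) x s" and ?i = "(if i = 0 then ?g else ?be) x s"
      have ji: "?j \<in> carrier ?T" "?i \<in> carrier ?T" using zc xs by auto
      have "(gsmult ?T c1 ?j \<oplus>\<^bsub>?T\<^esub> gsmult ?T c2 (?al x s)) \<ominus>\<^bsub>?T\<^esub> (gsmult ?T c3 ?i \<oplus>\<^bsub>?T\<^esub> gsmult ?T c4 (?al x s)) =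
        (c1 \<odot>\<^bsub>?T\<^esub> ?j \<ominus>\<^bsub>?T\<^esub> c3 \<odot>\<^bsub>?T\<^esub> ?i) \<oplus>\<^bsub>?T\<^esub> (c2 \<ominus> c4) \<odot>\<^bsub>?T\<^esub> ?al x s"
        using ji zc(3)[OF xs] c by (simp only: gsmult_eq[OF t] vcombine3[OF t])
      also have "c1 \<odot>\<^bsub>?T\<^esub> ?j \<ominus>\<^bsub>?T\<^esub> c3 \<odot>\<^bsub>?T\<^esub> ?i = ag \<odot>\<^bsub>?T\<^esub> ?g x s \<oplus>\<^bsub>?T\<^esub> ab \<odot>\<^bsub>?T\<^esub> ?be x s"
        using zc xs c by (cases "i = 0"; cases "j = 0") (simp_all add: ag_def ab_def minus_smult a_minus_def neg_smult vac add_smult)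
      finally show "(gsmult ?T c1 ?j \<oplus>\<^bsub>?T\<^esub> gsmult ?T c2 (?al x s)) \<ominus>\<^bsub>?T\<^esub> (gsmult ?T c3 ?i \<oplus>\<^bsub>?T\<^esub> gsmult ?T c4 (?al x s)) =
        ag \<odot>\<^bsub>?T\<^esub> ?g x s \<oplus>\<^bsub>?T\<^esub> (ab \<odot>\<^bsub>?T\<^esub> ?be x s \<oplus>\<^bsub>?T\<^esub> (c2 \<ominus> c4) \<odot>\<^bsub>?T\<^esub> ?al x s)"
        using zc xs c agb by (simp add: vassoc)
    qed
    from ind[OF agb _ this] have "ag = \<zero>" "ab = \<zero>" "c2 \<ominus> c4 = \<zero>" using c by auto
    then show "c1 = c3 \<and> c2 = c4 \<and> (i = 0 \<or> j = 0 \<longrightarrow> i \<noteq> j \<longrightarrow> c1 = \<zero>)"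
      using c by (auto simp: ag_def ab_def split: if_splits)
  qed simp
  interpret h: hstring K H "\<lambda>i. if i = 0 then ?S else ?S" "\<lambda>i. ?T" "\<lambda>i. ?al" "\<lambda>i. if i = 0 then ?g else ?be" seq_dec seq_enc
    by (rule hs)
  show ?thesis
  proof (intro exI conjI allI impI)
    show "embedded_sequence K H h.M (\<lambda>_ w. w)" by (rule h.embedded)
    fix m :: nat
    show "hmod_iso K H (sub_hmod K H (h.M m) (Rad K H (h.M m))) (power_hmod K H m T)"
      unfolding h.Rad_M by (rule h.N_iso[OF refl copy(3,4)[OF T] hT])
    show "hmod_iso K H (quot_hmod K H (h.M m) (Rad K H (h.M m))) (power_hmod K H m S)"
      unfolding h.Rad_M by (rule h.quot_iso_power[OF _ copy(3,4)[OF S] hS]) simp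
    show "End_scalar K H (h.M m)" by (rule h.End_scalar_M)
  qed
qed

text \<open>
  The relation lives either in \<open>Ext\<^sup>1(R, T)\<close>, where only the class of the first extension occurs, or in \<open>Ext\<^sup>1(S, T)\<close>, where
  the two independent classes occur.
\<close>
theorem modules_of_case_ii:
  fixes R :: "('k, 'r, 'g, 'a) hmod" and S :: "('k, 's, 'g, 'a) hmod" and T :: "('k, 't, 'g, 'a) hmod"
  assumes "case_ii K H R S T"
  shows "\<exists>(M :: nat \<Rightarrow> ('k, nat \<Rightarrow> 'k, 'g, 'a) hmod) e. embedded_sequence K H M e \<and>
         (\<forall>m\<ge>1.
            hmod_iso K H (sub_hmod K H (M m) (Rad K H (M m))) (power_hmod K H m T) \<and>
            hmod_iso K H (quot_hmod K H (M m) (Rad K H (M m)))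
              (sum_hmod K H R (power_hmod K H (m - 1) S)) \<and>
            End_scalar K H (M m))"
proof -
  have R: "simple K H R" and S: "simple K H S" and T: "simple K H T"
    and n: "\<not> hmod_iso K H R S" "\<not> hmod_iso K H R T" "\<not> hmod_iso K H S T"
    and e: "End_iso_field K H R" "End_iso_field K H S" "End_iso_field K H T"
    and d: "dim_ge K (Ext1 K H R T) 1" "dim_ge K (Ext1 K H S T) 2" using assms by (auto simp: case_ii_def)
  note hR = simple_hmodule[OF R] and hS = simple_hmodule[OF S] and hT = simple_hmodule[OF T]
  note eR = copy(7)[OF R scalar_end_of_End_iso_field[OF hR e(1)]] and eS = copy(7)[OF S scalar_end_of_End_iso_field[OF hS e(2)]]
    and eT = copy(7)[OF T scalar_end_of_End_iso_field[OF hT e(3)]]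
  let ?R = "copy R" and ?S = "copy S" and ?T = "copy T"
  obtain z1 where "indep_cocycles R T 1 z1" using independent_cocycles_exist[OF hR hT d(1)] by blast
  from copy_indep_cocycles[OF R T this] obtain w1 where w1: "indep_cocycles ?R ?T 1 w1" by blast
  obtain z2 where "indep_cocycles S T 2 z2" using independent_cocycles_exist[OF hS hT d(2)] by blast
  from copy_indep_cocycles[OF S T this] obtain w where w: "indep_cocycles ?S ?T 2 w" by blast
  let ?g = "w1 0" and ?be = "w 0" and ?al = "w 1"
  have g: "cocycle ?R ?T ?g" "\<not> coboundary ?R ?T ?g" using w1 indep_cocycles_not_coboundary[OF w1 copy(6)[OF T], of 0] by (auto simp: indep_cocycles_def)
  have z: "cocycle ?S ?T ?be" "cocycle ?S ?T ?al" using w by (auto simp: indep_cocycles_def)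
  have nb: "\<not> coboundary ?S ?T ?be" by (rule indep_cocycles_not_coboundary[OF w copy(6)[OF T]]) simp
  note ind = indep_cocycles_2[OF w copy(6)[OF T]]
  note gc = cocycleD(2)[OF g(1)] and zc = cocycleD(2)[OF z(1)] cocycleD(2)[OF z(2)]
  note t = hmodule_facts(1)[OF copy(6)[OF T]]
  note [simp] = t
  note nRS = copy_hom_zero(3)[OF R S n(1)]
  have hs: "hstring K H (\<lambda>i. if i = 0 then ?R else ?S) (\<lambda>i. ?T) (\<lambda>i. ?al) (\<lambda>i. if i = 0 then ?g else ?be) seq_dec seq_enc"
  proof (rule kronecker_string[OF copy(5)[OF R] eR copy(5)[OF S] eS copy(5)[OF T] eT copy_noniso[OF R T n(2)] copy_noniso[OF S T n(3)] _ g z(2,1) nb])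
    show "?R = ?S \<or> \<not> hmod_iso K H ?R ?S" using copy_noniso[OF R S n(1)] by simp
    fix i j :: nat and c1 c2 c3 c4
    assume c: "c1 \<in> carrier K" "c2 \<in> carrier K" "c3 \<in> carrier K" "c4 \<in> carrier K" and c2: "c2 \<noteq> \<zero> \<Longrightarrow> 0 < j"
      and c3: "c3 \<noteq> \<zero> \<Longrightarrow> (if i = 0 then ?R else ?S) = (if j = 0 then ?R else ?S)" and c4: "c4 \<noteq> \<zero> \<Longrightarrow> ?S = (if j = 0 then ?R else ?S)"
      and co: "coboundary (if j = 0 then ?R else ?S) ?T (\<lambda>x u. (gsmult ?T c1 ((if j = 0 then ?g else ?be) x u) \<oplus>\<^bsub>?T\<^esub> gsmult ?T c2 (?al x u)) \<ominus>\<^bsub>?T\<^esub>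
          (gsmult ?T c3 ((if i = 0 then ?g else ?be) x u) \<oplus>\<^bsub>?T\<^esub> gsmult ?T c4 (?al x u)))"
    show "c1 = c3 \<and> c2 = c4 \<and> (i = 0 \<or> j = 0 \<longrightarrow> i \<noteq> j \<longrightarrow> c1 = \<zero>)"
    proof (cases "j = 0")
      case True
      have c0: "c2 = \<zero>" "c4 = \<zero>" "i \<noteq> 0 \<Longrightarrow> c3 = \<zero>" using c2 c3 c4 True nRS by (auto split: if_splits)
      have "coboundary ?R ?T (\<lambda>x u. c1 \<odot>\<^bsub>?T\<^esub> ?g x u \<ominus>\<^bsub>?T\<^esub> c3 \<odot>\<^bsub>?T\<^esub> ?g x u)"
        by (rule coboundary_cong[OF co[unfolded if_P[OF True]]]) (use gc c c0 in \<open>auto simp: gsmult_eq\<close>)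
      from coboundary_scaled[OF copy(6)[OF R] copy(6)[OF T] g c(1,3) this] show ?thesis using c0 True by auto
    next
      case False
      have c0: "i = 0 \<Longrightarrow> c3 = \<zero>" using c3 False nRS by (auto split: if_splits)
      have "coboundary ?S ?T (\<lambda>x s. (c1 \<ominus> c3) \<odot>\<^bsub>?T\<^esub> ?be x s \<oplus>\<^bsub>?T\<^esub> (c2 \<ominus> c4) \<odot>\<^bsub>?T\<^esub> ?al x s)"
      proof (rule coboundary_cong[OF co[unfolded if_not_P[OF False]]])
        fix x s assume xs: "x \<in> ops" "s \<in> carrier ?S"
        have "gsmult ?T c3 ((if i = 0 then ?g else ?be) x s) = c3 \<odot>\<^bsub>?T\<^esub> ?be x s" using c0 zc xs by (auto simp: gsmult_eq)
        then have "(gsmult ?T c1 (?be x s) \<oplus>\<^bsub>?T\<^esub> gsmult ?T c2 (?al x s)) \<ominus>\<^bsub>?T\<^esub> (gsmult ?T c3 ((if i = 0 then ?g else ?be) x s) \<oplus>\<^bsub>?T\<^esub> gsmult ?T c4 (?al x s)) =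
          (c1 \<odot>\<^bsub>?T\<^esub> ?be x s \<ominus>\<^bsub>?T\<^esub> c3 \<odot>\<^bsub>?T\<^esub> ?be x s) \<oplus>\<^bsub>?T\<^esub> (c2 \<ominus> c4) \<odot>\<^bsub>?T\<^esub> ?al x s"
          using zc[OF xs] c by (simp only: gsmult_eq[OF t] vcombine3[OF t])
        then show "(gsmult ?T c1 (?be x s) \<oplus>\<^bsub>?T\<^esub> gsmult ?T c2 (?al x s)) \<ominus>\<^bsub>?T\<^esub> (gsmult ?T c3 ((if i = 0 then ?g else ?be) x s) \<oplus>\<^bsub>?T\<^esub> gsmult ?T c4 (?al x s)) =
          (c1 \<ominus> c3) \<odot>\<^bsub>?T\<^esub> ?be x s \<oplus>\<^bsub>?T\<^esub> (c2 \<ominus> c4) \<odot>\<^bsub>?T\<^esub> ?al x s"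
          using zc xs c by (simp add: minus_smult)
      qed
      from ind[OF _ _ this] have "c1 = c3" "c2 = c4" using c by auto
      then show ?thesis using c0 False by auto
    qed
  qed
  interpret h: hstring K H "\<lambda>i. if i = 0 then ?R else ?S" "\<lambda>i. ?T" "\<lambda>i. ?al" "\<lambda>i. if i = 0 then ?g else ?be" seq_dec seq_enc
    by (rule hs)
  show ?thesis
  proof (intro exI conjI allI impI)
    show "embedded_sequence K H h.M (\<lambda>_ w. w)" by (rule h.embedded)
    fix m :: nat assume m: "1 \<le> m"
    show "hmod_iso K H (sub_hmod K H (h.M m) (Rad K H (h.M m))) (power_hmod K H m T)"
      unfolding h.Rad_M by (rule h.N_iso[OF refl copy(3,4)[OF T] hT])
    show "hmod_iso K H (quot_hmod K H (h.M m) (Rad K H (h.M m))) (sum_hmod K H R (power_hmod K H (m - 1) S))"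
      unfolding h.Rad_M by (rule h.quot_iso_sum[OF _ _ copy(3,4)[OF S] hS copy(3,4)[OF R] hR m]) simp_all
    show "End_scalar K H (h.M m)" by (rule h.End_scalar_M)
  qed
qed

text \<open>
  The string goes around the cycle, \<open>s i\<close> being the position of index \<open>i\<close> on it. As \<open>r \<ge> 2\<close>, the two
  neighbours \<open>T\<^sub>k\<close> and \<open>T\<^sub>k\<^sub>-\<^sub>1\<close> of \<open>S\<^sub>k\<close> on the cycle differ, so every \<open>Ext\<^sup>1(P\<^sub>j, Q\<^sub>i)\<close> sees at
  most one of the chosen classes, and non-triviality takes the place of independence. The module \<open>R\<close> occurs
  at index \<open>0\<close> only, which prevents the string from being shifted along itself.
\<close>
theorem modules_of_case_iii:
  fixes R :: "('k, 'r, 'g, 'a) hmod" and Ss :: "nat \<Rightarrow> ('k, 's, 'g, 'a) hmod" and Ts :: "nat \<Rightarrow> ('k, 't, 'g, 'a) hmod"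
  assumes "case_iii K H r R Ss Ts"
  shows "\<exists>(M :: nat \<Rightarrow> ('k, nat \<Rightarrow> 'k, 'g, 'a) hmod) e. embedded_sequence K H M e \<and> (\<forall>m\<ge>1. End_scalar K H (M m))"
proof -
  define s where "s i = i mod r + 1" for i
  have r: "2 \<le> r" using assms by (simp add: case_iii_def)
  have s: "s i \<in> {1..r}" for i using r mod_less_divisor[of r i] by (auto simp: s_def Suc_le_eq)
  have s_Suc: "s (Suc i) = s i mod r + 1" for i by (simp add: s_def mod_Suc_eq)
  have R: "simple K H R" and S: "\<And>i. simple K H (Ss (s i))" and T: "\<And>i. simple K H (Ts (s i))"
    and nR: "\<And>i. \<not> hmod_iso K H R (Ss (s i))" "\<And>i. \<not> hmod_iso K H R (Ts (s i))"
    and nST: "\<And>i j. \<not> hmod_iso K H (Ss (s i)) (Ts (s j))"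
    and nSS: "\<And>i j. s i \<noteq> s j \<Longrightarrow> \<not> hmod_iso K H (Ss (s i)) (Ss (s j))"
    and nTT: "\<And>i j. s i \<noteq> s j \<Longrightarrow> \<not> hmod_iso K H (Ts (s i)) (Ts (s j))"
    and e: "End_iso_field K H R" "\<And>i. End_iso_field K H (Ss (s i))" "\<And>i. End_iso_field K H (Ts (s i))"
    and x0: "Ext1_nontrivial K H R (Ts 1)" and xb: "\<And>i. Ext1_nontrivial K H (Ss (s i)) (Ts (s i))"
    using assms s by (auto simp: case_iii_def)
  have xa: "Ext1_nontrivial K H (Ss (k mod r + 1)) (Ts k)" if k: "k \<in> {1..r}" for k
  proof (cases "k = r")
    case True
    then show ?thesis using assms by (simp add: case_iii_def)
  next
    case False
    then have "k \<in> {1..r - 1}" "k mod r = k" using k by auto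
    then show ?thesis using assms by (simp add: case_iii_def)
  qed
  note hR = simple_hmodule[OF R] and hS = simple_hmodule[OF S] and hT = simple_hmodule[OF T]
  note eR = copy(7)[OF R scalar_end_of_End_iso_field[OF hR e(1)]] and eS = copy(7)[OF S scalar_end_of_End_iso_field[OF hS e(2)]]
    and eT = copy(7)[OF T scalar_end_of_End_iso_field[OF hT e(3)]]
  define P where "P i = (if i = 0 then copy R else copy (Ss (s i)))" for i
  define Q where "Q i = copy (Ts (s i))" for i
  have s0: "s 0 = 1" by (simp add: s_def)
  have T1: "simple K H (Ts 1)" using T[of 0] by (simp add: s0)
  have "\<exists>z. cocycle (copy R) (copy (Ts 1)) z \<and> \<not> coboundary (copy R) (copy (Ts 1)) z"
    by (rule copy_nonsplit[OF R T1 Ext1_nontrivial_cocycle[OF hR simple_hmodule[OF T1] x0]])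
  then obtain g where g: "cocycle (copy R) (copy (Ts 1)) g" "\<not> coboundary (copy R) (copy (Ts 1)) g" by blast
  \<comment> \<open>One cocycle for each edge of the cycle, so that indices in the same position carry the same cocycle.\<close>
  define Bz where "Bz k = (SOME z. cocycle (copy (Ss k)) (copy (Ts k)) z \<and> \<not> coboundary (copy (Ss k)) (copy (Ts k)) z)" for k
  have Bz: "cocycle (copy (Ss (s i))) (copy (Ts (s i))) (Bz (s i)) \<and> \<not> coboundary (copy (Ss (s i))) (copy (Ts (s i))) (Bz (s i))" for i
    unfolding Bz_def by (rule someI_ex[OF copy_nonsplit[OF S T Ext1_nontrivial_cocycle[OF hS hT xb]]])
  define Az where "Az k = (SOME z. cocycle (copy (Ss (k mod r + 1))) (copy (Ts k)) z \<and> \<not> coboundary (copy (Ss (k mod r + 1))) (copy (Ts k)) z)" for k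
  have Az: "cocycle (copy (Ss (s (Suc i)))) (copy (Ts (s i))) (Az (s i)) \<and> \<not> coboundary (copy (Ss (s (Suc i)))) (copy (Ts (s i))) (Az (s i))" for i
    unfolding Az_def s_Suc
    by (rule someI_ex[OF copy_nonsplit[OF S[of "Suc i", unfolded s_Suc] T Ext1_nontrivial_cocycle[OF hS[of "Suc i", unfolded s_Suc] hT xa[OF s]]]])
  define b where "b i = (if i = 0 then g else Bz (s i))" for i
  define a where "a i = Az (s i)" for i
  have PP: "P i = P j \<Longrightarrow> (i = 0 \<longleftrightarrow> j = 0) \<and> (i \<noteq> 0 \<longrightarrow> s i = s j)" for i j
    using copy_hom_zero(3)[OF R S nR(1)] copy_hom_zero(3)[OF S S nSS] unfolding P_def by (auto split: if_splits) metis+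
  have QQ: "Q i = Q j \<Longrightarrow> s i = s j" for i j
    using copy_hom_zero(3)[OF T T nTT] unfolding Q_def by metis
  have sP: "simple K H (P i)" and sQ: "simple K H (Q i)" for i unfolding P_def Q_def using copy(5)[OF R] copy(5)[OF S] copy(5)[OF T] by auto
  note hP = simple_hmodule[OF sP] and hQ = simple_hmodule[OF sQ]
  have cb: "cocycle (P i) (Q i) (b i)" "\<not> coboundary (P i) (Q i) (b i)" for i using g Bz[of i] by (auto simp: P_def Q_def b_def s0)
  have ca: "cocycle (P (Suc i)) (Q i) (a i)" "\<not> coboundary (P (Suc i)) (Q i) (a i)" for i using Az[of i] by (auto simp: P_def Q_def a_def)
  \<comment> \<open>This is where \<open>r \<noteq> 1\<close> matters.\<close>
  have ss: "\<not> (s i = s j \<and> s (Suc i) = s j)" for i j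
  proof
    assume h: "s i = s j \<and> s (Suc i) = s j"
    then have "i mod r = Suc i mod r" by (simp add: s_def)
    then show False using r by (simp add: mod_Suc split: if_splits)
  qed
  have hs: "hstring K H P Q a b seq_dec seq_enc"
  proof (intro hstring.intro hcat_axioms hstring_axioms.intro)
    show "f u = \<zero>\<^bsub>Q j\<^esub>" if "f \<in> hmod_hom K H (P i) (Q j)" "u \<in> carrier (P i)" for f u i j
      using that copy_hom_zero(1)[OF R T nR(2)] copy_hom_zero(1)[OF S T nST] by (auto simp: P_def Q_def split: if_splits)
    show "f u = \<zero>\<^bsub>P i\<^esub>" if "f \<in> hmod_hom K H (Q j) (P i)" "u \<in> carrier (Q j)" for f u i j
      using that copy_hom_zero(2)[OF R T nR(2)] copy_hom_zero(2)[OF S T nST] by (auto simp: P_def Q_def split: if_splits)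
    show "P i = P j \<or> (\<forall>f\<in>hmod_hom K H (P i) (P j). \<forall>u\<in>carrier (P i). f u = \<zero>\<^bsub>P j\<^esub>)" for i j
    proof (cases "i = 0"; cases "j = 0")
      assume "i \<noteq> 0" "j \<noteq> 0"
      then show ?thesis using copy_hom_zero(1)[OF S S nSS, of i j] by (cases "s i = s j") (auto simp: P_def)
    qed (use copy_hom_zero(1,2)[OF R S nR(1)] in \<open>auto simp: P_def\<close>)
    show "Q i = Q j \<or> (\<forall>f\<in>hmod_hom K H (Q i) (Q j). \<forall>u\<in>carrier (Q i). f u = \<zero>\<^bsub>Q j\<^esub>)" for i j
      using copy_hom_zero(1)[OF T T nTT, of i j] by (cases "s i = s j") (auto simp: Q_def)
    fix i j :: nat and c1 c2 c3 c4
    assume c: "c1 \<in> carrier K" "c2 \<in> carrier K" "c3 \<in> carrier K" "c4 \<in> carrier K"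
      and c1: "c1 \<noteq> \<zero> \<Longrightarrow> Q j = Q i" and c2: "c2 \<noteq> \<zero> \<Longrightarrow> 0 < j \<and> Q (j - 1) = Q i"
      and c3: "c3 \<noteq> \<zero> \<Longrightarrow> P i = P j" and c4: "c4 \<noteq> \<zero> \<Longrightarrow> P (Suc i) = P j"
      and co: "coboundary (P j) (Q i) (\<lambda>x u. (gsmult (Q i) c1 (b j x u) \<oplus>\<^bsub>Q i\<^esub> gsmult (Q i) c2 (a (j - 1) x u)) \<ominus>\<^bsub>Q i\<^esub>
          (gsmult (Q i) c3 (b i x u) \<oplus>\<^bsub>Q i\<^esub> gsmult (Q i) c4 (a i x u)))"
    note qm = hmodule_facts(1)[OF hQ]
    note [simp] = qm
    have j1: "s j = s (Suc i)" if "0 < j" "s (j - 1) = s i"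
    proof -
      have "s j = s (Suc (j - 1))" using that by simp
      then show ?thesis using s_Suc that by metis
    qed
    have j2: "s (j - 1) = s i" if "0 < j" "s (Suc i) = s j"
    proof -
      have "Suc i mod r = Suc (j - 1) mod r" using that by (simp add: s_def)
      then have "i mod r = (j - 1) mod r" using r by (simp add: mod_Suc split: if_splits)
      then show ?thesis by (simp add: s_def)
    qed
    \<comment> \<open>A coefficient is zero unless its two modules are neighbours on the cycle.\<close>
    have k1: "c1 = \<zero>" if "s i \<noteq> s j" using c1 QQ[of j i] that by metis
    have k2: "c2 = \<zero>" if "\<not> (0 < j \<and> s (Suc i) = s j)" using c2 QQ[of "j - 1" i] j1 that by metis
    have k3: "c3 = \<zero>" if "\<not> ((i = 0 \<longleftrightarrow> j = 0) \<and> s i = s j)" using c3 PP[of i j] that by (metis)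
    have k4: "c4 = \<zero>" if "\<not> (0 < j \<and> s (Suc i) = s j)" using c4 PP[of "Suc i" j] that by (metis nat.distinct(1) neq0_conv)
    show "c1 = c3 \<and> c2 = c4 \<and> (i = 0 \<or> j = 0 \<longrightarrow> i \<noteq> j \<longrightarrow> c1 = \<zero>)"
    proof (cases "s i = s j")
      case True
      then have "s (Suc i) \<noteq> s j" using ss by blast
      then have z: "c2 = \<zero>" "c4 = \<zero>" using k2 k4 by auto
      have QQ': "Q i = Q j" using True by (simp add: Q_def)
      have bb: "gsmult (Q i) c3 (b i x u) = c3 \<odot>\<^bsub>Q i\<^esub> b j x u" if "x \<in> ops" "u \<in> carrier (P j)" for x u
      proof (cases "i = 0 \<longleftrightarrow> j = 0")
        case e: True
        then have "b i = b j" using True by (auto simp: b_def)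
        then show ?thesis using cocycleD(2)[OF cb(1) that] QQ' by (simp add: gsmult_eq)
      next
        case False
        then show ?thesis using k3 cocycleD(2)[OF cb(1) that] QQ' by simp
      qed
      have "coboundary (P j) (Q j) (\<lambda>x u. c1 \<odot>\<^bsub>Q j\<^esub> b j x u \<ominus>\<^bsub>Q j\<^esub> c3 \<odot>\<^bsub>Q j\<^esub> b j x u)"
        by (rule coboundary_cong[OF co[unfolded QQ']]) (use z cocycleD(2)[OF cb(1)] bb[unfolded QQ'] c in \<open>simp add: gsmult_eq\<close>)
      then have e: "c1 = c3" by (rule coboundary_scaled[OF hP hQ cb c(1,3)])
      moreover have "c1 = \<zero>" if "i = 0 \<or> j = 0" "i \<noteq> j" using that k3 e by auto
      ultimately show ?thesis using z by simp
    next
      case False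
      then have z: "c1 = \<zero>" "c3 = \<zero>" using k1 k3 by auto
      have "c2 = c4"
      proof (cases "0 < j \<and> s (Suc i) = s j")
        case True
        then have PP': "P (Suc i) = P j" and aa: "a (j - 1) = a i" using j2 by (auto simp: P_def a_def)
        have "coboundary (P (Suc i)) (Q i) (\<lambda>x u. c2 \<odot>\<^bsub>Q i\<^esub> a i x u \<ominus>\<^bsub>Q i\<^esub> c4 \<odot>\<^bsub>Q i\<^esub> a i x u)"
          by (rule coboundary_cong[OF co[folded PP']]) (use z cocycleD(2)[OF ca(1)] c in \<open>simp add: gsmult_eq aa[unfolded One_nat_def]\<close>)
        then show ?thesis by (rule coboundary_scaled[OF hP hQ ca c(2,4)])
      qed (use k2 k4 in auto)
      then show ?thesis using z by simp
    qed
  qed (use sP sQ cb ca eR eS eT in \<open>auto simp: seq_dec_enc seq_enc_dec P_def Q_def\<close>)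
  interpret h: hstring K H P Q a b seq_dec seq_enc by (rule hs)
  show ?thesis by (rule exI, rule exI, rule conjI[OF h.embedded]) (intro allI impI h.End_scalar_M)
qed

end

theorem theorem1p4:
  fixes K :: "'k ring" and p :: nat and H :: "('k, 'g, 'a) hgroup"
    and R :: "('k, 'r, 'g, 'a) hmod" and S :: "('k, 's, 'g, 'a) hmod"
    and T :: "('k, 't, 'g, 'a) hmod"
    and r :: nat
    and Ss :: "nat \<Rightarrow> ('k, 's, 'g, 'a) hmod" and Ts :: "nat \<Rightarrow> ('k, 't, 'g, 'a) hmod"
  assumes "field K" and "Factorial_Ring.prime p" and "ring_char K p"
    and "is_hgroup K H"
  shows
    "(case_i K H S T \<longrightarrow>
       (\<exists>(M :: nat \<Rightarrow> ('k, nat \<Rightarrow> 'k, 'g, 'a) hmod) e. embedded_sequence K H M e \<and>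
         (\<forall>m\<ge>1.
            hmod_iso K H (sub_hmod K H (M m) (Rad K H (M m))) (power_hmod K H m T) \<and>
            hmod_iso K H (quot_hmod K H (M m) (Rad K H (M m))) (power_hmod K H m S) \<and>
            End_scalar K H (M m)))) \<and>
     (case_ii K H R S T \<longrightarrow>
       (\<exists>(M :: nat \<Rightarrow> ('k, nat \<Rightarrow> 'k, 'g, 'a) hmod) e. embedded_sequence K H M e \<and>
         (\<forall>m\<ge>1.
            hmod_iso K H (sub_hmod K H (M m) (Rad K H (M m))) (power_hmod K H m T) \<and>
            hmod_iso K H (quot_hmod K H (M m) (Rad K H (M m)))
              (sum_hmod K H R (power_hmod K H (m - 1) S)) \<and>
            End_scalar K H (M m)))) \<and>
     (case_iii K H r R Ss Ts \<longrightarrow>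
       (\<exists>(M :: nat \<Rightarrow> ('k, nat \<Rightarrow> 'k, 'g, 'a) hmod) e. embedded_sequence K H M e \<and>
         (\<forall>m\<ge>1. End_scalar K H (M m))))"
proof -
  interpret hcat K H
    using assms by (intro hcat.intro ground.intro hcat_axioms.intro)
  show ?thesis using modules_of_case_i modules_of_case_ii modules_of_case_iii by blast
qed

end
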